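(* Let $A$ be a strongly standardly stratified algebra with characteristic tilting module $T$. Then $\operatorname{fdim}(A)\leq \operatorname{fdim}_{\Delta}(A)+\operatorname{pd}(T)$.
   Context: $A$ is a finite-dimensional, associative, unital algebra over an algebraically closed field $\Bbbk$; $A\text{-mod}$ is the category of finite-dimensional left $A$-modules. The isoclasses of simple modules are indexed by $\Lambda=\{1,\dots,n\}$ with its natural order; $L(\lambda)$, $P(\lambda)$, $I(\lambda)$ are the simple module, its projective cover and injective envelope. The standard module is $\Delta(\lambda)=P(\lambda)/\operatorname{Trace}_{P^{>\lambda}}(P(\lambda))$ where $P^{>\lambda}=\bigoplus_{\mu>\lambda}P(\mu)$; the costandard module $\nabla(\lambda)$ is the largest submodule of $I(\lambda)$ all of whose composition factors are $L(\mu)$ with $\mu\le\lambda$, and the proper costandard module $\overline{\nabla}(\lambda)$ is the largest submodule of $I(\lambda)$ whose composition factors are $L(\mu)$, $\mu\le\lambda$, with $L(\lambda)$ occurring exactly once. For a class $\mathcal M$ of modules, $\mathcal F(\mathcal M)$ is the full subcategory of modules having a finite filtration with subquotients in $\mathcal M$; $\mathcal F(\Delta)$, $\mathcal F(\overline{\nabla})$ are defined with $\mathcal M=\{\Delta(\lambda)\}$, resp. $\{\overline{\nabla}(\lambda)\}$. $A$ is strongly standardly stratified (SSS) if ${}_AA\in\mathcal F(\Delta)$. For an SSS-algebra, the characteristic tilting module $T$ is the (basic) module with $\operatorname{Add}(T)=\mathcal F(\Delta)\cap\mathcal F(\overline{\nabla})$. For a module $N$, $\dim_\Delta(N)$ is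 the minimal length $l$ of an exact sequence $0\to M_l\to\dots\to M_0\to N\to0$ with all $M_i\in\mathcal F(\Delta)$ ($\infty$ if none exists), and $\operatorname{fdim}_\Delta(A)$ is the supremum of $\dim_\Delta(M)$ over all modules $M$ with $\dim_\Delta(M)<\infty$. $\operatorname{fdim}(A)$ is the supremum of $\operatorname{pd}(M)$ over all modules $M$ of finite projective dimension. *)

theory Defs
  imports "Jordan_Normal_Form.Matrix" "HOL-Computational_Algebra.Polynomial" "HOL-Library.Extended_Nat"
begin

definition alg_closed :: "'k::field itself \<Rightarrow> bool" where
  "alg_closed _ \<longleftrightarrow> (\<forall>p::'k poly. degree p \<noteq> 0 \<longrightarrow> (\<exists>x. poly p x = 0))"

(* A finite-dimensional associative unital k-algebra, given on the coordinate space k^d *)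
record 'k falg =
  adim :: nat
  amul :: "'k vec \<Rightarrow> 'k vec \<Rightarrow> 'k vec"
  aone :: "'k vec"

definition is_falg :: "'k::field falg \<Rightarrow> bool" where
  "is_falg A \<longleftrightarrow> (let V = carrier_vec (adim A); m = amul A in
     aone A \<in> V \<and>
     (\<forall>a\<in>V. \<forall>b\<in>V. m a b \<in> V) \<and>
     (\<forall>a\<in>V. \<forall>b\<in>V. \<forall>c\<in>V. m (a + b) c = m a c + m b c \<and> m a (b + c) = m a b + m a c) \<and>
     (\<forall>a\<in>V. \<forall>b\<in>V. \<forall>s. m (s \<cdot>\<^sub>v a) b = s \<cdot>\<^sub>v m a b \<and> m a (s \<cdot>\<^sub>v b) = s \<cdot>\<^sub>v m a b) \<and>
     (\<forall>a\<in>V. \<forall>b\<in>V. \<forall>c\<in>V. m (m a b) c = m a (m b c)) \<and>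
     (\<forall>a\<in>V. m (aone A) a = a \<and> m a (aone A) = a))"

(* A finite-dimensional left module: a representation on k^(mdim M) *)
record 'k fmod =
  mdim :: nat
  act :: "'k vec \<Rightarrow> 'k mat"

definition is_mod :: "'k::field falg \<Rightarrow> 'k fmod \<Rightarrow> bool" where
  "is_mod A M \<longleftrightarrow> (let V = carrier_vec (adim A); n = mdim M in
     (\<forall>a\<in>V. act M a \<in> carrier_mat n n) \<and>
     (\<forall>a\<in>V. \<forall>b\<in>V. act M (a + b) = act M a + act M b) \<and>
     (\<forall>a\<in>V. \<forall>s. act M (s \<cdot>\<^sub>v a) = s \<cdot>\<^sub>m act M a) \<and>
     (\<forall>a\<in>V. \<forall>b\<in>V. act M (amul A a b) = act M a * act M b) \<and>
     act M (aone A) = 1\<^sub>m n)"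

definition regular :: "'k::field falg \<Rightarrow> 'k fmod" where
  "regular A = \<lparr> mdim = adim A,
     act = (\<lambda>a. mat (adim A) (adim A) (\<lambda>(i,j). amul A a (unit_vec (adim A) j) $ i)) \<rparr>"

definition hom :: "'k::field falg \<Rightarrow> 'k fmod \<Rightarrow> 'k fmod \<Rightarrow> 'k mat set" where
  "hom A M N = {f \<in> carrier_mat (mdim N) (mdim M).
      \<forall>a\<in>carrier_vec (adim A). f * act M a = act N a * f}"

definition img :: "'k::field mat \<Rightarrow> 'k vec set" where
  "img f = {f *\<^sub>v v | v. v \<in> carrier_vec (dim_col f)}"

definition kern :: "'k::field mat \<Rightarrow> 'k vec set" where
  "kern f = {v \<in> carrier_vec (dim_col f). f *\<^sub>v v = 0\<^sub>v (dim_row f)}"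

definition surj_map :: "'k::field mat \<Rightarrow> bool" where
  "surj_map f \<longleftrightarrow> img f = carrier_vec (dim_row f)"

definition inj_map :: "'k::field mat \<Rightarrow> bool" where
  "inj_map f \<longleftrightarrow> kern f = {0\<^sub>v (dim_col f)}"

definition iso :: "'k::field falg \<Rightarrow> 'k fmod \<Rightarrow> 'k fmod \<Rightarrow> bool" where
  "iso A M N \<longleftrightarrow> (\<exists>f\<in>hom A M N. \<exists>g\<in>hom A N M.
      f * g = 1\<^sub>m (mdim N) \<and> g * f = 1\<^sub>m (mdim M))"

definition submod :: "'k::field falg \<Rightarrow> 'k fmod \<Rightarrow> 'k vec set \<Rightarrow> bool" where
  "submod A M U \<longleftrightarrow> U \<subseteq> carrier_vec (mdim M) \<and> 0\<^sub>v (mdim M) \<in> U \<and>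
     (\<forall>u\<in>U. \<forall>v\<in>U. u + v \<in> U) \<and> (\<forall>u\<in>U. \<forall>s. s \<cdot>\<^sub>v u \<in> U) \<and>
     (\<forall>a\<in>carrier_vec (adim A). \<forall>u\<in>U. act M a *\<^sub>v u \<in> U)"

definition simple :: "'k::field falg \<Rightarrow> 'k fmod \<Rightarrow> bool" where
  "simple A M \<longleftrightarrow> is_mod A M \<and> mdim M > 0 \<and>
     (\<forall>U. submod A M U \<longrightarrow> U = {0\<^sub>v (mdim M)} \<or> U = carrier_vec (mdim M))"

definition projective :: "'k::field falg \<Rightarrow> 'k fmod \<Rightarrow> bool" where
  "projective A P \<longleftrightarrow> is_mod A P \<and>
     (\<forall>X Y g f. is_mod A X \<and> is_mod A Y \<and> g \<in> hom A X Y \<and> surj_map g \<and> f \<in> hom A P Y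
        \<longrightarrow> (\<exists>h\<in>hom A P X. g * h = f))"

definition injective :: "'k::field falg \<Rightarrow> 'k fmod \<Rightarrow> bool" where
  "injective A I \<longleftrightarrow> is_mod A I \<and>
     (\<forall>X Y g f. is_mod A X \<and> is_mod A Y \<and> g \<in> hom A X Y \<and> inj_map g \<and> f \<in> hom A X I
        \<longrightarrow> (\<exists>h\<in>hom A Y I. h * g = f))"

definition proj_cover :: "'k::field falg \<Rightarrow> 'k fmod \<Rightarrow> 'k mat \<Rightarrow> 'k fmod \<Rightarrow> bool" where
  "proj_cover A P \<pi> L \<longleftrightarrow> projective A P \<and> is_mod A L \<and> \<pi> \<in> hom A P L \<and> surj_map \<pi> \<and>
     (\<forall>U. submod A P U \<and> (\<forall>v\<in>carrier_vec (mdim P). \<exists>x\<in>U. \<exists>y\<in>kern \<pi>. v = x + y)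
          \<longrightarrow> U = carrier_vec (mdim P))"

definition inj_env :: "'k::field falg \<Rightarrow> 'k fmod \<Rightarrow> 'k mat \<Rightarrow> 'k fmod \<Rightarrow> bool" where
  "inj_env A I \<iota> L \<longleftrightarrow> injective A I \<and> is_mod A L \<and> \<iota> \<in> hom A L I \<and> inj_map \<iota> \<and>
     (\<forall>U. submod A I U \<and> U \<noteq> {0\<^sub>v (mdim I)} \<longrightarrow> (\<exists>v\<in>U. v \<noteq> 0\<^sub>v (mdim I) \<and> v \<in> img \<iota>))"

(* the subquotient V/U of M (U \<subseteq> V submodules) is isomorphic to N *)
definition sqiso :: "'k::field falg \<Rightarrow> 'k fmod \<Rightarrow> 'k vec set \<Rightarrow> 'k vec set \<Rightarrow> 'k fmod \<Rightarrow> bool" where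
  "sqiso A M U V N \<longleftrightarrow> (\<exists>\<phi>\<in>carrier_mat (mdim N) (mdim M).
     (\<forall>a\<in>carrier_vec (adim A). \<forall>v\<in>V. \<phi> *\<^sub>v (act M a *\<^sub>v v) = act N a *\<^sub>v (\<phi> *\<^sub>v v)) \<and>
     (\<lambda>v. \<phi> *\<^sub>v v) ` V = carrier_vec (mdim N) \<and>
     {v\<in>V. \<phi> *\<^sub>v v = 0\<^sub>v (mdim N)} = U)"

definition subchain :: "'k::field falg \<Rightarrow> 'k fmod \<Rightarrow> 'k vec set \<Rightarrow> 'k vec set list \<Rightarrow> bool" where
  "subchain A M V us \<longleftrightarrow> us \<noteq> [] \<and> hd us = {0\<^sub>v (mdim M)} \<and> last us = V \<and>
     (\<forall>i<length us. submod A M (us ! i)) \<and>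
     (\<forall>i. Suc i < length us \<longrightarrow> us ! i \<subseteq> us ! Suc i)"

definition filt :: "'k::field falg \<Rightarrow> ('k fmod \<Rightarrow> bool) \<Rightarrow> 'k fmod \<Rightarrow> bool" where
  "filt A C M \<longleftrightarrow> is_mod A M \<and> (\<exists>us. subchain A M (carrier_vec (mdim M)) us \<and>
     (\<forall>i. Suc i < length us \<longrightarrow> (\<exists>N. is_mod A N \<and> C N \<and> sqiso A M (us ! i) (us ! Suc i) N)))"

definition simples_indexed :: "'k::field falg \<Rightarrow> nat \<Rightarrow> (nat \<Rightarrow> 'k fmod) \<Rightarrow> bool" where
  "simples_indexed A n L \<longleftrightarrow> (\<forall>lm\<in>{1..n}. simple A (L lm)) \<and>
     (\<forall>lm\<in>{1..n}. \<forall>\<mu>\<in>{1..n}. iso A (L lm) (L \<mu>) \<longrightarrow> lm = \<mu>) \<and>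
     (\<forall>S. simple A S \<longrightarrow> (\<exists>lm\<in>{1..n}. iso A S (L lm)))"

definition trace :: "'k::field falg \<Rightarrow> 'k fmod set \<Rightarrow> 'k fmod \<Rightarrow> 'k vec set" where
  "trace A S M = \<Inter>{U. submod A M U \<and>
      (\<forall>X\<in>S. \<forall>f\<in>hom A X M. \<forall>v\<in>carrier_vec (mdim X). f *\<^sub>v v \<in> U)}"

definition is_std :: "'k::field falg \<Rightarrow> nat \<Rightarrow> (nat \<Rightarrow> 'k fmod) \<Rightarrow> nat \<Rightarrow> 'k fmod \<Rightarrow> bool" where
  "is_std A n L lm D \<longleftrightarrow> is_mod A D \<and> (\<exists>P \<pi>. proj_cover A P \<pi> (L lm) \<and>
     (\<exists>q\<in>hom A P D. surj_map q \<and>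
        kern q = trace A {X. \<exists>\<mu> \<pi>'. lm < \<mu> \<and> \<mu> \<le> n \<and> proj_cover A X \<pi>' (L \<mu>)} P))"

definition pcostd_prop :: "'k::field falg \<Rightarrow> (nat \<Rightarrow> 'k fmod) \<Rightarrow> nat \<Rightarrow> 'k fmod \<Rightarrow> 'k vec set \<Rightarrow> bool" where
  "pcostd_prop A L lm I U \<longleftrightarrow> submod A I U \<and> (\<exists>us. subchain A I U us \<and>
     (\<forall>i. Suc i < length us \<longrightarrow> (\<exists>\<mu>\<in>{1..lm}. sqiso A I (us ! i) (us ! Suc i) (L \<mu>))) \<and>
     card {i. Suc i < length us \<and> sqiso A I (us ! i) (us ! Suc i) (L lm)} = 1)"

definition is_pcostd :: "'k::field falg \<Rightarrow> (nat \<Rightarrow> 'k fmod) \<Rightarrow> nat \<Rightarrow> 'k fmod \<Rightarrow> bool" where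
  "is_pcostd A L lm N \<longleftrightarrow> is_mod A N \<and> (\<exists>I \<iota> j. inj_env A I \<iota> (L lm) \<and>
     j \<in> hom A N I \<and> inj_map j \<and> pcostd_prop A L lm I (img j) \<and>
     (\<forall>U. pcostd_prop A L lm I U \<longrightarrow> U \<subseteq> img j))"

definition F_Delta :: "'k::field falg \<Rightarrow> nat \<Rightarrow> (nat \<Rightarrow> 'k fmod) \<Rightarrow> 'k fmod \<Rightarrow> bool" where
  "F_Delta A n L = filt A (\<lambda>D. \<exists>lm\<in>{1..n}. is_std A n L lm D)"

definition F_pcostd :: "'k::field falg \<Rightarrow> nat \<Rightarrow> (nat \<Rightarrow> 'k fmod) \<Rightarrow> 'k fmod \<Rightarrow> bool" where
  "F_pcostd A n L = filt A (\<lambda>N. \<exists>lm\<in>{1..n}. is_pcostd A L lm N)"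

definition SSS :: "'k::field falg \<Rightarrow> nat \<Rightarrow> (nat \<Rightarrow> 'k fmod) \<Rightarrow> bool" where
  "SSS A n L \<longleftrightarrow> F_Delta A n L (regular A)"

definition dsum :: "'k::field fmod \<Rightarrow> 'k fmod \<Rightarrow> 'k fmod" where
  "dsum M N = \<lparr> mdim = mdim M + mdim N,
     act = (\<lambda>a. four_block_mat (act M a) (0\<^sub>m (mdim M) (mdim N)) (0\<^sub>m (mdim N) (mdim M)) (act N a)) \<rparr>"

fun dpow :: "'k::field fmod \<Rightarrow> nat \<Rightarrow> 'k fmod" where
  "dpow M 0 = \<lparr> mdim = 0, act = (\<lambda>a. 0\<^sub>m 0 0) \<rparr>"
| "dpow M (Suc r) = dsum M (dpow M r)"

definition summand :: "'k::field falg \<Rightarrow> 'k fmod \<Rightarrow> 'k fmod \<Rightarrow> bool" where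
  "summand A M X \<longleftrightarrow> is_mod A M \<and> (\<exists>i\<in>hom A M X. \<exists>p\<in>hom A X M. p * i = 1\<^sub>m (mdim M))"

definition in_add :: "'k::field falg \<Rightarrow> 'k fmod \<Rightarrow> 'k fmod \<Rightarrow> bool" where
  "in_add A T M \<longleftrightarrow> (\<exists>r. summand A M (dpow T r))"

definition basic :: "'k::field falg \<Rightarrow> 'k fmod \<Rightarrow> bool" where
  "basic A T \<longleftrightarrow> (\<forall>X. is_mod A X \<and> mdim X > 0 \<longrightarrow> \<not> summand A (dsum X X) T)"

definition char_tilting :: "'k::field falg \<Rightarrow> nat \<Rightarrow> (nat \<Rightarrow> 'k fmod) \<Rightarrow> 'k fmod \<Rightarrow> bool" where
  "char_tilting A n L T \<longleftrightarrow> is_mod A T \<and> basic A T \<and>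
     (\<forall>M. is_mod A M \<longrightarrow> (in_add A T M \<longleftrightarrow> F_Delta A n L M \<and> F_pcostd A n L M))"

definition resolution :: "'k::field falg \<Rightarrow> ('k fmod \<Rightarrow> bool) \<Rightarrow> 'k fmod \<Rightarrow> nat \<Rightarrow> bool" where
  "resolution A C M l \<longleftrightarrow> (\<exists>Ms ds. length Ms = Suc l \<and> length ds = Suc l \<and>
     (\<forall>i\<le>l. is_mod A (Ms ! i) \<and> C (Ms ! i)) \<and>
     ds ! 0 \<in> hom A (Ms ! 0) M \<and> (\<forall>i<l. ds ! Suc i \<in> hom A (Ms ! Suc i) (Ms ! i)) \<and>
     surj_map (ds ! 0) \<and> inj_map (ds ! l) \<and>
     (\<forall>i<l. img (ds ! Suc i) = kern (ds ! i)))"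

definition rdim :: "'k::field falg \<Rightarrow> ('k fmod \<Rightarrow> bool) \<Rightarrow> 'k fmod \<Rightarrow> enat" where
  "rdim A C M = (INF l\<in>{l. resolution A C M l}. enat l)"

definition pd :: "'k::field falg \<Rightarrow> 'k fmod \<Rightarrow> enat" where
  "pd A M = rdim A (projective A) M"

definition fdim :: "'k::field falg \<Rightarrow> enat" where
  "fdim A = (SUP M\<in>{M. is_mod A M \<and> pd A M < \<infinity>}. pd A M)"

definition Delta_dim :: "'k::field falg \<Rightarrow> nat \<Rightarrow> (nat \<Rightarrow> 'k fmod) \<Rightarrow> 'k fmod \<Rightarrow> enat" where
  "Delta_dim A n L M = rdim A (F_Delta A n L) M"

definition fdim_Delta :: "'k::field falg \<Rightarrow> nat \<Rightarrow> (nat \<Rightarrow> 'k fmod) \<Rightarrow> enat" where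
  "fdim_Delta A n L = (SUP M\<in>{M. is_mod A M \<and> Delta_dim A n L M < \<infinity>}. Delta_dim A n L M)"

end

theory Submission
  imports Defs
begin

text \<open>Every module in \<open>\<F>(\<Delta>)\<close> has a coresolution by modules in \<open>\<F>(\<Delta>) \<inter> \<F>(\<nabla>)\<close>, where \<open>\<nabla>\<close> denotes the proper
  costandard modules: universal extensions by standard modules, in the order of decreasing index, end in a
  module \<open>T\<close> with \<open>Ext\<^sup>1(\<Delta>, T) = 0\<close>, and this vanishing characterises \<open>\<F>(\<nabla>)\<close>. As projective dimensions on
  \<open>\<F>(\<Delta>)\<close> are bounded, a module \<open>X\<close> of largest projective dimension there, placed in \<open>0 \<rightarrow> X \<rightarrow> T \<rightarrow> X' \<rightarrow> 0\<close>, shows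
  that this dimension is at most the projective dimension of the characteristic tilting module. A module of
  finite projective dimension has a finite resolution by projectives, hence by modules in \<open>\<F>(\<Delta>)\<close>; a shortest
  one has length at most the \<open>\<Delta>\<close>-finitistic dimension, and adding up the projective dimensions along it gives
  the bound.\<close>

section \<open>Coordinate spaces inside a common vector space\<close>

text \<open>No derived functors are built. Vanishing of the first extension group means that all
  extensions split; the one use of a second extension group is phrased on the kernel of a projective
  presentation. Projective dimension is the existence of iterated syzygies, and it is compared along
  exact sequences by pullbacks. The order of the indices enters through one fact: the kernel of
  P(\<alpha>) -> \<Delta>(\<alpha>) is generated by images of P(\<nu>) with \<nu> > \<alpha>, so
  \<Delta>(\<alpha>) has no extensions by modules whose composition factors have index at most
  \<alpha>. This is why a single pass of universal extensions suffices: a later step adds only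
  modules filtered by a standard module of smaller index, which do not disturb the vanishing reached
  before. A uniform bound on projective dimensions must exist before a largest one can be chosen.
  Stratification is assumed for A alone, so closure under direct summands has to be proved to reach
  all projectives. The kernel above is then filtered by standard modules of larger index, and
  induction from the top index gives the bound.\<close>

text \<open>Vectors of \<open>k^m\<close>, for all \<open>m\<close> at once, are encoded by their coordinates as polynomials with vanishing
  coefficients from \<open>m\<close> on. This makes addition a group operation on a type, without carrier conditions.\<close>

definition Sp :: "nat \<Rightarrow> 'k::field poly set" where
  "Sp m = {x. \<forall>i\<ge>m. coeff x i = 0}"

text \<open>Linearity is demanded on all polynomials, not only on some \<open>Sp m\<close>, so that
  sums and composites need no side conditions. A map that is known only on unit vectors is extended
  by \<open>lincomb\<close>.\<close>

definition lin :: "('k::field poly \<Rightarrow> 'k poly) \<Rightarrow> bool" where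
  "lin f \<longleftrightarrow> (\<forall>x y. f (x + y) = f x + f y) \<and> (\<forall>c x. f (smult c x) = smult c (f x))"

definition subsp :: "'k::field poly set \<Rightarrow> bool" where
  "subsp U \<longleftrightarrow> 0 \<in> U \<and> (\<forall>x\<in>U. \<forall>y\<in>U. x + y \<in> U) \<and> (\<forall>c. \<forall>x\<in>U. smult c x \<in> U)"

abbreviation unit :: "nat \<Rightarrow> 'k::field poly" where
  "unit i \<equiv> monom 1 i"

abbreviation trunc :: "nat \<Rightarrow> 'k::field poly \<Rightarrow> 'k poly" where
  "trunc \<equiv> poly_cutoff"

text \<open>The linear map that sends \<open>unit i\<close> to \<open>b i\<close> for
  \<open>i < m\<close> and the other unit vectors to 0.\<close>

definition lincomb :: "nat \<Rightarrow> (nat \<Rightarrow> 'k::field poly) \<Rightarrow> 'k poly \<Rightarrow> 'k poly" where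
  "lincomb m b x = (\<Sum>i<m. smult (coeff x i) (b i))"

lemmas smult_simps [simp] = smult_add_right smult_diff_right smult_minus_right smult_minus_left

lemma smult_sum_right: "smult c (sum f S) = (\<Sum>i\<in>S. smult c (f i))"
  by (induction S rule: infinite_finite_induct) (auto simp: smult_simps)

lemma Sp_closed [intro]:
  "0 \<in> Sp m" "x \<in> Sp m \<Longrightarrow> y \<in> Sp m \<Longrightarrow> x + y \<in> Sp m" "x \<in> Sp m \<Longrightarrow> y \<in> Sp m \<Longrightarrow> x - y \<in> Sp m"
  "x \<in> Sp m \<Longrightarrow> smult c x \<in> Sp m" "x \<in> Sp m \<Longrightarrow> - x \<in> Sp m"
  by (auto simp: Sp_def )

lemma zero_Sp [simp]: "0 \<in> Sp m"
  by auto

lemma Sp_0 [simp]: "Sp 0 = {0}"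
  by (auto simp: Sp_def poly_eq_iff)

lemma Sp_mono: "m \<le> n \<Longrightarrow> x \<in> Sp m \<Longrightarrow> x \<in> Sp n"
  by (auto simp: Sp_def)

lemma Sp_iff_Suc: "x \<in> Sp m \<longleftrightarrow> x \<in> Sp (Suc m) \<and> coeff x m = 0"
  by (auto simp: Sp_def) (metis Suc_leI le_eq_less_or_eq)

lemma subsp_Sp: "subsp (Sp m)"
  by (auto simp: subsp_def)

lemma subspD:
  assumes "subsp U"
  shows "0 \<in> U" "x \<in> U \<Longrightarrow> y \<in> U \<Longrightarrow> x + y \<in> U" "x \<in> U \<Longrightarrow> smult c x \<in> U"
    "x \<in> U \<Longrightarrow> - x \<in> U" "x \<in> U \<Longrightarrow> y \<in> U \<Longrightarrow> x - y \<in> U"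
proof -
  show 1: "0 \<in> U" "\<And>x y. x \<in> U \<Longrightarrow> y \<in> U \<Longrightarrow> x + y \<in> U" "\<And>x c. x \<in> U \<Longrightarrow> smult c x \<in> U"
    using assms by (auto simp: subsp_def)
  show 2: "- x \<in> U" if "x \<in> U" for x using 1(3)[OF that, of "-1"] by simp
  show "x - y \<in> U" if "x \<in> U" "y \<in> U" for x y using 1(2)[OF that(1) 2[OF that(2)]] by simp
qed

lemma subsp_sum: "subsp U \<Longrightarrow> (\<And>i. i \<in> S \<Longrightarrow> f i \<in> U) \<Longrightarrow> sum f S \<in> U"
  by (induction S rule: infinite_finite_induct) (auto simp: subspD)

lemma unit_Sp [intro]: "i < m \<Longrightarrow> unit i \<in> Sp m"
  by (auto simp:  Sp_def)

lemma unit_nonzero: "unit i \<noteq> (0 :: 'k::field poly)"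
  by simp

lemma trunc_Sp [simp]: "trunc m x \<in> Sp m"
  by (auto simp: coeff_poly_cutoff Sp_def)

lemma trunc_id: "x \<in> Sp m \<Longrightarrow> trunc m x = x"
  by (auto simp: coeff_poly_cutoff Sp_def poly_eq_iff)

lemma trunc_Suc: "trunc (Suc m) x = trunc m x + smult (coeff x m) (unit m)"
  by (auto simp: coeff_poly_cutoff   poly_eq_iff less_Suc_eq)

lemma linI: "(\<And>x y. f (x + y) = f x + f y) \<Longrightarrow> (\<And>c x. f (smult c x) = smult c (f x)) \<Longrightarrow> lin f"
  by (auto simp: lin_def)

lemma linD:
  assumes "lin f"
  shows "f (x + y) = f x + f y" "f (smult c x) = smult c (f x)" "f 0 = 0" "f (- x) = - f x" "f (x - y) = f x - f y"
proof -
  show 1: "\<And>x y. f (x + y) = f x + f y" "\<And>c x. f (smult c x) = smult c (f x)"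
    using assms by (auto simp: lin_def)
  show "f 0 = 0" using 1(2)[of 0 0] by simp
  show 2: "f (- x) = - f x" for x using 1(2)[of "-1" x] by simp
  show "f (x - y) = f x - f y" using 1(1)[of x "-y"] 2 by simp
qed

lemma lin_sum: "lin f \<Longrightarrow> f (sum g S) = (\<Sum>i\<in>S. f (g i))"
  by (induction S rule: infinite_finite_induct) (auto simp: linD)

lemma lin_trunc: "lin (trunc m)"
  by (auto simp: lin_def coeff_poly_cutoff poly_eq_iff )

lemma lin_comp [intro]: "lin f \<Longrightarrow> lin g \<Longrightarrow> lin (\<lambda>x. f (g x))"
  by (simp add: lin_def)

lemma lin_intros [intro]:
  "lin (\<lambda>x. x)" "lin (\<lambda>x. 0)" "lin f \<Longrightarrow> lin g \<Longrightarrow> lin (\<lambda>x. f x + g x)"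
  "lin f \<Longrightarrow> lin g \<Longrightarrow> lin (\<lambda>x. f x - g x)"
  "lin f \<Longrightarrow> lin (\<lambda>x. smult c (f x))" "lin f \<Longrightarrow> lin (\<lambda>x. - f x)" "lin f \<Longrightarrow> lin (\<lambda>x. trunc m (f x))"
  "lin f \<Longrightarrow> lin (\<lambda>x. smult (coeff (f x) i) y)"
  by (simp_all add: lin_def lin_trunc[unfolded lin_def] smult_simps smult_add_left mult.commute)

lemma lin_lincomb: "lin (lincomb m b)"
  by (auto simp: lin_def lincomb_def smult_add_left sum.distrib smult_sum_right coeff_smult)

lemma lincomb_unit: "lincomb m unit x = trunc m x"
proof (induction m)
  case 0
  then show ?case by (auto simp: lincomb_def coeff_poly_cutoff poly_eq_iff)
next
  case (Suc m)
  then show ?case by (simp add: lincomb_def trunc_Suc)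
qed

lemma lin_of_lincomb: "lin f \<Longrightarrow> f (lincomb m b x) = lincomb m (\<lambda>i. f (b i)) x"
  by (simp add: lincomb_def lin_sum linD)

lemma lin_eq_lincomb:
  assumes "lin f" "x \<in> Sp m"
  shows "f x = lincomb m (\<lambda>i. f (unit i)) x"
  using lin_of_lincomb[OF assms(1), of m unit x] assms(2) by (simp add: lincomb_unit trunc_id)

lemma lincomb_in: "subsp U \<Longrightarrow> (\<And>i. i < m \<Longrightarrow> b i \<in> U) \<Longrightarrow> lincomb m b x \<in> U"
  unfolding lincomb_def by (intro subsp_sum) (auto intro: subspD)

lemma lincomb_cong: "(\<And>i. i < m \<Longrightarrow> b i = c i) \<Longrightarrow> lincomb m b x = lincomb m c x"
  unfolding lincomb_def by (intro sum.cong) auto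

lemma lin_eqI:
  assumes "lin f" "lin g" "\<And>i. i < m \<Longrightarrow> f (unit i) = g (unit i)" "x \<in> Sp m"
  shows "f x = g x"
  using assms(3) by (simp add: lin_eq_lincomb[OF assms(1,4)] lin_eq_lincomb[OF assms(2,4)] cong: lincomb_cong)

lemma subsp_image: "lin f \<Longrightarrow> subsp U \<Longrightarrow> subsp (f ` U)"
  unfolding subsp_def
proof (intro conjI ballI allI)
  assume f: "lin f" and U: "0 \<in> U \<and> (\<forall>x\<in>U. \<forall>y\<in>U. x + y \<in> U) \<and> (\<forall>c. \<forall>x\<in>U. smult c x \<in> U)"
  show "0 \<in> f ` U" using U linD(3)[OF f] by (metis image_eqI)
  show "x + y \<in> f ` U" if "x \<in> f ` U" "y \<in> f ` U" for x y
    using that U linD(1)[OF f] by (auto simp: image_iff) metis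
  show "smult c x \<in> f ` U" if "x \<in> f ` U" for x c
    using that U linD(2)[OF f] by (auto simp: image_iff) metis
qed

lemma lin_injD:
  assumes "lin f" "\<forall>x\<in>Sp m. f x = 0 \<longrightarrow> x = 0" "x \<in> Sp m" "y \<in> Sp m" "f x = f y"
  shows "x = y"
proof -
  have "f (x - y) = 0" using assms by (simp add: linD)
  then show ?thesis using assms(2,3,4) by (metis Sp_closed(3) eq_iff_diff_eq_0)
qed

text \<open>The source of all submodules and quotients below: \<open>j\<close> and \<open>l\<close>
  are inverse coordinates on \<open>U\<close>, and \<open>q\<close> is a quotient map with kernel
  \<open>U\<close>, both with values in coordinate spaces again. The induction on \<open>m\<close>
  asks whether \<open>U\<close> lies in the hyperplane where the last coordinate vanishes.\<close>

lemma subspace_split: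
  assumes "subsp U" "U \<subseteq> Sp m"
  shows "\<exists>r s j l q. r + s = m \<and> lin j \<and> lin l \<and> lin q \<and> (\<forall>x\<in>Sp r. j x \<in> U \<and> l (j x) = x) \<and>
     (\<forall>u\<in>U. l u \<in> Sp r \<and> j (l u) = u) \<and> (\<forall>x\<in>Sp m. q x \<in> Sp s) \<and> (\<forall>y\<in>Sp s. \<exists>x\<in>Sp m. q x = y) \<and>
     (\<forall>x\<in>Sp m. q x = 0 \<longleftrightarrow> x \<in> U)"
  using assms
proof (induction m arbitrary: U)
  case 0
  then have "U = {0}" by (auto simp: subsp_def)
  then show ?case by (intro exI[of _ 0] exI[of _ "\<lambda>x. 0"]) auto
next
  case (Suc m)
  let ?U0 = "U \<inter> Sp m"
  have U0: "subsp ?U0" using Suc.prems(1) subsp_Sp[of m] by (auto simp: subsp_def)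
  obtain r s j l q where rs: "r + s = m" and lin: "lin j" "lin l" "lin q"
    and j': "\<forall>x\<in>Sp r. j x \<in> ?U0 \<and> l (j x) = x"
    and l': "\<forall>u\<in>?U0. l u \<in> Sp r \<and> j (l u) = u"
    and q': "\<forall>x\<in>Sp m. q x \<in> Sp s" "\<forall>y\<in>Sp s. \<exists>x\<in>Sp m. q x = y"
    and ker': "\<forall>x\<in>Sp m. q x = 0 \<longleftrightarrow> x \<in> ?U0"
    using Suc.IH[OF U0 inf_le2] by (elim exE conjE) (rule that)
  note j = bspec[OF j'] and l = bspec[OF l'] and q = bspec[OF q'(1)] bspec[OF q'(2)] and ker = bspec[OF ker']
  note L = linD[OF lin(1)] linD[OF lin(2)] linD[OF lin(3)]
  show ?case
  proof (cases "U \<subseteq> Sp m")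
    case True
    \<comment> \<open>The last coordinate is independent of \<open>U\<close>, so it survives in the
      quotient as the new coordinate number \<open>s\<close>.\<close>
    let ?q = "\<lambda>x. q (trunc m x) + smult (coeff x m) (unit s)"
    have linq: "lin ?q"
      by (intro lin_intros(3) lin_comp[OF lin(3) lin_trunc] lin_intros(8)[OF lin_intros(1)])
    have Q1: "?q x \<in> Sp (Suc s)" for x
      using q(1)[OF trunc_Sp] by (auto intro!: Sp_closed intro: Sp_mono[of s])
    have Q2: "\<exists>x\<in>Sp (Suc m). ?q x = y" if y: "y \<in> Sp (Suc s)" for y
    proof -
      obtain x where x: "x \<in> Sp m" "q x = trunc s y" using q(2)[OF trunc_Sp] by metis
      let ?x = "x + smult (coeff y s) (unit m)"
      have "trunc m ?x = x" "coeff ?x m = coeff y s"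
        using x(1) by (auto simp: coeff_poly_cutoff Sp_def poly_eq_iff  )
      then have "?q ?x = y" using x y trunc_Suc[of s y] trunc_id[OF y] by simp
      moreover have "?x \<in> Sp (Suc m)" using x(1) by (auto intro!: Sp_closed intro: Sp_mono[of m])
      ultimately show ?thesis by blast
    qed
    have Q3: "?q x = 0 \<longleftrightarrow> x \<in> U" if x: "x \<in> Sp (Suc m)" for x
    proof
      assume 0: "?q x = 0"
      have "coeff (q (trunc m x)) s = 0" using q(1)[OF trunc_Sp] by (auto simp: Sp_def)
      then have "coeff x m = 0" using arg_cong[OF 0, of "\<lambda>p. coeff p s"] by (simp)
      moreover from this have "trunc m x = x" using x trunc_Suc[of m x] trunc_id[OF x] by simp
      ultimately show "x \<in> U" using 0 ker[OF trunc_Sp[of m x]] by simp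
    next
      assume "x \<in> U"
      with True have xm: "x \<in> Sp m" "coeff x m = 0" by (auto simp: Sp_def)
      with ker[OF xm(1)] \<open>x \<in> U\<close> trunc_id[OF xm(1)] show "?q x = 0" by simp
    qed
    have "U = ?U0" using True by blast
    then show ?thesis
      using rs lin(1,2) linq j' l' Q1 Q2 Q3
      by (intro exI[of _ r] exI[of _ "Suc s"] exI[of _ j] exI[of _ l] exI[of _ ?q]) simp
  next
    case False
    then obtain u0 where u0: "u0 \<in> U" "u0 \<notin> Sp m" by blast
    then have "coeff u0 m \<noteq> 0" using Suc.prems(2) Sp_iff_Suc by blast
    define u where "u = smult (inverse (coeff u0 m)) u0"
    have u: "u \<in> U" "coeff u m = 1" using u0 \<open>coeff u0 m \<noteq> 0\<close> Suc.prems(1) by (auto simp: u_def  subsp_def)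
    have uS: "u \<in> Sp (Suc m)" using u(1) Suc.prems(2) by blast
    \<comment> \<open>Projection onto the hyperplane \<open>Sp m\<close> along \<open>u\<close>,
      whose last coordinate is 1. It reduces membership in \<open>U\<close> to membership in
      \<open>?U0\<close>, and \<open>u\<close> supplies the new coordinate of the subspace.\<close>
    let ?p = "\<lambda>x. x - smult (coeff x m) u"
    let ?j = "\<lambda>x. j (trunc r x) + smult (coeff x r) u"
    let ?l = "\<lambda>x. l (?p x) + smult (coeff x m) (unit r)"
    let ?q = "\<lambda>x. q (?p x)"
    have linp: "lin ?p" by (auto intro!: linI simp: smult_add_left coeff_smult algebra_simps)
    have linj: "lin ?j"
      by (intro lin_intros(3) lin_comp[OF lin(1) lin_trunc] lin_intros(8)[OF lin_intros(1)])
    have linl: "lin ?l" by (intro lin_intros(3) lin_comp[OF lin(2) linp] lin_intros(8)[OF lin_intros(1)])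
    have linq: "lin ?q" by (rule lin_comp[OF lin(3) linp])
    have p: "?p x \<in> Sp m" if "x \<in> Sp (Suc m)" for x
      using that uS u(2) unfolding Sp_iff_Suc[of _ m] by (auto intro: Sp_closed)
    have pU: "?p x \<in> ?U0 \<longleftrightarrow> x \<in> U" if "x \<in> Sp (Suc m)" for x
    proof -
      have "x = ?p x + smult (coeff x m) u" by simp
      then show ?thesis using p[OF that] subspD[OF Suc.prems(1)] u(1) by (metis IntD1 IntI)
    qed
    have J: "?j x \<in> U \<and> ?l (?j x) = x" if x: "x \<in> Sp (Suc r)" for x
    proof -
      have jt: "j (trunc r x) \<in> ?U0" "l (j (trunc r x)) = trunc r x" using j[OF trunc_Sp] by auto
      then have "coeff (j (trunc r x)) m = 0" by (auto simp: Sp_def)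
      then have m: "coeff (?j x) m = coeff x r" using u(2) by (simp add: )
      then have "?p (?j x) = j (trunc r x)" by simp
      then have "?l (?j x) = trunc r x + smult (coeff x r) (unit r)" unfolding m using jt(2) by simp
      then have "?l (?j x) = x" using trunc_Suc[of r x] trunc_id[OF x] by simp
      moreover have "?j x \<in> U" using jt(1) u(1) subspD[OF Suc.prems(1)] by blast
      ultimately show ?thesis by blast
    qed
    have Lt: "?l v \<in> Sp (Suc r) \<and> ?j (?l v) = v" if v: "v \<in> U" for v
    proof -
      have vS: "v \<in> Sp (Suc m)" using v Suc.prems(2) by blast
      have lp: "l (?p v) \<in> Sp r" "j (l (?p v)) = ?p v" using l pU[OF vS] v by auto
      have "trunc r (?l v) = l (?p v)" "coeff (?l v) r = coeff v m"
        using lp(1) by (auto simp: coeff_poly_cutoff Sp_def poly_eq_iff  )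
      then have "?j (?l v) = v" using lp(2) by simp
      moreover have "?l v \<in> Sp (Suc r)" using lp(1) by (auto intro!: Sp_closed intro: Sp_mono[of r])
      ultimately show ?thesis by blast
    qed
    have Q1: "?q x \<in> Sp s" if "x \<in> Sp (Suc m)" for x using q(1)[OF p[OF that]] .
    have Q2: "\<exists>x\<in>Sp (Suc m). ?q x = y" if y: "y \<in> Sp s" for y
    proof -
      obtain x where x: "x \<in> Sp m" "q x = y" using q(2)[OF y] by blast
      then have "coeff x m = 0" by (auto simp: Sp_def)
      then have "?p x = x" by simp
      then show ?thesis using x Sp_mono[of m "Suc m" x] by (metis le_SucI order_refl)
    qed
    have Q3: "?q x = 0 \<longleftrightarrow> x \<in> U" if "x \<in> Sp (Suc m)" for x
      using ker[OF p[OF that]] pU[OF that] by simp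
    show ?thesis
      using rs linj linl linq J Lt Q1 Q2 Q3
      by (intro exI[of _ "Suc r"] exI[of _ s] exI[of _ ?j] exI[of _ ?l] exI[of _ ?q]) simp
  qed
qed

text \<open>Gaussian elimination: if some unknown occurs in the last equation, that equation is
  solved for it, which leaves one equation and one unknown less. All comparisons of dimensions rest
  on this.\<close>

lemma more_unknowns:
  assumes "lin f" "\<forall>x\<in>Sp (Suc b). f x \<in> Sp b"
  shows "\<exists>x\<in>Sp (Suc b). x \<noteq> 0 \<and> f x = 0"
  using assms
proof (induction b arbitrary: f)
  case 0
  have "unit 0 \<in> Sp (Suc 0)" by (rule unit_Sp) simp
  then show ?case using 0 unit_nonzero[of 0] by (metis Sp_0 singletonD)
next
  case (Suc b)
  note L = linD[OF Suc.prems(1)]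
  show ?case
  proof (cases "\<exists>i<Suc (Suc b). coeff (f (unit i)) b \<noteq> 0")
    case False
    have "f x \<in> Sp b" if x: "x \<in> Sp (Suc b)" for x
    proof -
      have xS: "x \<in> Sp (Suc (Suc b))" using x by (rule Sp_mono[rotated]) simp
      have "coeff (f x) b = coeff (lincomb (Suc (Suc b)) (\<lambda>i. f (unit i)) x) b"
        using lin_eq_lincomb[OF Suc.prems(1) xS] by simp
      also have "\<dots> = 0" unfolding lincomb_def coeff_sum
        using False by (intro sum.neutral) (auto simp: coeff_smult)
      finally have "coeff (f x) b = 0" .
      moreover have "f x \<in> Sp (Suc b)" using Suc.prems(2) xS by blast
      ultimately show ?thesis using Sp_iff_Suc by blast
    qed
    then show ?thesis using Suc.IH[OF Suc.prems(1)] by (metis Sp_mono le_SucI order_refl)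
  next
    case True
    then obtain i where i: "i < Suc (Suc b)" "coeff (f (unit i)) b \<noteq> 0" by blast
    \<comment> \<open>\<open>\<sigma>\<close> inserts a zero at position \<open>i\<close> and moves
      the later coordinates up by one. Then \<open>g\<close> fills position \<open>i\<close> with
      the value for which coefficient \<open>b\<close> of the image under \<open>f\<close>
      vanishes.\<close>
    define \<sigma> where "\<sigma> x = poly_cutoff i x + monom 1 (Suc i) * poly_shift i x" for x :: "'a poly"
    have coeff_\<sigma>: "coeff (\<sigma> x) k = (if k < i then coeff x k else if k = i then 0 else coeff x (k - 1))" for x k
      by (auto simp: \<sigma>_def coeff_poly_cutoff coeff_monom_mult coeff_poly_shift)
    have \<sigma>: "lin \<sigma>" by (auto intro!: linI simp: coeff_\<sigma> poly_eq_iff )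
    define g where "g x = \<sigma> x - smult (coeff (f (\<sigma> x)) b) (smult (1 / coeff (f (unit i)) b) (unit i))" for x
    have g: "lin g" unfolding g_def
      by (intro lin_intros(4) \<sigma> lin_intros(8)[OF lin_comp[OF Suc.prems(1) \<sigma>]])
    have gS: "g x \<in> Sp (Suc (Suc b))" if "x \<in> Sp (Suc b)" for x
    proof -
      have "\<sigma> x \<in> Sp (Suc (Suc b))" using that i(1) by (auto simp: coeff_\<sigma> Sp_def)
      then show ?thesis using i(1) by (auto simp: g_def)
    qed
    have fg0: "coeff (f (g x)) b = 0" for x
      using i(2) by (simp add: g_def L coeff_smult)
    have "f (g x) \<in> Sp b" if "x \<in> Sp (Suc b)" for x
    proof -
      have "f (g x) \<in> Sp (Suc b)" using Suc.prems(2) gS[OF that] by blast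
      then show ?thesis using fg0[of x] Sp_iff_Suc by blast
    qed
    then obtain x where x: "x \<in> Sp (Suc b)" "x \<noteq> 0" "f (g x) = 0"
      using Suc.IH[of "\<lambda>x. f (g x)"] Suc.prems(1) g by blast
    have "g x \<noteq> 0"
    proof
      assume g0: "g x = 0"
      have "coeff x k = 0" for k
      proof (cases "k < i")
        case True
        then show ?thesis using arg_cong[OF g0, of "\<lambda>p. coeff p k"] by (simp add: g_def coeff_\<sigma>  )
      next
        case False
        then show ?thesis using arg_cong[OF g0, of "\<lambda>p. coeff p (Suc k)"] by (simp add: g_def coeff_\<sigma>  )
      qed
      then show False using x(2) by (auto simp: poly_eq_iff)
    qed
    then show ?thesis using x gS by blast
  qed
qed

lemma lin_inj_dim:
  assumes "lin f" "\<forall>x\<in>Sp a. f x \<in> Sp b" "\<forall>x\<in>Sp a. f x = 0 \<longrightarrow> x = 0"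
  shows "a \<le> b"
proof (rule ccontr)
  assume "\<not> a \<le> b"
  then have "\<And>x. x \<in> Sp (Suc b) \<Longrightarrow> x \<in> Sp a" by (metis Sp_mono not_less_eq_eq)
  then show False using more_unknowns[of f b] assms by metis
qed

lemma lin_section:
  assumes f: "lin f" and m: "\<forall>y\<in>Sp b. \<exists>x\<in>Sp a. f x = y"
  obtains t where "lin t" "\<And>y. y \<in> Sp b \<Longrightarrow> t y \<in> Sp a" "\<And>y. y \<in> Sp b \<Longrightarrow> f (t y) = y"
proof -
  have "\<forall>i. \<exists>x. i < b \<longrightarrow> x \<in> Sp a \<and> f x = unit i" using m by blast
  then obtain c where c: "\<And>i. i < b \<Longrightarrow> c i \<in> Sp a \<and> f (c i) = unit i" by metis
  show ?thesis
  proof (rule that[of "lincomb b c"])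
    show "f (lincomb b c y) = y" if "y \<in> Sp b" for y
      using c trunc_id[OF that] by (simp add: lin_of_lincomb[OF f] lincomb_unit cong: lincomb_cong)
    show "lincomb b c y \<in> Sp a" for y using c by (intro lincomb_in[OF subsp_Sp]) auto
  qed (rule lin_lincomb)
qed

lemma lin_surj_dim:
  assumes "lin f" "\<forall>y\<in>Sp b. \<exists>x\<in>Sp a. f x = y"
  shows "b \<le> a"
proof -
  obtain t where t: "lin t" "\<And>y. y \<in> Sp b \<Longrightarrow> t y \<in> Sp a" "\<And>y. y \<in> Sp b \<Longrightarrow> f (t y) = y"
    using lin_section[OF assms] by blast
  have "y = 0" if "y \<in> Sp b" "t y = 0" for y
    using t(3)[OF that(1)] that(2) linD(3)[OF assms(1)] by simp
  then show ?thesis using lin_inj_dim[OF t(1)] t(2) by blast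
qed

text \<open>The image has \<open>r\<close> coordinates and codimension \<open>s\<close>. Injectivity
  forces \<open>a \<le> r\<close>, hence \<open>s = 0\<close>, and the quotient by the image is
  zero.\<close>

lemma lin_inj_eq_dim_surj:
  assumes f: "lin f" "\<forall>x\<in>Sp a. f x \<in> Sp a" "\<forall>x\<in>Sp a. f x = 0 \<longrightarrow> x = 0" and y: "y \<in> Sp a"
  shows "\<exists>x\<in>Sp a. f x = y"
proof -
  have U: "subsp (f ` Sp a)" "f ` Sp a \<subseteq> Sp a" using f subsp_image[OF f(1) subsp_Sp] by auto
  obtain r s j l q where rs: "r + s = a" and lin: "lin j" "lin l" "lin q"
    and l: "\<forall>u\<in>f ` Sp a. l u \<in> Sp r \<and> j (l u) = u"
    and q: "\<forall>x\<in>Sp a. q x \<in> Sp s" "\<forall>x\<in>Sp a. q x = 0 \<longleftrightarrow> x \<in> f ` Sp a"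
    using subspace_split[OF U] by blast
  have "x = 0" if "x \<in> Sp a" "l (f x) = 0" for x
    using l f(3) that linD(3)[OF lin(1)] by (metis imageI)
  then have "a \<le> r" using lin_inj_dim[of "\<lambda>x. l (f x)" a r] lin(2) f(1) l by blast
  then have "s = 0" using rs by simp
  then show ?thesis using q y by auto
qed

lemma lin_surj_eq_dim_inj:
  assumes f: "lin f" "\<forall>y\<in>Sp a. \<exists>x\<in>Sp a. f x = y" and x: "x \<in> Sp a" "f x = 0"
  shows "x = 0"
proof -
  obtain t where t: "lin t" "\<And>y. y \<in> Sp a \<Longrightarrow> t y \<in> Sp a" "\<And>y. y \<in> Sp a \<Longrightarrow> f (t y) = y"
    using lin_section[OF f] by blast
  obtain y where "y \<in> Sp a" "t y = x"
    using lin_inj_eq_dim_surj[OF t(1) _ _ x(1)] t linD(3)[OF f(1)] by metis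
  then show ?thesis using t(3)[of y] x(2) linD(3)[OF t(1)] by simp
qed

lemma lin_retraction:
  assumes f: "lin f" "\<forall>x\<in>Sp a. f x \<in> Sp b" "\<forall>x\<in>Sp a. f x = 0 \<longrightarrow> x = 0"
  obtains r where "lin r" "\<And>y. y \<in> Sp b \<Longrightarrow> r y \<in> Sp a" "\<And>x. x \<in> Sp a \<Longrightarrow> r (f x) = x"
proof -
  have U: "subsp (f ` Sp a)" "f ` Sp a \<subseteq> Sp b" using f subsp_image[OF f(1) subsp_Sp] by auto
  obtain r' s and j l q :: "'a poly \<Rightarrow> 'a poly" where lin: "lin j" "lin l" "lin q"
    and q: "\<forall>x\<in>Sp b. q x \<in> Sp s" "\<forall>y\<in>Sp s. \<exists>x\<in>Sp b. q x = y" "\<forall>x\<in>Sp b. q x = 0 \<longleftrightarrow> x \<in> f ` Sp a"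
    using subspace_split[OF U] by blast
  obtain t where t: "lin t" "\<And>y. y \<in> Sp s \<Longrightarrow> t y \<in> Sp b" "\<And>y. y \<in> Sp s \<Longrightarrow> q (t y) = y"
    using lin_section[OF lin(3) q(2)] by blast
  \<comment> \<open>Projection onto the image of \<open>f\<close> along the complement picked by the
    section \<open>t\<close>. The retraction is then defined by choosing preimages of the projected
    unit vectors.\<close>
  let ?p = "\<lambda>x. x - t (q x)"
  have p: "lin ?p" using t(1) lin(3) by auto
  have pU: "\<exists>x\<in>Sp a. f x = ?p y" if y: "y \<in> Sp b" for y
  proof -
    have "q (?p y) = 0" "?p y \<in> Sp b"
      using y q(1) t by (auto simp: linD(5)[OF lin(3)])
    then show ?thesis using q(3) by (metis (no_types, lifting) imageE)
  qed
  then have "\<forall>i. \<exists>x. i < b \<longrightarrow> x \<in> Sp a \<and> f x = ?p (unit i)" by blast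
  then obtain c where c: "\<And>i. i < b \<Longrightarrow> c i \<in> Sp a \<and> f (c i) = ?p (unit i)" by metis
  have fr: "f (lincomb b c y) = ?p y" if "y \<in> Sp b" for y
    using c lin_eq_lincomb[OF p that] by (simp add: lin_of_lincomb[OF f(1)] cong: lincomb_cong)
  have rS: "lincomb b c y \<in> Sp a" for y using c by (intro lincomb_in[OF subsp_Sp]) auto
  show ?thesis
  proof (rule that[OF lin_lincomb rS])
    fix x :: "'a poly" assume x: "x \<in> Sp a"
    then have fx: "f x \<in> Sp b" "q (f x) = 0" using f(2) q(3) by auto
    then have "f (lincomb b c (f x)) = f x" using fr[OF fx(1)] linD(3)[OF t(1)] by simp
    then show "lincomb b c (f x) = x" using lin_injD[OF f(1,3)] rS x by blast
  qed
qed

section \<open>Modules and homomorphisms\<close>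

definition pv :: "'k::field vec \<Rightarrow> 'k poly" where
  "pv v = (\<Sum>i<dim_vec v. monom (v $ i) i)"

abbreviation vc :: "nat \<Rightarrow> 'k::field poly \<Rightarrow> 'k vec" where
  "vc m x \<equiv> vec m (coeff x)"

text \<open>\<open>fm F\<close> reads only the coefficients below the number of columns and returns
  only coefficients below the number of rows; it is therefore linear on all polynomials.
  \<open>mt\<close> goes back, up to the behaviour outside the relevant \<open>Sp c\<close>.\<close>

definition fm :: "'k::field mat \<Rightarrow> 'k poly \<Rightarrow> 'k poly" where
  "fm F x = pv (F *\<^sub>v vc (dim_col F) x)"

definition mt :: "nat \<Rightarrow> nat \<Rightarrow> ('k::field poly \<Rightarrow> 'k poly) \<Rightarrow> 'k mat" where
  "mt r c f = mat r c (\<lambda>(i, j). coeff (f (unit j)) i)"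

lemma coeff_pv: "coeff (pv v) i = (if i < dim_vec v then v $ i else 0)"
  by (simp add: pv_def coeff_sum)

lemma pv_Sp: "dim_vec v = m \<Longrightarrow> pv v \<in> Sp m"
  by (auto simp: Sp_def coeff_pv)

lemma vc_pv: "dim_vec v = m \<Longrightarrow> vc m (pv v) = v"
  by (auto simp: coeff_pv)

lemma pv_vc: "x \<in> Sp m \<Longrightarrow> pv (vc m x) = x"
  by (auto simp: poly_eq_iff coeff_pv Sp_def)

lemma pv_simps:
  "dim_vec v = dim_vec w \<Longrightarrow> pv (v + w) = pv v + pv w" "pv (c \<cdot>\<^sub>v v) = smult c (pv v)" "pv (0\<^sub>v m) = 0"
  by (auto simp: poly_eq_iff coeff_pv)

lemma vc_simps: "vc m (x + y) = vc m x + vc m y" "vc m (smult c x) = c \<cdot>\<^sub>v vc m x" "vc m 0 = 0\<^sub>v m"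
  by auto

lemma coeff_fm: "coeff (fm F x) i = (if i < dim_row F then (\<Sum>j<dim_col F. F $$ (i, j) * coeff x j) else 0)"
  by (auto simp: fm_def coeff_pv scalar_prod_def atLeast0LessThan)

lemma lin_fm: "lin (fm F)"
  by (rule linI; rule poly_eqI) (auto simp: coeff_fm algebra_simps sum.distrib sum_distrib_left)

lemma fm_Sp: "F \<in> carrier_mat r c \<Longrightarrow> fm F x \<in> Sp r"
  by (auto simp: Sp_def coeff_fm)

lemma fm_vc: "F \<in> carrier_mat r c \<Longrightarrow> F *\<^sub>v vc c x = vc r (fm F x)"
  by (auto simp: fm_def vc_pv)

lemma fm_mult: "F \<in> carrier_mat r c \<Longrightarrow> G \<in> carrier_mat c d \<Longrightarrow> fm (F * G) x = fm F (fm G x)"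
  by (simp add: fm_def vc_pv assoc_mult_mat_vec[of _ r c _ d])

lemma fm_add: "F \<in> carrier_mat r c \<Longrightarrow> G \<in> carrier_mat r c \<Longrightarrow> fm (F + G) x = fm F x + fm G x"
  by (rule poly_eqI) (auto simp: coeff_fm algebra_simps sum.distrib)

lemma fm_smult: "fm (c \<cdot>\<^sub>m F) x = smult c (fm F x)"
  by (rule poly_eqI) (auto simp: coeff_fm algebra_simps sum_distrib_left)

lemma fm_one: "x \<in> Sp m \<Longrightarrow> fm (1\<^sub>m m) x = x"
  by (simp add: fm_def pv_vc)

lemma mt_carrier [simp]: "mt r c f \<in> carrier_mat r c"
  by (simp add: mt_def)

lemma fm_mt:
  assumes "lin f" "\<forall>x\<in>Sp c. f x \<in> Sp r" "x \<in> Sp c"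
  shows "fm (mt r c f) x = f x"
proof (rule poly_eqI)
  fix i
  have f: "f x = lincomb c (\<lambda>j. f (unit j)) x" by (rule lin_eq_lincomb[OF assms(1,3)])
  have "coeff (f x) i = 0" if "\<not> i < r" using assms that by (auto simp: Sp_def)
  then show "coeff (fm (mt r c f) x) i = coeff (f x) i"
    using f by (auto simp: coeff_fm mt_def lincomb_def coeff_sum mult.commute)
qed

lemma eq_mat_fm:
  assumes "F \<in> carrier_mat r c" "G \<in> carrier_mat r c" "\<And>x. x \<in> Sp c \<Longrightarrow> fm F x = fm G x"
  shows "F = G"
proof (rule eq_matI)
  fix i j assume injective_mod: "i < dim_row G" "j < dim_col G"
  have *: "coeff (fm H (unit j)) i = H $$ (i, j)" if "H \<in> carrier_mat r c" for H
    using that injective_mod assms(2) by (auto simp: coeff_fm if_distrib[of "\<lambda>x. _ * x"] sum.delta cong: if_cong)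
  show "F $$ (i, j) = G $$ (i, j)"
    using *[OF assms(1)] *[OF assms(2)] assms(3)[OF unit_Sp[of j c]] injective_mod assms(2) by auto
qed (use assms in auto)

locale fd_algebra =
  fixes A :: "'k::field falg"
  assumes falg: "is_falg A"
begin

abbreviation md :: "'k fmod \<Rightarrow> bool" where "md \<equiv> is_mod A"

abbreviation S :: "'k fmod \<Rightarrow> 'k poly set" where "S M \<equiv> Sp (mdim M)"

abbreviation V :: "'k vec set" where "V \<equiv> carrier_vec (adim A)"

definition ac :: "'k fmod \<Rightarrow> 'k vec \<Rightarrow> 'k poly \<Rightarrow> 'k poly" where
  "ac M a = fm (act M a)"

text \<open>Outside \<open>S M\<close> such a function is constrained by linearity alone. Functions
  that agree on \<open>S M\<close> represent the same homomorphism, so equations between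
  homomorphisms are always stated pointwise on the source.\<close>

definition homs :: "'k fmod \<Rightarrow> 'k fmod \<Rightarrow> ('k poly \<Rightarrow> 'k poly) set" where
  "homs M N = {f. lin f \<and> (\<forall>x\<in>S M. f x \<in> S N) \<and> (\<forall>a\<in>V. \<forall>x\<in>S M. f (ac M a x) = ac N a (f x))}"

definition inj_on_mod :: "'k fmod \<Rightarrow> ('k poly \<Rightarrow> 'k poly) \<Rightarrow> bool" where
  "inj_on_mod M f \<longleftrightarrow> (\<forall>x\<in>S M. f x = 0 \<longrightarrow> x = 0)"

definition onto :: "'k fmod \<Rightarrow> 'k fmod \<Rightarrow> ('k poly \<Rightarrow> 'k poly) \<Rightarrow> bool" where
  "onto M N f \<longleftrightarrow> (\<forall>y\<in>S N. \<exists>x\<in>S M. f x = y)"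

definition smod :: "'k fmod \<Rightarrow> 'k poly set \<Rightarrow> bool" where
  "smod M U \<longleftrightarrow> U \<subseteq> S M \<and> subsp U \<and> (\<forall>a\<in>V. \<forall>u\<in>U. ac M a u \<in> U)"

lemma algD:
  shows "aone A \<in> V" "\<And>a b. a \<in> V \<Longrightarrow> b \<in> V \<Longrightarrow> amul A a b \<in> V"
    "\<And>a b c. a \<in> V \<Longrightarrow> b \<in> V \<Longrightarrow> c \<in> V \<Longrightarrow> amul A (a + b) c = amul A a c + amul A b c"
    "\<And>a b c. a \<in> V \<Longrightarrow> b \<in> V \<Longrightarrow> c \<in> V \<Longrightarrow> amul A a (b + c) = amul A a b + amul A a c"
    "\<And>a b s. a \<in> V \<Longrightarrow> b \<in> V \<Longrightarrow> amul A (s \<cdot>\<^sub>v a) b = s \<cdot>\<^sub>v amul A a b"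
    "\<And>a b s. a \<in> V \<Longrightarrow> b \<in> V \<Longrightarrow> amul A a (s \<cdot>\<^sub>v b) = s \<cdot>\<^sub>v amul A a b"
    "\<And>a b c. a \<in> V \<Longrightarrow> b \<in> V \<Longrightarrow> c \<in> V \<Longrightarrow> amul A (amul A a b) c = amul A a (amul A b c)"
    "\<And>a. a \<in> V \<Longrightarrow> amul A (aone A) a = a" "\<And>a. a \<in> V \<Longrightarrow> amul A a (aone A) = a"
  using falg unfolding is_falg_def Let_def by auto

lemma mdD:
  assumes "md M"
  shows "a \<in> V \<Longrightarrow> act M a \<in> carrier_mat (mdim M) (mdim M)"
    "a \<in> V \<Longrightarrow> ac M a x \<in> S M"
    "a \<in> V \<Longrightarrow> b \<in> V \<Longrightarrow> ac M (a + b) x = ac M a x + ac M b x"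
    "a \<in> V \<Longrightarrow> ac M (s \<cdot>\<^sub>v a) x = smult s (ac M a x)"
    "a \<in> V \<Longrightarrow> b \<in> V \<Longrightarrow> ac M (amul A a b) x = ac M a (ac M b x)"
    "x \<in> S M \<Longrightarrow> ac M (aone A) x = x"
proof -
  show c: "\<And>a. a \<in> V \<Longrightarrow> act M a \<in> carrier_mat (mdim M) (mdim M)"
    using assms by (auto simp: is_mod_def Let_def)
  show "a \<in> V \<Longrightarrow> ac M a x \<in> S M" using c[of a] unfolding ac_def by (rule fm_Sp)
  show "a \<in> V \<Longrightarrow> b \<in> V \<Longrightarrow> ac M (a + b) x = ac M a x + ac M b x"
    using assms c by (auto simp: is_mod_def Let_def ac_def intro!: fm_add[of _ "mdim M" "mdim M"])
  show "a \<in> V \<Longrightarrow> ac M (s \<cdot>\<^sub>v a) x = smult s (ac M a x)"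
    using assms by (auto simp: is_mod_def Let_def ac_def intro!: fm_smult)
  show "a \<in> V \<Longrightarrow> b \<in> V \<Longrightarrow> ac M (amul A a b) x = ac M a (ac M b x)"
    using assms c by (auto simp: is_mod_def Let_def ac_def intro!: fm_mult[of _ "mdim M" "mdim M" _ "mdim M"])
  show "x \<in> S M \<Longrightarrow> ac M (aone A) x = x"
    using assms by (auto simp: is_mod_def Let_def ac_def intro!: fm_one)
qed

lemma lin_ac: "lin (ac M a)"
  unfolding ac_def by (rule lin_fm)

lemmas acD = linD[OF lin_ac]

lemma hmI:
  "lin f \<Longrightarrow> (\<And>x. x \<in> S M \<Longrightarrow> f x \<in> S N) \<Longrightarrow>
   (\<And>a x. a \<in> V \<Longrightarrow> x \<in> S M \<Longrightarrow> f (ac M a x) = ac N a (f x)) \<Longrightarrow> f \<in> homs M N"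
  by (auto simp: homs_def)

lemma homs_lin: "f \<in> homs M N \<Longrightarrow> lin f"
  by (auto simp: homs_def)

lemmas hmL = linD[OF homs_lin]

lemma homs_in: "f \<in> homs M N \<Longrightarrow> x \<in> S M \<Longrightarrow> f x \<in> S N"
  by (auto simp: homs_def)

lemma homs_ac: "f \<in> homs M N \<Longrightarrow> a \<in> V \<Longrightarrow> x \<in> S M \<Longrightarrow> f (ac M a x) = ac N a (f x)"
  by (auto simp: homs_def)

lemma homs_comp: "f \<in> homs M N \<Longrightarrow> g \<in> homs N P \<Longrightarrow> (\<lambda>x. g (f x)) \<in> homs M P"
  by (auto simp: homs_def intro: lin_comp)

lemma homs_id: "(\<lambda>x. x) \<in> homs M M"
  by (auto simp: homs_def)

lemma homs_zero: "(\<lambda>x. 0) \<in> homs M N"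
  by (auto simp: homs_def acD)

lemma homs_add: "f \<in> homs M N \<Longrightarrow> g \<in> homs M N \<Longrightarrow> (\<lambda>x. f x + g x) \<in> homs M N"
  by (auto simp: homs_def acD)

lemma homs_diff: "f \<in> homs M N \<Longrightarrow> g \<in> homs M N \<Longrightarrow> (\<lambda>x. f x - g x) \<in> homs M N"
  by (auto simp: homs_def acD)

lemma homs_smult: "f \<in> homs M N \<Longrightarrow> (\<lambda>x. smult c (f x)) \<in> homs M N"
  by (auto simp: homs_def acD)

text \<open>Allows a module to be given by linear maps on polynomials, with the axioms checked only
  on \<open>Sp m\<close>, instead of by matrices. Submodules, quotients and the dual of the regular
  module are obtained this way.\<close>

lemma ex_mod:
  assumes lin: "\<And>a. a \<in> V \<Longrightarrow> lin (\<rho> a)"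
    and in': "\<And>a x. a \<in> V \<Longrightarrow> x \<in> Sp m \<Longrightarrow> \<rho> a x \<in> Sp m"
    and add: "\<And>a b x. a \<in> V \<Longrightarrow> b \<in> V \<Longrightarrow> x \<in> Sp m \<Longrightarrow> \<rho> (a + b) x = \<rho> a x + \<rho> b x"
    and smult: "\<And>a s x. a \<in> V \<Longrightarrow> x \<in> Sp m \<Longrightarrow> \<rho> (s \<cdot>\<^sub>v a) x = smult s (\<rho> a x)"
    and mul: "\<And>a b x. a \<in> V \<Longrightarrow> b \<in> V \<Longrightarrow> x \<in> Sp m \<Longrightarrow> \<rho> (amul A a b) x = \<rho> a (\<rho> b x)"
    and one: "\<And>x. x \<in> Sp m \<Longrightarrow> \<rho> (aone A) x = x"
  shows "\<exists>N. md N \<and> mdim N = m \<and> (\<forall>a\<in>V. \<forall>x\<in>S N. ac N a x = \<rho> a x)"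
proof -
  define N where "N = \<lparr>mdim = m, act = (\<lambda>a. mt m m (\<rho> a))\<rparr>"
  have fm: "fm (mt m m (\<rho> a)) x = \<rho> a x" if "a \<in> V" "x \<in> Sp m" for a x
    using fm_mt[OF lin[OF that(1)] _ that(2)] in' that(1) by blast
  have "md N" unfolding is_mod_def Let_def
  proof (intro conjI ballI allI)
    show "act N a \<in> carrier_mat (mdim N) (mdim N)" for a by (simp add: N_def)
    show "act N (a + b) = act N a + act N b" if "a \<in> V" "b \<in> V" for a b
      using that by (intro eq_mat_fm[of _ m m]) (auto simp: N_def fm add fm_add[of _ m m])
    show "act N (s \<cdot>\<^sub>v a) = s \<cdot>\<^sub>m act N a" if "a \<in> V" for s a
      using that by (intro eq_mat_fm[of _ m m]) (auto simp: N_def fm smult fm_smult)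
    show "act N (amul A a b) = act N a * act N b" if "a \<in> V" "b \<in> V" for a b
      using that algD(2) in'
      by (intro eq_mat_fm[of _ m m]) (auto simp: N_def fm mul fm_mult[of _ m m _ m] intro!: mult_carrier_mat[of _ m m])
    show "act N (aone A) = 1\<^sub>m (mdim N)"
      using algD(1) by (intro eq_mat_fm[of _ m m]) (auto simp: N_def fm one fm_one)
  qed
  then show ?thesis using fm by (intro exI[of _ N]) (auto simp: N_def ac_def)
qed

lemma fm_homs:
  assumes "md M" "md N" "F \<in> hom A M N"
  shows "fm F \<in> homs M N"
proof (rule hmI)
  have F: "F \<in> carrier_mat (mdim N) (mdim M)" using assms by (simp add: hom_def)
  show "fm F x \<in> S N" for x using F by (rule fm_Sp)
  fix a x assume a: "a \<in> V"
  have "fm (F * act M a) x = fm (act N a * F) x" using assms a by (simp add: hom_def)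
  then show "fm F (ac M a x) = ac N a (fm F x)"
    using fm_mult[OF F mdD(1)[OF assms(1) a]] fm_mult[OF mdD(1)[OF assms(2) a] F] by (simp add: ac_def)
qed (rule lin_fm)

lemma fm_mt_homs: "f \<in> homs M N \<Longrightarrow> x \<in> S M \<Longrightarrow> fm (mt (mdim N) (mdim M) f) x = f x"
  by (rule fm_mt) (auto simp: homs_def)

lemma mt_hom:
  assumes "md M" "md N" "f \<in> homs M N"
  shows "mt (mdim N) (mdim M) f \<in> hom A M N"
  unfolding hom_def
proof (intro CollectI conjI ballI)
  let ?F = "mt (mdim N) (mdim M) f"
  show F: "?F \<in> carrier_mat (mdim N) (mdim M)" by simp
  fix a assume a: "a \<in> V"
  note aM = mdD(1)[OF assms(1) a] and aN = mdD(1)[OF assms(2) a]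
  show "?F * act M a = act N a * ?F"
  proof (rule eq_mat_fm[of _ "mdim N" "mdim M"])
    fix x assume x: "x \<in> S M"
    show "fm (?F * act M a) x = fm (act N a * ?F) x"
      using homs_ac[OF assms(3) a x] mdD(2)[OF assms(1) a, of x]
      by (simp add: fm_mult[OF F aM] fm_mult[OF aN F] fm_mt_homs[OF assms(3)] x ac_def)
  qed (use mult_carrier_mat[OF F aM] mult_carrier_mat[OF aN F] in auto)
qed

section \<open>Submodules, quotients and factorisation of homomorphisms\<close>

lemma smodD:
  assumes "smod M U"
  shows "U \<subseteq> S M" "subsp U" "a \<in> V \<Longrightarrow> u \<in> U \<Longrightarrow> ac M a u \<in> U"
  using assms by (auto simp: smod_def)

lemma smod_range:
  assumes "md M" "f \<in> homs M N" "smod M U"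
  shows "smod N (f ` U)"
  unfolding smod_def
proof (intro conjI ballI)
  note U = smodD[OF assms(3)]
  show "f ` U \<subseteq> S N" using homs_in[OF assms(2)] U(1) by blast
  show "subsp (f ` U)" using subsp_image[OF homs_lin[OF assms(2)] U(2)] .
  show "ac N a u \<in> f ` U" if "a \<in> V" "u \<in> f ` U" for a u
    using that U homs_ac[OF assms(2)] by (auto simp: image_iff) (metis subsetD)
qed

lemma smod_vimage:
  assumes "md M" "f \<in> homs M N" "smod N U"
  shows "smod M {x \<in> S M. f x \<in> U}"
  unfolding smod_def subsp_def
  using smodD(3)[OF assms(3)] subspD[OF smodD(2)[OF assms(3)]] hmL[OF assms(2)] homs_ac[OF assms(2)]
    mdD(2)[OF assms(1)]
  by auto

lemma smod_zero: "md M \<Longrightarrow> smod M {0}"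
  by (auto simp: smod_def subsp_def acD)

lemma smod_UNIV: "md M \<Longrightarrow> smod M (S M)"
  by (auto simp: smod_def subsp_Sp mdD)

lemma smod_ker: "md M \<Longrightarrow> md N \<Longrightarrow> f \<in> homs M N \<Longrightarrow> smod M {x \<in> S M. f x = 0}"
  using smod_vimage[of M f N "{0}"] smod_zero[of N] by simp

text \<open>A submodule is a subset, but the class of modules consists of coordinate spaces with an
  action. The action is transported along coordinates of \<open>U\<close>, and from then on the
  submodule is represented by \<open>N\<close> with its embedding \<open>j\<close>.\<close>

lemma realize_sub:
  assumes M: "md M" and U: "smod M U"
  obtains N j where "md N" "j \<in> homs N M" "inj_on_mod N j" "j ` S N = U"
proof -
  note U' = smodD[OF U]
  obtain r j l where lin: "lin j" "lin l"
    and j: "\<forall>x\<in>Sp r. j x \<in> U \<and> l (j x) = x" and l: "\<forall>u\<in>U. l u \<in> Sp r \<and> j (l u) = u"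
    using subspace_split[OF U'(2,1)] by blast
  note jD = bspec[OF j, THEN conjunct1] bspec[OF j, THEN conjunct2]
    and lD = bspec[OF l, THEN conjunct1] bspec[OF l, THEN conjunct2]
  have "\<exists>N. md N \<and> mdim N = r \<and> (\<forall>a\<in>V. \<forall>x\<in>S N. ac N a x = l (ac M a (j x)))"
  proof (rule ex_mod)
    have js: "j x \<in> S M" if "x \<in> Sp r" for x using jD(1)[OF that] U'(1) by blast
    fix a b :: "'k vec" and x c assume a: "a \<in> V"
    show "lin (\<lambda>x. l (ac M a (j x)))" by (intro lin_comp[OF lin(2)] lin_comp[OF lin_ac] lin(1))
    show "l (ac M (c \<cdot>\<^sub>v a) (j x)) = smult c (l (ac M a (j x)))"
      by (simp add: mdD(4)[OF M a] linD[OF lin(2)])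
    assume x: "x \<in> Sp r"
    show "l (ac M a (j x)) \<in> Sp r" using lD(1)[OF U'(3)[OF a jD(1)[OF x]]] .
    assume b: "b \<in> V"
    show "l (ac M (a + b) (j x)) = l (ac M a (j x)) + l (ac M b (j x))"
      by (simp add: mdD(3)[OF M a b] linD[OF lin(2)])
    show "l (ac M (amul A a b) (j x)) = l (ac M a (j (l (ac M b (j x)))))"
      using lD(2)[OF U'(3)[OF b jD(1)[OF x]]] by (simp add: mdD(5)[OF M a b])
  next
    fix x :: "'k poly" assume x: "x \<in> Sp r"
    show "l (ac M (aone A) (j x)) = x"
      using mdD(6)[OF M, of "j x"] jD[OF x] U'(1) by auto
  qed
  then obtain N where N: "md N" "mdim N = r" "\<forall>a\<in>V. \<forall>x\<in>S N. ac N a x = l (ac M a (j x))"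
    by blast
  have "j (ac N a x) = ac M a (j x)" if "a \<in> V" "x \<in> S N" for a x
    using N(2,3) that jD(1) lD(2) U'(3) by simp
  then have "j \<in> homs N M"
    using lin(1) N(2) jD(1) U'(1) by (intro hmI) auto
  moreover have "inj_on_mod N j"
    using jD(2) N(2) linD(3)[OF lin(2)] by (metis inj_on_mod_def)
  moreover have "j ` S N = U"
    unfolding N(2) using j l by (metis image_iff subsetI subset_antisym)
  ultimately show ?thesis using that N(1) by blast
qed

text \<open>The action on the quotient is computed on representatives that a linear section
  \<open>t\<close> of \<open>q\<close> selects.\<close>

lemma realize_quot:
  assumes M: "md M" and U: "smod M U"
  obtains Q q where "md Q" "q \<in> homs M Q" "onto M Q q" "\<And>x. x \<in> S M \<Longrightarrow> q x = 0 \<longleftrightarrow> x \<in> U"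
proof -
  note U' = smodD[OF U]
  obtain s q where lin: "lin q"
    and q: "\<forall>x\<in>S M. q x \<in> Sp s" "\<forall>y\<in>Sp s. \<exists>x\<in>S M. q x = y" "\<forall>x\<in>S M. q x = 0 \<longleftrightarrow> x \<in> U"
    using subspace_split[OF U'(2,1)] by blast
  note qD = bspec[OF q(1)] bspec[OF q(3)]
  obtain t where t: "lin t" "\<And>y. y \<in> Sp s \<Longrightarrow> t y \<in> S M" "\<And>y. y \<in> Sp s \<Longrightarrow> q (t y) = y"
    using lin_section[OF lin q(2)] by blast
  \<comment> \<open>Independence of the representative: \<open>x - t (q x)\<close> lies in
    \<open>U\<close>, which the action preserves.\<close>
  have key: "q (ac M a (t (q x))) = q (ac M a x)" if "a \<in> V" "x \<in> S M" for a x
  proof -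
    have "x - t (q x) \<in> U"
      using that qD t by (subst qD(2)[symmetric]) (auto simp: linD[OF lin])
    then have "q (ac M a (x - t (q x))) = 0"
      using that(1) U' qD by blast
    then show ?thesis by (simp add: acD linD[OF lin])
  qed
  have "\<exists>N. md N \<and> mdim N = s \<and> (\<forall>a\<in>V. \<forall>x\<in>S N. ac N a x = q (ac M a (t x)))"
  proof (rule ex_mod)
    fix a b :: "'k vec" and x c assume a: "a \<in> V"
    show "lin (\<lambda>x. q (ac M a (t x)))" by (intro lin_comp[OF lin] lin_comp[OF lin_ac] t(1))
    show "q (ac M (c \<cdot>\<^sub>v a) (t x)) = smult c (q (ac M a (t x)))"
      by (simp add: mdD(4)[OF M a] linD[OF lin])
    show "q (ac M a (t x)) \<in> Sp s" using qD(1)[OF mdD(2)[OF M a]] .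
    assume b: "b \<in> V"
    show "q (ac M (a + b) (t x)) = q (ac M a (t x)) + q (ac M b (t x))"
      by (simp add: mdD(3)[OF M a b] linD[OF lin])
    show "q (ac M (amul A a b) (t x)) = q (ac M a (t (q (ac M b (t x)))))"
      by (simp add: mdD(5)[OF M a b] key[OF a mdD(2)[OF M b]])
  next
    fix x :: "'k poly" assume x: "x \<in> Sp s"
    show "q (ac M (aone A) (t x)) = x"
      using mdD(6)[OF M t(2)[OF x]] t(3)[OF x] by simp
  qed
  then obtain N where N: "md N" "mdim N = s" "\<forall>a\<in>V. \<forall>x\<in>S N. ac N a x = q (ac M a (t x))"
    by blast
  have "q \<in> homs M N" using lin N qD key by (intro hmI) auto
  then show ?thesis using that[OF N(1)] q N(2) unfolding onto_def by blast
qed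

text \<open>The induced map is \<open>f\<close> after a merely linear section of \<open>q\<close>.
  It is a module homomorphism because \<open>f\<close> kills the kernel of \<open>q\<close>, so the
  choice of the section does not matter.\<close>

lemma descend:
  assumes M: "md M" and f: "f \<in> homs M X" and q: "q \<in> homs M Q" "onto M Q q"
    and ker: "\<And>x. x \<in> S M \<Longrightarrow> q x = 0 \<Longrightarrow> f x = 0"
  obtains h where "h \<in> homs Q X" "\<And>x. x \<in> S M \<Longrightarrow> h (q x) = f x"
proof -
  obtain t where t: "lin t" "\<And>y. y \<in> S Q \<Longrightarrow> t y \<in> S M" "\<And>y. y \<in> S Q \<Longrightarrow> q (t y) = y"
    using lin_section[OF homs_lin[OF q(1)]] q(2) unfolding onto_def by blast
  have key: "f (t (q x)) = f x" if x: "x \<in> S M" for x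
  proof -
    have "q (x - t (q x)) = 0" "x - t (q x) \<in> S M"
      using x t homs_in[OF q(1)] by (auto simp: hmL[OF q(1)])
    then have "f (x - t (q x)) = 0" using ker by blast
    then show ?thesis by (simp add: hmL[OF f])
  qed
  have "(\<lambda>y. f (t y)) \<in> homs Q X"
  proof (rule hmI)
    show "lin (\<lambda>y. f (t y))" using homs_lin[OF f] t(1) by (rule lin_comp)
    show "f (t y) \<in> S X" if "y \<in> S Q" for y using that t(2) homs_in[OF f] by blast
    fix a y assume a: "a \<in> V" and y: "y \<in> S Q"
    then have "ac Q a y = q (ac M a (t y))" using t homs_ac[OF q(1)] by simp
    then show "f (t (ac Q a y)) = ac X a (f (t y))"
      using key[of "ac M a (t y)"] homs_ac[OF f] mdD(2)[OF M] a y t by simp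
  qed
  then show ?thesis using that key by blast
qed

text \<open>Dual to \<open>descend\<close>: a merely linear retraction of \<open>j\<close> is
  applied after \<open>f\<close>, and compatibility with the action holds because the values of
  \<open>f\<close> lie in the image of \<open>j\<close>.\<close>

lemma corestrict:
  assumes f: "f \<in> homs X M" and j: "j \<in> homs U M" "inj_on_mod U j" and X: "md X" and U: "md U"
    and im: "\<And>x. x \<in> S X \<Longrightarrow> f x \<in> j ` S U"
  obtains h where "h \<in> homs X U" "\<And>x. x \<in> S X \<Longrightarrow> j (h x) = f x"
proof -
  obtain r where r: "lin r" "\<And>y. y \<in> S M \<Longrightarrow> r y \<in> S U" "\<And>x. x \<in> S U \<Longrightarrow> r (j x) = x"
    using lin_retraction[OF homs_lin[OF j(1)], of "mdim U" "mdim M"] homs_in[OF j(1)] j(2)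
    unfolding inj_on_mod_def by blast
  have key: "j (r (f x)) = f x" if "x \<in> S X" for x using im[OF that] r(3) by auto
  have "(\<lambda>x. r (f x)) \<in> homs X U"
  proof (rule hmI)
    show "lin (\<lambda>x. r (f x))" using r(1) homs_lin[OF f] by (rule lin_comp)
    show "r (f x) \<in> S U" if "x \<in> S X" for x using that r(2) homs_in[OF f] by blast
    fix a x assume a: "a \<in> V" and x: "x \<in> S X"
    have "ac M a (f x) = j (ac U a (r (f x)))"
      using key[OF x] homs_ac[OF j(1) a, of "r (f x)"] r(2) homs_in[OF f x] by simp
    then show "r (f (ac X a x)) = ac U a (r (f x))"
      using homs_ac[OF f a x] r(3) mdD(2)[OF U a] by simp
  qed
  then show ?thesis using that key by blast
qed

lemma inj_on_modD: "f \<in> homs M N \<Longrightarrow> inj_on_mod M f \<Longrightarrow> x \<in> S M \<Longrightarrow> y \<in> S M \<Longrightarrow> f x = f y \<Longrightarrow> x = y"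
  using lin_injD[OF homs_lin, of f M N "mdim M" x y] by (simp add: inj_on_mod_def)

lemma inj_dim: "f \<in> homs M N \<Longrightarrow> inj_on_mod M f \<Longrightarrow> mdim M \<le> mdim N"
  using lin_inj_dim[OF homs_lin, of f M N "mdim M" "mdim N"] homs_in[of f M N] by (simp add: inj_on_mod_def)

lemma onto_dim: "f \<in> homs M N \<Longrightarrow> onto M N f \<Longrightarrow> mdim N \<le> mdim M"
  using lin_surj_dim[OF homs_lin, of f M N "mdim N" "mdim M"] by (simp add: onto_def)

lemma inj_eq_dim_onto:
  assumes "f \<in> homs M N" "inj_on_mod M f" "mdim M = mdim N"
  shows "onto M N f"
proof -
  have "\<forall>x\<in>S M. f x \<in> S M" using homs_in[OF assms(1)] unfolding assms(3) by blast
  then show ?thesis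
    using lin_inj_eq_dim_surj[OF homs_lin[OF assms(1)]] assms(2) unfolding inj_on_mod_def onto_def assms(3)
    by blast
qed

lemma onto_eq_dim_inj:
  assumes "f \<in> homs M N" "onto M N f" "mdim M = mdim N"
  shows "inj_on_mod M f"
  using lin_surj_eq_dim_inj[OF homs_lin[OF assms(1)]] assms(2) unfolding inj_on_mod_def onto_def assms(3)
  by blast

lemma homs_inverse:
  assumes "md M" "f \<in> homs M N" "inj_on_mod M f" "onto M N f"
  obtains g where "g \<in> homs N M" "\<And>x. x \<in> S M \<Longrightarrow> g (f x) = x" "\<And>y. y \<in> S N \<Longrightarrow> f (g y) = y"
proof -
  obtain g where g: "g \<in> homs N M" "\<And>x. x \<in> S M \<Longrightarrow> g (f x) = x"
    using descend[OF assms(1) homs_id assms(2,4)] assms(3) unfolding inj_on_mod_def by blast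
  moreover have "f (g y) = y" if "y \<in> S N" for y
    using assms(4) that g(2) unfolding onto_def by metis
  ultimately show ?thesis using that by blast
qed

lemma zero_mod: "\<exists>Z. md Z \<and> mdim Z = 0"
  using ex_mod[of "\<lambda>a x. x" 0] by auto

end

section \<open>Exact sequences and direct sums\<close>

lemma sum_lessThan_add: "(\<Sum>j<m + n. f j) = (\<Sum>j<m. f j) + (\<Sum>j<n. f (m + j))" for n :: nat
  by (induction n) (auto simp: add.assoc)

context fd_algebra
begin

lemma mdI:
  assumes "\<And>a. a \<in> V \<Longrightarrow> act M a \<in> carrier_mat (mdim M) (mdim M)"
    "\<And>a b x. a \<in> V \<Longrightarrow> b \<in> V \<Longrightarrow> x \<in> S M \<Longrightarrow> ac M (a + b) x = ac M a x + ac M b x"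
    "\<And>a c x. a \<in> V \<Longrightarrow> x \<in> S M \<Longrightarrow> ac M (c \<cdot>\<^sub>v a) x = smult c (ac M a x)"
    "\<And>a b x. a \<in> V \<Longrightarrow> b \<in> V \<Longrightarrow> x \<in> S M \<Longrightarrow> ac M (amul A a b) x = ac M a (ac M b x)"
    "\<And>x. x \<in> S M \<Longrightarrow> ac M (aone A) x = x"
  shows "md M"
  unfolding is_mod_def Let_def
proof (intro conjI ballI allI)
  let ?m = "mdim M"
  note eq = eq_mat_fm[of _ ?m ?m]
  show "act M a \<in> carrier_mat ?m ?m" if "a \<in> V" for a using assms(1)[OF that] .
  show "act M (a + b) = act M a + act M b" if "a \<in> V" "b \<in> V" for a b
    using assms(1)[of a] assms(1)[of b] assms(1)[of "a + b"] assms(2)[of a b] that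
    by (intro eq) (auto simp: ac_def fm_add[of _ ?m ?m])
  show "act M (c \<cdot>\<^sub>v a) = c \<cdot>\<^sub>m act M a" if "a \<in> V" for a c
    using assms(1)[of a] assms(1)[of "c \<cdot>\<^sub>v a"] assms(3)[of a] that
    by (intro eq) (auto simp: ac_def fm_smult)
  show "act M (amul A a b) = act M a * act M b" if "a \<in> V" "b \<in> V" for a b
    using assms(1)[of a] assms(1)[of b] assms(1)[of "amul A a b"] assms(4)[of a b] that algD(2)
    by (intro eq) (auto simp: ac_def fm_mult[of _ ?m ?m _ ?m] intro: mult_carrier_mat[of _ ?m ?m])
  show "act M (aone A) = 1\<^sub>m ?m"
    using assms(1)[of "aone A"] assms(5) algD(1) by (intro eq) (auto simp: ac_def fm_one)
qed

lemma ac_dsum: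
  assumes M: "md M" and N: "md N" and a: "a \<in> V"
  shows "ac (dsum M N) a z =
    ac M a (poly_cutoff (mdim M) z) + monom 1 (mdim M) * ac N a (poly_shift (mdim M) z)"
proof (rule poly_eqI)
  fix i
  let ?m = "mdim M" and ?n = "mdim N"
  note c = mdD(1)[OF M a] mdD(1)[OF N a]
  show "coeff (ac (dsum M N) a z) i = coeff (ac M a (poly_cutoff ?m z) + monom 1 ?m * ac N a (poly_shift ?m z)) i"
    using c by (auto simp: ac_def dsum_def coeff_fm sum_lessThan_add coeff_monom_mult coeff_poly_cutoff
        coeff_poly_shift add.commute)
qed

text \<open>Replaces the block matrices of \<open>dsum\<close> by the biproduct equations. The
  coordinates of \<open>N\<close> come after those of \<open>M\<close>, so \<open>i2\<close>
  multiplies by a monomial of degree \<open>mdim M\<close> and \<open>p2\<close> shifts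
  back.\<close>

lemma dsum_maps:
  assumes M: "md M" and N: "md N"
  obtains i1 i2 p1 p2 where "md (dsum M N)"
    "i1 \<in> homs M (dsum M N)" "i2 \<in> homs N (dsum M N)" "p1 \<in> homs (dsum M N) M" "p2 \<in> homs (dsum M N) N"
    "\<And>x. x \<in> S M \<Longrightarrow> p1 (i1 x) = x" "\<And>x. x \<in> S M \<Longrightarrow> p2 (i1 x) = 0"
    "\<And>y. y \<in> S N \<Longrightarrow> p2 (i2 y) = y" "\<And>y. y \<in> S N \<Longrightarrow> p1 (i2 y) = 0"
    "\<And>z. z \<in> S (dsum M N) \<Longrightarrow> i1 (p1 z) + i2 (p2 z) = z"
proof -
  let ?D = "dsum M N" and ?m = "mdim M" and ?n = "mdim N"
  let ?i1 = "\<lambda>x::'k poly. x" and ?i2 = "\<lambda>y::'k poly. monom 1 ?m * y"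
  let ?p1 = "\<lambda>z::'k poly. poly_cutoff ?m z" and ?p2 = "\<lambda>z::'k poly. poly_shift ?m z"
  have dim: "mdim ?D = ?m + ?n" by (simp add: dsum_def)
  have c: "act ?D a \<in> carrier_mat (mdim ?D) (mdim ?D)" if "a \<in> V" for a
    using mdD(1)[OF M that] mdD(1)[OF N that] by (auto simp: dsum_def)
  have lin: "lin ?i1" "lin ?i2" "lin ?p1" "lin ?p2"
    by (auto simp: lin_def poly_eq_iff coeff_monom_mult coeff_poly_shift coeff_poly_cutoff)
  have in': "?i1 x \<in> S ?D" "?i2 y \<in> S ?D" "?p1 z \<in> S M" "?p2 w \<in> S N"
    if "x \<in> S M" "y \<in> S N" "w \<in> S ?D" for x y z w
    using that by (auto simp: Sp_def dim coeff_monom_mult coeff_poly_shift coeff_poly_cutoff)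
  have p: "?p1 (?i1 x) = x" "?p2 (?i1 x) = 0" "?p2 (?i2 y) = y" "?p1 (?i2 y) = 0" "?i1 (?p1 z) + ?i2 (?p2 z) = z"
    if "x \<in> S M" for x y z
    using that by (auto simp: Sp_def poly_eq_iff coeff_monom_mult coeff_poly_shift coeff_poly_cutoff)
  note pi = p[OF zero_Sp]
  note ac = ac_dsum[OF M N]
  have act1: "?p1 (ac ?D a z) = ac M a (?p1 z)" and act2: "?p2 (ac ?D a z) = ac N a (?p2 z)" if "a \<in> V" for a z
    using p(1,2)[OF mdD(2)[OF M that, of "?p1 z"]] pi(3,4)
    by (simp_all only: ac[OF that] linD[OF lin(3)] linD[OF lin(4)] add_0_right add_0_left)
  have D: "md ?D"
  proof (rule mdI)
    fix a b :: "'k vec" and x :: "'k poly" and k assume a: "a \<in> V" and x: "x \<in> S ?D"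
    show "ac ?D (k \<cdot>\<^sub>v a) x = smult k (ac ?D a x)"
      using a by (simp add: ac mdD(4)[OF M a] mdD(4)[OF N a])
    assume b: "b \<in> V"
    show "ac ?D (a + b) x = ac ?D a x + ac ?D b x"
      using a b by (simp add: ac mdD(3)[OF M a b] mdD(3)[OF N a b] algebra_simps)
    show "ac ?D (amul A a b) x = ac ?D a (ac ?D b x)"
      using ac[OF a, of "ac ?D b x"] algD(2)[OF a b]
      by (simp add: act1[OF b] act2[OF b] ac mdD(5)[OF M a b] mdD(5)[OF N a b])
  next
    fix x assume "x \<in> S ?D"
    then show "ac ?D (aone A) x = x"
      using pi(5)[of x] in'[OF zero_Sp zero_Sp] by (simp add: ac[OF algD(1)] mdD(6)[OF M] mdD(6)[OF N])
  qed (rule c)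
  show ?thesis
  proof (rule that[OF D])
    show "?i1 \<in> homs M ?D"
      using lin(1) in'(1)[OF _ zero_Sp zero_Sp] p(1,2) by (intro hmI) (auto simp: ac acD)
    show "?i2 \<in> homs N ?D"
    proof (rule hmI)
      show "?i2 x \<in> S ?D" if "x \<in> S N" for x using in'(2)[OF zero_Sp that zero_Sp] .
      show "?i2 (ac N a x) = ac ?D a (?i2 x)" if "a \<in> V" for a x
        by (simp add: ac[OF that] pi(3,4) acD)
    qed (rule lin)
    show "?p1 \<in> homs ?D M" using lin(3) act1 by (intro hmI) auto
    show "?p2 \<in> homs ?D N" using lin(4) act2 in'(4)[OF zero_Sp zero_Sp] by (intro hmI) auto
    show "?p1 (?i1 x) = x" "?p2 (?i1 x) = 0" if "x \<in> S M" for x using p(1,2)[OF that] .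
  qed (use pi in auto)
qed

section \<open>Short exact sequences, pullbacks and pushouts\<close>

definition ses :: "'k fmod \<Rightarrow> 'k fmod \<Rightarrow> 'k fmod \<Rightarrow> ('k poly \<Rightarrow> 'k poly) \<Rightarrow> ('k poly \<Rightarrow> 'k poly) \<Rightarrow> bool" where
  "ses X Y Z f g \<longleftrightarrow> md X \<and> md Y \<and> md Z \<and> f \<in> homs X Y \<and> g \<in> homs Y Z \<and> inj_on_mod X f \<and> onto Y Z g \<and>
     (\<forall>y\<in>S Y. g y = 0 \<longleftrightarrow> y \<in> f ` S X)"

lemma sesD:
  assumes "ses X Y Z f g"
  shows "md X" "md Y" "md Z" "f \<in> homs X Y" "g \<in> homs Y Z" "inj_on_mod X f" "onto Y Z g"
    "x \<in> S X \<Longrightarrow> g (f x) = 0"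
    "y \<in> S Y \<Longrightarrow> g y = 0 \<longleftrightarrow> y \<in> f ` S X"
    "y \<in> S Y \<Longrightarrow> g y = 0 \<Longrightarrow> \<exists>x\<in>S X. f x = y"
    "x \<in> S X \<Longrightarrow> f x = 0 \<Longrightarrow> x = 0"
    "z \<in> S Z \<Longrightarrow> \<exists>y\<in>S Y. g y = z"
  using assms homs_in[of f X Y] unfolding ses_def onto_def inj_on_mod_def by auto

lemma sesI:
  assumes "md X" "md Y" "md Z" "f \<in> homs X Y" "g \<in> homs Y Z"
    "\<And>x. x \<in> S X \<Longrightarrow> f x = 0 \<Longrightarrow> x = 0" "\<And>z. z \<in> S Z \<Longrightarrow> \<exists>y\<in>S Y. g y = z"
    "\<And>x. x \<in> S X \<Longrightarrow> g (f x) = 0" "\<And>y. y \<in> S Y \<Longrightarrow> g y = 0 \<Longrightarrow> \<exists>x\<in>S X. f x = y"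
  shows "ses X Y Z f g"
  using assms unfolding ses_def onto_def inj_on_mod_def by blast

lemma ses_kernel:
  assumes "md Y" "md Z" "g \<in> homs Y Z" "onto Y Z g"
  obtains X f where "ses X Y Z f g"
proof -
  obtain X f where "md X" "f \<in> homs X Y" "inj_on_mod X f" "f ` S X = {x \<in> S Y. g x = 0}"
    using realize_sub[OF assms(1) smod_ker[OF assms(1-3)]] by blast
  then have "ses X Y Z f g" using assms unfolding ses_def by blast
  then show ?thesis by (rule that)
qed

lemma ses_cokernel:
  assumes "md X" "md Y" "f \<in> homs X Y" "inj_on_mod X f"
  obtains Z g where "ses X Y Z f g"
proof -
  obtain Z g where "md Z" "g \<in> homs Y Z" "onto Y Z g" "\<And>x. x \<in> S Y \<Longrightarrow> g x = 0 \<longleftrightarrow> x \<in> f ` S X"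
    using realize_quot[OF assms(2) smod_range[OF assms(1,3) smod_UNIV[OF assms(1)]]] by blast
  then have "ses X Y Z f g" using assms unfolding ses_def by blast
  then show ?thesis by (rule that)
qed

lemma ses_dsum:
  assumes "md M" "md N"
  obtains f g where "ses M (dsum M N) N f g"
proof -
  obtain i1 i2 p1 p2 where D: "md (dsum M N)"
    "i1 \<in> homs M (dsum M N)" "i2 \<in> homs N (dsum M N)" "p1 \<in> homs (dsum M N) M" "p2 \<in> homs (dsum M N) N"
    "\<And>x. x \<in> S M \<Longrightarrow> p1 (i1 x) = x" "\<And>x. x \<in> S M \<Longrightarrow> p2 (i1 x) = 0"
    "\<And>y. y \<in> S N \<Longrightarrow> p2 (i2 y) = y" "\<And>y. y \<in> S N \<Longrightarrow> p1 (i2 y) = 0"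
    "\<And>z. z \<in> S (dsum M N) \<Longrightarrow> i1 (p1 z) + i2 (p2 z) = z"
    using dsum_maps[OF assms] by blast
  have "ses M (dsum M N) N i1 p2"
  proof (rule sesI)
    show "x = 0" if "x \<in> S M" "i1 x = 0" for x using D(6)[OF that(1)] that(2) hmL(3)[OF D(4)] by simp
    show "\<exists>y\<in>S (dsum M N). p2 y = z" if "z \<in> S N" for z using D(8)[OF that] homs_in[OF D(3) that] by blast
    show "\<exists>x\<in>S M. i1 x = y" if "y \<in> S (dsum M N)" "p2 y = 0" for y
      using D(10)[OF that(1)] that(2) hmL(3)[OF D(3)] homs_in[OF D(4) that(1)] by auto
  qed (use assms D in auto)
  then show ?thesis by (rule that)
qed

text \<open>The endomorphism that sends \<open>z\<close> to \<open>z - s (g z)\<close> takes values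
  in the kernel of \<open>g\<close>, hence factors through \<open>f\<close>.\<close>

lemma ses_retraction:
  assumes "ses Y Z X f g" and s: "s \<in> homs X Z" "\<And>x. x \<in> S X \<Longrightarrow> g (s x) = x"
  obtains r where "r \<in> homs Z Y" "\<And>y. y \<in> S Y \<Longrightarrow> r (f y) = y" "\<And>z. z \<in> S Z \<Longrightarrow> f (r z) + s (g z) = z"
proof -
  note E = sesD[OF assms(1)]
  have h: "(\<lambda>z. z - s (g z)) \<in> homs Z Z" using homs_diff[OF homs_id homs_comp[OF E(5) s(1)]] .
  have "z - s (g z) \<in> f ` S Y" if "z \<in> S Z" for z
  proof -
    have "g (z - s (g z)) = 0" using s(2) homs_in[OF E(5) that] by (simp add: hmL[OF E(5)])
    then show ?thesis using E(9) homs_in[OF h that] by blast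
  qed
  then obtain r where r: "r \<in> homs Z Y" "\<And>z. z \<in> S Z \<Longrightarrow> f (r z) = z - s (g z)"
    using corestrict[OF h E(4,6,2,1)] by blast
  show ?thesis
  proof (rule that[OF r(1)])
    show "r (f y) = y" if y: "y \<in> S Y" for y
    proof (rule inj_on_modD[OF E(4,6)])
      show "f (r (f y)) = f y"
        using r(2)[OF homs_in[OF E(4) y]] E(8)[OF y] by (simp add: hmL[OF s(1)])
    qed (use y homs_in[OF r(1) homs_in[OF E(4) y]] in auto)
    show "f (r z) + s (g z) = z" if "z \<in> S Z" for z using r(2)[OF that] by simp
  qed
qed

text \<open>Realised as the kernel of the difference of the two maps on the direct sum of
  \<open>Y\<close> and \<open>P\<close>.\<close>

lemma pullback:
  assumes "md Y" "md P" "md Z" "g \<in> homs Y Z" "p \<in> homs P Z"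
  obtains W a b where "md W" "a \<in> homs W Y" "b \<in> homs W P" "\<And>w. w \<in> S W \<Longrightarrow> g (a w) = p (b w)"
    "\<And>y t. y \<in> S Y \<Longrightarrow> t \<in> S P \<Longrightarrow> g y = p t \<Longrightarrow> \<exists>w\<in>S W. a w = y \<and> b w = t"
    "\<And>w. w \<in> S W \<Longrightarrow> a w = 0 \<Longrightarrow> b w = 0 \<Longrightarrow> w = 0"
    "\<And>T s t. md T \<Longrightarrow> s \<in> homs T Y \<Longrightarrow> t \<in> homs T P \<Longrightarrow> (\<And>x. x \<in> S T \<Longrightarrow> g (s x) = p (t x)) \<Longrightarrow>
       \<exists>h\<in>homs T W. \<forall>x\<in>S T. a (h x) = s x \<and> b (h x) = t x"
proof -
  let ?D = "dsum Y P"
  obtain i1 i2 p1 p2 where D: "md ?D"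
    "i1 \<in> homs Y ?D" "i2 \<in> homs P ?D" "p1 \<in> homs ?D Y" "p2 \<in> homs ?D P"
    "\<And>x. x \<in> S Y \<Longrightarrow> p1 (i1 x) = x" "\<And>x. x \<in> S Y \<Longrightarrow> p2 (i1 x) = 0"
    "\<And>y. y \<in> S P \<Longrightarrow> p2 (i2 y) = y" "\<And>y. y \<in> S P \<Longrightarrow> p1 (i2 y) = 0"
    "\<And>z. z \<in> S ?D \<Longrightarrow> i1 (p1 z) + i2 (p2 z) = z"
    using dsum_maps[OF assms(1,2)] by blast
  have h: "(\<lambda>z. g (p1 z) - p (p2 z)) \<in> homs ?D Z"
    using homs_diff[OF homs_comp[OF D(4) assms(4)] homs_comp[OF D(5) assms(5)]] .
  obtain W w where W: "md W" "w \<in> homs W ?D" "inj_on_mod W w" "w ` S W = {z \<in> S ?D. g (p1 z) - p (p2 z) = 0}"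
    using realize_sub[OF D(1) smod_ker[OF D(1) assms(3) h]] by blast
  have pair: "i1 y + i2 t \<in> S ?D" "p1 (i1 y + i2 t) = y" "p2 (i1 y + i2 t) = t" if "y \<in> S Y" "t \<in> S P" for y t
    using that D homs_in[OF D(2)] homs_in[OF D(3)] by (auto simp: hmL[OF D(4)] hmL[OF D(5)])
  show ?thesis
  proof (rule that[OF W(1) homs_comp[OF W(2) D(4)] homs_comp[OF W(2) D(5)]])
    show "g (p1 (w x)) = p (p2 (w x))" if "x \<in> S W" for x using W(4) that by auto
    show "\<exists>x\<in>S W. p1 (w x) = y \<and> p2 (w x) = t" if "y \<in> S Y" "t \<in> S P" "g y = p t" for y t
    proof -
      have "i1 y + i2 t \<in> w ` S W" unfolding W(4) using pair[OF that(1,2)] that(3) by simp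
      then show ?thesis using pair[OF that(1,2)] by (metis imageE)
    qed
    show "x = 0" if "x \<in> S W" "p1 (w x) = 0" "p2 (w x) = 0" for x
    proof -
      have "w x = 0" using D(10)[OF homs_in[OF W(2) that(1)]] that(2,3) hmL(3)[OF D(2)] hmL(3)[OF D(3)] by simp
      then show ?thesis using W(3) that(1) by (simp add: inj_on_mod_def)
    qed
    fix T s t assume T: "md T" "s \<in> homs T Y" "t \<in> homs T P" "\<And>x. x \<in> S T \<Longrightarrow> g (s x) = p (t x)"
    have st: "(\<lambda>x. i1 (s x) + i2 (t x)) \<in> homs T ?D"
      using homs_add[OF homs_comp[OF T(2) D(2)] homs_comp[OF T(3) D(3)]] .
    note pr = pair[OF homs_in[OF T(2)] homs_in[OF T(3)]]
    have "i1 (s x) + i2 (t x) \<in> w ` S W" if "x \<in> S T" for x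
      unfolding W(4) using pr[OF that that] T(4)[OF that] by simp
    then obtain k where k: "k \<in> homs T W" "\<And>x. x \<in> S T \<Longrightarrow> w (k x) = i1 (s x) + i2 (t x)"
      using corestrict[OF st W(2,3) T(1) W(1)] by blast
    then show "\<exists>k\<in>homs T W. \<forall>x\<in>S T. p1 (w (k x)) = s x \<and> p2 (w (k x)) = t x"
      using pr by (intro bexI[of _ k]) auto
  qed
qed

text \<open>For two epimorphisms onto the same module, \<open>W\<close> is at once an extension of
  \<open>P\<close> by \<open>X\<close> and of \<open>Y\<close> by \<open>K\<close>. All comparisons
  of projective dimensions along a sequence are read off from these two views of
  \<open>W\<close>.\<close>

lemma ses_pullback:
  assumes E: "ses X Y Z f g" and F: "ses K P Z k p"
  obtains W u a v b where "ses X W P u b" "ses K W Y v a"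
proof -
  note E' = sesD[OF E] and F' = sesD[OF F]
  show ?thesis
  proof (rule pullback[OF E'(2) F'(2) E'(3,5) F'(5)])
  fix W a b assume W: "md W" "a \<in> homs W Y" "b \<in> homs W P" "\<And>w. w \<in> S W \<Longrightarrow> g (a w) = p (b w)"
    and pr: "\<And>y t. y \<in> S Y \<Longrightarrow> t \<in> S P \<Longrightarrow> g y = p t \<Longrightarrow> \<exists>w\<in>S W. a w = y \<and> b w = t"
    and z: "\<And>w. w \<in> S W \<Longrightarrow> a w = 0 \<Longrightarrow> b w = 0 \<Longrightarrow> w = 0"
    and U: "\<And>T s t. md T \<Longrightarrow> s \<in> homs T Y \<Longrightarrow> t \<in> homs T P \<Longrightarrow> (\<And>x. x \<in> S T \<Longrightarrow> g (s x) = p (t x)) \<Longrightarrow>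
       \<exists>h\<in>homs T W. \<forall>x\<in>S T. a (h x) = s x \<and> b (h x) = t x"
  obtain u where u: "u \<in> homs X W" "\<And>x. x \<in> S X \<Longrightarrow> a (u x) = f x \<and> b (u x) = 0"
    using U[OF E'(1,4) homs_zero] E'(8) hmL(3)[OF F'(5)] by metis
  obtain v where v: "v \<in> homs K W" "\<And>x. x \<in> S K \<Longrightarrow> a (v x) = 0 \<and> b (v x) = k x"
    using U[OF F'(1) homs_zero F'(4)] F'(8) hmL(3)[OF E'(5)] by metis
  have "ses X W P u b"
  proof (rule sesI[OF E'(1) W(1) F'(2) u(1) W(3)])
    show "x = 0" if "x \<in> S X" "u x = 0" for x
      using u(2)[OF that(1)] that hmL(3)[OF W(2)] E'(11) by simp
    show "\<exists>w\<in>S W. b w = t" if "t \<in> S P" for t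
      using E'(12)[OF homs_in[OF F'(5) that]] pr[OF _ that] by blast
    show "\<exists>x\<in>S X. u x = w" if w: "w \<in> S W" "b w = 0" for w
    proof -
      have "g (a w) = 0" using W(4)[OF w(1)] w(2) hmL(3)[OF F'(5)] by simp
      then obtain x where x: "x \<in> S X" "f x = a w" using E'(10)[OF homs_in[OF W(2) w(1)]] by blast
      have "w - u x = 0"
      proof (rule z)
        show "w - u x \<in> S W" using w(1) homs_in[OF u(1) x(1)] by blast
      qed (use u(2)[OF x(1)] x(2) w(2) in \<open>simp_all add: hmL[OF W(2)] hmL[OF W(3)]\<close>)
      then show ?thesis using x(1) by auto
    qed
  qed (use u(2) in auto)
  moreover have "ses K W Y v a"
  proof (rule sesI[OF F'(1) W(1) E'(2) v(1) W(2)])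
    show "x = 0" if "x \<in> S K" "v x = 0" for x
      using v(2)[OF that(1)] that hmL(3)[OF W(3)] F'(11) by simp
    show "\<exists>w\<in>S W. a w = y" if "y \<in> S Y" for y
      using F'(12)[OF homs_in[OF E'(5) that]] pr[OF that] by metis
    show "\<exists>x\<in>S K. v x = w" if w: "w \<in> S W" "a w = 0" for w
    proof -
      have "p (b w) = 0" using W(4)[OF w(1)] w(2) hmL(3)[OF E'(5)] by simp
      then obtain x where x: "x \<in> S K" "k x = b w" using F'(10)[OF homs_in[OF W(3) w(1)]] by blast
      have "w - v x = 0"
      proof (rule z)
        show "w - v x \<in> S W" using w(1) homs_in[OF v(1) x(1)] by blast
      qed (use v(2)[OF x(1)] x(2) w(2) in \<open>simp_all add: hmL[OF W(2)] hmL[OF W(3)]\<close>)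
      then show ?thesis using x(1) by auto
    qed
  qed (use v(2) in auto)
  ultimately show ?thesis by (rule that)
  qed
qed

text \<open>\<open>X'\<close> is the cokernel of the embedding of \<open>K\<close> into the direct
  sum of \<open>X\<close> and \<open>P\<close> that sends \<open>k\<close> to the pair of
  \<open>- \<phi> k\<close> and \<open>i k\<close>.\<close>

lemma ses_pushout:
  assumes E: "ses K P Z i p" and X: "md X" and \<phi>: "\<phi> \<in> homs K X"
  obtains X' j q \<psi> where "ses X X' Z j q" "\<psi> \<in> homs P X'" "\<And>k. k \<in> S K \<Longrightarrow> \<psi> (i k) = j (\<phi> k)"
    "\<And>x. x \<in> S P \<Longrightarrow> q (\<psi> x) = p x"
proof -
  note E' = sesD[OF E]
  let ?D = "dsum X P"
  obtain i1 i2 p1 p2 where D: "md ?D"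
    "i1 \<in> homs X ?D" "i2 \<in> homs P ?D" "p1 \<in> homs ?D X" "p2 \<in> homs ?D P"
    "\<And>x. x \<in> S X \<Longrightarrow> p1 (i1 x) = x" "\<And>x. x \<in> S X \<Longrightarrow> p2 (i1 x) = 0"
    "\<And>y. y \<in> S P \<Longrightarrow> p2 (i2 y) = y" "\<And>y. y \<in> S P \<Longrightarrow> p1 (i2 y) = 0"
    "\<And>z. z \<in> S ?D \<Longrightarrow> i1 (p1 z) + i2 (p2 z) = z"
    using dsum_maps[OF X E'(2)] by blast
  let ?h = "\<lambda>k. i2 (i k) - i1 (\<phi> k)"
  have h: "?h \<in> homs K ?D" using homs_diff[OF homs_comp[OF E'(4) D(3)] homs_comp[OF \<phi> D(2)]] .
  have ph: "p2 (?h k) = i k" "p1 (?h k) = - \<phi> k" if "k \<in> S K" for k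
    using that D homs_in[OF E'(4)] homs_in[OF \<phi>] by (auto simp: hmL[OF D(4)] hmL[OF D(5)])
  have hinj: "inj_on_mod K ?h" unfolding inj_on_mod_def
    using ph(1) hmL(3)[OF D(5)] E'(11) by metis
  obtain X' c where C: "ses K ?D X' ?h c" using ses_cokernel[OF E'(1) D(1) h hinj] by blast
  note C' = sesD[OF C]
  have "p (p2 z) = 0" if z: "z \<in> S ?D" "c z = 0" for z
  proof -
    obtain k where k: "k \<in> S K" "?h k = z" using C'(10)[OF z] by blast
    then have "p2 z = i k" using ph(1) by blast
    then show ?thesis using E'(8)[OF k(1)] by simp
  qed
  then obtain q where q: "q \<in> homs X' Z" "\<And>z. z \<in> S ?D \<Longrightarrow> q (c z) = p (p2 z)"
    using descend[OF D(1) homs_comp[OF D(5) E'(5)] C'(5,7)] by blast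
  let ?j = "\<lambda>x. c (i1 x)" and ?\<psi> = "\<lambda>x. c (i2 x)"
  have j: "?j \<in> homs X X'" and \<psi>: "?\<psi> \<in> homs P X'"
    using homs_comp[OF D(2) C'(5)] homs_comp[OF D(3) C'(5)] .
  have "ses X X' Z ?j q"
  proof (rule sesI[OF X C'(3) E'(3) j q(1)])
    show "x = 0" if x: "x \<in> S X" "?j x = 0" for x
    proof -
      obtain k where k: "k \<in> S K" "?h k = i1 x" using C'(10)[OF homs_in[OF D(2) x(1)] x(2)] by blast
      then have "i k = 0" using ph(1)[OF k(1)] D(7)[OF x(1)] by simp
      then have "k = 0" using E'(11) k(1) by blast
      then show ?thesis using ph(2)[OF k(1)] k(2) D(6)[OF x(1)] hmL(3)[OF \<phi>] by simp
    qed
    show "\<exists>y\<in>S X'. q y = z" if z: "z \<in> S Z" for z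
    proof -
      obtain x where x: "x \<in> S P" "p x = z" using E'(12)[OF z] by blast
      have "q (c (i2 x)) = z" using q(2)[OF homs_in[OF D(3) x(1)]] D(8)[OF x(1)] x(2) by simp
      then show ?thesis using homs_in[OF \<psi> x(1)] by blast
    qed
    show "q (?j x) = 0" if "x \<in> S X" for x
      using q(2)[OF homs_in[OF D(2) that]] D(7)[OF that] hmL(3)[OF E'(5)] by simp
    show "\<exists>x\<in>S X. ?j x = y" if y: "y \<in> S X'" "q y = 0" for y
    proof -
      obtain z where z: "z \<in> S ?D" "c z = y" using C'(12)[OF y(1)] by blast
      have "p (p2 z) = 0" using q(2)[OF z(1)] z(2) y(2) by simp
      then obtain k where k: "k \<in> S K" "i k = p2 z" using E'(10) homs_in[OF D(5) z(1)] by blast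
      \<comment> \<open>Modulo the relation given by \<open>k\<close>, the representative
        \<open>z\<close> of \<open>y\<close> can be moved into the summand \<open>X\<close>.\<close>
      let ?x = "p1 z + \<phi> k"
      have "z - i1 ?x = ?h k" using D(10)[OF z(1)] k(2) by (simp add: hmL[OF D(2)] algebra_simps)
      moreover have "c (z - i1 ?x) = y - c (i1 ?x)" using z(2) by (simp add: hmL[OF C'(5)])
      ultimately have "c (i1 ?x) = y" using C'(8)[OF k(1)] by simp
      moreover have "?x \<in> S X" using homs_in[OF D(4) z(1)] homs_in[OF \<phi> k(1)] by auto
      ultimately show ?thesis by blast
    qed
  qed
  moreover have "?\<psi> (i k) = ?j (\<phi> k)" if "k \<in> S K" for k
    using C'(8)[OF that] by (simp add: hmL[OF C'(5)])
  moreover have "q (?\<psi> x) = p x" if "x \<in> S P" for x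
    using q(2)[OF homs_in[OF D(3) that]] D(8)[OF that] by simp
  ultimately show ?thesis using that[OF _ \<psi>] by blast
qed

end

section \<open>Projective modules\<close>

context fd_algebra
begin

definition proj_mod :: "'k fmod \<Rightarrow> bool" where
  "proj_mod P \<longleftrightarrow> md P \<and> (\<forall>X Y g f. md X \<longrightarrow> md Y \<longrightarrow> g \<in> homs X Y \<longrightarrow> onto X Y g \<longrightarrow> f \<in> homs P Y \<longrightarrow>
     (\<exists>h\<in>homs P X. \<forall>x\<in>S P. g (h x) = f x))"

lemma proj_mod_md: "proj_mod P \<Longrightarrow> md P"
  by (simp add: proj_mod_def)

lemma proj_mod_lift:
  assumes "proj_mod P" "md X" "md Y" "g \<in> homs X Y" "onto X Y g" "f \<in> homs P Y"
  obtains h where "h \<in> homs P X" "\<And>x. x \<in> S P \<Longrightarrow> g (h x) = f x"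
  using assms unfolding proj_mod_def by blast

lemma hom_carrier: "F \<in> hom A X Y \<Longrightarrow> F \<in> carrier_mat (mdim Y) (mdim X)"
  by (simp add: hom_def)

lemma carrier_vec_pv: "v \<in> carrier_vec m \<longleftrightarrow> (\<exists>x\<in>Sp m. v = vc m x)"
  using vc_pv[of v m] pv_Sp[of v m] by (auto intro!: bexI[of _ "pv v"])

lemma img_fm: "F \<in> carrier_mat r c \<Longrightarrow> img F = vc r ` fm F ` Sp c"
  unfolding img_def by (auto simp: carrier_vec_pv image_iff fm_vc) (metis fm_vc carrier_vec_pv)

lemma kern_fm:
  assumes "F \<in> carrier_mat r c"
  shows "kern F = vc c ` {x \<in> Sp c. fm F x = 0}"
proof -
  have "F *\<^sub>v vc c x = 0\<^sub>v r \<longleftrightarrow> fm F x = 0" if "x \<in> Sp c" for x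
    unfolding fm_vc[OF assms] by (metis fm_Sp[OF assms] pv_vc vc_simps(3) pv_simps(3))
  then show ?thesis using assms unfolding kern_def by (auto simp: carrier_vec_pv image_iff)
qed

lemma surj_map_iff: "F \<in> hom A X Y \<Longrightarrow> surj_map F \<longleftrightarrow> onto X Y (fm F)"
proof -
  assume "F \<in> hom A X Y"
  then have F: "F \<in> carrier_mat (mdim Y) (mdim X)" by (rule hom_carrier)
  have "surj_map F \<longleftrightarrow> vc (mdim Y) ` fm F ` S X = vc (mdim Y) ` S Y"
  proof -
    have "carrier_vec (mdim Y) = vc (mdim Y) ` S Y" using carrier_vec_pv[of _ "mdim Y"] by blast
    then show ?thesis using F unfolding surj_map_def img_fm[OF F] by simp
  qed
  also have "\<dots> \<longleftrightarrow> fm F ` S X = S Y"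
  proof
    assume e: "vc (mdim Y) ` fm F ` S X = vc (mdim Y) ` S Y"
    have p: "pv ` vc (mdim Y) ` U = U" if U: "U \<subseteq> S Y" for U
    proof -
      have "(\<lambda>x. pv (vc (mdim Y) x)) ` U = (\<lambda>x. x) ` U" using U pv_vc by (intro image_cong) blast+
      then show ?thesis by (simp add: image_image)
    qed
    have sub: "fm F ` S X \<subseteq> S Y" using fm_Sp[OF F] by blast
    show "fm F ` S X = S Y" using arg_cong[OF e, of "(`) pv"] unfolding p[OF sub] p[OF order_refl] .
  qed simp
  also have "\<dots> \<longleftrightarrow> S Y \<subseteq> fm F ` S X" using fm_Sp[OF F] by blast
  also have "\<dots> \<longleftrightarrow> onto X Y (fm F)" unfolding onto_def subset_iff image_iff by metis
  finally show ?thesis .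
qed

lemma inj_map_iff: "F \<in> hom A X Y \<Longrightarrow> inj_map F \<longleftrightarrow> inj_on_mod X (fm F)"
proof -
  assume "F \<in> hom A X Y"
  then have F: "F \<in> carrier_mat (mdim Y) (mdim X)" by (rule hom_carrier)
  have 0: "vc (mdim X) x = 0\<^sub>v (mdim X) \<longleftrightarrow> x = 0" if "x \<in> S X" for x
    using pv_vc[OF that] pv_simps(3) by (metis vc_simps(3))
  have "inj_map F \<longleftrightarrow> vc (mdim X) ` {x \<in> S X. fm F x = 0} = {0\<^sub>v (mdim X)}"
    using F unfolding inj_map_def kern_fm[OF F] by auto
  also have "\<dots> \<longleftrightarrow> inj_on_mod X (fm F)"
  proof
    assume "vc (mdim X) ` {x \<in> S X. fm F x = 0} = {0\<^sub>v (mdim X)}"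
    then show "inj_on_mod X (fm F)" unfolding inj_on_mod_def using 0 by blast
  next
    assume "inj_on_mod X (fm F)"
    then have "{x \<in> S X. fm F x = 0} = {0}" unfolding inj_on_mod_def using linD(3)[OF lin_fm] by auto
    then show "vc (mdim X) ` {x \<in> S X. fm F x = 0} = {0\<^sub>v (mdim X)}" by auto
  qed
  finally show ?thesis .
qed

lemma mt_onto:
  assumes "md X" "md Y" "f \<in> homs X Y"
  shows "surj_map (mt (mdim Y) (mdim X) f) \<longleftrightarrow> onto X Y f"
  unfolding surj_map_iff[OF mt_hom[OF assms]] onto_def using fm_mt_homs[OF assms(3)] by auto

lemma mt_inj:
  assumes "md X" "md Y" "f \<in> homs X Y"
  shows "inj_map (mt (mdim Y) (mdim X) f) \<longleftrightarrow> inj_on_mod X f"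
  unfolding inj_map_iff[OF mt_hom[OF assms]] inj_on_mod_def using fm_mt_homs[OF assms(3)] by auto

lemma mult_eq_iff:
  assumes "F \<in> carrier_mat c d" "G \<in> carrier_mat r c" "H \<in> carrier_mat r d"
  shows "G * F = H \<longleftrightarrow> (\<forall>x\<in>Sp d. fm G (fm F x) = fm H x)"
  using eq_mat_fm[of "G * F" r d H] assms fm_mult[OF assms(2,1)] by auto

lemma projective_iff: "projective A P \<longleftrightarrow> proj_mod P"
proof
  assume P: "projective A P"
  then have mP: "md P" by (simp add: projective_def)
  show "proj_mod P" unfolding proj_mod_def
  proof (intro conjI mP allI impI)
    fix X Y g f assume *: "md X" "md Y" "g \<in> homs X Y" "onto X Y g" "f \<in> homs P Y"
    let ?g = "mt (mdim Y) (mdim X) g" and ?f = "mt (mdim Y) (mdim P) f"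
    have "?g \<in> hom A X Y" "surj_map ?g" "?f \<in> hom A P Y"
      using mt_hom * mt_onto mP by auto
    then obtain h where h: "h \<in> hom A P X" "?g * h = ?f"
      using P * unfolding projective_def by blast
    have "\<forall>x\<in>S P. fm ?g (fm h x) = fm ?f x"
      using iffD1[OF mult_eq_iff[OF hom_carrier[OF h(1)] mt_carrier mt_carrier] h(2)] .
    then have "\<forall>x\<in>S P. g (fm h x) = f x"
      using fm_mt_homs[OF *(3)] fm_mt_homs[OF *(5)] homs_in[OF fm_homs[OF mP *(1) h(1)]] by simp
    then show "\<exists>h\<in>homs P X. \<forall>x\<in>S P. g (h x) = f x" using fm_homs[OF mP *(1) h(1)] by blast
  qed
next
  assume P: "proj_mod P"
  note mP = proj_mod_md[OF P]
  show "projective A P" unfolding projective_def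
  proof (intro conjI mP allI impI)
    fix X Y g f assume *: "md X \<and> md Y \<and> g \<in> hom A X Y \<and> surj_map g \<and> f \<in> hom A P Y"
    then have g: "fm g \<in> homs X Y" "onto X Y (fm g)" and f: "fm f \<in> homs P Y"
      using fm_homs surj_map_iff mP by auto
    then obtain h where h: "h \<in> homs P X" "\<And>x. x \<in> S P \<Longrightarrow> fm g (h x) = fm f x"
      using proj_mod_lift[OF P _ _ g f] * by blast
    let ?h = "mt (mdim X) (mdim P) h"
    have "?h \<in> hom A P X" using mt_hom h(1) * mP by blast
    moreover have "g * ?h = f"
      using h(2) fm_mt_homs[OF h(1)] * hom_carrier by (subst mult_eq_iff[of _ "mdim X" "mdim P" _ "mdim Y"]) auto
    ultimately show "\<exists>h\<in>hom A P X. g * h = f" by blast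
  qed
qed

lemma proj_mod_zero:
  assumes "md Z" "mdim Z = 0"
  shows "proj_mod Z"
  unfolding proj_mod_def
proof (intro conjI assms(1) allI impI)
  fix X Y g f assume "g \<in> homs X Y" "f \<in> homs Z Y"
  then have "\<forall>x\<in>S Z. g 0 = f x" using assms(2) by (simp add: hmL(3)[of g] hmL(3)[of f])
  then show "\<exists>h\<in>homs Z X. \<forall>x\<in>S Z. g (h x) = f x" by (intro bexI[OF _ homs_zero])
qed

lemma proj_mod_dsum:
  assumes P: "proj_mod P" and Q: "proj_mod Q"
  shows "proj_mod (dsum P Q)"
proof -
  let ?D = "dsum P Q"
  obtain i1 i2 p1 p2 where D: "md ?D"
    "i1 \<in> homs P ?D" "i2 \<in> homs Q ?D" "p1 \<in> homs ?D P" "p2 \<in> homs ?D Q"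
    "\<And>x. x \<in> S P \<Longrightarrow> p1 (i1 x) = x" "\<And>x. x \<in> S P \<Longrightarrow> p2 (i1 x) = 0"
    "\<And>y. y \<in> S Q \<Longrightarrow> p2 (i2 y) = y" "\<And>y. y \<in> S Q \<Longrightarrow> p1 (i2 y) = 0"
    "\<And>z. z \<in> S ?D \<Longrightarrow> i1 (p1 z) + i2 (p2 z) = z"
    using dsum_maps[OF proj_mod_md[OF P] proj_mod_md[OF Q]] by blast
  show ?thesis unfolding proj_mod_def
  proof (intro conjI D(1) allI impI)
    fix X Y g f assume *: "md X" "md Y" "g \<in> homs X Y" "onto X Y g" "f \<in> homs ?D Y"
    obtain h1 where h1: "h1 \<in> homs P X" "\<And>x. x \<in> S P \<Longrightarrow> g (h1 x) = f (i1 x)"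
      using proj_mod_lift[OF P *(1-4) homs_comp[OF D(2) *(5)]] by blast
    obtain h2 where h2: "h2 \<in> homs Q X" "\<And>x. x \<in> S Q \<Longrightarrow> g (h2 x) = f (i2 x)"
      using proj_mod_lift[OF Q *(1-4) homs_comp[OF D(3) *(5)]] by blast
    let ?h = "\<lambda>z. h1 (p1 z) + h2 (p2 z)"
    have h: "?h \<in> homs ?D X" using homs_add[OF homs_comp[OF D(4) h1(1)] homs_comp[OF D(5) h2(1)]] .
    have "g (?h z) = f z" if "z \<in> S ?D" for z
      using h1(2)[OF homs_in[OF D(4) that]] h2(2)[OF homs_in[OF D(5) that]] D(10)[OF that]
      by (simp add: hmL[OF *(3)] hmL(1)[OF *(5), symmetric])
    then show "\<exists>h\<in>homs ?D X. \<forall>x\<in>S ?D. g (h x) = f x" by (intro bexI[OF _ h] ballI)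
  qed
qed

lemma proj_mod_retract:
  assumes Y: "proj_mod Y" and X: "md X" "i \<in> homs X Y" "r \<in> homs Y X" "\<And>x. x \<in> S X \<Longrightarrow> r (i x) = x"
  shows "proj_mod X"
  unfolding proj_mod_def
proof (intro conjI X(1) allI impI)
  fix M N g f assume *: "md M" "md N" "g \<in> homs M N" "onto M N g" "f \<in> homs X N"
  obtain h where h: "h \<in> homs Y M" "\<And>x. x \<in> S Y \<Longrightarrow> g (h x) = f (r x)"
    using proj_mod_lift[OF Y *(1-4) homs_comp[OF X(3) *(5)]] by blast
  have "g (h (i x)) = f x" if "x \<in> S X" for x
    using h(2)[OF homs_in[OF X(2) that]] X(4)[OF that] by simp
  then show "\<exists>h\<in>homs X M. \<forall>x\<in>S X. g (h x) = f x" by (intro bexI[OF _ homs_comp[OF X(2) h(1)]] ballI)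
qed

lemma proj_mod_ext:
  assumes E: "ses X Y Z f g" and X: "proj_mod X" and Z: "proj_mod Z"
  shows "proj_mod Y"
proof -
  note E' = sesD[OF E]
  obtain s where s: "s \<in> homs Z Y" "\<And>z. z \<in> S Z \<Longrightarrow> g (s z) = z"
    using proj_mod_lift[OF Z E'(2,3,5,7) homs_id] by blast
  obtain r where r: "r \<in> homs Y X" "\<And>x. x \<in> S X \<Longrightarrow> r (f x) = x" "\<And>y. y \<in> S Y \<Longrightarrow> f (r y) + s (g y) = y"
    using ses_retraction[OF E s] by blast
  obtain i1 i2 p1 p2 where D: "md (dsum X Z)"
    "i1 \<in> homs X (dsum X Z)" "i2 \<in> homs Z (dsum X Z)" "p1 \<in> homs (dsum X Z) X" "p2 \<in> homs (dsum X Z) Z"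
    "\<And>x. x \<in> S X \<Longrightarrow> p1 (i1 x) = x" "\<And>x. x \<in> S X \<Longrightarrow> p2 (i1 x) = 0"
    "\<And>y. y \<in> S Z \<Longrightarrow> p2 (i2 y) = y" "\<And>y. y \<in> S Z \<Longrightarrow> p1 (i2 y) = 0"
    "\<And>z. z \<in> S (dsum X Z) \<Longrightarrow> i1 (p1 z) + i2 (p2 z) = z"
    using dsum_maps[OF E'(1,3)] by blast
  show ?thesis
  proof (rule proj_mod_retract[OF proj_mod_dsum[OF X Z] E'(2)])
    show "(\<lambda>y. i1 (r y) + i2 (g y)) \<in> homs Y (dsum X Z)"
      using homs_add[OF homs_comp[OF r(1) D(2)] homs_comp[OF E'(5) D(3)]] .
    show "(\<lambda>z. f (p1 z) + s (p2 z)) \<in> homs (dsum X Z) Y"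
      using homs_add[OF homs_comp[OF D(4) E'(4)] homs_comp[OF D(5) s(1)]] .
    show "f (p1 (i1 (r y) + i2 (g y))) + s (p2 (i1 (r y) + i2 (g y))) = y" if "y \<in> S Y" for y
      using r(3)[OF that] D(6,7)[OF homs_in[OF r(1) that]] D(8,9)[OF homs_in[OF E'(5) that]]
      by (simp add: hmL[OF D(4)] hmL[OF D(5)])
  qed
qed

section \<open>The regular module and enough projectives\<close>

lemma amul_dim [simp]: "a \<in> V \<Longrightarrow> b \<in> V \<Longrightarrow> dim_vec (amul A a b) = adim A"
  using algD(2) by (rule carrier_vecD)

lemma ac_regular:
  assumes a: "a \<in> V"
  shows "ac (regular A) a x = pv (amul A a (vc (adim A) x))"
proof -
  let ?d = "adim A"
  have c: "act (regular A) a \<in> carrier_mat ?d ?d" by (simp add: regular_def)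
  have l: "lin (\<lambda>x. pv (amul A a (vc ?d x)))"
    using algD(2)[OF a] by (intro linI) (simp_all add: vc_simps algD(4,6) a pv_simps)
  have t: "vc ?d x = vc ?d (trunc ?d x)" for x :: "'k poly" by (auto simp: coeff_poly_cutoff)
  have "ac (regular A) a (trunc ?d x) = pv (amul A a (vc ?d (trunc ?d x)))"
  proof (rule lin_eqI[OF lin_ac l])
    fix i assume i: "i < ?d"
    have u: "vc ?d (unit i) = unit_vec ?d i" using i by (intro eq_vecI) auto
    show "ac (regular A) a (unit i) = pv (amul A a (vc ?d (unit i)))"
      unfolding u using i algD(2)[OF a, of "unit_vec ?d i"]
      by (auto simp: poly_eq_iff coeff_pv ac_def coeff_fm regular_def if_distrib[of "\<lambda>x. _ * x"] cong: if_cong)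
  qed simp
  moreover have "ac (regular A) a x = ac (regular A) a (trunc ?d x)"
    using t[of x] c unfolding ac_def fm_def by auto
  ultimately show ?thesis using t by metis
qed

lemma md_regular: "md (regular A)"
proof (rule mdI)
  have d: "mdim (regular A) = adim A" by (simp add: regular_def)
  fix a b :: "'k vec" and x :: "'k poly" and c assume a: "a \<in> V"
  show "act (regular A) a \<in> carrier_mat (mdim (regular A)) (mdim (regular A))" by (simp add: regular_def)
  show "ac (regular A) (c \<cdot>\<^sub>v a) x = smult c (ac (regular A) a x)"
    using a algD(2)[OF a] by (simp add: ac_regular algD(5) pv_simps)
  assume b: "b \<in> V"
  show "ac (regular A) (a + b) x = ac (regular A) a x + ac (regular A) b x"
    using a b algD(2)[OF a] algD(2)[OF b] by (simp add: ac_regular algD(3) pv_simps)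
  show "ac (regular A) (amul A a b) x = ac (regular A) a (ac (regular A) b x)"
    using a b algD(2)[OF a] algD(2)[OF b] by (simp add: ac_regular algD(2,7) vc_pv)
next
  fix x assume "x \<in> S (regular A)"
  then have "x \<in> Sp (adim A)" by (simp add: regular_def)
  then show "ac (regular A) (aone A) x = x"
    by (simp add: ac_regular algD pv_vc)
qed

lemma regular_map:
  assumes X: "md X" and x0: "x0 \<in> S X"
  obtains h where "h \<in> homs (regular A) X" "h (pv (aone A)) = x0" "\<And>x. h x = ac X (vc (adim A) x) x0"
proof -
  let ?h = "\<lambda>x. ac X (vc (adim A) x) x0"
  have "?h \<in> homs (regular A) X"
  proof (rule hmI)
    show "lin ?h" by (intro linI) (simp_all add: vc_simps mdD[OF X])
    show "?h x \<in> S X" for x by (simp add: mdD[OF X])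
    show "?h (ac (regular A) a x) = ac X a (?h x)" if "a \<in> V" for a x
      using that algD(2)[OF that] by (simp add: ac_regular vc_pv mdD(5)[OF X])
  qed
  moreover have "?h (pv (aone A)) = x0" using algD(1) by (simp add: vc_pv mdD(6)[OF X x0])
  ultimately show ?thesis using that by blast
qed

lemma proj_mod_regular: "proj_mod (regular A)"
  unfolding proj_mod_def
proof (intro conjI md_regular allI impI)
  let ?R = "regular A"
  have d: "mdim ?R = adim A" by (simp add: regular_def)
  fix X Y g f assume *: "md X" "md Y" "g \<in> homs X Y" "onto X Y g" "f \<in> homs ?R Y"
  let ?e = "pv (aone A)"
  have e: "?e \<in> S ?R" using pv_Sp[of "aone A" "adim A"] algD(1) d by simp
  then obtain x0 where x0: "x0 \<in> S X" "g x0 = f ?e" using *(4) homs_in[OF *(5) e] unfolding onto_def by blast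
  obtain h where h: "h \<in> homs ?R X" "\<And>x. h x = ac X (vc (adim A) x) x0"
    using regular_map[OF *(1) x0(1)] by blast
  have "g (h x) = f x" if x: "x \<in> S ?R" for x
  proof -
    let ?a = "vc (adim A) x"
    have "g (h x) = f (ac ?R ?a ?e)" using homs_ac[OF *(3) _ x0(1)] homs_ac[OF *(5) _ e] x0(2) h(2) by simp
    also have "ac ?R ?a ?e = x" using algD(1) x d by (simp add: ac_regular vc_pv algD pv_vc)
    finally show ?thesis .
  qed
  then show "\<exists>h\<in>homs ?R X. \<forall>x\<in>S ?R. g (h x) = f x" using h(1) by blast
qed

text \<open>The cover is a direct sum of copies of the regular module, one for each unit vector of
  \<open>M\<close>. The predicate \<open>Q\<close> is carried along the construction so that the
  covering module can later be chosen filtered by standard modules.\<close>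

lemma enough_projectives_in:
  assumes M: "md M" and Q0: "\<And>Z. md Z \<Longrightarrow> mdim Z = 0 \<Longrightarrow> Q Z"
    and QD: "\<And>P. md P \<Longrightarrow> Q P \<Longrightarrow> Q (dsum (regular A) P)"
  obtains P p where "proj_mod P" "Q P" "p \<in> homs P M" "onto P M p"
proof -
  have "\<exists>P p. proj_mod P \<and> Q P \<and> p \<in> homs P M \<and> (\<forall>i<n. unit i \<in> p ` S P)" if "n \<le> mdim M" for n
    using that
  proof (induction n)
    case 0
    obtain Z where "md Z" "mdim Z = 0" using zero_mod by blast
    then show ?case using proj_mod_zero Q0 homs_zero by blast
  next
    case (Suc n)
    then obtain P p where P: "proj_mod P" "Q P" "p \<in> homs P M" "\<forall>i<n. unit i \<in> p ` S P" by auto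
    let ?R = "regular A"
    let ?D = "dsum ?R P"
    obtain i1 i2 p1 p2 where D: "md ?D"
      "i1 \<in> homs ?R ?D" "i2 \<in> homs P ?D" "p1 \<in> homs ?D ?R" "p2 \<in> homs ?D P"
      "\<And>x. x \<in> S ?R \<Longrightarrow> p1 (i1 x) = x" "\<And>x. x \<in> S ?R \<Longrightarrow> p2 (i1 x) = 0"
      "\<And>y. y \<in> S P \<Longrightarrow> p2 (i2 y) = y" "\<And>y. y \<in> S P \<Longrightarrow> p1 (i2 y) = 0"
      "\<And>z. z \<in> S ?D \<Longrightarrow> i1 (p1 z) + i2 (p2 z) = z"
      using dsum_maps[OF md_regular proj_mod_md[OF P(1)]] by blast
    have "unit n \<in> S M" using Suc.prems by auto
    then obtain h where h: "h \<in> homs ?R M" "h (pv (aone A)) = unit n" using regular_map[OF M] by blast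
    have e: "pv (aone A) \<in> S ?R" using pv_Sp[of "aone A" "adim A"] algD(1) by (simp add: regular_def)
    let ?f = "\<lambda>z. h (p1 z) + p (p2 z)"
    have f: "?f \<in> homs ?D M" using homs_add[OF homs_comp[OF D(4) h(1)] homs_comp[OF D(5) P(3)]] .
    have "unit i \<in> ?f ` S ?D" if "i < Suc n" for i
    proof (cases "i = n")
      case True
      have "?f (i1 (pv (aone A))) = unit n" using D(6,7)[OF e] h(2) hmL(3)[OF P(3)] by simp
      then show ?thesis using True by (intro image_eqI[OF _ homs_in[OF D(2) e]]) simp
    next
      case False
      then have "i < n" using that by simp
      then obtain x where x: "x \<in> S P" "p x = unit i" using P(4) by (metis imageE)
      have "?f (i2 x) = unit i" using D(8,9)[OF x(1)] x(2) hmL(3)[OF h(1)] by simp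
      then show ?thesis by (intro image_eqI[OF _ homs_in[OF D(3) x(1)]]) simp
    qed
    then have "\<forall>i<Suc n. unit i \<in> ?f ` S ?D" by blast
    with proj_mod_dsum[OF proj_mod_regular P(1)] QD[OF proj_mod_md[OF P(1)] P(2)] f
    have "proj_mod ?D \<and> Q ?D \<and> ?f \<in> homs ?D M \<and> (\<forall>i<Suc n. unit i \<in> ?f ` S ?D)" by (intro conjI)
    then show ?case by (intro exI)
  qed
  then obtain P p where P: "proj_mod P" "Q P" "p \<in> homs P M" "\<And>i. i < mdim M \<Longrightarrow> unit i \<in> p ` S P" by blast
  have sub: "subsp (p ` S P)" using subsp_image[OF homs_lin[OF P(3)] subsp_Sp] .
  have "y \<in> p ` S P" if "y \<in> S M" for y
    using lincomb_in[OF sub, of "mdim M" unit y] P(4) trunc_id[OF that] by (simp add: lincomb_unit)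
  then have "onto P M p" unfolding onto_def by blast
  then show ?thesis using that P by blast
qed

lemma enough_projectives:
  assumes "md M"
  obtains P p where "proj_mod P" "p \<in> homs P M" "onto P M p"
  using enough_projectives_in[OF assms, of "\<lambda>_. True"] by blast

lemma ses_projective:
  assumes "md M"
  obtains K P k p where "ses K P M k p" "proj_mod P"
proof -
  obtain P p where P: "proj_mod P" "p \<in> homs P M" "onto P M p" using enough_projectives[OF assms] by blast
  obtain K k where "ses K P M k p" using ses_kernel[OF proj_mod_md[OF P(1)] assms P(2,3)] by blast
  then show ?thesis using that P(1) by blast
qed

end

section \<open>Vanishing of first extension groups\<close>

context fd_algebra
begin

text \<open>Vanishing of Ext^1(X, Y). The submodule of the extension is the second argument
  \<open>Y\<close>, the quotient is the first argument \<open>X\<close>.\<close>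

definition Ext1_zero :: "'k fmod \<Rightarrow> 'k fmod \<Rightarrow> bool" where
  "Ext1_zero X Y \<longleftrightarrow> (\<forall>Z f g. ses Y Z X f g \<longrightarrow> (\<exists>s\<in>homs X Z. \<forall>x\<in>S X. g (s x) = x))"

lemma Ext1_zero_section:
  assumes "Ext1_zero X Y" "ses Y Z X f g"
  obtains s where "s \<in> homs X Z" "\<And>x. x \<in> S X \<Longrightarrow> g (s x) = x"
  using assms unfolding Ext1_zero_def by blast

text \<open>The extension is pushed out along \<open>\<phi>\<close>; the pushout splits, and a
  retraction onto \<open>Y\<close> gives the extended map.\<close>

lemma Ext1_zero_extend:
  assumes E: "Ext1_zero X Y" and U: "ses U W X i p" and Y: "md Y" and \<phi>: "\<phi> \<in> homs U Y"
  obtains \<psi> where "\<psi> \<in> homs W Y" "\<And>u. u \<in> S U \<Longrightarrow> \<psi> (i u) = \<phi> u"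
proof -
  obtain Y' j q \<psi> where P: "ses Y Y' X j q" "\<psi> \<in> homs W Y'" "\<And>u. u \<in> S U \<Longrightarrow> \<psi> (i u) = j (\<phi> u)"
    "\<And>x. x \<in> S W \<Longrightarrow> q (\<psi> x) = p x"
    using ses_pushout[OF U Y \<phi>] by blast
  obtain s where s: "s \<in> homs X Y'" "\<And>x. x \<in> S X \<Longrightarrow> q (s x) = x" using Ext1_zero_section[OF E P(1)] by blast
  obtain r where r: "r \<in> homs Y' Y" "\<And>y. y \<in> S Y \<Longrightarrow> r (j y) = y" "\<And>z. z \<in> S Y' \<Longrightarrow> j (r z) + s (q z) = z"
    using ses_retraction[OF P(1) s] by blast
  have "r (\<psi> (i u)) = \<phi> u" if "u \<in> S U" for u
    using P(3)[OF that] r(2)[OF homs_in[OF \<phi> that]] by simp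
  then show ?thesis using that[OF homs_comp[OF P(2) r(1)]] by blast
qed

lemma ses_factor:
  assumes E: "ses Y Z X j q" and f: "f \<in> homs U Z" and U: "md U" and z: "\<And>u. u \<in> S U \<Longrightarrow> q (f u) = 0"
  obtains h where "h \<in> homs U Y" "\<And>u. u \<in> S U \<Longrightarrow> j (h u) = f u"
proof -
  note E' = sesD[OF E]
  have "f u \<in> j ` S Y" if "u \<in> S U" for u
    using E'(9)[OF homs_in[OF f that]] z[OF that] by simp
  then show ?thesis using corestrict[OF f E'(4,6) U E'(1)] that by blast
qed

lemma ses_descend:
  assumes E: "ses Y Z X j q" and f: "f \<in> homs Z W" and z: "\<And>y. y \<in> S Y \<Longrightarrow> f (j y) = 0"
  obtains h where "h \<in> homs X W" "\<And>x. x \<in> S Z \<Longrightarrow> h (q x) = f x"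
proof -
  note E' = sesD[OF E]
  have "f x = 0" if "x \<in> S Z" "q x = 0" for x using E'(10)[OF that] z by blast
  then show ?thesis using descend[OF E'(2) f E'(5,7)] that by blast
qed

text \<open>Given compatible maps on the terms of a projective presentation, the difference \<open>h - j \<psi>\<close> of the
  lift and the correction descends to the cokernel.\<close>

lemma lift_from_presentation:
  assumes P: "ses K P X i p" "proj_mod P" and E: "ses Y Z W j q" and f: "f \<in> homs X W"
    and ex: "\<And>\<phi>. \<phi> \<in> homs K Y \<Longrightarrow> \<exists>\<psi>\<in>homs P Y. \<forall>k\<in>S K. \<psi> (i k) = \<phi> k"
  obtains h where "h \<in> homs X Z" "\<And>x. x \<in> S X \<Longrightarrow> q (h x) = f x"
proof -
  note P' = sesD[OF P(1)] and E' = sesD[OF E]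
  obtain h0 where h0: "h0 \<in> homs P Z" "\<And>x. x \<in> S P \<Longrightarrow> q (h0 x) = f (p x)"
    using proj_mod_lift[OF P(2) E'(2,3,5,7) homs_comp[OF P'(5) f]] by blast
  have "q (h0 (i k)) = 0" if "k \<in> S K" for k
    using h0(2)[OF homs_in[OF P'(4) that]] P'(8)[OF that] hmL(3)[OF f] by simp
  then obtain \<phi> where \<phi>: "\<phi> \<in> homs K Y" "\<And>k. k \<in> S K \<Longrightarrow> j (\<phi> k) = h0 (i k)"
    using ses_factor[OF E homs_comp[OF P'(4) h0(1)] P'(1)] by blast
  obtain \<psi> where \<psi>: "\<psi> \<in> homs P Y" "\<forall>k\<in>S K. \<psi> (i k) = \<phi> k" using ex[OF \<phi>(1)] by blast
  have h1: "(\<lambda>x. h0 x - j (\<psi> x)) \<in> homs P Z" using homs_diff[OF h0(1) homs_comp[OF \<psi>(1) E'(4)]] .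
  have "h0 (i k) - j (\<psi> (i k)) = 0" if "k \<in> S K" for k using \<phi>(2)[OF that] \<psi>(2) that by simp
  then obtain h where h: "h \<in> homs X Z" "\<And>x. x \<in> S P \<Longrightarrow> h (p x) = h0 x - j (\<psi> x)"
    using ses_descend[OF P(1) h1] by blast
  have "q (h x) = f x" if x: "x \<in> S X" for x
  proof -
    obtain y where y: "y \<in> S P" "p y = x" using P'(12)[OF x] by blast
    show ?thesis using h(2)[OF y(1)] y h0(2)[OF y(1)] E'(8)[OF homs_in[OF \<psi>(1) y(1)]] by (simp add: hmL[OF E'(5)])
  qed
  then show ?thesis using that[OF h(1)] by blast
qed

text \<open>Surjectivity of Hom(X, Z) -> Hom(X, W). A projective cover of \<open>X\<close> always
  lifts, and the vanishing is what allows this lift to be corrected on the kernel.\<close>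

lemma Ext1_zero_lift:
  assumes X: "md X" and E: "Ext1_zero X Y" and F: "ses Y Z W j q" and f: "f \<in> homs X W"
  obtains h where "h \<in> homs X Z" "\<And>x. x \<in> S X \<Longrightarrow> q (h x) = f x"
proof -
  obtain K P i p where P: "ses K P X i p" "proj_mod P" using ses_projective[OF X] by blast
  have "\<exists>\<psi>\<in>homs P Y. \<forall>k\<in>S K. \<psi> (i k) = \<phi> k" if \<phi>: "\<phi> \<in> homs K Y" for \<phi>
    by (rule Ext1_zero_extend[OF E P(1) sesD(1)[OF F] \<phi>]) (intro bexI ballI)
  from lift_from_presentation[OF P F f this] show ?thesis using that by blast
qed

text \<open>One presentation is enough to test vanishing, as Ext^1(X, Y) is the cokernel of Hom(P,
  Y) -> Hom(K, Y). \<open>Ext1_zero_extend\<close> gives the converse.\<close>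

lemma Ext1_zero_I:
  assumes P: "ses K P X i p" "proj_mod P"
    and ex: "\<And>\<phi>. \<phi> \<in> homs K Y \<Longrightarrow> \<exists>\<psi>\<in>homs P Y. \<forall>k\<in>S K. \<psi> (i k) = \<phi> k"
  shows "Ext1_zero X Y"
  unfolding Ext1_zero_def
proof (intro allI impI)
  fix Z f g assume E: "ses Y Z X f g"
  obtain h where "h \<in> homs X Z" "\<And>x. x \<in> S X \<Longrightarrow> g (h x) = x"
    using lift_from_presentation[OF P E homs_id ex] by blast
  then show "\<exists>s\<in>homs X Z. \<forall>x\<in>S X. g (s x) = x" by blast
qed

lemma Ext1_zero_proj_mod: "proj_mod P \<Longrightarrow> Ext1_zero P Y"
  unfolding Ext1_zero_def
proof (intro allI impI)
  fix Z f g assume P: "proj_mod P" and E: "ses Y Z P f g"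
  note E' = sesD[OF E]
  obtain h where "h \<in> homs P Z" "\<And>x. x \<in> S P \<Longrightarrow> g (h x) = x"
    using proj_mod_lift[OF P E'(2,3,5,7) homs_id] by blast
  then show "\<exists>s\<in>homs P Z. \<forall>x\<in>S P. g (s x) = x" by blast
qed

text \<open>Let \<open>P\<close> present \<open>X2\<close> with kernel \<open>K\<close>, and let
  \<open>Q\<close> be the kernel of the composite onto \<open>X3\<close>. Then \<open>K\<close> lies
  in \<open>Q\<close> with quotient \<open>X1\<close>, and \<open>Q\<close> in \<open>P\<close> with
  quotient \<open>X3\<close>, so a map on \<open>K\<close> is extended in two stages.\<close>

lemma Ext1_zero_ext_left:
  assumes E: "ses X1 X2 X3 a b" and Ext1_zero: "Ext1_zero X1 Y" and E3: "Ext1_zero X3 Y" and Y: "md Y"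
  shows "Ext1_zero X2 Y"
proof -
  note E' = sesD[OF E]
  obtain K P i p where P: "ses K P X2 i p" "proj_mod P" using ses_projective[OF E'(2)] by blast
  note P' = sesD[OF P(1)]
  have on: "onto P X3 (\<lambda>x. b (p x))"
    using P'(12) E'(12) unfolding onto_def by metis
  obtain Q c where Q: "ses Q P X3 c (\<lambda>x. b (p x))"
    using ses_kernel[OF P'(2) E'(3) homs_comp[OF P'(5) E'(5)] on] by blast
  note Q' = sesD[OF Q]
  have "b (p (i k)) = 0" if "k \<in> S K" for k using P'(8)[OF that] hmL(3)[OF E'(5)] by simp
  then obtain u where u: "u \<in> homs K Q" "\<And>k. k \<in> S K \<Longrightarrow> c (u k) = i k"
    using ses_factor[OF Q P'(4,1)] by blast
  obtain v where v: "v \<in> homs Q X1" "\<And>x. x \<in> S Q \<Longrightarrow> a (v x) = p (c x)"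
    using ses_factor[OF E homs_comp[OF Q'(4) P'(5)] Q'(1)] Q'(8) by blast
  have F: "ses K Q X1 u v"
  proof (rule sesI[OF P'(1) Q'(1) E'(1) u(1) v(1)])
    show "x = 0" if "x \<in> S K" "u x = 0" for x
      using u(2)[OF that(1)] that hmL(3)[OF Q'(4)] P'(11) by simp
    show "\<exists>y\<in>S Q. v y = x" if x: "x \<in> S X1" for x
    proof -
      obtain y where y: "y \<in> S P" "p y = a x" using P'(12)[OF homs_in[OF E'(4) x]] by blast
      then obtain z where z: "z \<in> S Q" "c z = y" using Q'(10)[OF y(1)] E'(8)[OF x] by auto
      have "v z = x"
        by (rule inj_on_modD[OF E'(4,6)]) (use v(2)[OF z(1)] z y x homs_in[OF v(1) z(1)] in auto)
      then show ?thesis using z(1) by blast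
    qed
    show "v (u x) = 0" if x: "x \<in> S K" for x
      by (rule E'(11)) (use v(2)[OF homs_in[OF u(1) x]] u(2)[OF x] P'(8)[OF x] homs_in[OF v(1) homs_in[OF u(1) x]] in auto)
    show "\<exists>x\<in>S K. u x = y" if y: "y \<in> S Q" "v y = 0" for y
    proof -
      have "p (c y) = 0" using v(2)[OF y(1)] y(2) hmL(3)[OF E'(4)] by simp
      then obtain k where k: "k \<in> S K" "i k = c y" using P'(10)[OF homs_in[OF Q'(4) y(1)]] by blast
      have "u k = y"
        by (rule inj_on_modD[OF Q'(4,6)]) (use u(2)[OF k(1)] k y homs_in[OF u(1) k(1)] in auto)
      then show ?thesis using k(1) by blast
    qed
  qed
  show ?thesis
  proof (rule Ext1_zero_I[OF P])
    fix \<phi> assume \<phi>: "\<phi> \<in> homs K Y"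
    obtain \<psi> where \<psi>: "\<psi> \<in> homs Q Y" "\<And>k. k \<in> S K \<Longrightarrow> \<psi> (u k) = \<phi> k"
      using Ext1_zero_extend[OF Ext1_zero F Y \<phi>] by blast
    obtain \<chi> where \<chi>: "\<chi> \<in> homs P Y" "\<And>k. k \<in> S Q \<Longrightarrow> \<chi> (c k) = \<psi> k"
      using Ext1_zero_extend[OF E3 Q Y \<psi>(1)] by blast
    have "\<chi> (i k) = \<phi> k" if "k \<in> S K" for k
      using \<chi>(2)[OF homs_in[OF u(1) that]] \<psi>(2)[OF that] u(2)[OF that] by simp
    then show "\<exists>\<psi>\<in>homs P Y. \<forall>k\<in>S K. \<psi> (i k) = \<phi> k" using \<chi>(1) by blast
  qed
qed

text \<open>The image of \<open>\<phi>\<close> in \<open>Y3\<close> is extended to \<open>P\<close>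
  and lifted to \<open>Y2\<close> by projectivity. The error on \<open>K\<close> has values in
  \<open>Y1\<close>, where it is extended as well.\<close>

lemma Ext1_zero_ext_right:
  assumes X: "md X" and E: "ses Y1 Y2 Y3 a b" and Ext1_zero: "Ext1_zero X Y1" and E3: "Ext1_zero X Y3"
  shows "Ext1_zero X Y2"
proof -
  note E' = sesD[OF E]
  obtain K P i p where P: "ses K P X i p" "proj_mod P" using ses_projective[OF X] by blast
  note P' = sesD[OF P(1)]
  show ?thesis
  proof (rule Ext1_zero_I[OF P])
    fix \<phi> assume \<phi>: "\<phi> \<in> homs K Y2"
    obtain \<psi> where \<psi>: "\<psi> \<in> homs P Y3" "\<And>k. k \<in> S K \<Longrightarrow> \<psi> (i k) = b (\<phi> k)"
      using Ext1_zero_extend[OF E3 P(1) E'(3) homs_comp[OF \<phi> E'(5)]] by blast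
    obtain h where h: "h \<in> homs P Y2" "\<And>x. x \<in> S P \<Longrightarrow> b (h x) = \<psi> x"
      using proj_mod_lift[OF P(2) E'(2,3,5,7) \<psi>(1)] by blast
    have d: "(\<lambda>k. \<phi> k - h (i k)) \<in> homs K Y2" using homs_diff[OF \<phi> homs_comp[OF P'(4) h(1)]] .
    have "b (\<phi> k - h (i k)) = 0" if "k \<in> S K" for k
      using h(2)[OF homs_in[OF P'(4) that]] \<psi>(2)[OF that] by (simp add: hmL[OF E'(5)])
    then obtain t where t: "t \<in> homs K Y1" "\<And>k. k \<in> S K \<Longrightarrow> a (t k) = \<phi> k - h (i k)"
      using ses_factor[OF E d P'(1)] by blast
    obtain t' where t': "t' \<in> homs P Y1" "\<And>k. k \<in> S K \<Longrightarrow> t' (i k) = t k"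
      using Ext1_zero_extend[OF Ext1_zero P(1) E'(1) t(1)] by blast
    have "h (i k) + a (t' (i k)) = \<phi> k" if "k \<in> S K" for k
      using t(2)[OF that] t'(2)[OF that] by simp
    then show "\<exists>\<psi>\<in>homs P Y2. \<forall>k\<in>S K. \<psi> (i k) = \<phi> k"
      by (intro bexI[OF _ homs_add[OF h(1) homs_comp[OF t'(1) E'(4)]]] ballI)
  qed
qed

text \<open>The hypothesis on \<open>K\<close> says that the second extension group of \<open>X\<close> by \<open>Y1\<close> vanishes.\<close>

lemma Ext1_zero_quot_right:
  assumes P: "ses K P X i p" "proj_mod P" and E: "ses Y1 Y2 Y3 a b" and K: "Ext1_zero K Y1" and E2: "Ext1_zero X Y2"
  shows "Ext1_zero X Y3"
proof (rule Ext1_zero_I[OF P])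
  note P' = sesD[OF P(1)] and E' = sesD[OF E]
  fix \<phi> assume \<phi>: "\<phi> \<in> homs K Y3"
  obtain h where h: "h \<in> homs K Y2" "\<And>x. x \<in> S K \<Longrightarrow> b (h x) = \<phi> x" using Ext1_zero_lift[OF P'(1) K E \<phi>] by blast
  obtain \<psi> where \<psi>: "\<psi> \<in> homs P Y2" "\<And>k. k \<in> S K \<Longrightarrow> \<psi> (i k) = h k"
    using Ext1_zero_extend[OF E2 P(1) E'(2) h(1)] by blast
  have "b (\<psi> (i k)) = \<phi> k" if "k \<in> S K" for k using \<psi>(2)[OF that] h(2)[OF that] by simp
  then show "\<exists>\<psi>\<in>homs P Y3. \<forall>k\<in>S K. \<psi> (i k) = \<phi> k" by (intro bexI[OF _ homs_comp[OF \<psi>(1) E'(5)]] ballI)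
qed

text \<open>The part Hom(X1, Y) -> Ext^1(X3, Y) -> Ext^1(X2, Y) of the long exact sequence: a lift
  of \<open>b\<close> to \<open>Z\<close> restricts to a map from \<open>X1\<close> to
  \<open>Y\<close>, which is zero, so the lift descends to a section.\<close>

lemma Ext1_zero_quot_left:
  assumes E: "ses X1 X2 X3 a b" and E2: "Ext1_zero X2 Y" and 0: "\<And>f x. f \<in> homs X1 Y \<Longrightarrow> x \<in> S X1 \<Longrightarrow> f x = 0"
  shows "Ext1_zero X3 Y"
  unfolding Ext1_zero_def
proof (intro allI impI)
  note E' = sesD[OF E]
  fix Z j q assume F: "ses Y Z X3 j q"
  note F' = sesD[OF F]
  obtain h where h: "h \<in> homs X2 Z" "\<And>x. x \<in> S X2 \<Longrightarrow> q (h x) = b x" using Ext1_zero_lift[OF E'(2) E2 F E'(5)] by blast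
  have "q (h (a x)) = 0" if "x \<in> S X1" for x using h(2)[OF homs_in[OF E'(4) that]] E'(8)[OF that] by simp
  then obtain \<phi> where \<phi>: "\<phi> \<in> homs X1 Y" "\<And>x. x \<in> S X1 \<Longrightarrow> j (\<phi> x) = h (a x)"
    using ses_factor[OF F homs_comp[OF E'(4) h(1)] E'(1)] by blast
  have "h (a x) = 0" if "x \<in> S X1" for x using \<phi>(2)[OF that] 0[OF \<phi>(1) that] hmL(3)[OF F'(4)] by simp
  then obtain s where s: "s \<in> homs X3 Z" "\<And>x. x \<in> S X2 \<Longrightarrow> s (b x) = h x" using ses_descend[OF E h(1)] by blast
  have "q (s x) = x" if x: "x \<in> S X3" for x
    using E'(12)[OF x] s(2) h(2) by metis
  then show "\<exists>s\<in>homs X3 Z. \<forall>x\<in>S X3. q (s x) = x" using s(1) by blast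
qed

section \<open>Projective dimension\<close>

text \<open>Projective dimension at most \<open>n\<close>. A single presentation with a good kernel
  is asked for; that every presentation is then as good follows from \<open>schanuel\<close>
  together with \<open>pdle_retract\<close>.\<close>

primrec pdle :: "nat \<Rightarrow> 'k fmod \<Rightarrow> bool" where
  "pdle 0 M \<longleftrightarrow> proj_mod M"
| "pdle (Suc n) M \<longleftrightarrow> (\<exists>K P k g. ses K P M k g \<and> proj_mod P \<and> pdle n K)"

lemma pdle_SucI: "ses K P M k g \<Longrightarrow> proj_mod P \<Longrightarrow> pdle n K \<Longrightarrow> pdle (Suc n) M"
  by auto

lemma proj_mod_pdle: "proj_mod P \<Longrightarrow> pdle n P"
proof (induction n arbitrary: P)
  case (Suc n)
  obtain Z where Z: "md Z" "mdim Z = 0" using zero_mod by blast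
  have "ses Z P P (\<lambda>x. 0) (\<lambda>x. x)"
    using Z proj_mod_md[OF Suc.prems] homs_zero homs_id by (intro sesI) auto
  then show ?case using pdle_SucI Suc.prems Suc.IH[OF proj_mod_zero[OF Z]] by blast
qed simp

lemma pdle_Suc: "pdle n M \<Longrightarrow> pdle (Suc n) M"
proof (induction n arbitrary: M)
  case 0
  then show ?case using proj_mod_pdle[of M "Suc 0"] by simp
next
  case (Suc n)
  then obtain K P k g where "ses K P M k g" "proj_mod P" "pdle n K" by auto
  then show ?case using pdle_SucI[of K P M k g "Suc n"] Suc.IH by blast
qed

lemma pdle_mono: "m \<le> n \<Longrightarrow> pdle m M \<Longrightarrow> pdle n M"
  by (induction n rule: dec_induct) (use pdle_Suc in blast)+

lemma pdle_md: "pdle n M \<Longrightarrow> md M"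
  using proj_mod_md sesD(3) by (cases n) auto

text \<open>\<open>P3\<close> is mapped to \<open>Y\<close> by a lift \<open>t\<close> of
  \<open>g3\<close>, which makes the direct sum of \<open>P1\<close> and \<open>P3\<close> a cover
  of \<open>Y\<close>. Its kernel is an extension of the two given kernels.\<close>

lemma horseshoe:
  assumes E: "ses X Y Z f g" and P1: "ses K1 P1 X k1 g1" "proj_mod P1" and P3: "ses K3 P3 Z k3 g3" "proj_mod P3"
  obtains K2 k2 g2 u v where "ses K2 (dsum P1 P3) Y k2 g2" "ses K1 K2 K3 u v"
proof -
  note E' = sesD[OF E] and P1' = sesD[OF P1(1)] and P3' = sesD[OF P3(1)]
  let ?D = "dsum P1 P3"
  obtain i1 i2 p1 p2 where D: "md ?D"
    "i1 \<in> homs P1 ?D" "i2 \<in> homs P3 ?D" "p1 \<in> homs ?D P1" "p2 \<in> homs ?D P3"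
    "\<And>x. x \<in> S P1 \<Longrightarrow> p1 (i1 x) = x" "\<And>x. x \<in> S P1 \<Longrightarrow> p2 (i1 x) = 0"
    "\<And>y. y \<in> S P3 \<Longrightarrow> p2 (i2 y) = y" "\<And>y. y \<in> S P3 \<Longrightarrow> p1 (i2 y) = 0"
    "\<And>z. z \<in> S ?D \<Longrightarrow> i1 (p1 z) + i2 (p2 z) = z"
    using dsum_maps[OF P1'(2) P3'(2)] by blast
  obtain t where t: "t \<in> homs P3 Y" "\<And>x. x \<in> S P3 \<Longrightarrow> g (t x) = g3 x"
    using proj_mod_lift[OF P3(2) E'(2,3,5,7) P3'(5)] by blast
  let ?g = "\<lambda>z. f (g1 (p1 z)) + t (p2 z)"
  have gh: "?g \<in> homs ?D Y" using homs_add[OF homs_comp[OF homs_comp[OF D(4) P1'(5)] E'(4)] homs_comp[OF D(5) t(1)]] .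
  have g: "?g (i1 x + i2 y) = f (g1 x) + t y" if "x \<in> S P1" "y \<in> S P3" for x y
    using D(6,7)[OF that(1)] D(8,9)[OF that(2)] by (simp add: hmL[OF D(4)] hmL[OF D(5)])
  \<comment> \<open>If \<open>y\<close> and \<open>w\<close> agree in \<open>Z\<close>, then
    \<open>y - t w\<close> comes from \<open>X\<close> and hence from \<open>P1\<close>. This yields
    both surjectivity onto \<open>Y\<close> and surjectivity of the kernels onto
    \<open>K3\<close>.\<close>
  have key: "\<exists>x\<in>S P1. f (g1 x) = y - t w" if y: "y \<in> S Y" "w \<in> S P3" "g y = g3 w" for y w
  proof -
    have "y - t w \<in> S Y" "g (y - t w) = 0"
      using y t(2)[OF y(2)] homs_in[OF t(1) y(2)] by (auto simp: hmL[OF E'(5)])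
    then obtain x where x: "x \<in> S X" "f x = y - t w" using E'(10) by blast
    then show ?thesis using P1'(12)[OF x(1)] by auto
  qed
  have on: "onto ?D Y ?g" unfolding onto_def
  proof
    fix y assume y: "y \<in> S Y"
    obtain w where w: "w \<in> S P3" "g3 w = g y" using P3'(12)[OF homs_in[OF E'(5) y]] by blast
    obtain x where x: "x \<in> S P1" "f (g1 x) = y - t w" using key[OF y w(1)] w(2) by auto
    have "?g (i1 x + i2 w) = y" using g[OF x(1) w(1)] x(2) by simp
    moreover have "i1 x + i2 w \<in> S ?D" using homs_in[OF D(2) x(1)] homs_in[OF D(3) w(1)] by blast
    ultimately show "\<exists>x\<in>S ?D. ?g x = y" by blast
  qed
  obtain K2 k2 where K2: "ses K2 ?D Y k2 ?g" using ses_kernel[OF D(1) E'(2) gh on] by blast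
  note K2' = sesD[OF K2]
  have "?g (i1 (k1 x)) = 0" if "x \<in> S K1" for x
  proof -
    note kx = homs_in[OF P1'(4) that]
    show ?thesis using D(6,7)[OF kx] P1'(8)[OF that] hmL(3)[OF E'(4)] hmL(3)[OF t(1)] by simp
  qed
  then obtain u where u: "u \<in> homs K1 K2" "\<And>x. x \<in> S K1 \<Longrightarrow> k2 (u x) = i1 (k1 x)"
    using ses_factor[OF K2 homs_comp[OF P1'(4) D(2)] P1'(1)] by blast
  have "g3 (p2 (k2 x)) = 0" if "x \<in> S K2" for x
  proof -
    note kx = homs_in[OF K2'(4) that]
    have "g (?g (k2 x)) = 0" using K2'(8)[OF that] hmL(3)[OF E'(5)] by simp
    then show ?thesis
      using E'(8)[OF homs_in[OF P1'(5) homs_in[OF D(4) kx]]] t(2)[OF homs_in[OF D(5) kx]] by (simp add: hmL[OF E'(5)])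
  qed
  then obtain v where v: "v \<in> homs K2 K3" "\<And>x. x \<in> S K2 \<Longrightarrow> k3 (v x) = p2 (k2 x)"
    using ses_factor[OF P3(1) homs_comp[OF K2'(4) D(5)] K2'(1)] by blast
  have "ses K1 K2 K3 u v"
  proof (rule sesI[OF P1'(1) K2'(1) P3'(1) u(1) v(1)])
    show "x = 0" if x: "x \<in> S K1" "u x = 0" for x
    proof -
      have "i1 (k1 x) = 0" using u(2)[OF x(1)] x(2) hmL(3)[OF K2'(4)] by simp
      then have "k1 x = 0" using D(6)[OF homs_in[OF P1'(4) x(1)]] hmL(3)[OF D(4)] by simp
      then show ?thesis using P1'(11)[OF x(1)] by simp
    qed
    show "\<exists>y\<in>S K2. v y = w" if w: "w \<in> S K3" for w
    proof -
      note kw = homs_in[OF P3'(4) w]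
      obtain x where x: "x \<in> S P1" "f (g1 x) = 0 - t (k3 w)"
        using key[OF zero_Sp kw] P3'(8)[OF w] hmL(3)[OF E'(5)] by auto
      have in': "i1 x + i2 (k3 w) \<in> S ?D" using homs_in[OF D(2) x(1)] homs_in[OF D(3) kw] by blast
      have "?g (i1 x + i2 (k3 w)) = 0" using g[OF x(1) kw] x(2) by simp
      then obtain y where y: "y \<in> S K2" "k2 y = i1 x + i2 (k3 w)" using K2'(10)[OF in'] by blast
      have "k3 (v y) = k3 w" using v(2)[OF y(1)] y(2) D(7)[OF x(1)] D(8)[OF kw] by (simp add: hmL[OF D(5)])
      then have "v y = w" using inj_on_modD[OF P3'(4,6) homs_in[OF v(1) y(1)] w] by simp
      then show ?thesis using y(1) by blast
    qed
    show "v (u x) = 0" if x: "x \<in> S K1" for x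
    proof (rule P3'(11))
      note ux = homs_in[OF u(1) x]
      show "v (u x) \<in> S K3" using homs_in[OF v(1) ux] .
      show "k3 (v (u x)) = 0" using v(2)[OF ux] u(2)[OF x] D(7)[OF homs_in[OF P1'(4) x]] by simp
    qed
    show "\<exists>x\<in>S K1. u x = y" if y: "y \<in> S K2" "v y = 0" for y
    proof -
      note ky = homs_in[OF K2'(4) y(1)]
      have p2: "p2 (k2 y) = 0" using v(2)[OF y(1)] y(2) hmL(3)[OF P3'(4)] by simp
      then have "f (g1 (p1 (k2 y))) = 0" using K2'(8)[OF y(1)] hmL(3)[OF t(1)] by simp
      then have "g1 (p1 (k2 y)) = 0" using E'(11)[OF homs_in[OF P1'(5) homs_in[OF D(4) ky]]] by simp
      then obtain x where x: "x \<in> S K1" "k1 x = p1 (k2 y)" using P1'(10)[OF homs_in[OF D(4) ky]] by blast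
      have "k2 (u x) = k2 y" using u(2)[OF x(1)] x(2) D(10)[OF ky] p2 hmL(3)[OF D(3)] by simp
      then have "u x = y" using inj_on_modD[OF K2'(4,6) homs_in[OF u(1) x(1)] y(1)] by simp
      then show ?thesis using x(1) by blast
    qed
  qed
  then show ?thesis using that K2 by blast
qed

lemma pdle_ext:
  assumes "ses X Y Z f g" "pdle n X" "pdle n Z"
  shows "pdle n Y"
  using assms
proof (induction n arbitrary: X Y Z f g)
  case 0
  then show ?case using proj_mod_ext by simp
next
  case (Suc n)
  obtain K1 P1 k1 g1 where P1: "ses K1 P1 X k1 g1" "proj_mod P1" "pdle n K1" using Suc.prems(2) by auto
  obtain K3 P3 k3 g3 where P3: "ses K3 P3 Z k3 g3" "proj_mod P3" "pdle n K3" using Suc.prems(3) by auto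
  obtain K2 k2 g2 u v where K: "ses K2 (dsum P1 P3) Y k2 g2" "ses K1 K2 K3 u v"
    using horseshoe[OF Suc.prems(1) P1(1,2) P3(1,2)] by blast
  show ?case using pdle_SucI[OF K(1) proj_mod_dsum[OF P1(2) P3(2)] Suc.IH[OF K(2) P1(3) P3(3)]] .
qed

definition retract :: "'k fmod \<Rightarrow> 'k fmod \<Rightarrow> bool" where
  "retract X Y \<longleftrightarrow> md X \<and> md Y \<and> (\<exists>i\<in>homs X Y. \<exists>r\<in>homs Y X. \<forall>x\<in>S X. r (i x) = x)"

lemma ses_split_retract:
  assumes E: "ses X Y Z f g" and Z: "proj_mod Z"
  shows "retract X Y"
proof -
  note E' = sesD[OF E]
  obtain s where s: "s \<in> homs Z Y" "\<And>x. x \<in> S Z \<Longrightarrow> g (s x) = x" using Ext1_zero_section[OF Ext1_zero_proj_mod[OF Z] E] by blast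
  obtain r where "r \<in> homs Y X" "\<And>x. x \<in> S X \<Longrightarrow> r (f x) = x" "\<And>y. y \<in> S Y \<Longrightarrow> f (r y) + s (g y) = y"
    using ses_retraction[OF E s] by blast
  then show ?thesis unfolding retract_def using E'(1,2,4) by blast
qed

text \<open>Closure under retracts at level \<open>n\<close> is a premise because
  \<open>pdle_retract\<close> at level \<open>Suc n\<close> calls this lemma with its own induction
  hypothesis. The pullback of the two covers is an extension of \<open>P\<close> by the good kernel
  and has \<open>K\<close> as a direct summand.\<close>

lemma schanuel:
  assumes step: "\<And>X Y. retract X Y \<Longrightarrow> pdle n Y \<Longrightarrow> pdle n X"
    and X: "pdle (Suc n) X" and E: "ses K P X k g" "proj_mod P"
  shows "pdle n K"
proof -
  obtain K' P' k' g' where E': "ses K' P' X k' g'" "proj_mod P'" "pdle n K'" using X by auto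
  obtain W u a v b where W: "ses K W P' u b" "ses K' W P v a" by (rule ses_pullback[OF E(1) E'(1)]) (rule that)
  have "pdle n W" using pdle_ext[OF W(2) E'(3) proj_mod_pdle[OF E(2)]] .
  then show ?thesis using step ses_split_retract[OF W(1) E'(2)] by blast
qed

lemma retract_complement:
  assumes "retract X Y"
  obtains X' i c r where "ses X' Y X c r" "i \<in> homs X Y" "\<And>x. x \<in> S X \<Longrightarrow> r (i x) = x"
proof -
  obtain i r where ir: "i \<in> homs X Y" "r \<in> homs Y X" "\<forall>x\<in>S X. r (i x) = x" and m: "md X" "md Y"
    using assms unfolding retract_def by blast
  have "onto Y X r" unfolding onto_def using ir homs_in[OF ir(1)] by blast
  then obtain X' c where "ses X' Y X c r" using ses_kernel[OF m(2,1) ir(2)] by blast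
  then show ?thesis using that ir by blast
qed

text \<open>The split sequence \<open>X' \<rightarrow> Y \<rightarrow> X\<close> gives, by the horseshoe construction, a presentation of \<open>Y\<close> whose kernel is an
  extension of \<open>K\<close> by \<open>K'\<close>. As the lift of \<open>P \<rightarrow> X\<close> to \<open>Y\<close> may be chosen through the section, this extension
  splits.\<close>

lemma pdle_retract: "retract X Y \<Longrightarrow> pdle n Y \<Longrightarrow> pdle n X"
proof (induction n arbitrary: X Y)
  case 0
  then show ?case using proj_mod_retract unfolding retract_def by auto
next
  case (Suc n)
  obtain X' i c r where E: "ses X' Y X c r" and i: "i \<in> homs X Y" "\<And>x. x \<in> S X \<Longrightarrow> r (i x) = x"
    by (rule retract_complement[OF Suc.prems(1)]) (rule that)
  note E' = sesD[OF E]
  obtain K P k g where P: "ses K P X k g" "proj_mod P" using ses_projective[OF E'(3)] by blast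
  obtain K' P' k' g' where P': "ses K' P' X' k' g'" "proj_mod P'" using ses_projective[OF E'(1)] by blast
  note Q = sesD[OF P(1)] and Q' = sesD[OF P'(1)]
  let ?D = "dsum P P'"
  obtain i1 i2 p1 p2 where D: "md ?D"
    "i1 \<in> homs P ?D" "i2 \<in> homs P' ?D" "p1 \<in> homs ?D P" "p2 \<in> homs ?D P'"
    "\<And>x. x \<in> S P \<Longrightarrow> p1 (i1 x) = x" "\<And>x. x \<in> S P \<Longrightarrow> p2 (i1 x) = 0"
    "\<And>y. y \<in> S P' \<Longrightarrow> p2 (i2 y) = y" "\<And>y. y \<in> S P' \<Longrightarrow> p1 (i2 y) = 0"
    "\<And>z. z \<in> S ?D \<Longrightarrow> i1 (p1 z) + i2 (p2 z) = z"
    using dsum_maps[OF Q(2) Q'(2)] by blast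
  let ?g = "\<lambda>z. i (g (p1 z)) + c (g' (p2 z))"
  have gh: "?g \<in> homs ?D Y"
    using homs_add[OF homs_comp[OF homs_comp[OF D(4) Q(5)] i(1)] homs_comp[OF homs_comp[OF D(5) Q'(5)] E'(4)]] .
  have rg: "r (?g z) = g (p1 z)" if "z \<in> S ?D" for z
    using i(2)[OF homs_in[OF Q(5) homs_in[OF D(4) that]]] E'(8)[OF homs_in[OF Q'(5) homs_in[OF D(5) that]]]
    by (simp add: hmL[OF E'(5)])
  have on: "onto ?D Y ?g" unfolding onto_def
  proof
    fix y assume y: "y \<in> S Y"
    note ry = homs_in[OF E'(5) y]
    have "y - i (r y) \<in> S Y" "r (y - i (r y)) = 0"
      using y homs_in[OF i(1) ry] i(2)[OF ry] by (auto simp: hmL[OF E'(5)])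
    then obtain x' where x': "x' \<in> S X'" "c x' = y - i (r y)" using E'(10) by blast
    obtain a where a: "a \<in> S P" "g a = r y" using Q(12)[OF ry] by blast
    obtain b where b: "b \<in> S P'" "g' b = x'" using Q'(12)[OF x'(1)] by blast
    have "?g (i1 a + i2 b) = y"
      using D(6,7)[OF a(1)] D(8,9)[OF b(1)] a(2) b(2) x'(2) by (simp add: hmL[OF D(4)] hmL[OF D(5)])
    moreover have "i1 a + i2 b \<in> S ?D" using homs_in[OF D(2) a(1)] homs_in[OF D(3) b(1)] by blast
    ultimately show "\<exists>x\<in>S ?D. ?g x = y" by blast
  qed
  obtain L l where L: "ses L ?D Y l ?g" using ses_kernel[OF D(1) E'(2) gh on] by blast
  note L' = sesD[OF L]
  have "pdle n L" using schanuel[OF Suc.IH Suc.prems(2) L proj_mod_dsum[OF P(2) P'(2)]] .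
  moreover have "retract K L"
  proof -
    have "?g (i1 (k x)) = 0" if "x \<in> S K" for x
      using D(6,7)[OF homs_in[OF Q(4) that]] Q(8)[OF that] hmL(3)[OF i(1)] hmL(3)[OF Q'(5)] hmL(3)[OF E'(4)] by simp
    then obtain a where a: "a \<in> homs K L" "\<And>x. x \<in> S K \<Longrightarrow> l (a x) = i1 (k x)"
      using ses_factor[OF L homs_comp[OF Q(4) D(2)] Q(1)] by blast
    have "g (p1 (l x)) = 0" if "x \<in> S L" for x
      using rg[OF homs_in[OF L'(4) that]] L'(8)[OF that] hmL(3)[OF E'(5)] by simp
    then obtain b where b: "b \<in> homs L K" "\<And>x. x \<in> S L \<Longrightarrow> k (b x) = p1 (l x)"
      using ses_factor[OF P(1) homs_comp[OF L'(4) D(4)] L'(1)] by blast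
    have "b (a x) = x" if x: "x \<in> S K" for x
    proof (rule inj_on_modD[OF Q(4,6) _ x])
      show "b (a x) \<in> S K" using homs_in[OF b(1) homs_in[OF a(1) x]] .
      show "k (b (a x)) = k x" using b(2)[OF homs_in[OF a(1) x]] a(2)[OF x] D(6)[OF homs_in[OF Q(4) x]] by simp
    qed
    then show ?thesis unfolding retract_def using Q(1) L'(1) a(1) b(1) by blast
  qed
  ultimately have "pdle n K" using Suc.IH by blast
  then show ?case using pdle_SucI[OF P] by blast
qed

text \<open>The pullback \<open>W\<close> of \<open>Y\<close> along a projective cover of
  \<open>Z\<close> is an extension of \<open>Y\<close> by a syzygy of \<open>Z\<close>, so its
  dimension is at most \<open>n\<close>. It also maps onto the projective \<open>P\<close> with
  kernel \<open>X\<close>; that sequence splits.\<close>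

lemma pdle_kernel:
  assumes E: "ses X Y Z f g" and Y: "pdle n Y" and Z: "pdle (Suc n) Z"
  shows "pdle n X"
proof -
  obtain K P k p where P: "ses K P Z k p" "proj_mod P" "pdle n K" using Z by auto
  obtain W u a v b where W: "ses X W P u b" "ses K W Y v a" by (rule ses_pullback[OF E P(1)]) (rule that)
  have "pdle n W" using pdle_ext[OF W(2) P(3) Y] .
  then show ?thesis using pdle_retract[OF ses_split_retract[OF W(1) P(2)]] by blast
qed

text \<open>In the same pullback, \<open>W\<close> is now bounded as an extension of
  \<open>P\<close> by \<open>X\<close>. The syzygy \<open>K\<close> of \<open>Z\<close> is the
  kernel of \<open>W\<close> onto \<open>Y\<close>, so \<open>pdle_kernel\<close> bounds it.\<close>

lemma pdle_cokernel:
  assumes E: "ses X Y Z f g" and X: "pdle n X" and Y: "pdle n Y"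
  shows "pdle (Suc n) Z"
proof -
  obtain K P k p where P: "ses K P Z k p" "proj_mod P" using ses_projective[OF sesD(3)[OF E]] by blast
  obtain W u a v b where W: "ses X W P u b" "ses K W Y v a" by (rule ses_pullback[OF E P(1)]) (rule that)
  have "pdle n W" using pdle_ext[OF W(1) X proj_mod_pdle[OF P(2)]] .
  then have "pdle n K" using pdle_kernel[OF W(2) _ pdle_Suc[OF Y]] by blast
  then show ?thesis using pdle_SucI[OF P] by blast
qed

end

section \<open>Submodules, simple modules and filtrations\<close>

lemma vc_inj: "x \<in> Sp m \<Longrightarrow> y \<in> Sp m \<Longrightarrow> vc m x = vc m y \<Longrightarrow> x = y"
  by (metis pv_vc)

lemma vc_mem: "U \<subseteq> Sp m \<Longrightarrow> x \<in> Sp m \<Longrightarrow> vc m x \<in> vc m ` U \<longleftrightarrow> x \<in> U"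
  using vc_inj by blast

lemma vc_pv_image: "W \<subseteq> carrier_vec m \<Longrightarrow> vc m ` pv ` W = W"
  unfolding image_image by (rule trans[OF image_cong[OF refl] image_ident]) (auto simp: vc_pv)

lemma pv_vc_image: "U \<subseteq> Sp m \<Longrightarrow> pv ` vc m ` U = U"
  unfolding image_image by (rule trans[OF image_cong[OF refl] image_ident]) (auto simp: pv_vc)

lemma pv_image_Sp: "W \<subseteq> carrier_vec m \<Longrightarrow> pv ` W \<subseteq> Sp m"
  by (auto intro!: pv_Sp)

lemma carrier_vec_image: "carrier_vec m = vc m ` Sp m"
  using vc_pv_image[of "carrier_vec m" m] pv_image_Sp[of "carrier_vec m" m] by auto

lemma vc_image_eq: "U \<subseteq> Sp m \<Longrightarrow> W \<subseteq> Sp m \<Longrightarrow> vc m ` U = vc m ` W \<longleftrightarrow> U = W"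
  using pv_vc_image[of U m] pv_vc_image[of W m] by metis

lemma vc_image_subset: "U \<subseteq> Sp m \<Longrightarrow> W \<subseteq> Sp m \<Longrightarrow> vc m ` U \<subseteq> vc m ` W \<Longrightarrow> U \<subseteq> W"
  using image_mono[of "vc m ` U" "vc m ` W" pv] by (simp only: pv_vc_image)

lemma image_inverse_image: "U \<subseteq> j ` B \<Longrightarrow> j ` {x \<in> B. j x \<in> U} = U"
  by auto

lemma zero_vec_image: "{0\<^sub>v m} = vc m ` {0}"
  by (simp add: vc_simps(3))

context fd_algebra
begin

abbreviation vs :: "'k fmod \<Rightarrow> 'k poly set \<Rightarrow> 'k vec set" where
  "vs M U \<equiv> vc (mdim M) ` U"

lemma act_vc: "md M \<Longrightarrow> a \<in> V \<Longrightarrow> act M a *\<^sub>v vc (mdim M) x = vc (mdim M) (ac M a x)"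
  unfolding ac_def by (rule fm_vc[OF mdD(1)])

lemma submod_vs:
  assumes M: "md M" and U: "U \<subseteq> S M"
  shows "submod A M (vs M U) \<longleftrightarrow> smod M U"
proof -
  note mem = vc_mem[OF U]
  have "submod A M (vs M U) \<longleftrightarrow> vc (mdim M) 0 \<in> vs M U \<and>
     (\<forall>u\<in>U. \<forall>v\<in>U. vc (mdim M) (u + v) \<in> vs M U) \<and> (\<forall>u\<in>U. \<forall>c. vc (mdim M) (smult c u) \<in> vs M U) \<and>
     (\<forall>a\<in>V. \<forall>u\<in>U. vc (mdim M) (ac M a u) \<in> vs M U)"
    unfolding submod_def vc_simps ball_simps using act_vc[OF M] by auto
  also have "\<dots> \<longleftrightarrow> smod M U"
  proof -
    have "vc (mdim M) (u + v) \<in> vs M U \<longleftrightarrow> u + v \<in> U" if "u \<in> U" "v \<in> U" for u v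
      using that U by (intro mem) auto
    moreover have "vc (mdim M) (smult c u) \<in> vs M U \<longleftrightarrow> smult c u \<in> U" if "u \<in> U" for u c
      using that U by (intro mem) auto
    moreover have "vc (mdim M) (ac M a u) \<in> vs M U \<longleftrightarrow> ac M a u \<in> U" if "a \<in> V" for a u
      using mdD(2)[OF M that] by (intro mem)
    ultimately show ?thesis using U mem[OF zero_Sp] unfolding smod_def subsp_def by blast
  qed
  finally show ?thesis .
qed

lemma submod_carrier: "submod A M W \<Longrightarrow> W \<subseteq> carrier_vec (mdim M)"
  by (simp add: submod_def)

lemma submod_pv: "md M \<Longrightarrow> submod A M W \<Longrightarrow> smod M (pv ` W)"
  using submod_vs[of M "pv ` W"] pv_image_Sp[OF submod_carrier] vc_pv_image[OF submod_carrier] by simp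

definition simple_mod :: "'k fmod \<Rightarrow> bool" where
  "simple_mod M \<longleftrightarrow> md M \<and> mdim M > 0 \<and> (\<forall>U. smod M U \<longrightarrow> U = {0} \<or> U = S M)"

lemma simple_iff: "simple A M \<longleftrightarrow> simple_mod M"
proof -
  have z: "vs M U = {0\<^sub>v (mdim M)} \<longleftrightarrow> U = {0}" if "U \<subseteq> S M" for U
    unfolding zero_vec_image by (rule vc_image_eq[OF that]) simp
  have f: "vs M U = carrier_vec (mdim M) \<longleftrightarrow> U = S M" if "U \<subseteq> S M" for U
    unfolding carrier_vec_image by (rule vc_image_eq[OF that]) simp
  show ?thesis
  proof
    assume s: "simple A M"
    then have M: "md M" by (simp add: simple_def)
    have "U = {0} \<or> U = S M" if U: "smod M U" for U
      using s submod_vs[OF M smodD(1)[OF U]] U z[OF smodD(1)[OF U]] f[OF smodD(1)[OF U]]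
      unfolding simple_def by blast
    then show "simple_mod M" using s unfolding simple_mod_def simple_def by blast
  next
    assume s: "simple_mod M"
    then have M: "md M" by (simp add: simple_mod_def)
    have "W = {0\<^sub>v (mdim M)} \<or> W = carrier_vec (mdim M)" if W: "submod A M W" for W
    proof -
      have U: "smod M (pv ` W)" using submod_pv[OF M W] .
      then have "pv ` W = {0} \<or> pv ` W = S M" using s unfolding simple_mod_def by blast
      then show ?thesis
        using z[OF smodD(1)[OF U]] f[OF smodD(1)[OF U]] unfolding vc_pv_image[OF submod_carrier[OF W]] by blast
    qed
    then show "simple A M" using s unfolding simple_mod_def simple_def by blast
  qed
qed

section \<open>Isomorphisms and Schur's lemma\<close>

definition isom :: "'k fmod \<Rightarrow> 'k fmod \<Rightarrow> bool" where
  "isom M N \<longleftrightarrow> md M \<and> md N \<and> (\<exists>f\<in>homs M N. inj_on_mod M f \<and> onto M N f)"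

lemma isomI: "md M \<Longrightarrow> md N \<Longrightarrow> f \<in> homs M N \<Longrightarrow> inj_on_mod M f \<Longrightarrow> onto M N f \<Longrightarrow> isom M N"
  unfolding isom_def by blast

lemma isomE:
  assumes "isom M N"
  obtains f g where "f \<in> homs M N" "g \<in> homs N M" "\<And>x. x \<in> S M \<Longrightarrow> g (f x) = x" "\<And>y. y \<in> S N \<Longrightarrow> f (g y) = y"
proof -
  obtain f where f: "md M" "f \<in> homs M N" "inj_on_mod M f" "onto M N f" using assms unfolding isom_def by blast
  obtain g where "g \<in> homs N M" "\<And>x. x \<in> S M \<Longrightarrow> g (f x) = x" "\<And>y. y \<in> S N \<Longrightarrow> f (g y) = y"
    using homs_inverse[OF f] by blast
  then show ?thesis using that f(2) by blast
qed

lemma isom_inverseI: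
  assumes "md M" "md N" "f \<in> homs M N" "g \<in> homs N M" "\<And>x. x \<in> S M \<Longrightarrow> g (f x) = x" "\<And>y. y \<in> S N \<Longrightarrow> f (g y) = y"
  shows "isom M N"
proof (rule isomI[OF assms(1-3)])
  show "inj_on_mod M f" unfolding inj_on_mod_def using assms(5) hmL(3)[OF assms(4)] by metis
  show "onto M N f" unfolding onto_def using assms(6) homs_in[OF assms(4)] by blast
qed

lemma isom_sym: "isom M N \<Longrightarrow> isom N M"
proof -
  assume i: "isom M N"
  obtain f g where "f \<in> homs M N" "g \<in> homs N M" "\<And>x. x \<in> S M \<Longrightarrow> g (f x) = x" "\<And>y. y \<in> S N \<Longrightarrow> f (g y) = y"
    using isomE[OF i] by blast
  then show "isom N M" using isom_inverseI[of N M g f] i unfolding isom_def by blast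
qed

lemma iso_iff: "md M \<Longrightarrow> md N \<Longrightarrow> iso A M N \<longleftrightarrow> isom M N"
proof
  assume m: "md M" "md N" and "iso A M N"
  then obtain f g where fg: "f \<in> hom A M N" "g \<in> hom A N M" "f * g = 1\<^sub>m (mdim N)" "g * f = 1\<^sub>m (mdim M)"
    unfolding iso_def by blast
  note c = hom_carrier[OF fg(1)] hom_carrier[OF fg(2)]
  show "isom M N"
  proof (rule isom_inverseI[OF m fm_homs[OF m fg(1)] fm_homs[OF m(2,1) fg(2)]])
    show "fm g (fm f x) = x" if "x \<in> S M" for x
      using fm_mult[OF c(2,1), of x] fg(4) fm_one[OF that] by simp
    show "fm f (fm g x) = x" if "x \<in> S N" for x
      using fm_mult[OF c(1,2), of x] fg(3) fm_one[OF that] by simp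
  qed
next
  assume m: "md M" "md N" and i: "isom M N"
  obtain f g where fg: "f \<in> homs M N" "g \<in> homs N M" "\<And>x. x \<in> S M \<Longrightarrow> g (f x) = x" "\<And>y. y \<in> S N \<Longrightarrow> f (g y) = y"
    using isomE[OF i] by blast
  let ?f = "mt (mdim N) (mdim M) f" and ?g = "mt (mdim M) (mdim N) g"
  have "?f * ?g = 1\<^sub>m (mdim N)"
    by (subst mult_eq_iff[of _ "mdim M" "mdim N" _ "mdim N"])
      (auto simp: fm_mt_homs[OF fg(1)] fm_mt_homs[OF fg(2)] fg(4) fm_one homs_in[OF fg(2)])
  moreover have "?g * ?f = 1\<^sub>m (mdim M)"
    by (subst mult_eq_iff[of _ "mdim N" "mdim M" _ "mdim M"])
      (auto simp: fm_mt_homs[OF fg(1)] fm_mt_homs[OF fg(2)] fg(3) fm_one homs_in[OF fg(1)])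
  ultimately show "iso A M N" unfolding iso_def using mt_hom[OF m fg(1)] mt_hom[OF m(2,1) fg(2)] by blast
qed

lemma inj_ker: "inj_on_mod M f \<longleftrightarrow> {x \<in> S M. f x = 0} \<subseteq> {0}"
  unfolding inj_on_mod_def by blast

lemma nonzero_inj: "simple_mod M \<Longrightarrow> md N \<Longrightarrow> f \<in> homs M N \<Longrightarrow> x \<in> S M \<Longrightarrow> f x \<noteq> 0 \<Longrightarrow> inj_on_mod M f"
  using smod_ker[of M N f] unfolding simple_mod_def inj_ker by blast

lemma nonzero_onto:
  assumes "md M" "simple_mod N" "f \<in> homs M N" "x \<in> S M" "f x \<noteq> 0"
  shows "onto M N f"
proof -
  have "smod N (f ` S M)" using smod_range[OF assms(1,3) smod_UNIV[OF assms(1)]] .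
  then have "f ` S M = S N" using assms unfolding simple_mod_def by blast
  then show ?thesis unfolding onto_def by (metis imageE)
qed

lemma nonzero_isom: "simple_mod M \<Longrightarrow> simple_mod N \<Longrightarrow> f \<in> homs M N \<Longrightarrow> x \<in> S M \<Longrightarrow> f x \<noteq> 0 \<Longrightarrow> isom M N"
  using nonzero_inj[of M N f x] nonzero_onto[of M N f x] isomI[of M N f] unfolding simple_mod_def by blast

lemma nonzero_element: "mdim M > 0 \<longleftrightarrow> (\<exists>x\<in>S M. x \<noteq> 0)"
proof
  assume "mdim M > 0"
  then show "\<exists>x\<in>S M. x \<noteq> 0" using unit_Sp[of 0 "mdim M"] unit_nonzero[of 0] by blast
next
  assume "\<exists>x\<in>S M. x \<noteq> 0"
  then show "mdim M > 0" by (cases "mdim M") auto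
qed

lemma onto_image: "onto M N f \<longleftrightarrow> S N \<subseteq> f ` S M"
  unfolding onto_def subset_iff image_iff by metis

lemma onto_image_eq: "f \<in> homs M N \<Longrightarrow> onto M N f \<Longrightarrow> f ` S M = S N"
  unfolding onto_image using homs_in by blast

text \<open>\<open>sqiso\<close> wants a matrix on the whole of \<open>M\<close>, although only its
  restriction to the larger submodule has to respect the action. So \<open>g\<close> is extended by
  a linear retraction of \<open>j\<close>, which need not be a homomorphism.
  \<open>sqiso_map\<close> is the way back.\<close>

lemma sqiso_of:
  assumes m: "md M" "md B" "md N" and j: "j \<in> homs B M" "inj_on_mod B j" and g: "g \<in> homs B N" "onto B N g"
  shows "sqiso A M (vs M (j ` {x \<in> S B. g x = 0})) (vs M (j ` S B)) N"
proof -
  obtain r where r: "lin r" "\<And>y. y \<in> S M \<Longrightarrow> r y \<in> S B" "\<And>x. x \<in> S B \<Longrightarrow> r (j x) = x"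
    using lin_retraction[OF homs_lin[OF j(1)], of "mdim B" "mdim M"] homs_in[OF j(1)] j(2)
    unfolding inj_on_mod_def by blast
  let ?F = "mt (mdim N) (mdim M) (\<lambda>x. g (r x))"
  have F: "fm ?F (j x) = g x" if "x \<in> S B" for x
    using fm_mt[OF lin_comp[OF homs_lin[OF g(1)] r(1)], of "mdim M" "mdim N" "j x"]
      homs_in[OF g(1) r(2)] homs_in[OF j(1) that] r(3)[OF that] by simp
  have Fv: "?F *\<^sub>v vc (mdim M) (j x) = vc (mdim N) (g x)" if "x \<in> S B" for x
    using fm_vc[OF mt_carrier, of "mdim N" "mdim M" "\<lambda>x. g (r x)" "j x"] F[OF that] by simp
  have z: "vc (mdim N) (g x) = 0\<^sub>v (mdim N) \<longleftrightarrow> g x = 0" if "x \<in> S B" for x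
    using vc_inj[OF homs_in[OF g(1) that] zero_Sp] by (metis vc_simps(3))
  show ?thesis unfolding sqiso_def
  proof (intro bexI[OF _ mt_carrier] conjI ballI)
    fix a v assume a: "a \<in> V" and v: "v \<in> vs M (j ` S B)"
    then obtain x where x: "x \<in> S B" "v = vc (mdim M) (j x)" by blast
    have "act M a *\<^sub>v v = vc (mdim M) (j (ac B a x))"
      unfolding x(2) act_vc[OF m(1) a] homs_ac[OF j(1) a x(1)] ..
    then have "?F *\<^sub>v (act M a *\<^sub>v v) = vc (mdim N) (ac N a (g x))"
      using Fv[OF mdD(2)[OF m(2) a]] homs_ac[OF g(1) a x(1)] by simp
    then show "?F *\<^sub>v (act M a *\<^sub>v v) = act N a *\<^sub>v (?F *\<^sub>v v)"
      unfolding x(2) Fv[OF x(1)] act_vc[OF m(3) a] .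
  next
    have "(\<lambda>v. ?F *\<^sub>v v) ` vs M (j ` S B) = vs N (g ` S B)"
      unfolding image_image using Fv by (intro image_cong) auto
    moreover have "g ` S B = S N" by (rule onto_image_eq[OF g])
    ultimately show "(\<lambda>v. ?F *\<^sub>v v) ` vs M (j ` S B) = carrier_vec (mdim N)"
      using carrier_vec_image by metis
  next
    show "{v \<in> vs M (j ` S B). ?F *\<^sub>v v = 0\<^sub>v (mdim N)} = vs M (j ` {x \<in> S B. g x = 0})"
      using Fv z by auto
  qed
qed

lemma sqiso_map:
  assumes sq: "sqiso A M (vs M U) (vs M W) N" and U: "U \<subseteq> W"
    and m: "md M" "md B" "md N" and j: "j \<in> homs B M" "j ` S B = W"
  obtains g where "g \<in> homs B N" "onto B N g" "\<And>x. x \<in> S B \<Longrightarrow> g x = 0 \<longleftrightarrow> j x \<in> U"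
proof -
  obtain F where F: "F \<in> carrier_mat (mdim N) (mdim M)"
    and act: "\<forall>a\<in>V. \<forall>v\<in>vs M W. F *\<^sub>v (act M a *\<^sub>v v) = act N a *\<^sub>v (F *\<^sub>v v)"
    and im: "(\<lambda>v. F *\<^sub>v v) ` vs M W = carrier_vec (mdim N)"
    and ker: "{v \<in> vs M W. F *\<^sub>v v = 0\<^sub>v (mdim N)} = vs M U"
    using sq unfolding sqiso_def by (elim bexE conjE) (rule that)
  have Fv: "F *\<^sub>v vc (mdim M) x = vc (mdim N) (fm F x)" for x using fm_vc[OF F] .
  have W: "W \<subseteq> S M" using j homs_in by blast
  have jW: "j x \<in> W" if "x \<in> S B" for x using j(2) that by blast
  let ?g = "\<lambda>x. fm F (j x)"
  have "?g \<in> homs B N"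
  proof (rule hmI)
    show "lin ?g" using lin_comp[OF lin_fm homs_lin[OF j(1)]] .
    show "?g x \<in> S N" for x using fm_Sp[OF F] .
    fix a x assume a: "a \<in> V" and x: "x \<in> S B"
    have "vc (mdim N) (fm F (ac M a (j x))) = vc (mdim N) (ac N a (fm F (j x)))"
      using bspec[OF bspec[OF act a] imageI[OF jW[OF x]]] unfolding act_vc[OF m(1) a] Fv act_vc[OF m(3) a] .
    then show "?g (ac B a x) = ac N a (?g x)"
      using vc_inj[OF fm_Sp[OF F] mdD(2)[OF m(3) a]] homs_ac[OF j(1) a x] by simp
  qed
  moreover have "onto B N ?g" unfolding onto_def
  proof
    fix y assume y: "y \<in> S N"
    then have "vc (mdim N) y \<in> (\<lambda>v. F *\<^sub>v v) ` vs M W" unfolding im by simp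
    then obtain w where w: "w \<in> W" "vc (mdim N) y = vc (mdim N) (fm F w)" using Fv by auto
    then have "fm F w = y" using vc_inj[OF y fm_Sp[OF F]] by simp
    then show "\<exists>x\<in>S B. ?g x = y" using w(1) j(2) by blast
  qed
  moreover have "?g x = 0 \<longleftrightarrow> j x \<in> U" if x: "x \<in> S B" for x
  proof -
    have jx: "j x \<in> S M" using homs_in[OF j(1) x] .
    have "j x \<in> U \<longleftrightarrow> vc (mdim M) (j x) \<in> vs M U" using vc_mem[OF _ jx] U W by blast
    also have "\<dots> \<longleftrightarrow> vc (mdim N) (?g x) = 0\<^sub>v (mdim N)" unfolding ker[symmetric] using Fv jW[OF x] by auto
    also have "\<dots> \<longleftrightarrow> ?g x = 0" using vc_inj[OF fm_Sp[OF F] zero_Sp] by (metis vc_simps(3))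
    finally show ?thesis by simp
  qed
  ultimately show ?thesis using that by blast
qed

section \<open>Filtrations by a class of modules\<close>

lemma filt_md: "filt A C M \<Longrightarrow> md M"
  by (simp add: filt_def)

lemma filt_zero:
  assumes "md M" "mdim M = 0"
  shows "filt A C M"
proof -
  have "carrier_vec 0 = {0\<^sub>v 0 :: 'k vec}" by auto
  then have "subchain A M (carrier_vec (mdim M)) [{0\<^sub>v (mdim M)}]"
    using submod_vs[OF assms(1), of "{0}"] smod_zero[OF assms(1)] assms(2) by (auto simp: subchain_def vc_simps)
  then show ?thesis using assms(1) unfolding filt_def by (intro conjI exI[of _ "[{0\<^sub>v (mdim M)}]"]) auto
qed

lemma filt_step:
  assumes E: "ses X Y Z f g" and X: "filt A C X" and Z: "C Z"
  shows "filt A C Y"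
proof -
  note E' = sesD[OF E]
  obtain us where us: "subchain A X (carrier_vec (mdim X)) us"
    and sq: "\<And>i. Suc i < length us \<Longrightarrow> \<exists>N. md N \<and> C N \<and> sqiso A X (us ! i) (us ! Suc i) N"
    using X unfolding filt_def by blast
  have ne: "us \<noteq> []" and hd: "hd us = {0\<^sub>v (mdim X)}" and last: "last us = carrier_vec (mdim X)"
    and sub: "\<And>i. i < length us \<Longrightarrow> submod A X (us ! i)"
    and inc: "\<And>i. Suc i < length us \<Longrightarrow> us ! i \<subseteq> us ! Suc i"
    using us unfolding subchain_def by auto
  define e where "e W = vs Y (f ` pv ` W)" for W
  \<comment> \<open>The chain of \<open>X\<close> is carried into \<open>Y\<close> along
    \<open>f\<close>, and \<open>Y\<close> itself is added on top.\<close>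
  define vs' where "vs' = map e us @ [carrier_vec (mdim Y)]"
  have e_sub: "submod A Y (e W)" if "submod A X W" for W
  proof -
    have "smod Y (f ` pv ` W)" using smod_range[OF E'(1,4) submod_pv[OF E'(1) that]] .
    then show ?thesis unfolding e_def using submod_vs[OF E'(2) smodD(1)] by blast
  qed
  have e_last: "e (carrier_vec (mdim X)) = vs Y (f ` S X)"
    unfolding e_def carrier_vec_image pv_vc_image[OF order_refl] ..
  have nth1: "vs' ! i = e (us ! i)" if "i < length us" for i using that by (simp add: vs'_def nth_append)
  have nth2: "vs' ! length us = carrier_vec (mdim Y)" by (simp add: vs'_def nth_append)
  have len: "length vs' = Suc (length us)" by (simp add: vs'_def)
  have lst: "vs' ! i = vs Y (f ` S X)" if "Suc i = length us" for i
  proof -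
    have "us ! i = last us" using that ne by (simp add: last_conv_nth flip: that)
    then show ?thesis using nth1[of i] that last e_last by simp
  qed
  have "subchain A Y (carrier_vec (mdim Y)) vs'" unfolding subchain_def
  proof (intro conjI allI impI)
    show "vs' \<noteq> []" "last vs' = carrier_vec (mdim Y)" by (auto simp: vs'_def)
    have "pv (0\<^sub>v (mdim X)) = (0 :: 'k poly)" by (rule pv_simps(3))
    then show "hd vs' = {0\<^sub>v (mdim Y)}"
      using ne hd hmL(3)[OF E'(4)] by (simp add: vs'_def hd_append hd_map e_def vc_simps(3))
    show "submod A Y (vs' ! i)" if "i < length vs'" for i
    proof (cases "i < length us")
      case True
      then show ?thesis using nth1 e_sub sub by simp
    next
      case False
      then have "vs' ! i = vs Y (S Y)" using that len nth2 carrier_vec_image by (metis less_antisym)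
      then show ?thesis using submod_vs[OF E'(2) order_refl] smod_UNIV[OF E'(2)] by simp
    qed
    show "vs' ! i \<subseteq> vs' ! Suc i" if "Suc i < length vs'" for i
    proof (cases "Suc i < length us")
      case True
      then show ?thesis using nth1[of i] nth1[of "Suc i"] inc[OF True] unfolding e_def by (simp add: image_mono)
    next
      case False
      then have "Suc i = length us" using that len by simp
      moreover have "f ` S X \<subseteq> S Y" using homs_in[OF E'(4)] by blast
      ultimately show ?thesis using lst[of i] nth2 by (auto simp del: carrier_vec_dim_vec)
    qed
  qed
  moreover have "\<exists>N. md N \<and> C N \<and> sqiso A Y (vs' ! i) (vs' ! Suc i) N" if "Suc i < length vs'" for i
  proof (cases "Suc i < length us")
    case True
    obtain N where N: "md N" "C N" "sqiso A X (us ! i) (us ! Suc i) N" using sq[OF True] by blast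
    let ?U = "pv ` (us ! i)" and ?W = "pv ` (us ! Suc i)"
    have sU: "submod A X (us ! i)" and sW: "submod A X (us ! Suc i)" using sub True by auto
    have UW: "?U \<subseteq> ?W" using inc[OF True] by blast
    have eq: "vs X ?U = us ! i" "vs X ?W = us ! Suc i"
      using vc_pv_image[OF submod_carrier] sU sW by auto
    obtain B j where B: "md B" "j \<in> homs B X" "inj_on_mod B j" "j ` S B = ?W"
      using realize_sub[OF E'(1) submod_pv[OF E'(1) sW]] by blast
    obtain h where h: "h \<in> homs B N" "onto B N h" "\<And>x. x \<in> S B \<Longrightarrow> h x = 0 \<longleftrightarrow> j x \<in> ?U"
    proof -
      have sq': "sqiso A X (vs X ?U) (vs X ?W) N" using N(3) eq by simp
      show ?thesis by (rule sqiso_map[OF sq' UW E'(1) B(1) N(1) B(2,4)]) (rule that)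
    qed
    have fj: "(\<lambda>x. f (j x)) \<in> homs B Y" using homs_comp[OF B(2) E'(4)] .
    have "inj_on_mod B (\<lambda>x. f (j x))"
      using B(3) E'(11) homs_in[OF B(2)] unfolding inj_on_mod_def by blast
    from sqiso_of[OF E'(2) B(1) N(1) fj this h(1,2)]
    have "sqiso A Y (vs Y (f ` j ` {x \<in> S B. h x = 0})) (vs Y (f ` j ` S B)) N" by (simp only: image_image)
    moreover have "j ` {x \<in> S B. h x = 0} = ?U"
      using image_inverse_image[of ?U j "S B"] UW B(4) h(3) by (simp cong: conj_cong)
    ultimately have "sqiso A Y (vs' ! i) (vs' ! Suc i) N"
      using nth1[of i] nth1[of "Suc i"] True B(4) unfolding e_def by simp
    then show ?thesis using N by blast
  next
    case False
    then have i: "Suc i = length us" using that len by simp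
    have "inj_on_mod Y (\<lambda>x. x)" by (simp add: inj_on_mod_def)
    from sqiso_of[OF E'(2,2,3) homs_id this E'(5,7)]
    have "sqiso A Y (vs Y {x \<in> S Y. g x = 0}) (vs Y (S Y)) Z" by simp
    moreover have "{x \<in> S Y. g x = 0} = f ` S X" using E'(9) homs_in[OF E'(4)] by blast
    ultimately show ?thesis using lst[OF i] nth2 i E'(3) Z carrier_vec_image by metis
  qed
  ultimately show ?thesis using E'(2) unfolding filt_def by blast
qed

text \<open>With \<open>filt_zero\<close> and \<open>filt_step\<close> this turns
  \<open>filt\<close> into an inductive class, generated from zero modules by extensions with a
  member of \<open>C\<close> on top, and hides the chains of submodules.\<close>

lemma filt_induct [consumes 1, case_names zero step]:
  assumes M: "filt A C M" and zero: "\<And>Z. md Z \<Longrightarrow> mdim Z = 0 \<Longrightarrow> P Z"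
    and step: "\<And>X Y Z f g. ses X Y Z f g \<Longrightarrow> filt A C X \<Longrightarrow> C Z \<Longrightarrow> P X \<Longrightarrow> P Y"
  shows "P M"
proof -
  have mM: "md M" using filt_md[OF M] .
  obtain us where us: "subchain A M (carrier_vec (mdim M)) us"
    and sq: "\<And>i. Suc i < length us \<Longrightarrow> \<exists>N. md N \<and> C N \<and> sqiso A M (us ! i) (us ! Suc i) N"
    using M unfolding filt_def by blast
  have ne: "us \<noteq> []" and hd: "hd us = {0\<^sub>v (mdim M)}" and last: "last us = carrier_vec (mdim M)"
    and sub: "\<And>i. i < length us \<Longrightarrow> submod A M (us ! i)"
    and inc: "\<And>i. Suc i < length us \<Longrightarrow> us ! i \<subseteq> us ! Suc i"
    using us unfolding subchain_def by auto
  \<comment> \<open>Proved for every module \<open>B\<close> that realises a term of the chain. The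
    conjunct on \<open>filt\<close> is needed for the premise of \<open>step\<close>; the statement
    for \<open>M\<close> is the last term.\<close>
  have main: "P B \<and> filt A C B"
    if "i < length us" "md B" "j \<in> homs B M" "inj_on_mod B j" "vs M (j ` S B) = us ! i" for i B j
    using that
  proof (induction i arbitrary: B j)
    case 0
    have "vs M (j ` S B) = vs M {0}" using 0(5) hd ne by (simp add: hd_conv_nth vc_simps(3))
    moreover have "j ` S B \<subseteq> S M" using homs_in[OF 0(3)] by blast
    ultimately have "j ` S B = {0}" using vc_image_eq[of "j ` S B" "mdim M" "{0}"] by simp
    then have "j x = 0" if "x \<in> S B" for x using that by blast
    then have "mdim B = 0" using 0(4) nonzero_element[of B] unfolding inj_on_mod_def by blast
    then show ?case using zero filt_zero 0(2) by blast
  next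
    case (Suc i)
    obtain N where N: "md N" "C N" "sqiso A M (us ! i) (us ! Suc i) N" using sq Suc.prems(1) by blast
    let ?U = "pv ` (us ! i)" and ?W = "j ` S B"
    have sU: "submod A M (us ! i)" using sub Suc.prems(1) by auto
    have eq: "vs M ?U = us ! i" using vc_pv_image[OF submod_carrier[OF sU]] .
    have W: "?W \<subseteq> S M" using homs_in[OF Suc.prems(3)] by blast
    have "vs M ?U \<subseteq> vs M ?W" using inc[OF Suc.prems(1)] Suc.prems(5) eq by simp
    then have UW: "?U \<subseteq> ?W" using vc_image_subset[OF smodD(1)[OF submod_pv[OF mM sU]] W] by blast
    obtain g where g: "g \<in> homs B N" "onto B N g" "\<And>x. x \<in> S B \<Longrightarrow> g x = 0 \<longleftrightarrow> j x \<in> ?U"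
    proof -
      have sq': "sqiso A M (vs M ?U) (vs M ?W) N" using N(3) eq Suc.prems(5) by simp
      show ?thesis by (rule sqiso_map[OF sq' UW mM Suc.prems(2) N(1) Suc.prems(3) refl]) (rule that)
    qed
    obtain K k where E: "ses K B N k g" using ses_kernel[OF Suc.prems(2) N(1) g(1,2)] by blast
    note E' = sesD[OF E]
    have inj: "inj_on_mod K (\<lambda>x. j (k x))"
      using Suc.prems(4) E'(11) homs_in[OF E'(4)] unfolding inj_on_mod_def by blast
    have "k ` S K = {x \<in> S B. g x = 0}" using E'(9) homs_in[OF E'(4)] by blast
    moreover have "j ` {x \<in> S B. g x = 0} = ?U"
      using image_inverse_image[OF UW] g(3) by (simp cong: conj_cong)
    ultimately have "vs M ((\<lambda>x. j (k x)) ` S K) = us ! i" using eq by (metis image_image)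
    then have "P K \<and> filt A C K"
      using Suc.IH[OF _ E'(1) homs_comp[OF E'(4) Suc.prems(3)] inj] Suc.prems(1) by simp
    then show ?case using step[OF E] filt_step[OF E] N(2) by blast
  qed
  have "us ! (length us - 1) = vs M ((\<lambda>x. x) ` S M)"
    using last ne carrier_vec_image by (simp add: last_conv_nth)
  moreover have "inj_on_mod M (\<lambda>x. x)" by (simp add: inj_on_mod_def)
  ultimately show ?thesis using main[of "length us - 1" M "\<lambda>x. x"] ne mM homs_id by simp
qed

lemma filt_single: "md M \<Longrightarrow> C M \<Longrightarrow> filt A C M"
proof -
  assume M: "md M" "C M"
  obtain Z where Z: "md Z" "mdim Z = 0" using zero_mod by blast
  have "ses Z M M (\<lambda>x. 0) (\<lambda>x. x)"
    using Z M(1) homs_zero homs_id by (intro sesI) auto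
  then show ?thesis using filt_step filt_zero[OF Z] M(2) by blast
qed

lemma filt_mono: "filt A C M \<Longrightarrow> (\<And>N. C N \<Longrightarrow> D N) \<Longrightarrow> filt A D M"
  unfolding filt_def by metis

lemma ses_dim0_right:
  assumes "ses X Y Z f g" "mdim Z = 0"
  shows "isom X Y"
proof -
  note E = sesD[OF assms(1)]
  have "onto X Y f" unfolding onto_def using E(10) homs_in[OF E(5)] assms(2) by auto
  then show ?thesis using isomI[OF E(1,2,4,6)] by blast
qed

lemma isom_ses_mid:
  assumes E: "ses X Y Z f g" and i: "isom Y Y'"
  obtains f' g' where "ses X Y' Z f' g'"
proof -
  note E' = sesD[OF E]
  obtain a b where ab: "a \<in> homs Y Y'" "b \<in> homs Y' Y" "\<And>x. x \<in> S Y \<Longrightarrow> b (a x) = x" "\<And>y. y \<in> S Y' \<Longrightarrow> a (b y) = y"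
    using isomE[OF i] by blast
  have "ses X Y' Z (\<lambda>x. a (f x)) (\<lambda>y. g (b y))"
  proof (rule sesI[OF E'(1) _ E'(3) homs_comp[OF E'(4) ab(1)] homs_comp[OF ab(2) E'(5)]])
    show "md Y'" using i by (simp add: isom_def)
    show "x = 0" if "x \<in> S X" "a (f x) = 0" for x
      using ab(3)[OF homs_in[OF E'(4) that(1)]] that E'(11) hmL(3)[OF ab(2)] by simp
    show "\<exists>y\<in>S Y'. g (b y) = z" if "z \<in> S Z" for z
      using E'(12)[OF that] ab(3) homs_in[OF ab(1)] by metis
    show "g (b (a (f x))) = 0" if "x \<in> S X" for x
      using ab(3)[OF homs_in[OF E'(4) that]] E'(8)[OF that] by simp
    show "\<exists>x\<in>S X. a (f x) = y" if "y \<in> S Y'" "g (b y) = 0" for y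
      using E'(10)[OF homs_in[OF ab(2) that(1)] that(2)] ab(4)[OF that(1)] by metis
  qed
  then show ?thesis by (rule that)
qed

lemma filt_isom: "filt A C M \<Longrightarrow> isom M N \<Longrightarrow> filt A C N"
proof (induction rule: filt_induct)
  case (zero Z)
  have "mdim N \<le> mdim Z" using zero(3) onto_dim unfolding isom_def by blast
  then show ?case using filt_zero zero unfolding isom_def by simp
next
  case (step X Y Z f g)
  obtain f' g' where "ses X N Z f' g'" by (rule isom_ses_mid[OF step(1,5)]) (rule that)
  then show ?case using filt_step step(2,3) by blast
qed

text \<open>\<open>W\<close> is the preimage in \<open>Y\<close> of the submodule \<open>Z'\<close>
  of \<open>Z\<close>.\<close>

lemma ses_preimage:
  assumes E: "ses X Y Z f g" and F: "ses Z' Z N a b"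
  obtains W u v w where "ses X W Z' u v" "ses W Y N w (\<lambda>y. b (g y))"
proof -
  note E' = sesD[OF E] and F' = sesD[OF F]
  have on: "onto Y N (\<lambda>y. b (g y))" unfolding onto_def using E'(12) F'(12) by metis
  obtain W w where W: "ses W Y N w (\<lambda>y. b (g y))"
    using ses_kernel[OF E'(2) F'(3) homs_comp[OF E'(5) F'(5)] on] by blast
  note W' = sesD[OF W]
  have "b (g (f x)) = 0" if "x \<in> S X" for x using E'(8)[OF that] hmL(3)[OF F'(5)] by simp
  then obtain u where u: "u \<in> homs X W" "\<And>x. x \<in> S X \<Longrightarrow> w (u x) = f x"
    using ses_factor[OF W E'(4,1)] by blast
  obtain v where v: "v \<in> homs W Z'" "\<And>x. x \<in> S W \<Longrightarrow> a (v x) = g (w x)"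
    using ses_factor[OF F homs_comp[OF W'(4) E'(5)] W'(1)] W'(8) by blast
  have "ses X W Z' u v"
  proof (rule sesI[OF E'(1) W'(1) F'(1) u(1) v(1)])
    show "x = 0" if "x \<in> S X" "u x = 0" for x
      using u(2)[OF that(1)] that hmL(3)[OF W'(4)] E'(11) by simp
    show "\<exists>y\<in>S W. v y = z" if z: "z \<in> S Z'" for z
    proof -
      obtain y where y: "y \<in> S Y" "g y = a z" using E'(12)[OF homs_in[OF F'(4) z]] by blast
      then obtain x where x: "x \<in> S W" "w x = y" using W'(10)[OF y(1)] F'(8)[OF z] by auto
      have "a (v x) = a z" using v(2)[OF x(1)] x y by simp
      then show ?thesis using inj_on_modD[OF F'(4,6) homs_in[OF v(1) x(1)] z] x(1) by blast
    qed
    show "v (u x) = 0" if x: "x \<in> S X" for x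
    proof (rule F'(11)[OF homs_in[OF v(1) homs_in[OF u(1) x]]])
      show "a (v (u x)) = 0" using v(2)[OF homs_in[OF u(1) x]] u(2)[OF x] E'(8)[OF x] by simp
    qed
    show "\<exists>x\<in>S X. u x = y" if y: "y \<in> S W" "v y = 0" for y
    proof -
      have "g (w y) = 0" using v(2)[OF y(1)] y(2) hmL(3)[OF F'(4)] by simp
      then obtain x where x: "x \<in> S X" "f x = w y" using E'(10)[OF homs_in[OF W'(4) y(1)]] by blast
      have "w (u x) = w y" using u(2)[OF x(1)] x(2) by simp
      then show ?thesis using inj_on_modD[OF W'(4,6) homs_in[OF u(1) x(1)] y(1)] x(1) by blast
    qed
  qed
  then show ?thesis using that W by blast
qed

text \<open>The filtration of \<open>Z\<close> is lifted step by step: the preimage in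
  \<open>Y\<close> of a term of it is again an extension by \<open>X\<close>, and the subquotients
  stay the same.\<close>

lemma filt_ext:
  assumes "ses X Y Z f g" "filt A C X" "filt A C Z"
  shows "filt A C Y"
  using assms(3,1,2)
proof (induction arbitrary: Y f g rule: filt_induct)
  case (zero Z)
  then show ?case using filt_isom ses_dim0_right by blast
next
  case (step Z' Z N a b)
  obtain W u v w where W: "ses X W Z' u v" "ses W Y N w (\<lambda>y. b (g y))"
    by (rule ses_preimage[OF step(5,1)]) (rule that)
  show ?case using filt_step[OF W(2)] step(4)[OF W(1) step(6)] step(3) by blast
qed

text \<open>For submodules \<open>X\<close> of \<open>Y\<close> of \<open>W\<close>, the quotient
  \<open>Q\<close> of \<open>W\<close> by \<open>X\<close> contains \<open>Z\<close>, the quotient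
  of \<open>Y\<close> by \<open>X\<close>, and the rest of \<open>Q\<close> is
  \<open>N\<close>.\<close>

lemma ses_third_iso:
  assumes E: "ses X Y Z f g" and F: "ses Y W N a b"
  obtains Q q u v where "ses X W Q (\<lambda>x. a (f x)) q" "ses Z Q N u v"
proof -
  note E' = sesD[OF E] and F' = sesD[OF F]
  have inj: "inj_on_mod X (\<lambda>x. a (f x))"
    using E'(11) F'(11) homs_in[OF E'(4)] unfolding inj_on_mod_def by blast
  obtain Q q where Q: "ses X W Q (\<lambda>x. a (f x)) q"
    using ses_cokernel[OF E'(1) F'(2) homs_comp[OF E'(4) F'(4)] inj] by blast
  note Q' = sesD[OF Q]
  obtain u where u: "u \<in> homs Z Q" "\<And>y. y \<in> S Y \<Longrightarrow> u (g y) = q (a y)"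
    using ses_descend[OF E homs_comp[OF F'(4) Q'(5)]] Q'(8) by blast
  have "b (a (f x)) = 0" if "x \<in> S X" for x using F'(8)[OF homs_in[OF E'(4) that]] .
  then obtain v where v: "v \<in> homs Q N" "\<And>y. y \<in> S W \<Longrightarrow> v (q y) = b y"
    using ses_descend[OF Q F'(5)] by blast
  have "ses Z Q N u v"
  proof (rule sesI[OF E'(3) Q'(3) F'(3) u(1) v(1)])
    show "z = 0" if z: "z \<in> S Z" "u z = 0" for z
    proof -
      obtain y where y: "y \<in> S Y" "g y = z" using E'(12)[OF z(1)] by blast
      then have "q (a y) = 0" using u(2)[OF y(1)] z(2) by simp
      then obtain x where x: "x \<in> S X" "a (f x) = a y" using Q'(10)[OF homs_in[OF F'(4) y(1)]] by blast
      then have "f x = y" using inj_on_modD[OF F'(4,6) homs_in[OF E'(4) x(1)] y(1)] by blast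
      then show ?thesis using E'(8)[OF x(1)] y(2) by simp
    qed
    show "\<exists>y\<in>S Q. v y = z" if z: "z \<in> S N" for z
      using F'(12)[OF z] v(2) homs_in[OF Q'(5)] by metis
    show "v (u z) = 0" if z: "z \<in> S Z" for z
    proof -
      obtain y where y: "y \<in> S Y" "g y = z" using E'(12)[OF z] by blast
      then show ?thesis using u(2)[OF y(1)] v(2)[OF homs_in[OF F'(4) y(1)]] F'(8)[OF y(1)] by simp
    qed
    show "\<exists>z\<in>S Z. u z = y" if y: "y \<in> S Q" "v y = 0" for y
    proof -
      obtain w where w: "w \<in> S W" "q w = y" using Q'(12)[OF y(1)] by blast
      then have "b w = 0" using v(2)[OF w(1)] y(2) by simp
      then obtain x where x: "x \<in> S Y" "a x = w" using F'(10)[OF w(1)] by blast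
      then show ?thesis using u(2)[OF x(1)] w(2) homs_in[OF E'(5) x(1)] by blast
    qed
  qed
  then show ?thesis using that Q by blast
qed

end

section \<open>Resolutions\<close>

context fd_algebra
begin

lemma exact_iff:
  assumes m: "md X" "md Y" "md Z" and F: "F \<in> hom A X Y" and G: "G \<in> hom A Y Z"
  shows "img F = kern G \<longleftrightarrow> (\<forall>y\<in>S Y. fm G y = 0 \<longleftrightarrow> y \<in> fm F ` S X)"
proof -
  have sub: "fm F ` S X \<subseteq> S Y" using homs_in[OF fm_homs[OF m(1,2) F]] by blast
  have "img F = kern G \<longleftrightarrow> fm F ` S X = {y \<in> S Y. fm G y = 0}"
    unfolding img_fm[OF hom_carrier[OF F]] kern_fm[OF hom_carrier[OF G]]
    by (rule vc_image_eq[OF sub]) blast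
  also have "\<dots> \<longleftrightarrow> (\<forall>y\<in>S Y. fm G y = 0 \<longleftrightarrow> y \<in> fm F ` S X)" using sub by blast
  finally show ?thesis .
qed

lemma resolution_0_iff:
  assumes M: "md M"
  shows "resolution A C M 0 \<longleftrightarrow> (\<exists>N. md N \<and> C N \<and> isom N M)"
proof
  assume "resolution A C M 0"
  then obtain Ms ds where r: "md (Ms ! 0)" "C (Ms ! 0)" "ds ! 0 \<in> hom A (Ms ! 0) M" "surj_map (ds ! 0)"
    "inj_map (ds ! 0)"
    unfolding resolution_def by auto
  have "isom (Ms ! 0) M"
    using isomI[OF r(1) M fm_homs[OF r(1) M r(3)]] surj_map_iff[OF r(3)] inj_map_iff[OF r(3)] r(4,5) by blast
  then show "\<exists>N. md N \<and> C N \<and> isom N M" using r(1,2) by blast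
next
  assume "\<exists>N. md N \<and> C N \<and> isom N M"
  then obtain N f where N: "md N" "C N" "f \<in> homs N M" "inj_on_mod N f" "onto N M f"
    unfolding isom_def by blast
  let ?F = "mt (mdim M) (mdim N) f"
  show "resolution A C M 0" unfolding resolution_def
    using N mt_hom[OF N(1) M N(3)] mt_onto[OF N(1) M N(3)] mt_inj[OF N(1) M N(3)]
    by (intro exI[of _ "[N]"] exI[of _ "[?F]"]) simp
qed

text \<open>Together with \<open>resolution_SucI\<close>, this replaces the lists of a resolution by
  iterated short exact sequences, the form in which \<open>pdle\<close> is defined.\<close>

lemma resolution_SucD:
  assumes M: "md M" and R: "resolution A C M (Suc l)"
  obtains K N k g where "ses K N M k g" "C N" "resolution A C K l"
proof -
  obtain Ms ds where len: "length Ms = Suc (Suc l)" "length ds = Suc (Suc l)"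
    and Ms: "\<And>i. i \<le> Suc l \<Longrightarrow> md (Ms ! i) \<and> C (Ms ! i)"
    and d0: "ds ! 0 \<in> hom A (Ms ! 0) M" and d: "\<And>i. i < Suc l \<Longrightarrow> ds ! Suc i \<in> hom A (Ms ! Suc i) (Ms ! i)"
    and sj: "surj_map (ds ! 0)" and injective_mod: "inj_map (ds ! Suc l)"
    and ex: "\<And>i. i < Suc l \<Longrightarrow> img (ds ! Suc i) = kern (ds ! i)"
    using R unfolding resolution_def by auto
  have m0: "md (Ms ! 0)" "C (Ms ! 0)" and m1: "md (Ms ! Suc 0)" using Ms[of 0] Ms[of "Suc 0"] by auto
  have d1: "ds ! Suc 0 \<in> hom A (Ms ! Suc 0) (Ms ! 0)" using d[of 0] by simp
  note h0 = fm_homs[OF m0(1) M d0] and h1 = fm_homs[OF m1 m0(1) d1]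
  have on0: "onto (Ms ! 0) M (fm (ds ! 0))" using surj_map_iff[OF d0] sj by blast
  obtain K k where E: "ses K (Ms ! 0) M k (fm (ds ! 0))" using ses_kernel[OF m0(1) M h0 on0] by blast
  note E' = sesD[OF E]
  have ex0: "\<forall>y\<in>S (Ms ! 0). fm (ds ! 0) y = 0 \<longleftrightarrow> y \<in> fm (ds ! Suc 0) ` S (Ms ! Suc 0)"
    using exact_iff[OF m1 m0(1) M d1 d0] ex[of 0] by simp
  have "fm (ds ! 0) (fm (ds ! Suc 0) u) = 0" if "u \<in> S (Ms ! Suc 0)" for u
    using ex0 homs_in[OF h1 that] that by blast
  then obtain e where e: "e \<in> homs (Ms ! Suc 0) K" "\<And>u. u \<in> S (Ms ! Suc 0) \<Longrightarrow> k (e u) = fm (ds ! Suc 0) u"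
    using ses_factor[OF E h1 m1] by blast
  let ?e = "mt (mdim K) (mdim (Ms ! Suc 0)) e"
  have e0: "e u = 0 \<longleftrightarrow> fm (ds ! Suc 0) u = 0" if "u \<in> S (Ms ! Suc 0)" for u
    using e(2)[OF that] hmL(3)[OF E'(4)] E'(11)[OF homs_in[OF e(1) that]] by metis
  have eon: "onto (Ms ! Suc 0) K e" unfolding onto_def
  proof
    fix x assume x: "x \<in> S K"
    have "k x \<in> fm (ds ! Suc 0) ` S (Ms ! Suc 0)" using ex0 E'(8)[OF x] homs_in[OF E'(4) x] by blast
    then obtain u where u: "u \<in> S (Ms ! Suc 0)" "k x = fm (ds ! Suc 0) u" by blast
    have "e u = x" using inj_on_modD[OF E'(4,6) homs_in[OF e(1) u(1)] x] e(2)[OF u(1)] u(2) by simp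
    then show "\<exists>u\<in>S (Ms ! Suc 0). e u = x" using u(1) by blast
  qed
  \<comment> \<open>The augmentation and the first differential are dropped; in place of the latter
    stands \<open>?e\<close>, its corestriction to the kernel \<open>K\<close>, as the new
    augmentation. For \<open>l = 0\<close> it is also the last map, hence the case split for
    injectivity.\<close>
  have "resolution A C K l" unfolding resolution_def
  proof (intro exI[of _ "tl Ms"] exI[of _ "?e # drop 2 ds"] conjI allI impI)
    have n: "tl Ms ! i = Ms ! Suc i" if "i \<le> l" for i using that len(1) by (simp add: nth_tl)
    have nd: "(?e # drop 2 ds) ! Suc i = ds ! Suc (Suc i)" for i using len(2) by simp
    have eh: "?e \<in> hom A (Ms ! Suc 0) K" using mt_hom[OF m1 E'(1) e(1)] .
    show "length (tl Ms) = Suc l" "length (?e # drop 2 ds) = Suc l" using len by auto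
    show "md (tl Ms ! i)" "C (tl Ms ! i)" if "i \<le> l" for i using n[OF that] Ms[of "Suc i"] that by auto
    show "(?e # drop 2 ds) ! 0 \<in> hom A (tl Ms ! 0) K" using eh n[of 0] by simp
    show "(?e # drop 2 ds) ! Suc i \<in> hom A (tl Ms ! Suc i) (tl Ms ! i)" if "i < l" for i
      using d[of "Suc i"] that n[of i] n[of "Suc i"] nd by simp
    show "surj_map ((?e # drop 2 ds) ! 0)" using mt_onto[OF m1 E'(1) e(1)] eon by simp
    show "inj_map ((?e # drop 2 ds) ! l)"
    proof (cases l)
      case 0
      have "inj_on_mod (Ms ! Suc 0) e" using inj_map_iff[OF d1] injective_mod 0 e0 unfolding inj_on_mod_def by simp
      then show ?thesis using mt_inj[OF m1 E'(1) e(1)] 0 by simp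
    next
      case (Suc l')
      then show ?thesis using injective_mod nd by simp
    qed
    show "img ((?e # drop 2 ds) ! Suc i) = kern ((?e # drop 2 ds) ! i)" if i: "i < l" for i
    proof (cases i)
      case 0
      have m2: "md (Ms ! Suc (Suc 0))" using Ms[of "Suc (Suc 0)"] i 0 by simp
      have d2: "ds ! Suc (Suc 0) \<in> hom A (Ms ! Suc (Suc 0)) (Ms ! Suc 0)" using d[of "Suc 0"] i 0 by simp
      have "\<forall>y\<in>S (Ms ! Suc 0). fm (ds ! Suc 0) y = 0 \<longleftrightarrow> y \<in> fm (ds ! Suc (Suc 0)) ` S (Ms ! Suc (Suc 0))"
        using exact_iff[OF m2 m1 m0(1) d2 d1] ex[of "Suc 0"] i 0 by simp
      then have "img (ds ! Suc (Suc 0)) = kern ?e"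
        unfolding exact_iff[OF m2 m1 E'(1) d2 eh] using fm_mt_homs[OF e(1)] e0 by simp
      then show ?thesis using nd[of 0] 0 by simp
    next
      case (Suc i')
      then show ?thesis using ex[of "Suc (Suc i')"] nd i by simp
    qed
  qed
  then show ?thesis using that E m0(2) by blast
qed

lemma resolution_SucI:
  assumes E: "ses K N M k g" and C: "C N" and R: "resolution A C K l"
  shows "resolution A C M (Suc l)"
proof -
  note E' = sesD[OF E]
  obtain Ms ds where len: "length Ms = Suc l" "length ds = Suc l"
    and Ms: "\<And>i. i \<le> l \<Longrightarrow> md (Ms ! i) \<and> C (Ms ! i)"
    and d0: "ds ! 0 \<in> hom A (Ms ! 0) K" and d: "\<And>i. i < l \<Longrightarrow> ds ! Suc i \<in> hom A (Ms ! Suc i) (Ms ! i)"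
    and sj: "surj_map (ds ! 0)" and injective_mod: "inj_map (ds ! l)"
    and ex: "\<And>i. i < l \<Longrightarrow> img (ds ! Suc i) = kern (ds ! i)"
    using R unfolding resolution_def by auto
  have m0: "md (Ms ! 0)" using Ms[of 0] by auto
  note h0 = fm_homs[OF m0 E'(1) d0]
  let ?e = "\<lambda>x. k (fm (ds ! 0) x)"
  let ?E = "mt (mdim N) (mdim (Ms ! 0)) ?e" and ?G = "mt (mdim M) (mdim N) g"
  have eh: "?e \<in> homs (Ms ! 0) N" using homs_comp[OF h0 E'(4)] .
  have e0: "?e u = 0 \<longleftrightarrow> fm (ds ! 0) u = 0" if "u \<in> S (Ms ! 0)" for u
    using hmL(3)[OF E'(4)] E'(11)[OF homs_in[OF h0 that]] by metis
  have Eh: "?E \<in> hom A (Ms ! 0) N" and Gh: "?G \<in> hom A N M"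
    using mt_hom[OF m0 E'(2) eh] mt_hom[OF E'(2,3,5)] .
  \<comment> \<open>Splicing: the old augmentation is followed by the embedding of \<open>K\<close>
    to become the first differential, and \<open>?G\<close> is the new augmentation.\<close>
  let ?ds = "?G # ?E # tl ds"
  have nd: "?ds ! Suc (Suc i) = ds ! Suc i" if "i < l" for i using that len(2) by (simp add: nth_tl)
  show ?thesis unfolding resolution_def
  proof (intro exI[of _ "N # Ms"] exI[of _ ?ds] conjI allI impI)
    show "length (N # Ms) = Suc (Suc l)" "length ?ds = Suc (Suc l)" using len by auto
    show "md ((N # Ms) ! i)" "C ((N # Ms) ! i)" if "i \<le> Suc l" for i
      using that Ms E'(2) C by (cases i; simp)+
    show "?ds ! 0 \<in> hom A ((N # Ms) ! 0) M" using Gh by simp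
    show "?ds ! Suc i \<in> hom A ((N # Ms) ! Suc i) ((N # Ms) ! i)" if "i < Suc l" for i
      using that Eh d nd by (cases i) simp_all
    show "surj_map (?ds ! 0)" using mt_onto[OF E'(2,3,5)] E'(7) by simp
    show "inj_map (?ds ! Suc l)"
    proof (cases l)
      case 0
      have "inj_on_mod (Ms ! 0) ?e" using inj_map_iff[OF d0] injective_mod 0 e0 unfolding inj_on_mod_def by simp
      then show ?thesis using mt_inj[OF m0 E'(2) eh] 0 by simp
    next
      case (Suc l')
      then show ?thesis using injective_mod nd[of l'] by simp
    qed
    show "img (?ds ! Suc i) = kern (?ds ! i)" if i: "i < Suc l" for i
    proof (cases i)
      case 0
      have "fm (ds ! 0) ` S (Ms ! 0) = S K"
        using onto_image_eq[OF h0] surj_map_iff[OF d0] sj by blast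
      then have im: "?e ` S (Ms ! 0) = k ` S K" by (metis image_image)
      have "fm ?E ` S (Ms ! 0) = ?e ` S (Ms ! 0)" using fm_mt_homs[OF eh] by (intro image_cong) auto
      then have "img ?E = kern ?G"
        unfolding exact_iff[OF m0 E'(2,3) Eh Gh] using im fm_mt_homs[OF E'(5)] E'(9) by simp
      then show ?thesis using 0 by simp
    next
      case (Suc i')
      note i' = Suc
      show ?thesis
      proof (cases i')
        case 0
        have m1: "md (Ms ! Suc 0)" using Ms[of "Suc 0"] i i' 0 by simp
        have d1: "ds ! Suc 0 \<in> hom A (Ms ! Suc 0) (Ms ! 0)" using d[of 0] i i' 0 by simp
        have "\<forall>y\<in>S (Ms ! 0). fm (ds ! 0) y = 0 \<longleftrightarrow> y \<in> fm (ds ! Suc 0) ` S (Ms ! Suc 0)"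
          using exact_iff[OF m1 m0 E'(1) d1 d0] ex[of 0] i i' 0 by simp
        then have "img (ds ! Suc 0) = kern ?E"
          unfolding exact_iff[OF m1 m0 E'(2) d1 Eh] using fm_mt_homs[OF eh] e0 by simp
        then show ?thesis using nd[of 0] i i' 0 by simp
      next
        case (Suc i'')
        then show ?thesis using ex[of "Suc i''"] nd[of i''] nd[of i'] i i' by simp
      qed
    qed
  qed
qed

lemma isom_retract:
  assumes "isom M N"
  shows "retract N M"
proof -
  obtain f g where "f \<in> homs M N" "g \<in> homs N M" "\<And>x. x \<in> S M \<Longrightarrow> g (f x) = x" "\<And>y. y \<in> S N \<Longrightarrow> f (g y) = y"
    by (rule isomE[OF assms]) (rule that)
  then show ?thesis using assms unfolding retract_def isom_def by blast
qed

lemma pdle_isom: "isom M N \<Longrightarrow> pdle n M \<Longrightarrow> pdle n N"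
  using pdle_retract isom_retract by blast

text \<open>The bound starts at \<open>t\<close> for a resolution of length 0 and grows by one with
  each syzygy, through \<open>pdle_cokernel\<close>.\<close>

lemma resolution_pdle:
  assumes C: "\<And>X. md X \<Longrightarrow> C X \<Longrightarrow> pdle t X"
  shows "md M \<Longrightarrow> resolution A C M d \<Longrightarrow> pdle (d + t) M"
proof (induction d arbitrary: M)
  case 0
  then show ?case using resolution_0_iff[OF 0(1)] C pdle_isom by auto
next
  case (Suc d)
  obtain K N k g where K: "ses K N M k g" "C N" "resolution A C K d"
    by (rule resolution_SucD[OF Suc.prems]) (rule that)
  note K' = sesD[OF K(1)]
  have "pdle (d + t) N" using pdle_mono[OF le_add2 C[OF K'(2) K(2)]] .
  then show ?case using pdle_cokernel[OF K(1) Suc.IH[OF K'(1) K(3)]] by simp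
qed

lemma pdle_resolution: "pdle n M \<Longrightarrow> resolution A (projective A) M n"
proof (induction n arbitrary: M)
  case 0
  then have "md M" "isom M M" "projective A M"
    using proj_mod_md isomI[of M M "\<lambda>x. x"] homs_id projective_iff by (auto simp: inj_on_mod_def onto_def)
  then show ?case using resolution_0_iff by blast
next
  case (Suc n)
  then obtain K P k g where P: "ses K P M k g" "proj_mod P" "pdle n K" by auto
  have "projective A P" using projective_iff P(2) by blast
  then show ?case using resolution_SucI[OF P(1) _ Suc.IH[OF P(3)]] by blast
qed

section \<open>Projective covers\<close>

definition pcover :: "'k fmod \<Rightarrow> ('k poly \<Rightarrow> 'k poly) \<Rightarrow> 'k fmod \<Rightarrow> bool" where
  "pcover P p L \<longleftrightarrow> proj_mod P \<and> md L \<and> p \<in> homs P L \<and> onto P L p \<and> (\<forall>U. smod P U \<and> S L \<subseteq> p ` U \<longrightarrow> U = S P)"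

lemma pcD:
  assumes "pcover P p L"
  shows "proj_mod P" "md P" "md L" "p \<in> homs P L" "onto P L p" "smod P U \<Longrightarrow> S L \<subseteq> p ` U \<Longrightarrow> U = S P"
  using assms proj_mod_md unfolding pcover_def by auto

lemma superfluous_iff:
  assumes m: "md P" "md L" and F: "F \<in> hom A P L" "onto P L (fm F)" and U: "U \<subseteq> S P"
  shows "(\<forall>v\<in>carrier_vec (mdim P). \<exists>x\<in>vs P U. \<exists>y\<in>kern F. v = x + y) \<longleftrightarrow> S L \<subseteq> fm F ` U"
proof
  note k = kern_fm[OF hom_carrier[OF F(1)]]
  note L = linD[OF lin_fm[of F]]
  {
    assume *: "\<forall>v\<in>carrier_vec (mdim P). \<exists>x\<in>vs P U. \<exists>y\<in>kern F. v = x + y"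
    show "S L \<subseteq> fm F ` U"
    proof
      fix z assume "z \<in> S L"
      then obtain v where v: "v \<in> S P" "fm F v = z" using F(2) unfolding onto_def by blast
      obtain x y where xy: "x \<in> U" "y \<in> S P" "fm F y = 0" "vc (mdim P) v = vc (mdim P) x + vc (mdim P) y"
        using *[rule_format, of "vc (mdim P) v"] unfolding k by auto
      have "vc (mdim P) v = vc (mdim P) (x + y)" using xy(4) by (simp only: vc_simps)
      moreover have "x + y \<in> S P" using xy(1,2) U by blast
      ultimately have "v = x + y" using vc_inj[OF v(1)] by blast
      then have "fm F x = z" using v(2) xy(3) by (simp add: L)
      then show "z \<in> fm F ` U" using xy(1) by blast
    qed
  next
    assume *: "S L \<subseteq> fm F ` U"
    show "\<forall>v\<in>carrier_vec (mdim P). \<exists>x\<in>vs P U. \<exists>y\<in>kern F. v = x + y"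
    proof
      fix v :: "'k vec" assume "v \<in> carrier_vec (mdim P)"
      then obtain w where w: "w \<in> S P" "v = vc (mdim P) w" using carrier_vec_pv by blast
      have "fm F w \<in> S L" using homs_in[OF fm_homs[OF m F(1)] w(1)] .
      then obtain u where u: "u \<in> U" "fm F w = fm F u" using * by blast
      have "w - u \<in> S P" "fm F (w - u) = 0" using w(1) u U by (auto simp: L)
      then have "vc (mdim P) (w - u) \<in> kern F" unfolding k by blast
      moreover have "v = vc (mdim P) u + vc (mdim P) (w - u)" unfolding w(2) vc_simps(1)[symmetric] by simp
      ultimately show "\<exists>x\<in>vs P U. \<exists>y\<in>kern F. v = x + y" using u(1) by blast
    qed
  }
qed

lemma pcover_fm:
  assumes "proj_cover A P \<pi> L"
  shows "pcover P (fm \<pi>) L"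
proof -
  have P: "proj_mod P" "md L" "\<pi> \<in> hom A P L" "surj_map \<pi>"
    and sup: "\<And>W. submod A P W \<Longrightarrow> \<forall>v\<in>carrier_vec (mdim P). \<exists>x\<in>W. \<exists>y\<in>kern \<pi>. v = x + y \<Longrightarrow>
      W = carrier_vec (mdim P)"
    using assms projective_iff unfolding proj_cover_def by auto
  note mP = proj_mod_md[OF P(1)]
  have on: "onto P L (fm \<pi>)" using surj_map_iff[OF P(3)] P(4) by blast
  have "U = S P" if U: "smod P U" "S L \<subseteq> fm \<pi> ` U" for U
  proof -
    note US = smodD(1)[OF U(1)]
    have "vs P U = carrier_vec (mdim P)"
      using sup[of "vs P U"] submod_vs[OF mP US] U superfluous_iff[OF mP P(2,3) on US] by blast
    then show ?thesis using vc_image_eq[OF US order_refl] carrier_vec_image by metis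
  qed
  then show ?thesis unfolding pcover_def using P(1,2) fm_homs[OF mP P(2,3)] on by blast
qed

lemma pcover_mt:
  assumes "pcover P p L"
  shows "proj_cover A P (mt (mdim L) (mdim P) p) L"
proof -
  note P = pcD[OF assms]
  let ?F = "mt (mdim L) (mdim P) p"
  note F = mt_hom[OF P(2,3,4)]
  have on: "onto P L (fm ?F)" using mt_onto[OF P(2,3,4)] P(5) surj_map_iff[OF F] by blast
  have im: "fm ?F ` U = p ` U" if "U \<subseteq> S P" for U using that fm_mt_homs[OF P(4)] by (intro image_cong) auto
  have "W = carrier_vec (mdim P)"
    if W: "submod A P W" "\<forall>v\<in>carrier_vec (mdim P). \<exists>x\<in>W. \<exists>y\<in>kern ?F. v = x + y" for W
  proof -
    have eq: "vs P (pv ` W) = W" using vc_pv_image[OF submod_carrier[OF W(1)]] .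
    have sU: "smod P (pv ` W)" using submod_pv[OF P(2) W(1)] .
    note US = smodD(1)[OF sU]
    have "S L \<subseteq> p ` pv ` W"
      using superfluous_iff[OF P(2,3) F on US] W(2) unfolding eq im[OF US] by blast
    then have "pv ` W = S P" using P(6)[OF sU] by blast
    then show ?thesis using eq carrier_vec_image by metis
  qed
  then show ?thesis unfolding proj_cover_def
    using P projective_iff F mt_onto[OF P(2,3,4)] by blast
qed

text \<open>Among all factorisations of endomorphisms of \<open>P\<close> over \<open>L\<close> choose one through a module \<open>W\<close> of least
  dimension. By minimality \<open>c j\<close> is bijective, so \<open>W\<close> is a direct summand of \<open>P\<close>.\<close>

lemma ex_pcover:
  assumes L: "md L"
  obtains P p where "pcover P p L"
proof -
  obtain P p where P: "proj_mod P" "p \<in> homs P L" "onto P L p" using enough_projectives[OF L] by blast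
  note mP = proj_mod_md[OF P(1)]
  define T where "T W j c \<longleftrightarrow> md W \<and> j \<in> homs W P \<and> c \<in> homs P W \<and> (\<forall>x\<in>S P. p (j (c x)) = p x)" for W j c
  define R where "R n \<longleftrightarrow> (\<exists>W j c. T W j c \<and> mdim W = n)" for n
  have "T P (\<lambda>x. x) (\<lambda>x. x)" unfolding T_def using mP homs_id by blast
  then have "R (mdim P)" unfolding R_def by blast
  then have "R (LEAST n. R n)" by (rule LeastI)
  then obtain W j c where T: "T W j c" and least: "mdim W = (LEAST n. R n)" unfolding R_def by blast
  have min: "mdim W \<le> mdim W'" if "T W' j' c'" for W' j' c'
    unfolding least by (rule Least_le) (use that in \<open>auto simp: R_def\<close>)
  have W: "md W" "j \<in> homs W P" "c \<in> homs P W" and e: "\<And>x. x \<in> S P \<Longrightarrow> p (j (c x)) = p x" using T unfolding T_def by auto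
  note cj = homs_comp[OF W(2,3)]
  \<comment> \<open>The square of the endomorphism \<open>j c\<close> is again over \<open>L\<close>
    and factors through the image \<open>W'\<close> of \<open>c j\<close>. Minimality gives equal
    dimensions, so \<open>c j\<close> is onto.\<close>
  obtain W' i where W': "md W'" "i \<in> homs W' W" "inj_on_mod W' i" "i ` S W' = (\<lambda>x. c (j x)) ` S W"
    using realize_sub[OF W(1) smod_range[OF W(1) cj smod_UNIV[OF W(1)]]] by blast
  have "c (j (c x)) \<in> i ` S W'" if "x \<in> S P" for x
    unfolding W'(4) using homs_in[OF W(3) that] by blast
  then obtain c' where c': "c' \<in> homs P W'" "\<And>x. x \<in> S P \<Longrightarrow> i (c' x) = c (j (c x))"
    using corestrict[OF homs_comp[OF W(3) cj] W'(2,3) mP W'(1)] by blast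
  have "p (j (i (c' x))) = p x" if x: "x \<in> S P" for x
    using c'(2)[OF x] e[OF homs_in[OF W(2) homs_in[OF W(3) x]]] e[OF x] by simp
  then have "T W' (\<lambda>x. j (i x)) c'" unfolding T_def using W'(1) homs_comp[OF W'(2) W(2)] c'(1) by blast
  then have "mdim W' = mdim W" using min inj_dim[OF W'(2,3)] by (metis order_antisym)
  then have "i ` S W' = S W" using onto_image_eq[OF W'(2) inj_eq_dim_onto[OF W'(2,3)]] by blast
  then have on: "onto W W (\<lambda>x. c (j x))" unfolding onto_image W'(4) by simp
  obtain t where t: "t \<in> homs W W" "\<And>x. x \<in> S W \<Longrightarrow> t (c (j x)) = x"
    "\<And>y. y \<in> S W \<Longrightarrow> c (j (t y)) = y"
    using homs_inverse[OF W(1) cj onto_eq_dim_inj[OF cj on refl] on] by blast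
  have pW: "proj_mod W" using proj_mod_retract[OF P(1) W(1,2) homs_comp[OF W(3) t(1)] t(2)] .
  let ?q = "\<lambda>x. p (j x)"
  note q = homs_comp[OF W(2) P(2)]
  have "\<exists>x\<in>S W. ?q x = y" if y: "y \<in> S L" for y
  proof -
    obtain x where x: "x \<in> S P" "p x = y" using P(3) y unfolding onto_def by blast
    then show ?thesis using e[OF x(1)] homs_in[OF W(3) x(1)] by blast
  qed
  then have qon: "onto W L ?q" unfolding onto_def by blast
  have "U = S W" if U: "smod W U" "S L \<subseteq> ?q ` U" for U
  proof -
    obtain B u where B: "md B" "u \<in> homs B W" "inj_on_mod B u" "u ` S B = U" using realize_sub[OF W(1) U(1)] by blast
    note uq = homs_comp[OF B(2) q]
    have "(\<lambda>x. ?q (u x)) ` S B = ?q ` U" using B(4) by (metis image_image)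
    then have "onto B L (\<lambda>x. ?q (u x))" using U(2) unfolding onto_image by simp
    \<comment> \<open>If \<open>B\<close> still maps onto \<open>L\<close>, the cover of
      \<open>L\<close> by \<open>P\<close> lifts to \<open>B\<close>. This gives a factorisation
      over \<open>L\<close> through \<open>B\<close>, so \<open>B\<close> cannot be smaller than
      \<open>W\<close>.\<close>
    then obtain h where h: "h \<in> homs P B" "\<And>x. x \<in> S P \<Longrightarrow> ?q (u (h x)) = p x"
      using proj_mod_lift[OF P(1) B(1) L uq _ P(2)] by blast
    have "T B (\<lambda>x. j (u x)) h" unfolding T_def using B(1) homs_comp[OF B(2) W(2)] h by blast
    then have "mdim B = mdim W" using min inj_dim[OF B(2,3)] by (metis order_antisym)
    then show ?thesis using onto_image_eq[OF B(2) inj_eq_dim_onto[OF B(2,3)]] B(4) by simp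
  qed
  then have "pcover W ?q L" unfolding pcover_def using pW L q qon by blast
  then show ?thesis by (rule that)
qed

end

section \<open>Injective envelopes\<close>

context fd_algebra
begin

definition injective_mod :: "'k fmod \<Rightarrow> bool" where
  "injective_mod I \<longleftrightarrow> md I \<and> (\<forall>X Y g f. md X \<longrightarrow> md Y \<longrightarrow> g \<in> homs X Y \<longrightarrow> inj_on_mod X g \<longrightarrow> f \<in> homs X I \<longrightarrow>
     (\<exists>h\<in>homs Y I. \<forall>x\<in>S X. h (g x) = f x))"

lemma injective_mod_md: "injective_mod I \<Longrightarrow> md I"
  by (simp add: injective_mod_def)

lemma injective_mod_extend:
  assumes "injective_mod I" "md X" "md Y" "g \<in> homs X Y" "inj_on_mod X g" "f \<in> homs X I"
  obtains h where "h \<in> homs Y I" "\<And>x. x \<in> S X \<Longrightarrow> h (g x) = f x"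
  using assms unfolding injective_mod_def by blast

lemma injective_if_injective_mod:
  assumes I: "injective_mod I"
  shows "injective A I"
  unfolding injective_def
proof (intro conjI injective_mod_md[OF I] allI impI)
  note mI = injective_mod_md[OF I]
  fix X Y g f assume *: "md X \<and> md Y \<and> g \<in> hom A X Y \<and> inj_map g \<and> f \<in> hom A X I"
  then have g: "fm g \<in> homs X Y" "inj_on_mod X (fm g)" and f: "fm f \<in> homs X I"
    using fm_homs inj_map_iff mI by auto
  then obtain h where h: "h \<in> homs Y I" "\<And>x. x \<in> S X \<Longrightarrow> h (fm g x) = fm f x"
    using injective_mod_extend[OF I _ _ g f] * by blast
  let ?h = "mt (mdim I) (mdim Y) h"
  have "?h \<in> hom A Y I" using mt_hom h(1) * mI by blast
  moreover have "?h * g = f"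
    using h(2) fm_mt_homs[OF h(1)] * hom_carrier homs_in[OF g(1)]
    by (subst mult_eq_iff[of _ "mdim Y" "mdim X" _ "mdim I"]) auto
  ultimately show "\<exists>h\<in>hom A Y I. h * g = f" by blast
qed

lemma injective_mod_retract:
  assumes Y: "injective_mod Y" and X: "md X" "i \<in> homs X Y" "r \<in> homs Y X" "\<And>x. x \<in> S X \<Longrightarrow> r (i x) = x"
  shows "injective_mod X"
  unfolding injective_mod_def
proof (intro conjI X(1) allI impI)
  fix M N g f assume *: "md M" "md N" "g \<in> homs M N" "inj_on_mod M g" "f \<in> homs M X"
  obtain h where h: "h \<in> homs N Y" "\<And>x. x \<in> S M \<Longrightarrow> h (g x) = i (f x)"
    using injective_mod_extend[OF Y *(1-4) homs_comp[OF *(5) X(2)]] by blast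
  have "r (h (g x)) = f x" if "x \<in> S M" for x
    using h(2)[OF that] X(4)[OF homs_in[OF *(5) that]] by simp
  then show "\<exists>h\<in>homs N X. \<forall>x\<in>S M. h (g x) = f x" by (intro bexI[OF _ homs_comp[OF h(1) X(3)]] ballI)
qed

section \<open>The dual of the regular module\<close>

definition pair :: "'k poly \<Rightarrow> 'k vec \<Rightarrow> 'k" where
  "pair x b = (\<Sum>j<adim A. coeff x j * b $ j)"

text \<open>Functionals on A are stored by their values on the unit vectors, as elements of
  \<open>Sp (adim A)\<close>. \<open>pair\<close> evaluates such an element at a vector, and on
  functionals \<open>rep\<close> is inverse to it by \<open>pair_rep\<close> and
  \<open>pair_eqI\<close>.\<close>

definition rep :: "('k vec \<Rightarrow> 'k) \<Rightarrow> 'k poly" where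
  "rep \<phi> = (\<Sum>j<adim A. monom (\<phi> (unit_vec (adim A) j)) j)"

definition functional :: "('k vec \<Rightarrow> 'k) \<Rightarrow> bool" where
  "functional \<phi> \<longleftrightarrow> (\<forall>b\<in>V. \<forall>c\<in>V. \<phi> (b + c) = \<phi> b + \<phi> c) \<and> (\<forall>b\<in>V. \<forall>s. \<phi> (s \<cdot>\<^sub>v b) = s * \<phi> b)"

lemma coeff_rep: "coeff (rep \<phi>) i = (if i < adim A then \<phi> (unit_vec (adim A) i) else 0)"
  by (simp add: rep_def coeff_sum)

lemma rep_Sp: "rep \<phi> \<in> Sp (adim A)"
  by (auto simp: Sp_def coeff_rep)

lemma pair_rep:
  assumes \<phi>: "functional \<phi>" and b: "b \<in> V"
  shows "pair (rep \<phi>) b = \<phi> b"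
proof -
  \<comment> \<open>Scalars are viewed as constant polynomials so that the expansion of linear maps
    in unit vectors applies.\<close>
  let ?d = "adim A" and ?f = "\<lambda>y. monom (\<phi> (vc (adim A) y)) 0"
  have l: "lin ?f"
    using \<phi> by (intro linI) (auto simp: vc_simps functional_def add_monom smult_monom)
  have u: "vc ?d (unit i) = unit_vec ?d i" if "i < ?d" for i using that by (intro eq_vecI) auto
  have "?f (pv b) = lincomb ?d (\<lambda>i. ?f (unit i)) (pv b)"
    using b by (intro lin_eq_lincomb[OF l] pv_Sp) simp
  then have "coeff (?f (pv b)) 0 = (\<Sum>i<?d. coeff (pv b) i * \<phi> (vc ?d (unit i)))"
    by (simp add: lincomb_def coeff_sum)
  then have "\<phi> b = (\<Sum>i<?d. coeff (pv b) i * \<phi> (vc ?d (unit i)))" using b by (simp add: vc_pv)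
  also have "\<dots> = (\<Sum>i<?d. coeff (rep \<phi>) i * b $ i)"
    using b by (intro sum.cong refl) (simp add: coeff_pv coeff_rep u mult.commute)
  finally show ?thesis by (simp add: pair_def)
qed

lemma pair_eqI:
  assumes "x \<in> Sp (adim A)" "y \<in> Sp (adim A)" "\<And>b. b \<in> V \<Longrightarrow> pair x b = pair y b"
  shows "x = y"
proof (rule poly_eqI)
  fix i
  have p: "pair z (unit_vec (adim A) i) = coeff z i" if "i < adim A" for z
  proof -
    have "pair z (unit_vec (adim A) i) = (\<Sum>j<adim A. if j = i then coeff z j else 0)"
      unfolding pair_def using that by (intro sum.cong) auto
    then show ?thesis using that by simp
  qed
  show "coeff x i = coeff y i"
    using p[of x] p[of y] assms by (cases "i < adim A") (auto simp: Sp_def)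
qed

lemma pair_functional: "functional (pair x)"
  by (auto simp: functional_def pair_def algebra_simps sum.distrib sum_distrib_left)

lemma pair_add: "pair (x + y) b = pair x b + pair y b" "pair (smult c x) b = c * pair x b"
  by (auto simp: pair_def algebra_simps sum.distrib sum_distrib_left)

lemma functional_mult: "a \<in> V \<Longrightarrow> functional (\<lambda>b. pair x (amul A b a))"
  using pair_functional[of x] algD(2) unfolding functional_def by (auto simp: algD(3,5))

text \<open>\<open>J\<close> is Hom_k(A, k) with the action \<open>(a x)(b) = x(b a)\<close>:
  multiplication on the right of A becomes an action from the left on its dual.\<close>

lemma ex_dual_regular:
  obtains J where "md J" "mdim J = adim A"
    "\<forall>a\<in>V. \<forall>b\<in>V. \<forall>x\<in>S J. pair (ac J a x) b = pair x (amul A b a)"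
proof -
  let ?r = "\<lambda>a x. rep (\<lambda>b. pair x (amul A b a))"
  have p: "pair (?r a x) b = pair x (amul A b a)" if "a \<in> V" "b \<in> V" for a b x
    using pair_rep[OF functional_mult[OF that(1)] that(2)] .
  have "\<exists>N. md N \<and> mdim N = adim A \<and> (\<forall>a\<in>V. \<forall>x\<in>S N. ac N a x = ?r a x)"
  proof (rule ex_mod)
    fix a b :: "'k vec" and x c assume a: "a \<in> V"
    show "lin (?r a)" by (intro linI poly_eqI) (simp_all add: coeff_rep pair_add)
    show "?r a x \<in> Sp (adim A)" by (rule rep_Sp)
    show "?r (c \<cdot>\<^sub>v a) x = smult c (?r a x)"
      by (rule pair_eqI) (use a algD(2) pair_functional[of x] in
        \<open>auto simp: rep_Sp p pair_add algD(6) functional_def intro: Sp_closed\<close>)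
    assume b: "b \<in> V"
    show "?r (a + b) x = ?r a x + ?r b x"
      by (rule pair_eqI) (use a b algD(2) pair_functional[of x] in
        \<open>auto simp: rep_Sp p pair_add algD(4) functional_def intro: Sp_closed\<close>)
    show "?r (amul A a b) x = ?r a (?r b x)"
      by (rule pair_eqI) (use a b algD(2) in \<open>auto simp: rep_Sp p algD(7)\<close>)
  next
    fix x :: "'k poly" assume "x \<in> Sp (adim A)"
    then show "?r (aone A) x = x"
      by (intro pair_eqI) (use algD(1) in \<open>auto simp: rep_Sp p algD(9)\<close>)
  qed
  then show ?thesis using that p by metis
qed

context
  fixes J
  assumes J: "md J" "mdim J = adim A"
    and act_dual: "\<forall>a\<in>V. \<forall>b\<in>V. \<forall>x\<in>S J. pair (ac J a x) b = pair x (amul A b a)"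
begin

lemmas pair_ac = act_dual[rule_format]

text \<open>Linear maps \<open>Y \<rightarrow> k\<close>, encoded as linear maps with constant polynomials as values, correspond to module
  homomorphisms from \<open>Y\<close> to the dual \<open>J\<close> of the regular module.\<close>

lemma dual_map:
  assumes Y: "md Y" and \<xi>: "lin \<xi>"
  obtains h where "h \<in> homs Y J" "\<And>y b. b \<in> V \<Longrightarrow> pair (h y) b = coeff (\<xi> (ac Y b y)) 0"
proof -
  let ?\<phi> = "\<lambda>y b. coeff (\<xi> (ac Y b y)) 0"
  let ?h = "\<lambda>y. rep (?\<phi> y)"
  note L = linD[OF \<xi>]
  have f: "functional (?\<phi> y)" for y
    unfolding functional_def by (auto simp: mdD(3,4)[OF Y] L)
  have p: "pair (?h y) b = ?\<phi> y b" if "b \<in> V" for y b using pair_rep[OF f that] .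
  have hS: "?h y \<in> S J" for y using rep_Sp J(2) by simp
  have "?h \<in> homs Y J"
  proof (rule hmI)
    show "lin ?h" by (intro linI poly_eqI) (simp_all add: coeff_rep acD L)
    show "?h (ac Y a y) = ac J a (?h y)" if a: "a \<in> V" for a y
    proof (rule pair_eqI)
      show "?h (ac Y a y) \<in> Sp (adim A)" by (rule rep_Sp)
      show "ac J a (?h y) \<in> Sp (adim A)" using mdD(2)[OF J(1) a] J(2) by simp
      show "pair (?h (ac Y a y)) b = pair (ac J a (?h y)) b" if b: "b \<in> V" for b
        using p[OF b] pair_ac[OF a b hS] p[OF algD(2)[OF b a]] mdD(5)[OF Y b a] by simp
    qed
  qed (rule hS)
  then show ?thesis using that p by blast
qed

text \<open>A homomorphism into \<open>J\<close> is determined by the functional that evaluates its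
  values at the unit of A. To extend it along \<open>g\<close>, this functional is extended linearly
  by a retraction of \<open>g\<close> and turned back into a homomorphism by
  \<open>dual_map\<close>.\<close>

lemma injective_mod_dual: "injective_mod J"
  unfolding injective_mod_def
proof (intro conjI J(1) allI impI)
  fix X Y g f assume *: "md X" "md Y" "g \<in> homs X Y" "inj_on_mod X g" "f \<in> homs X J"
  obtain r where r: "lin r" "\<And>y. y \<in> S Y \<Longrightarrow> r y \<in> S X" "\<And>x. x \<in> S X \<Longrightarrow> r (g x) = x"
    using lin_retraction[OF homs_lin[OF *(3)], of "mdim X" "mdim Y"] homs_in[OF *(3)] *(4)
    unfolding inj_on_mod_def by blast
  let ?\<xi> = "\<lambda>y. monom (pair (f (r y)) (aone A)) 0"
  have l: "lin ?\<xi>"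
    by (intro linI) (simp_all add: linD[OF r(1)] hmL[OF *(5)] pair_add add_monom smult_monom)
  obtain h where h: "h \<in> homs Y J" "\<And>y b. b \<in> V \<Longrightarrow> pair (h y) b = coeff (?\<xi> (ac Y b y)) 0"
    using dual_map[OF *(2) l] by blast
  have "h (g x) = f x" if x: "x \<in> S X" for x
  proof (rule pair_eqI)
    show "h (g x) \<in> Sp (adim A)" "f x \<in> Sp (adim A)"
      using homs_in[OF h(1) homs_in[OF *(3) x]] homs_in[OF *(5) x] J(2) by auto
    fix b assume b: "b \<in> V"
    have "r (ac Y b (g x)) = ac X b x" using homs_ac[OF *(3) b x] r(3)[OF mdD(2)[OF *(1) b, of x]] by simp
    then show "pair (h (g x)) b = pair (f x) b"
      using h(2)[OF b] homs_ac[OF *(5) b x] pair_ac[OF b algD(1) homs_in[OF *(5) x]] algD(8)[OF b] by simp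
  qed
  then show "\<exists>h\<in>homs Y J. \<forall>x\<in>S X. h (g x) = f x" using h(1) by blast
qed

end

text \<open>Some coordinate functional does not vanish at a nonzero element \<open>x0\<close>. The
  corresponding map to the dual of A is nonzero at \<open>x0\<close>, hence injective on the simple
  module.\<close>

lemma simple_embeds_in_injective:
  assumes L: "simple_mod L"
  obtains J h where "injective_mod J" "h \<in> homs L J" "inj_on_mod L h"
proof -
  have mL: "md L" and "mdim L > 0" using L by (auto simp: simple_mod_def)
  then obtain x0 where x0: "x0 \<in> S L" "x0 \<noteq> 0" using nonzero_element by blast
  then obtain i where i: "coeff x0 i \<noteq> 0" by (metis leading_coeff_0_iff)
  obtain J where J: "md J" "mdim J = adim A"
    "\<forall>a\<in>V. \<forall>b\<in>V. \<forall>x\<in>S J. pair (ac J a x) b = pair x (amul A b a)"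
    by (rule ex_dual_regular) (rule that)
  have l: "lin (\<lambda>x. monom (coeff x i) 0)" by (intro linI) (simp_all add: add_monom smult_monom)
  obtain h where h: "h \<in> homs L J" "\<And>y b. b \<in> V \<Longrightarrow> pair (h y) b = coeff (monom (coeff (ac L b y) i) 0) 0"
    by (rule dual_map[OF J mL l]) (rule that)
  have "pair (h x0) (aone A) \<noteq> 0" using h(2)[OF algD(1)] mdD(6)[OF mL x0(1)] i by simp
  then have "h x0 \<noteq> 0" by (auto simp: pair_def)
  then have "inj_on_mod L h" using nonzero_inj[OF L J(1) h(1) x0(1)] by blast
  then show ?thesis using that injective_mod_dual[OF J] h(1) by blast
qed

definition envelope :: "'k fmod \<Rightarrow> ('k poly \<Rightarrow> 'k poly) \<Rightarrow> 'k fmod \<Rightarrow> bool" where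
  "envelope I i L \<longleftrightarrow> injective_mod I \<and> md L \<and> i \<in> homs L I \<and> inj_on_mod L i \<and>
     (\<forall>U. smod I U \<and> U \<noteq> {0} \<longrightarrow> (\<exists>v\<in>U. v \<noteq> 0 \<and> v \<in> i ` S L))"

lemma ieD:
  assumes "envelope I i L"
  shows "injective_mod I" "md I" "md L" "i \<in> homs L I" "inj_on_mod L i"
    "smod I U \<Longrightarrow> U \<noteq> {0} \<Longrightarrow> \<exists>v\<in>U. v \<noteq> 0 \<and> v \<in> i ` S L"
  using assms injective_mod_md unfolding envelope_def by auto

lemma envelope_mt:
  assumes "envelope I i L"
  shows "inj_env A I (mt (mdim I) (mdim L) i) L"
proof -
  note I = ieD[OF assms]
  let ?F = "mt (mdim I) (mdim L) i"
  have im: "img ?F = vs I (i ` S L)"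
  proof -
    have "fm ?F ` S L = i ` S L" using fm_mt_homs[OF I(4)] by (intro image_cong) auto
    then show ?thesis using img_fm[OF mt_carrier, of "mdim I" "mdim L" i] by simp
  qed
  have "\<exists>v\<in>W. v \<noteq> 0\<^sub>v (mdim I) \<and> v \<in> img ?F" if W: "submod A I W" "W \<noteq> {0\<^sub>v (mdim I)}" for W
  proof -
    have eq: "vs I (pv ` W) = W" using vc_pv_image[OF submod_carrier[OF W(1)]] .
    note sU = submod_pv[OF I(2) W(1)]
    have "pv ` W \<noteq> {0}" using W(2) eq zero_vec_image by metis
    then obtain v where v: "v \<in> pv ` W" "v \<noteq> 0" "v \<in> i ` S L" using I(6)[OF sU] by blast
    have "vc (mdim I) v \<noteq> 0\<^sub>v (mdim I)"
    proof
      assume "vc (mdim I) v = 0\<^sub>v (mdim I)"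
      then have "vc (mdim I) v = vc (mdim I) 0" by (simp only: vc_simps)
      then show False using vc_inj[OF _ zero_Sp] v(1,2) smodD(1)[OF sU] by blast
    qed
    moreover have "vc (mdim I) v \<in> W" using imageI[OF v(1), of "vc (mdim I)"] unfolding eq .
    moreover have "vc (mdim I) v \<in> img ?F" using imageI[OF v(3), of "vc (mdim I)"] unfolding im .
    ultimately show ?thesis by blast
  qed
  then show ?thesis unfolding inj_env_def
    using I injective_if_injective_mod mt_hom[OF I(3,2,4)] mt_inj[OF I(3,2,4)] by blast
qed

text \<open>Dual to \<open>ex_pcover\<close>: among factorisations of endomorphisms of
  \<open>J\<close> that fix the embedded \<open>L\<close> pointwise, one through a \<open>W\<close>
  of least dimension makes \<open>W\<close> a direct summand. If a nonzero submodule met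
  \<open>L\<close> trivially, the quotient of \<open>W\<close> by it would give a smaller
  factorisation.\<close>

lemma ex_envelope:
  assumes L: "simple_mod L"
  obtains I i where "envelope I i L"
proof -
  have mL: "md L" using L by (simp add: simple_mod_def)
  obtain J p where J: "injective_mod J" "p \<in> homs L J" "inj_on_mod L p"
    using simple_embeds_in_injective[OF L] by blast
  note mJ = injective_mod_md[OF J(1)]
  define T where "T W j c \<longleftrightarrow> md W \<and> j \<in> homs W J \<and> c \<in> homs J W \<and> (\<forall>x\<in>S L. j (c (p x)) = p x)" for W j c
  define R where "R n \<longleftrightarrow> (\<exists>W j c. T W j c \<and> mdim W = n)" for n
  have "T J (\<lambda>x. x) (\<lambda>x. x)" unfolding T_def using mJ homs_id by blast
  then have "R (mdim J)" unfolding R_def by blast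
  then have "R (LEAST n. R n)" by (rule LeastI)
  then obtain W j c where T: "T W j c" and least: "mdim W = (LEAST n. R n)" unfolding R_def by blast
  have min: "mdim W \<le> mdim W'" if "T W' j' c'" for W' j' c'
    unfolding least by (rule Least_le) (use that in \<open>auto simp: R_def\<close>)
  have W: "md W" "j \<in> homs W J" "c \<in> homs J W" and e: "\<And>x. x \<in> S L \<Longrightarrow> j (c (p x)) = p x" using T unfolding T_def by auto
  note cj = homs_comp[OF W(2,3)]
  obtain W' i where W': "md W'" "i \<in> homs W' W" "inj_on_mod W' i" "i ` S W' = (\<lambda>x. c (j x)) ` S W"
    using realize_sub[OF W(1) smod_range[OF W(1) cj smod_UNIV[OF W(1)]]] by blast
  have "c (j (c x)) \<in> i ` S W'" if "x \<in> S J" for x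
    unfolding W'(4) using homs_in[OF W(3) that] by blast
  then obtain c' where c': "c' \<in> homs J W'" "\<And>x. x \<in> S J \<Longrightarrow> i (c' x) = c (j (c x))"
    using corestrict[OF homs_comp[OF W(3) cj] W'(2,3) mJ W'(1)] by blast
  have "j (i (c' (p x))) = p x" if x: "x \<in> S L" for x
    using c'(2)[OF homs_in[OF J(2) x]] e[OF x] by simp
  then have "T W' (\<lambda>x. j (i x)) c'" unfolding T_def using W'(1) homs_comp[OF W'(2) W(2)] c'(1) by blast
  then have "mdim W' = mdim W" using min inj_dim[OF W'(2,3)] by (metis order_antisym)
  then have "i ` S W' = S W" using onto_image_eq[OF W'(2) inj_eq_dim_onto[OF W'(2,3)]] by blast
  then have on: "onto W W (\<lambda>x. c (j x))" unfolding onto_image W'(4) by simp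
  obtain t where t: "t \<in> homs W W" "\<And>x. x \<in> S W \<Longrightarrow> t (c (j x)) = x"
    "\<And>y. y \<in> S W \<Longrightarrow> c (j (t y)) = y"
    using homs_inverse[OF W(1) cj onto_eq_dim_inj[OF cj on refl] on] by blast
  have iW: "injective_mod W" using injective_mod_retract[OF J(1) W(1,2) homs_comp[OF W(3) t(1)] t(2)] .
  let ?q = "\<lambda>x. c (p x)"
  note q = homs_comp[OF J(2) W(3)]
  have qinj: "inj_on_mod L ?q" unfolding inj_on_mod_def
  proof (intro ballI impI)
    fix x assume x: "x \<in> S L" "c (p x) = 0"
    then have "p x = 0" using e[OF x(1)] hmL(3)[OF W(2)] by simp
    then show "x = 0" using J(3) x(1) unfolding inj_on_mod_def by blast
  qed
  have "\<exists>v\<in>U. v \<noteq> 0 \<and> v \<in> ?q ` S L" if U: "smod W U" "U \<noteq> {0}" for U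
  proof (rule ccontr)
    assume neg: "\<not> (\<exists>v\<in>U. v \<noteq> 0 \<and> v \<in> ?q ` S L)"
    obtain B u where B: "md B" "u \<in> homs W B" "onto W B u" "\<And>x. x \<in> S W \<Longrightarrow> u x = 0 \<longleftrightarrow> x \<in> U"
      using realize_quot[OF W(1) U(1)] by blast
    note uq = homs_comp[OF q B(2)]
    have "inj_on_mod L (\<lambda>x. u (?q x))" unfolding inj_on_mod_def
    proof (intro ballI impI)
      fix x assume x: "x \<in> S L" "u (?q x) = 0"
      then have "?q x \<in> U" using B(4)[OF homs_in[OF q x(1)]] by simp
      then have "?q x = 0" using neg x(1) by blast
      then show "x = 0" using qinj x(1) unfolding inj_on_mod_def by blast
    qed
    then obtain h where h: "h \<in> homs B J" "\<And>x. x \<in> S L \<Longrightarrow> h (u (?q x)) = p x"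
      using injective_mod_extend[OF J(1) mL B(1) uq _ J(2)] by blast
    have "T B h (\<lambda>x. u (c x))" unfolding T_def using B(1) homs_comp[OF W(3) B(2)] h by blast
    then have "mdim W = mdim B" using min onto_dim[OF B(2,3)] by (metis order_antisym)
    then have "inj_on_mod W u" using onto_eq_dim_inj[OF B(2,3)] by blast
    then have "U \<subseteq> {0}" using B(4) smodD(1)[OF U(1)] unfolding inj_on_mod_def by blast
    then show False using U(2) subspD(1)[OF smodD(2)[OF U(1)]] by blast
  qed
  then have "envelope W ?q L" unfolding envelope_def using iW mL q qinj by blast
  then show ?thesis by (rule that)
qed

end

section \<open>Standard modules\<close>

lemma (in fd_algebra) retract_trans: "retract X Y \<Longrightarrow> retract Y Z \<Longrightarrow> retract X Z"
proof -
  assume XY: "retract X Y" and YZ: "retract Y Z"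
  obtain i r where 1: "i \<in> homs X Y" "r \<in> homs Y X" "\<forall>x\<in>S X. r (i x) = x" using XY unfolding retract_def by blast
  obtain j s where 2: "j \<in> homs Y Z" "s \<in> homs Z Y" "\<forall>y\<in>S Y. s (j y) = y" using YZ unfolding retract_def by blast
  have "r (s (j (i x))) = x" if "x \<in> S X" for x using 1(3) 2(3) homs_in[OF 1(1) that] that by simp
  then have "\<exists>r\<in>homs Z X. \<forall>x\<in>S X. r (j (i x)) = x" by (intro bexI[OF _ homs_comp[OF 2(2) 1(2)]] ballI)
  then have "\<exists>i\<in>homs X Z. \<exists>r\<in>homs Z X. \<forall>x\<in>S X. r (i x) = x" by (intro bexI[OF _ homs_comp[OF 1(1) 2(1)]])
  then show "retract X Z" using XY YZ unfolding retract_def by blast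
qed

text \<open>In a split sequence the submodule and the quotient exchange their roles. This is what
  moves a standard module downwards when filtrations are reordered.\<close>

lemma (in fd_algebra) ses_swap:
  assumes E: "ses X Q D s t" and \<sigma>: "\<sigma> \<in> homs D Q" "\<And>d. d \<in> S D \<Longrightarrow> t (\<sigma> d) = d"
  obtains \<rho> where "ses D Q X \<sigma> \<rho>"
proof -
  note E' = sesD[OF E]
  obtain \<rho> where \<rho>: "\<rho> \<in> homs Q X" "\<And>x. x \<in> S X \<Longrightarrow> \<rho> (s x) = x" "\<And>z. z \<in> S Q \<Longrightarrow> s (\<rho> z) + \<sigma> (t z) = z"
    using ses_retraction[OF E \<sigma>] by blast
  have "ses D Q X \<sigma> \<rho>"
  proof (rule sesI[OF E'(3,2,1) \<sigma>(1) \<rho>(1)])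
    show "x = 0" if "x \<in> S D" "\<sigma> x = 0" for x using \<sigma>(2)[OF that(1)] that(2) hmL(3)[OF E'(5)] by simp
    show "\<exists>y\<in>S Q. \<rho> y = z" if "z \<in> S X" for z using \<rho>(2)[OF that] homs_in[OF E'(4) that] by blast
    show "\<rho> (\<sigma> x) = 0" if x: "x \<in> S D" for x
    proof (rule E'(11)[OF homs_in[OF \<rho>(1) homs_in[OF \<sigma>(1) x]]])
      show "s (\<rho> (\<sigma> x)) = 0" using \<rho>(3)[OF homs_in[OF \<sigma>(1) x]] \<sigma>(2)[OF x] by simp
    qed
    show "\<exists>x\<in>S D. \<sigma> x = y" if "y \<in> S Q" "\<rho> y = 0" for y
      using \<rho>(3)[OF that(1)] that(2) hmL(3)[OF E'(4)] homs_in[OF E'(5) that(1)] by auto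
  qed
  then show ?thesis by (rule that)
qed

section \<open>Induction on dimension: simple quotients and simple submodules\<close>

lemma (in fd_algebra) ses_dim_less:
  assumes E: "ses X Y Z f g" and Z: "mdim Z > 0"
  shows "mdim X < mdim Y"
proof (rule ccontr)
  note E' = sesD[OF E]
  assume "\<not> mdim X < mdim Y"
  then have "mdim X = mdim Y" using inj_dim[OF E'(4,6)] by simp
  then have "f ` S X = S Y" using onto_image_eq[OF E'(4) inj_eq_dim_onto[OF E'(4,6)]] by simp
  moreover obtain z where z: "z \<in> S Z" "z \<noteq> 0" using Z nonzero_element by blast
  moreover obtain y where "y \<in> S Y" "g y = z" using E'(12)[OF z(1)] by blast
  ultimately show False using E'(9)[of y] by simp
qed

lemma (in fd_algebra) ses_dim_less':
  assumes E: "ses X Y Z f g" and X: "mdim X > 0"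
  shows "mdim Z < mdim Y"
proof (rule ccontr)
  note E' = sesD[OF E]
  assume "\<not> mdim Z < mdim Y"
  then have "mdim Y = mdim Z" using onto_dim[OF E'(5,7)] by simp
  then have inj: "inj_on_mod Y g" using onto_eq_dim_inj[OF E'(5,7)] by simp
  obtain x where x: "x \<in> S X" "x \<noteq> 0" using X nonzero_element by blast
  then have "f x = 0" using inj E'(8)[OF x(1)] homs_in[OF E'(4) x(1)] unfolding inj_on_mod_def by simp
  then show False using E'(11) x by blast
qed

lemma (in fd_algebra) not_simple_ses:
  assumes M: "md M" "mdim M > 0" "\<not> simple_mod M"
  obtains X Z f g where "ses X M Z f g" "mdim X > 0" "mdim Z > 0"
proof -
  obtain U where U: "smod M U" "U \<noteq> {0}" "U \<noteq> S M" using M unfolding simple_mod_def by blast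
  obtain X f where X: "md X" "f \<in> homs X M" "inj_on_mod X f" "f ` S X = U" using realize_sub[OF M(1) U(1)] by blast
  obtain Z g where E: "ses X M Z f g" using ses_cokernel[OF X(1) M(1) X(2,3)] by blast
  note E' = sesD[OF E]
  have "mdim X > 0"
  proof (rule ccontr)
    assume "\<not> mdim X > 0"
    then have "U = {0}" using X(4) hmL(3)[OF X(2)] by auto
    then show False using U(2) by blast
  qed
  moreover have "mdim Z > 0"
  proof (rule ccontr)
    assume "\<not> mdim Z > 0"
    then have "g y = 0" if "y \<in> S M" for y using homs_in[OF E'(5) that] by simp
    then have "S M \<subseteq> U" using E'(9) X(4) by blast
    then show False using U(3) smodD(1)[OF U(1)] by blast
  qed
  ultimately show ?thesis using that E by blast
qed

lemma (in fd_algebra) ex_simple_quotient: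
  assumes "md M" "mdim M > 0"
  shows "\<exists>N g. simple_mod N \<and> g \<in> homs M N \<and> onto M N g"
  using assms
proof (induction "mdim M" arbitrary: M rule: less_induct)
  case less
  show ?case
  proof (cases "simple_mod M")
    case True
    have "onto M M (\<lambda>x. x)" by (simp add: onto_def)
    then show ?thesis using True homs_id by blast
  next
    case False
    obtain X Z f g where E: "ses X M Z f g" "mdim X > 0" "mdim Z > 0"
      by (rule not_simple_ses[OF less.prems False]) (rule that)
    note E' = sesD[OF E(1)]
    obtain N h where N: "simple_mod N" "h \<in> homs Z N" "onto Z N h"
      using less.hyps[OF ses_dim_less'[OF E(1,2)] E'(3) E(3)] by blast
    have "onto M N (\<lambda>x. h (g x))" using N(3) E'(12) unfolding onto_def by metis
    then show ?thesis using N(1) homs_comp[OF E'(5) N(2)] by blast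
  qed
qed

lemma (in fd_algebra) ex_simple_sub:
  assumes "md M" "mdim M > 0"
  shows "\<exists>N f. simple_mod N \<and> f \<in> homs N M \<and> inj_on_mod N f"
  using assms
proof (induction "mdim M" arbitrary: M rule: less_induct)
  case less
  show ?case
  proof (cases "simple_mod M")
    case True
    have "inj_on_mod M (\<lambda>x. x)" by (simp add: inj_on_mod_def)
    then show ?thesis using True homs_id by blast
  next
    case False
    obtain X Z f g where E: "ses X M Z f g" "mdim X > 0" "mdim Z > 0"
      by (rule not_simple_ses[OF less.prems False]) (rule that)
    note E' = sesD[OF E(1)]
    obtain N h where N: "simple_mod N" "h \<in> homs N X" "inj_on_mod N h"
      using less.hyps[OF ses_dim_less[OF E(1,3)] E'(1) E(2)] by blast
    have "inj_on_mod N (\<lambda>x. f (h x))" using N(3) E'(11) homs_in[OF N(2)] unfolding inj_on_mod_def by blast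
    then show ?thesis using N(1) homs_comp[OF N(2) E'(4)] by blast
  qed
qed

text \<open>\<open>L\<close> is the only simple quotient of its cover. Either \<open>f\<close> kills
  the kernel of \<open>p\<close> and factors through \<open>L\<close>, or it is onto already on that
  kernel; then the kernel of \<open>f\<close> maps onto \<open>L\<close> and is all of
  \<open>P\<close>, so \<open>f\<close> is zero.\<close>

lemma (in fd_algebra) cover_hom_simple:
  assumes P: "pcover P p L" "simple_mod L" and N: "simple_mod N" and f: "f \<in> homs P N" and x: "x \<in> S P" "f x \<noteq> 0"
  shows "isom L N"
proof -
  note P' = pcD[OF P(1)]
  have mN: "md N" using N by (simp add: simple_mod_def)
  let ?K = "{x \<in> S P. p x = 0}"
  have "smod N (f ` ?K)" using smod_range[OF P'(2) f smod_ker[OF P'(2,3,4)]] .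
  then consider "f ` ?K = {0}" | "f ` ?K = S N" using N unfolding simple_mod_def by blast
  then show ?thesis
  proof cases
    case 1
    then have "f y = 0" if "y \<in> S P" "p y = 0" for y using that by blast
    then obtain h where h: "h \<in> homs L N" "\<And>y. y \<in> S P \<Longrightarrow> h (p y) = f y"
      using descend[OF P'(2) f P'(4,5)] by blast
    show ?thesis using nonzero_isom[OF P(2) N h(1) homs_in[OF P'(4) x(1)]] h(2)[OF x(1)] x(2) by simp
  next
    case 2
    have "S L \<subseteq> p ` {x \<in> S P. f x = 0}"
    proof
      fix z assume "z \<in> S L"
      then obtain y where y: "y \<in> S P" "p y = z" using P'(5) unfolding onto_def by blast
      have "f y \<in> f ` ?K" unfolding 2 using homs_in[OF f y(1)] .
      then obtain k where k: "k \<in> S P" "p k = 0" "f y = f k" by blast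
      have "y - k \<in> {x \<in> S P. f x = 0}" "p (y - k) = z"
        using y k by (auto simp: hmL[OF f] hmL[OF P'(4)])
      then show "z \<in> p ` {x \<in> S P. f x = 0}" by blast
    qed
    then have "{x \<in> S P. f x = 0} = S P" using P'(6)[OF smod_ker[OF P'(2) mN f]] by blast
    then show ?thesis using x by blast
  qed
qed

section \<open>Modules with bounded composition factors\<close>

locale indexed_algebra = fd_algebra A for A :: "'k::field falg" +
  fixes n :: nat and L :: "nat \<Rightarrow> 'k fmod"
  assumes idx: "simples_indexed A n L"
begin

lemma simple_mod_L: "\<mu> \<in> {1..n} \<Longrightarrow> simple_mod (L \<mu>)"
  using idx simple_iff unfolding simples_indexed_def by blast

lemma md_L: "\<mu> \<in> {1..n} \<Longrightarrow> md (L \<mu>)"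
  using simple_mod_L simple_mod_def by blast

lemma L_nonzero: "\<mu> \<in> {1..n} \<Longrightarrow> mdim (L \<mu>) > 0"
  using simple_mod_L simple_mod_def by blast

lemma isom_L: "\<mu> \<in> {1..n} \<Longrightarrow> \<nu> \<in> {1..n} \<Longrightarrow> isom (L \<mu>) (L \<nu>) \<Longrightarrow> \<mu> = \<nu>"
  using idx iso_iff[OF md_L md_L] unfolding simples_indexed_def by blast

lemma simple_mod_isom_L: "simple_mod N \<Longrightarrow> \<exists>\<mu>\<in>{1..n}. isom N (L \<mu>)"
  using idx simple_iff iso_iff[OF _ md_L] unfolding simples_indexed_def simple_mod_def by meson

lemma ex_L_quotient:
  assumes "md M" "mdim M > 0"
  obtains \<mu> g where "\<mu> \<in> {1..n}" "g \<in> homs M (L \<mu>)" "onto M (L \<mu>) g"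
proof -
  obtain N h where N: "simple_mod N" "h \<in> homs M N" "onto M N h" using ex_simple_quotient[OF assms] by blast
  obtain \<mu> where \<mu>: "\<mu> \<in> {1..n}" "isom N (L \<mu>)" using simple_mod_isom_L[OF N(1)] by blast
  obtain f where f: "f \<in> homs N (L \<mu>)" "onto N (L \<mu>) f" using \<mu>(2) unfolding isom_def by blast
  have "onto M (L \<mu>) (\<lambda>x. f (h x))" using N(3) f(2) unfolding onto_def by metis
  then show ?thesis using that \<mu>(1) homs_comp[OF N(2) f(1)] by blast
qed

lemma ex_L_sub:
  assumes "md M" "mdim M > 0"
  obtains \<mu> g where "\<mu> \<in> {1..n}" "g \<in> homs (L \<mu>) M" "inj_on_mod (L \<mu>) g"
proof -
  obtain N h where N: "simple_mod N" "h \<in> homs N M" "inj_on_mod N h" using ex_simple_sub[OF assms] by blast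
  obtain \<mu> where \<mu>: "\<mu> \<in> {1..n}" "isom N (L \<mu>)" using simple_mod_isom_L[OF N(1)] by blast
  obtain f where f: "f \<in> homs (L \<mu>) N" "inj_on_mod (L \<mu>) f" using isom_sym[OF \<mu>(2)] unfolding isom_def by blast
  have "inj_on_mod (L \<mu>) (\<lambda>x. h (f x))" using N(3) f(2) homs_in[OF f(1)] unfolding inj_on_mod_def by blast
  then show ?thesis using that \<mu>(1) homs_comp[OF f(1) N(2)] by blast
qed

text \<open>\<open>factors_le \<kappa>\<close> consists of the modules with all composition factors among \<open>L 1, \<dots>, L \<kappa>\<close>. Stated through maps from
  projective covers, closure under submodules, quotients and extensions is immediate.\<close>

definition factors_le :: "nat \<Rightarrow> 'k fmod \<Rightarrow> bool" where
  "factors_le \<kappa> X \<longleftrightarrow> md X \<and> (\<forall>\<nu>. \<kappa> < \<nu> \<longrightarrow> \<nu> \<le> n \<longrightarrow> (\<forall>P p. pcover P p (L \<nu>) \<longrightarrow> (\<forall>f\<in>homs P X. \<forall>x\<in>S P. f x = 0)))"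

lemma factors_le_md: "factors_le \<kappa> X \<Longrightarrow> md X"
  by (simp add: factors_le_def)

lemma ClD: "factors_le \<kappa> X \<Longrightarrow> \<kappa> < \<nu> \<Longrightarrow> \<nu> \<le> n \<Longrightarrow> pcover P p (L \<nu>) \<Longrightarrow> f \<in> homs P X \<Longrightarrow> x \<in> S P \<Longrightarrow> f x = 0"
  unfolding factors_le_def by blast

lemma ClI:
  "md X \<Longrightarrow> (\<And>\<nu> P p f x. \<kappa> < \<nu> \<Longrightarrow> \<nu> \<le> n \<Longrightarrow> pcover P p (L \<nu>) \<Longrightarrow> f \<in> homs P X \<Longrightarrow> x \<in> S P \<Longrightarrow> f x = 0) \<Longrightarrow> factors_le \<kappa> X"
  unfolding factors_le_def by blast

lemma factors_le_mono: "factors_le \<kappa> X \<Longrightarrow> \<kappa> \<le> \<kappa>' \<Longrightarrow> factors_le \<kappa>' X"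
  unfolding factors_le_def by (meson le_less_trans)

lemma factors_le_inj:
  assumes Y: "factors_le \<kappa> Y" and X: "md X" "j \<in> homs X Y" "inj_on_mod X j"
  shows "factors_le \<kappa> X"
proof (rule ClI[OF X(1)])
  fix \<nu> P p f x assume *: "\<kappa> < \<nu>" "\<nu> \<le> n" "pcover P p (L \<nu>)" "f \<in> homs P X" "x \<in> S P"
  have "j (f x) = 0" using ClD[OF Y *(1-3) homs_comp[OF *(4) X(2)] *(5)] .
  then show "f x = 0" using X(3) homs_in[OF *(4,5)] unfolding inj_on_mod_def by blast
qed

lemma factors_le_onto:
  assumes X: "factors_le \<kappa> X" and Y: "md Y" "g \<in> homs X Y" "onto X Y g"
  shows "factors_le \<kappa> Y"
proof (rule ClI[OF Y(1)])
  fix \<nu> P p f x assume *: "\<kappa> < \<nu>" "\<nu> \<le> n" "pcover P p (L \<nu>)" "f \<in> homs P Y" "x \<in> S P"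
  obtain h where h: "h \<in> homs P X" "\<And>x. x \<in> S P \<Longrightarrow> g (h x) = f x"
    using proj_mod_lift[OF pcD(1)[OF *(3)] factors_le_md[OF X] Y *(4)] by blast
  show "f x = 0" using h(2)[OF *(5)] ClD[OF X *(1-3) h(1) *(5)] hmL(3)[OF Y(2)] by simp
qed

lemma factors_le_ext:
  assumes E: "ses X Y Z f g" and X: "factors_le \<kappa> X" and Z: "factors_le \<kappa> Z"
  shows "factors_le \<kappa> Y"
proof (rule ClI[OF sesD(2)[OF E]])
  note E' = sesD[OF E]
  fix \<nu> P p h x assume *: "\<kappa> < \<nu>" "\<nu> \<le> n" "pcover P p (L \<nu>)" "h \<in> homs P Y" "x \<in> S P"
  have "g (h y) = 0" if "y \<in> S P" for y using ClD[OF Z *(1-3) homs_comp[OF *(4) E'(5)] that] .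
  then obtain h' where h': "h' \<in> homs P X" "\<And>y. y \<in> S P \<Longrightarrow> f (h' y) = h y"
    using ses_factor[OF E *(4) pcD(2)[OF *(3)]] by blast
  show "h x = 0" using h'(2)[OF *(5)] ClD[OF X *(1-3) h'(1) *(5)] hmL(3)[OF E'(4)] by simp
qed

lemma factors_le_zero: "md Z \<Longrightarrow> mdim Z = 0 \<Longrightarrow> factors_le \<kappa> Z"
  by (rule ClI) (auto dest: homs_in)

text \<open>A nonzero map from the cover of L(\<nu>) to L(\<mu>) exists only for \<nu> = \<mu>, by
  \<open>cover_hom_simple\<close>.\<close>

lemma factors_le_L:
  assumes \<mu>: "\<mu> \<in> {1..n}"
  shows "factors_le \<kappa> (L \<mu>) \<longleftrightarrow> \<mu> \<le> \<kappa>"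
proof
  assume C: "factors_le \<kappa> (L \<mu>)"
  obtain P p where P: "pcover P p (L \<mu>)" using ex_pcover[OF md_L[OF \<mu>]] by blast
  note P' = pcD[OF P]
  obtain z where z: "z \<in> S (L \<mu>)" "z \<noteq> 0" using L_nonzero[OF \<mu>] nonzero_element by blast
  then obtain x where x: "x \<in> S P" "p x = z" using P'(5) unfolding onto_def by blast
  show "\<mu> \<le> \<kappa>"
  proof (rule ccontr)
    assume "\<not> \<mu> \<le> \<kappa>"
    then have "p x = 0" using ClD[OF C _ _ P P'(4) x(1)] \<mu> by simp
    then show False using x z by blast
  qed
next
  assume le: "\<mu> \<le> \<kappa>"
  show "factors_le \<kappa> (L \<mu>)"
  proof (rule ClI[OF md_L[OF \<mu>]])
    fix \<nu> P p f x assume *: "\<kappa> < \<nu>" "\<nu> \<le> n" "pcover P p (L \<nu>)" "f \<in> homs P (L \<mu>)" "x \<in> S P"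
    have \<nu>: "\<nu> \<in> {1..n}" using * le \<mu> by auto
    show "f x = 0"
    proof (rule ccontr)
      assume "f x \<noteq> 0"
      then have "\<nu> = \<mu>" using cover_hom_simple[OF *(3) simple_mod_L[OF \<nu>] simple_mod_L[OF \<mu>] *(4,5)] isom_L[OF \<nu> \<mu>] by blast
      then show False using le *(1) by simp
    qed
  qed
qed

lemma factors_le_filt: "factors_le \<kappa> X \<Longrightarrow> filt A (\<lambda>N. \<exists>\<mu>\<in>{1..n}. \<mu> \<le> \<kappa> \<and> N = L \<mu>) X"
proof (induction "mdim X" arbitrary: X rule: less_induct)
  case less
  note mX = factors_le_md[OF less.prems]
  show ?case
  proof (cases "mdim X = 0")
    case True
    then show ?thesis using filt_zero mX by blast
  next
    case False
    then obtain \<mu> g where \<mu>: "\<mu> \<in> {1..n}" "g \<in> homs X (L \<mu>)" "onto X (L \<mu>) g" using ex_L_quotient[OF mX] by blast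
    obtain K k where E: "ses K X (L \<mu>) k g" using ses_kernel[OF mX md_L[OF \<mu>(1)] \<mu>(2,3)] by blast
    note E' = sesD[OF E]
    have "\<mu> \<le> \<kappa>" using factors_le_onto[OF less.prems md_L[OF \<mu>(1)] \<mu>(2,3)] factors_le_L[OF \<mu>(1)] by blast
    moreover have "filt A (\<lambda>N. \<exists>\<mu>\<in>{1..n}. \<mu> \<le> \<kappa> \<and> N = L \<mu>) K"
      using less.hyps[OF ses_dim_less[OF E L_nonzero[OF \<mu>(1)]] factors_le_inj[OF less.prems E'(1,4,6)]] .
    ultimately show ?thesis using filt_step[OF E] \<mu>(1) by blast
  qed
qed

section \<open>Traces and standard modules\<close>

definition trace_gt :: "nat \<Rightarrow> 'k fmod \<Rightarrow> 'k poly set" where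
  "trace_gt \<alpha> P = {x \<in> S P. \<forall>U. smod P U \<longrightarrow>
     (\<forall>\<nu> X p f. \<alpha> < \<nu> \<longrightarrow> \<nu> \<le> n \<longrightarrow> pcover X p (L \<nu>) \<longrightarrow> f \<in> homs X P \<longrightarrow> f ` S X \<subseteq> U) \<longrightarrow> x \<in> U}"

lemma trace_gt_smod: "md P \<Longrightarrow> smod P (trace_gt \<alpha> P)"
  unfolding smod_def subsp_def
proof (intro conjI ballI allI)
  assume P: "md P"
  show "trace_gt \<alpha> P \<subseteq> S P" "0 \<in> trace_gt \<alpha> P" unfolding trace_gt_def by (auto dest: smodD(2) subspD(1))
  show "x + y \<in> trace_gt \<alpha> P" if "x \<in> trace_gt \<alpha> P" "y \<in> trace_gt \<alpha> P" for x y
    using that subspD(2)[OF smodD(2)] unfolding trace_gt_def by auto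
  show "smult c x \<in> trace_gt \<alpha> P" if "x \<in> trace_gt \<alpha> P" for x c
    using that subspD(3)[OF smodD(2)] unfolding trace_gt_def by auto
  show "ac P a x \<in> trace_gt \<alpha> P" if "x \<in> trace_gt \<alpha> P" "a \<in> V" for x a
    using that smodD(3)[OF _ that(2)] mdD(2)[OF P that(2)] unfolding trace_gt_def by auto
qed

lemma trace_gt_contains: "\<alpha> < \<nu> \<Longrightarrow> \<nu> \<le> n \<Longrightarrow> pcover X p (L \<nu>) \<Longrightarrow> f \<in> homs X P \<Longrightarrow> x \<in> S X \<Longrightarrow> f x \<in> trace_gt \<alpha> P"
  unfolding trace_gt_def using homs_in by blast

lemma trace_gt_least:
  "smod P U \<Longrightarrow> (\<And>\<nu> X p f x. \<alpha> < \<nu> \<Longrightarrow> \<nu> \<le> n \<Longrightarrow> pcover X p (L \<nu>) \<Longrightarrow> f \<in> homs X P \<Longrightarrow> x \<in> S X \<Longrightarrow> f x \<in> U) \<Longrightarrow> trace_gt \<alpha> P \<subseteq> U"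
  unfolding trace_gt_def by blast

definition std_mod :: "nat \<Rightarrow> 'k fmod \<Rightarrow> bool" where
  "std_mod \<alpha> D \<longleftrightarrow> md D \<and> (\<exists>P p q. pcover P p (L \<alpha>) \<and> q \<in> homs P D \<and> onto P D q \<and> {x \<in> S P. q x = 0} = trace_gt \<alpha> P)"

lemma trace_trace_gt:
  assumes P: "md P"
  shows "trace A {X. \<exists>\<mu> \<pi>'. \<alpha> < \<mu> \<and> \<mu> \<le> n \<and> proj_cover A X \<pi>' (L \<mu>)} P = vs P (trace_gt \<alpha> P)"
    (is "trace A ?X P = _")
proof
  have mX: "md X" if "X \<in> ?X" for X using that pcover_fm pcD(2) by blast
  have X: "X \<in> ?X" if "\<alpha> < \<nu>" "\<nu> \<le> n" "pcover X p (L \<nu>)" for \<nu> X p using pcover_mt that by blast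
  let ?W = "vs P (trace_gt \<alpha> P)"
  note trace_gt = trace_gt_smod[OF P]
  have "submod A P ?W" using submod_vs[OF P smodD(1)[OF trace_gt]] trace_gt by blast
  moreover have "F *\<^sub>v v \<in> ?W" if XF: "X \<in> ?X" "F \<in> hom A X P" "v \<in> carrier_vec (mdim X)" for X F v
  proof -
    obtain x where x: "x \<in> S X" "v = vc (mdim X) x" using XF(3) carrier_vec_pv by blast
    obtain \<mu> \<pi> where \<mu>: "\<alpha> < \<mu>" "\<mu> \<le> n" "proj_cover A X \<pi> (L \<mu>)" using XF(1) by blast
    have "fm F x \<in> trace_gt \<alpha> P" using trace_gt_contains[OF \<mu>(1,2) pcover_fm[OF \<mu>(3)] fm_homs[OF mX[OF XF(1)] P XF(2)] x(1)] .
    then show ?thesis unfolding x(2) fm_vc[OF hom_carrier[OF XF(2)]] by blast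
  qed
  ultimately show "trace A ?X P \<subseteq> ?W" unfolding trace_def by (intro Inter_lower) blast
  show "?W \<subseteq> trace A ?X P" unfolding trace_def
  proof (rule Inter_greatest)
    fix W assume "W \<in> {U. submod A P U \<and> (\<forall>X\<in>?X. \<forall>f\<in>hom A X P. \<forall>v\<in>carrier_vec (mdim X). f *\<^sub>v v \<in> U)}"
    then have W: "submod A P W" "\<And>X f v. X \<in> ?X \<Longrightarrow> f \<in> hom A X P \<Longrightarrow> v \<in> carrier_vec (mdim X) \<Longrightarrow> f *\<^sub>v v \<in> W"
      by blast+
    have "trace_gt \<alpha> P \<subseteq> pv ` W"
    proof (rule trace_gt_least[OF submod_pv[OF P W(1)]])
      fix \<nu> X p f x assume *: "\<alpha> < \<nu>" "\<nu> \<le> n" "pcover X p (L \<nu>)" "f \<in> homs X P" "x \<in> S X"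
      have "mt (mdim P) (mdim X) f *\<^sub>v vc (mdim X) x \<in> W"
        by (rule W(2)[OF X[OF *(1-3)] mt_hom[OF pcD(2)[OF *(3)] P *(4)]]) simp
      then have "vc (mdim P) (f x) \<in> W"
        using fm_vc[OF mt_carrier, of "mdim P" "mdim X" f x] fm_mt_homs[OF *(4,5)] by simp
      then show "f x \<in> pv ` W" using pv_vc[OF homs_in[OF *(4,5)]] by (metis imageI)
    qed
    then have "?W \<subseteq> vs P (pv ` W)" by blast
    then show "?W \<subseteq> W" unfolding vc_pv_image[OF submod_carrier[OF W(1)]] .
  qed
qed

lemma is_std_iff: "is_std A n L \<alpha> D \<longleftrightarrow> std_mod \<alpha> D"
proof
  assume "is_std A n L \<alpha> D"
  then obtain P \<pi> q where D: "md D" "proj_cover A P \<pi> (L \<alpha>)" "q \<in> hom A P D" "surj_map q"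
    "kern q = trace A {X. \<exists>\<mu> \<pi>'. \<alpha> < \<mu> \<and> \<mu> \<le> n \<and> proj_cover A X \<pi>' (L \<mu>)} P"
    unfolding is_std_def by blast
  note P = pcover_fm[OF D(2)]
  note mP = pcD(2)[OF P]
  have "vs P {x \<in> S P. fm q x = 0} = vs P (trace_gt \<alpha> P)"
    using D(5) unfolding trace_trace_gt[OF mP] kern_fm[OF hom_carrier[OF D(3)]] .
  then have "{x \<in> S P. fm q x = 0} = trace_gt \<alpha> P"
    using vc_image_eq[OF _ smodD(1)[OF trace_gt_smod[OF mP]], of "{x \<in> S P. fm q x = 0}" \<alpha>] by blast
  then show "std_mod \<alpha> D" unfolding std_mod_def using D(1) P fm_homs[OF mP D(1,3)] surj_map_iff[OF D(3)] D(4) by blast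
next
  assume "std_mod \<alpha> D"
  then obtain P p q where D: "md D" "pcover P p (L \<alpha>)" "q \<in> homs P D" "onto P D q" "{x \<in> S P. q x = 0} = trace_gt \<alpha> P"
    unfolding std_mod_def by blast
  note mP = pcD(2)[OF D(2)]
  let ?q = "mt (mdim D) (mdim P) q"
  have "{x \<in> S P. fm ?q x = 0} = trace_gt \<alpha> P" unfolding D(5)[symmetric] using fm_mt_homs[OF D(3)] by auto
  then have "kern ?q = trace A {X. \<exists>\<mu> \<pi>'. \<alpha> < \<mu> \<and> \<mu> \<le> n \<and> proj_cover A X \<pi>' (L \<mu>)} P"
    unfolding trace_trace_gt[OF mP] kern_fm[OF mt_carrier] by simp
  then show "is_std A n L \<alpha> D" unfolding is_std_def
    using D(1) pcover_mt[OF D(2)] mt_hom[OF mP D(1,3)] mt_onto[OF mP D(1,3)] D(4) by blast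
qed

lemma std_mod_md: "std_mod \<alpha> D \<Longrightarrow> md D"
  by (simp add: std_mod_def)

lemma ex_std_mod:
  assumes "\<alpha> \<in> {1..n}"
  obtains D where "std_mod \<alpha> D"
proof -
  obtain P p where P: "pcover P p (L \<alpha>)" using ex_pcover[OF md_L[OF assms]] by blast
  note mP = pcD(2)[OF P]
  obtain Q q where Q: "md Q" "q \<in> homs P Q" "onto P Q q" "\<And>x. x \<in> S P \<Longrightarrow> q x = 0 \<longleftrightarrow> x \<in> trace_gt \<alpha> P"
    using realize_quot[OF mP trace_gt_smod[OF mP]] by blast
  have "{x \<in> S P. q x = 0} = trace_gt \<alpha> P" using Q(4) smodD(1)[OF trace_gt_smod[OF mP]] by blast
  then show ?thesis using that P Q unfolding std_mod_def by blast
qed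

lemma std_mod_presentation:
  assumes D: "std_mod \<alpha> D" and \<alpha>: "\<alpha> \<in> {1..n}"
  obtains K P k q p r where "ses K P D k q" "proj_mod P" "pcover P p (L \<alpha>)" "factors_le \<alpha> D"
    "\<And>Y f x. factors_le \<alpha> Y \<Longrightarrow> f \<in> homs K Y \<Longrightarrow> x \<in> S K \<Longrightarrow> f x = 0" "r \<in> homs D (L \<alpha>)" "onto D (L \<alpha>) r"
    "\<And>U. smod D U \<Longrightarrow> S (L \<alpha>) \<subseteq> r ` U \<Longrightarrow> U = S D"
proof -
  obtain P p q where P: "md D" "pcover P p (L \<alpha>)" "q \<in> homs P D" "onto P D q" "{x \<in> S P. q x = 0} = trace_gt \<alpha> P"
    using D unfolding std_mod_def by blast
  note P' = pcD[OF P(2)]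
  obtain K k where E: "ses K P D k q" using ses_kernel[OF P'(2) P(1,3,4)] by blast
  note E' = sesD[OF E]
  have ktr: "k ` S K = trace_gt \<alpha> P" using E'(9) homs_in[OF E'(4)] P(5) by blast
  have CD: "factors_le \<alpha> D"
  proof (rule ClI[OF P(1)])
    fix \<nu> X p' f x assume *: "\<alpha> < \<nu>" "\<nu> \<le> n" "pcover X p' (L \<nu>)" "f \<in> homs X D" "x \<in> S X"
    obtain h where h: "h \<in> homs X P" "\<And>x. x \<in> S X \<Longrightarrow> q (h x) = f x"
      using proj_mod_lift[OF pcD(1)[OF *(3)] P'(2) P(1,3,4) *(4)] by blast
    have "h x \<in> {x \<in> S P. q x = 0}" unfolding P(5) using trace_gt_contains[OF *(1-3) h(1) *(5)] .
    then show "f x = 0" using h(2)[OF *(5)] by simp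
  qed
  have K0: "f x = 0" if Y: "factors_le \<alpha> Y" and f: "f \<in> homs K Y" and x: "x \<in> S K" for Y f x
  proof -
    \<comment> \<open>A map from P(\<nu>) to \<open>P\<close> with \<nu> > \<alpha> lands in the
      trace, hence factors through \<open>K\<close>, and its composite with \<open>f\<close>
      vanishes. So the kernel of \<open>f\<close> contains every image that generates the trace,
      which is \<open>K\<close>.\<close>
    let ?U = "k ` {x \<in> S K. f x = 0}"
    have "trace_gt \<alpha> P \<subseteq> ?U"
    proof (rule trace_gt_least[OF smod_range[OF E'(1,4) smod_ker[OF E'(1) factors_le_md[OF Y] f]]])
      fix \<nu> X p' g y assume *: "\<alpha> < \<nu>" "\<nu> \<le> n" "pcover X p' (L \<nu>)" "g \<in> homs X P" "y \<in> S X"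
      have "q (g z) = 0" if "z \<in> S X" for z using trace_gt_contains[OF *(1-4) that] P(5) by blast
      then obtain h where h: "h \<in> homs X K" "\<And>z. z \<in> S X \<Longrightarrow> k (h z) = g z"
        using ses_factor[OF E *(4) pcD(2)[OF *(3)]] by blast
      have "f (h y) = 0" using ClD[OF Y *(1-3) homs_comp[OF h(1) f] *(5)] .
      then show "g y \<in> ?U" using h(2)[OF *(5)] homs_in[OF h(1) *(5)] by force
    qed
    then obtain z where z: "z \<in> S K" "f z = 0" "k x = k z" using ktr x by blast
    then show ?thesis using inj_on_modD[OF E'(4,6) x z(1,3)] by simp
  qed
  have "p (k x) = 0" if "x \<in> S K" for x
    using K0[OF _ homs_comp[OF E'(4) P'(4)] that] factors_le_L[OF \<alpha>] by blast
  then obtain r where r: "r \<in> homs D (L \<alpha>)" "\<And>x. x \<in> S P \<Longrightarrow> r (q x) = p x" using ses_descend[OF E P'(4)] by blast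
  have ron: "onto D (L \<alpha>) r"
    using P'(5) r(2) homs_in[OF P(3)] unfolding onto_def by metis
  have sup: "U = S D" if U: "smod D U" "S (L \<alpha>) \<subseteq> r ` U" for U
  proof -
    let ?U = "{x \<in> S P. q x \<in> U}"
    have "S (L \<alpha>) \<subseteq> p ` ?U"
    proof
      fix z assume "z \<in> S (L \<alpha>)"
      then obtain u where u: "u \<in> U" "z = r u" using U(2) by blast
      then obtain x where "x \<in> S P" "q x = u" using E'(12) smodD(1)[OF U(1)] by blast
      then show "z \<in> p ` ?U" using r(2) u by force
    qed
    then have eq: "?U = S P" using P'(6)[OF smod_vimage[OF P'(2) P(3) U(1)]] by blast
    have "S D \<subseteq> U"
    proof
      fix y assume "y \<in> S D"
      then obtain x where "x \<in> S P" "q x = y" using E'(12) by blast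
      then show "y \<in> U" using eq by blast
    qed
    then show ?thesis using smodD(1)[OF U(1)] by blast
  qed
  show ?thesis
  proof (rule that[OF E P'(1) P(2) CD _ r(1) ron])
    show "f x = 0" if "factors_le \<alpha> Y" "f \<in> homs K Y" "x \<in> S K" for Y f x using K0[OF that] .
    show "U = S D" if "smod D U" "S (L \<alpha>) \<subseteq> r ` U" for U using sup[OF that] .
  qed
qed

lemma std_mod_factors_le: "std_mod \<alpha> D \<Longrightarrow> \<alpha> \<in> {1..n} \<Longrightarrow> factors_le \<alpha> D"
  by (rule std_mod_presentation)

text \<open>\<Delta>(\<alpha>) is projective relative to modules with factors of index at most
  \<alpha>: the only map from the kernel of its presentation to \<open>Y\<close> is zero and extends
  trivially.\<close>

lemma std_mod_Ext1_zero:
  assumes D: "std_mod \<alpha> D" "\<alpha> \<in> {1..n}" and Y: "factors_le \<alpha> Y"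
  shows "Ext1_zero D Y"
proof (rule std_mod_presentation[OF D])
  fix K P k q assume E: "ses K P D k q" "proj_mod P"
    and K0: "\<And>Y f x. factors_le \<alpha> Y \<Longrightarrow> f \<in> homs K Y \<Longrightarrow> x \<in> S K \<Longrightarrow> f x = 0"
  show ?thesis
  proof (rule Ext1_zero_I[OF E])
    fix \<phi> assume "\<phi> \<in> homs K Y"
    then have "\<forall>x\<in>S K. 0 = \<phi> x" using K0[OF Y] by simp
    then show "\<exists>\<psi>\<in>homs P Y. \<forall>x\<in>S K. \<psi> (k x) = \<phi> x" by (intro bexI[OF _ homs_zero])
  qed
qed

lemma std_mod_hom_cover:
  assumes D: "std_mod \<alpha> D" and f: "f \<in> homs D Y" and x: "x \<in> S D" "f x \<noteq> 0"
  obtains P p g y where "pcover P p (L \<alpha>)" "g \<in> homs P Y" "y \<in> S P" "g y \<noteq> 0"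
proof -
  obtain P p q where P: "pcover P p (L \<alpha>)" "q \<in> homs P D" "onto P D q" using D unfolding std_mod_def by blast
  obtain y where "y \<in> S P" "q y = x" using P(3) x(1) unfolding onto_def by blast
  then show ?thesis using that[OF P(1) homs_comp[OF P(2) f]] x(2) by blast
qed

section \<open>Modules filtered by standard modules with indices in a given set\<close>

definition Delta_filt :: "nat set \<Rightarrow> 'k fmod \<Rightarrow> bool" where
  "Delta_filt I = filt A (\<lambda>D. \<exists>\<alpha>\<in>I. std_mod \<alpha> D)"

lemma F_Delta_Delta_filt: "F_Delta A n L = Delta_filt {1..n}"
  unfolding F_Delta_def Delta_filt_def is_std_iff ..

lemma Delta_filt_md: "Delta_filt I X \<Longrightarrow> md X"
  unfolding Delta_filt_def by (rule filt_md)

lemma Delta_filt_mono: "Delta_filt I X \<Longrightarrow> I \<subseteq> J \<Longrightarrow> Delta_filt J X"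
  unfolding Delta_filt_def by (rule filt_mono) blast+

lemma Delta_filt_step: "ses X Y D f g \<Longrightarrow> Delta_filt I X \<Longrightarrow> \<alpha> \<in> I \<Longrightarrow> std_mod \<alpha> D \<Longrightarrow> Delta_filt I Y"
  unfolding Delta_filt_def by (rule filt_step) blast+

lemma Delta_filt_ext: "ses X Y Z f g \<Longrightarrow> Delta_filt I X \<Longrightarrow> Delta_filt I Z \<Longrightarrow> Delta_filt I Y"
  unfolding Delta_filt_def by (rule filt_ext)

lemma Delta_filt_zero: "md Z \<Longrightarrow> mdim Z = 0 \<Longrightarrow> Delta_filt I Z"
  unfolding Delta_filt_def by (rule filt_zero)

lemma Delta_filt_isom: "Delta_filt I X \<Longrightarrow> isom X Y \<Longrightarrow> Delta_filt I Y"
  unfolding Delta_filt_def by (rule filt_isom)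

lemma Delta_filt_induct [consumes 1, case_names zero step]:
  assumes "Delta_filt I M" "\<And>Z. md Z \<Longrightarrow> mdim Z = 0 \<Longrightarrow> Q Z"
    "\<And>X Y D f g \<alpha>. ses X Y D f g \<Longrightarrow> Delta_filt I X \<Longrightarrow> \<alpha> \<in> I \<Longrightarrow> std_mod \<alpha> D \<Longrightarrow> Q X \<Longrightarrow> Q Y"
  shows "Q M"
  using assms(1) unfolding Delta_filt_def by (rule filt_induct) (use assms(2,3) in \<open>auto simp: Delta_filt_def\<close>)

lemma Delta_filt_factors_le:
  assumes "Delta_filt I X" "I \<subseteq> {1..n}" "\<And>i. i \<in> I \<Longrightarrow> i \<le> \<kappa>"
  shows "factors_le \<kappa> X"
  using assms(1)
proof (induction rule: Delta_filt_induct)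
  case (zero Z)
  then show ?case by (rule factors_le_zero)
next
  case (step X Y D f g \<alpha>)
  then have "factors_le \<kappa> D" using factors_le_mono[OF std_mod_factors_le] assms(2,3) by blast
  then show ?case using factors_le_ext[OF step(1,5)] by blast
qed

lemma Delta_filt_hom_zero:
  assumes U: "Delta_filt I U" and I: "I \<subseteq> {1..n}" and C: "\<And>D f x \<alpha>. \<alpha> \<in> I \<Longrightarrow> std_mod \<alpha> D \<Longrightarrow> f \<in> homs D Y \<Longrightarrow> x \<in> S D \<Longrightarrow> f x = 0"
  shows "f \<in> homs U Y \<Longrightarrow> x \<in> S U \<Longrightarrow> f x = 0"
  using U
proof (induction arbitrary: f x rule: Delta_filt_induct)
  case (zero Z)
  then show ?case using hmL(3) by auto
next
  case (step X U D a b \<alpha>)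
  note E' = sesD[OF step(1)]
  have "f (a y) = 0" if "y \<in> S X" for y using step(5)[OF homs_comp[OF E'(4) step(6)] that] .
  then obtain h where h: "h \<in> homs D Y" "\<And>y. y \<in> S U \<Longrightarrow> h (b y) = f y"
    using ses_descend[OF step(1,6)] by blast
  show ?case using h(2)[OF step(7)] C[OF step(3,4) h(1) homs_in[OF E'(5) step(7)]] by simp
qed

text \<open>Each subquotient of \<open>U\<close> is a quotient of some P(\<alpha>) with \<alpha> >
  \<kappa>, and such a module has no nonzero map to \<open>Y\<close>.\<close>

lemma Delta_filt_hom_factors_le:
  assumes U: "Delta_filt I U" and I: "I \<subseteq> {1..n}" "\<And>i. i \<in> I \<Longrightarrow> \<kappa> < i" and Y: "factors_le \<kappa> Y"
    and f: "f \<in> homs U Y" "x \<in> S U"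
  shows "f x = 0"
proof (rule Delta_filt_hom_zero[OF U I(1) _ f])
  fix D g y \<alpha> assume *: "\<alpha> \<in> I" "std_mod \<alpha> D" "g \<in> homs D Y" "y \<in> S D"
  show "g y = 0"
  proof (rule ccontr)
    assume "g y \<noteq> 0"
    then obtain P p h z where "pcover P p (L \<alpha>)" "h \<in> homs P Y" "z \<in> S P" "h z \<noteq> 0"
      by (rule std_mod_hom_cover[OF *(2,3,4)]) (rule that)
    moreover have "\<kappa> < \<alpha>" "\<alpha> \<le> n" using I *(1) by auto
    ultimately show False using ClD[OF Y] by blast
  qed
qed

text \<open>As there are no extensions of \<open>\<Delta>(\<mu>)\<close> by modules in \<open>factors_le \<mu>\<close>, a filtration can be reordered with the larger
  indices at the bottom.\<close>

lemma Delta_filt_reorder: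
  assumes X: "Delta_filt I X" and I: "I \<subseteq> {1..n}"
  shows "\<exists>U X' u v. ses U X X' u v \<and> Delta_filt {i \<in> I. \<kappa> < i} U \<and> Delta_filt {i \<in> I. i \<le> \<kappa>} X'"
  using X
proof (induction rule: Delta_filt_induct)
  case (zero Z)
  then have "ses Z Z Z (\<lambda>x. x) (\<lambda>x. 0)" using homs_id homs_zero by (intro sesI) auto
  then show ?case using Delta_filt_zero[OF zero] by blast
next
  case (step X Y D a b \<mu>)
  obtain U X' u v where IH: "ses U X X' u v" "Delta_filt {i \<in> I. \<kappa> < i} U" "Delta_filt {i \<in> I. i \<le> \<kappa>} X'" using step(5) by blast
  obtain Q q s t where Q: "ses U Y Q (\<lambda>x. a (u x)) q" "ses X' Q D s t"
    by (rule ses_third_iso[OF IH(1) step(1)]) (rule that)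
  show ?case
  proof (cases "\<mu> \<le> \<kappa>")
    case True
    then have "Delta_filt {i \<in> I. i \<le> \<kappa>} Q" using Delta_filt_step[OF Q(2) IH(3) _ step(4)] step(3) by blast
    then show ?thesis using Q(1) IH(2) by blast
  next
    case False
    \<comment> \<open>The factors of \<open>X'\<close> have index at most \<kappa> < \<mu>, so the
      new \<Delta>(\<mu>) on top of \<open>X'\<close> splits off. It can therefore be put below
      \<open>X'\<close>, directly on top of \<open>U\<close>.\<close>
    have "factors_le \<kappa> X'" using Delta_filt_factors_le[OF IH(3)] I by blast
    then have "Ext1_zero D X'" using std_mod_Ext1_zero[OF step(4)] step(3) I factors_le_mono[of \<kappa> X' \<mu>] False by auto
    then obtain \<sigma> where \<sigma>: "\<sigma> \<in> homs D Q" "\<And>d. d \<in> S D \<Longrightarrow> t (\<sigma> d) = d" using Ext1_zero_section[OF _ Q(2)] by blast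
    obtain \<rho> where R: "ses D Q X' \<sigma> \<rho>" using ses_swap[OF Q(2) \<sigma>] by blast
    obtain W u' v' w where W: "ses U W D u' v'" "ses W Y X' w (\<lambda>y. \<rho> (q y))"
      by (rule ses_preimage[OF Q(1) R]) (rule that)
    have "Delta_filt {i \<in> I. \<kappa> < i} W" using Delta_filt_step[OF W(1) IH(2) _ step(4)] step(3) False by auto
    then show ?thesis using W(2) IH(3) by blast
  qed
qed

lemma Delta_filt_Ext1_zero:
  assumes X: "Delta_filt I X" and I: "I \<subseteq> {1..n}" and Y: "md Y" and C: "\<And>D \<alpha>. \<alpha> \<in> I \<Longrightarrow> std_mod \<alpha> D \<Longrightarrow> Ext1_zero D Y"
  shows "Ext1_zero X Y"
  using X
proof (induction rule: Delta_filt_induct)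
  case (zero Z)
  then show ?case using Ext1_zero_proj_mod proj_mod_zero by blast
next
  case (step X Z D a b \<mu>)
  then show ?case using Ext1_zero_ext_left[OF step(1,5) C[OF step(3,4)] Y] by blast
qed

text \<open>A nonzero map to L(\<mu>) would restrict to a nonzero map on some \<Delta>(\<alpha>),
  whose projective cover has L(\<alpha>) as its only simple quotient.\<close>

lemma Delta_filt_top:
  assumes U: "Delta_filt {\<alpha>} U" and \<alpha>: "\<alpha> \<in> {1..n}" and \<mu>: "\<mu> \<in> {1..n}" and f: "f \<in> homs U (L \<mu>)" "x \<in> S U" "f x \<noteq> 0"
  shows "\<mu> = \<alpha>"
proof (rule ccontr)
  assume ne: "\<mu> \<noteq> \<alpha>"
  have "f x = 0"
  proof (rule Delta_filt_hom_zero[OF U _ _ f(1,2)])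
    fix D g y \<nu> assume *: "\<nu> \<in> {\<alpha>}" "std_mod \<nu> D" "g \<in> homs D (L \<mu>)" "y \<in> S D"
    show "g y = 0"
    proof (rule ccontr)
      assume "g y \<noteq> 0"
      then obtain P p h z where P: "pcover P p (L \<nu>)" "h \<in> homs P (L \<mu>)" "z \<in> S P" "h z \<noteq> 0"
        by (rule std_mod_hom_cover[OF *(2,3,4)]) (rule that)
      have "isom (L \<nu>) (L \<mu>)" using cover_hom_simple[OF P(1) simple_mod_L simple_mod_L P(2-4)] *(1) \<alpha> \<mu> by blast
      then show False using isom_L[OF _ \<mu>] *(1) \<alpha> ne by blast
    qed
  qed (use \<alpha> in auto)
  then show False using f(3) by blast
qed

text \<open>\<open>\<Delta>(\<alpha>)\<close> is projective relative to \<open>factors_le \<alpha>\<close> and has a simple top, which makes it a direct summand of every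
  nonzero summand of a module filtered by \<open>\<Delta>(\<alpha>)\<close>.\<close>

lemma Delta_filt_single_retract:
  assumes U: "Delta_filt {\<alpha>} U" and \<alpha>: "\<alpha> \<in> {1..n}"
  shows "retract W U \<Longrightarrow> Delta_filt {\<alpha>} W"
proof (induction "mdim W" arbitrary: W rule: less_induct)
  case less
  obtain i r where ir: "i \<in> homs W U" "r \<in> homs U W" "\<And>x. x \<in> S W \<Longrightarrow> r (i x) = x" and mW: "md W" and mU: "md U"
    using less.prems unfolding retract_def by blast
  show ?case
  proof (cases "mdim W = 0")
    case True
    then show ?thesis using Delta_filt_zero mW by blast
  next
    case False
    then obtain \<mu> g where g: "\<mu> \<in> {1..n}" "g \<in> homs W (L \<mu>)" "onto W (L \<mu>) g" using ex_L_quotient[OF mW] by blast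
    obtain z where z: "z \<in> S (L \<mu>)" "z \<noteq> 0" using L_nonzero[OF g(1)] nonzero_element by blast
    obtain x where x: "x \<in> S W" "g x = z" using g(3) z(1) unfolding onto_def by blast
    have "g (r (i x)) \<noteq> 0" using ir(3)[OF x(1)] x(2) z(2) by simp
    then have eq: "\<mu> = \<alpha>" using Delta_filt_top[OF U \<alpha> g(1) homs_comp[OF ir(2) g(2)] homs_in[OF ir(1) x(1)]] by blast
    have CU: "factors_le \<alpha> U" using Delta_filt_factors_le[OF U] \<alpha> by simp
    have iinj: "inj_on_mod W i" unfolding inj_on_mod_def using ir(3) hmL(3)[OF ir(2)] by metis
    have CW: "factors_le \<alpha> W" using factors_le_inj[OF CU mW ir(1) iinj] .
    obtain D where D: "std_mod \<alpha> D" using ex_std_mod[OF \<alpha>] by blast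
    show ?thesis
    proof (rule std_mod_presentation[OF D \<alpha>])
      fix r0 assume CD: "factors_le \<alpha> D" and r0: "r0 \<in> homs D (L \<alpha>)" "onto D (L \<alpha>) r0"
        and sup: "\<And>U. smod D U \<Longrightarrow> S (L \<alpha>) \<subseteq> r0 ` U \<Longrightarrow> U = S D"
      obtain N m where N: "ses N D (L \<alpha>) m r0" using ses_kernel[OF std_mod_md[OF D] md_L[OF \<alpha>] r0] by blast
      note N' = sesD[OF N]
      have "Ext1_zero U N"
        using Delta_filt_Ext1_zero[OF U _ N'(1)] std_mod_Ext1_zero[OF _ \<alpha> factors_le_inj[OF CD N'(1,4,6)]] \<alpha> by blast
      moreover have gr: "(\<lambda>x. g (r x)) \<in> homs U (L \<alpha>)" using homs_comp[OF ir(2) g(2)] eq by simp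
      ultimately obtain h where h: "h \<in> homs U D" "\<And>x. x \<in> S U \<Longrightarrow> r0 (h x) = g (r x)"
        using Ext1_zero_lift[OF mU _ N] by blast
      let ?e = "\<lambda>x. h (i x)"
      note e = homs_comp[OF ir(1) h(1)]
      have re: "r0 (?e x) = g x" if "x \<in> S W" for x using h(2)[OF homs_in[OF ir(1) that]] ir(3)[OF that] by simp
      have "S (L \<alpha>) \<subseteq> r0 ` ?e ` S W"
      proof
        fix z assume "z \<in> S (L \<alpha>)"
        then obtain x where "x \<in> S W" "g x = z" using g(3) eq unfolding onto_def by blast
        then show "z \<in> r0 ` ?e ` S W" using re by force
      qed
      then have "?e ` S W = S D" using sup[OF smod_range[OF mW e smod_UNIV[OF mW]]] by blast
      then have eon: "onto W D ?e" unfolding onto_image by simp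
      obtain W' w where W': "ses W' W D w ?e" using ses_kernel[OF mW std_mod_md[OF D] e eon] by blast
      note F = sesD[OF W']
      have "Ext1_zero D W'" using std_mod_Ext1_zero[OF D \<alpha> factors_le_inj[OF CW F(1,4,6)]] .
      then obtain s where s: "s \<in> homs D W" "\<And>x. x \<in> S D \<Longrightarrow> ?e (s x) = x" using Ext1_zero_section[OF _ W'] by blast
      obtain t where t: "t \<in> homs W W'" "\<And>y. y \<in> S W' \<Longrightarrow> t (w y) = y" "\<And>z. z \<in> S W \<Longrightarrow> w (t z) + s (?e z) = z"
        using ses_retraction[OF W' s] by blast
      have "retract W' W" unfolding retract_def using F(1,2,4) t(1,2) by blast
      moreover have "mdim D > 0"
      proof -
        have "mdim (L \<alpha>) \<le> mdim D" using onto_dim[OF r0] .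
        then show ?thesis using L_nonzero[OF \<alpha>] by simp
      qed
      ultimately have "Delta_filt {\<alpha>} W'"
        using less.hyps[OF ses_dim_less[OF W']] retract_trans less.prems by blast
      then show ?thesis using Delta_filt_step[OF W' _ _ D] by blast
    qed
  qed
qed

lemma Delta_filt_empty: "Delta_filt {} X \<Longrightarrow> mdim X = 0"
  by (induction rule: Delta_filt_induct) auto

text \<open>Closure under direct summands, by induction on the largest index. The part
  \<open>U\<close> of \<open>X\<close> filtered by the top standard module cuts out a submodule
  \<open>W\<close> of \<open>Y\<close>, and the retraction restricts to one of \<open>U\<close> onto
  \<open>W\<close> and descends to one of the quotients. The former is handled by
  \<open>Delta_filt_single_retract\<close>, the latter by induction.\<close>

lemma Delta_filt_retract:
  "\<kappa> \<le> n \<Longrightarrow> Delta_filt {1..\<kappa>} X \<Longrightarrow> retract Y X \<Longrightarrow> Delta_filt {1..\<kappa>} Y"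
proof (induction \<kappa> arbitrary: X Y)
  case 0
  obtain i r where "i \<in> homs Y X" "r \<in> homs X Y" "\<forall>x\<in>S Y. r (i x) = x" "md Y" using 0(3) unfolding retract_def by blast
  then have "onto X Y r" using homs_in unfolding onto_def by metis
  then have "mdim Y = 0" using onto_dim[OF \<open>r \<in> homs X Y\<close>] Delta_filt_empty 0(2) by simp
  then show ?case using Delta_filt_zero \<open>md Y\<close> by blast
next
  case (Suc \<kappa>)
  obtain i r where ir: "i \<in> homs Y X" "r \<in> homs X Y" "\<And>x. x \<in> S Y \<Longrightarrow> r (i x) = x" and mY: "md Y" and mX: "md X"
    using Suc.prems(3) unfolding retract_def by blast
  have I: "{1..Suc \<kappa>} \<subseteq> {1..n}" using Suc.prems(1) by auto
  have I1: "{i \<in> {1..Suc \<kappa>}. \<kappa> < i} = {Suc \<kappa>}" and I2: "{i \<in> {1..Suc \<kappa>}. i \<le> \<kappa>} = {1..\<kappa>}" by auto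
  obtain U X' u v where E: "ses U X X' u v" "Delta_filt {Suc \<kappa>} U" "Delta_filt {1..\<kappa>} X'"
    using Delta_filt_reorder[OF Suc.prems(2) I, of \<kappa>] unfolding I1 I2 by blast
  note E' = sesD[OF E(1)]
  have CX: "factors_le \<kappa> X'" using Delta_filt_factors_le[OF E(3)] Suc.prems(1) by auto
  note vi = homs_comp[OF ir(1) E'(5)]
  obtain W w where W: "md W" "w \<in> homs W Y" "inj_on_mod W w" "w ` S W = {y \<in> S Y. v (i y) = 0}"
    using realize_sub[OF mY smod_ker[OF mY E'(3) vi]] by blast
  obtain Z z where F: "ses W Y Z w z" using ses_cokernel[OF W(1) mY W(2,3)] by blast
  note F' = sesD[OF F]
  have "v (i (w x)) = 0" if "x \<in> S W" for x using W(4) that by blast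
  then obtain iW where iW: "iW \<in> homs W U" "\<And>x. x \<in> S W \<Longrightarrow> u (iW x) = i (w x)"
    using ses_factor[OF E(1) homs_comp[OF W(2) ir(1)] W(1)] by blast
  note ru = homs_comp[OF E'(4) ir(2)]
  \<comment> \<open>There are no nonzero maps from \<open>U\<close> to \<open>X'\<close>, as the
    factors of \<open>X'\<close> have smaller index. Hence the idempotent \<open>i r\<close> of
    \<open>X\<close> maps \<open>U\<close> into itself, which lets the retraction respect
    \<open>W\<close>.\<close>
  have U0: "v (i (r (u x))) = 0" if "x \<in> S U" for x
    using Delta_filt_hom_factors_le[OF E(2) _ _ CX homs_comp[OF ru vi] that] Suc.prems(1) by simp
  have zru: "z (r (u x)) = 0" if x: "x \<in> S U" for x
    using F'(9)[OF homs_in[OF ru x]] W(4) U0[OF x] homs_in[OF ru x] by blast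
  then obtain rU where rU: "rU \<in> homs U W" "\<And>x. x \<in> S U \<Longrightarrow> w (rU x) = r (u x)"
    using ses_factor[OF F ru E'(1)] by blast
  have "rU (iW x) = x" if x: "x \<in> S W" for x
  proof (rule inj_on_modD[OF W(2,3) _ x])
    note ix = homs_in[OF iW(1) x]
    show "rU (iW x) \<in> S W" using homs_in[OF rU(1) ix] .
    show "w (rU (iW x)) = w x" using rU(2)[OF ix] iW(2)[OF x] ir(3)[OF homs_in[OF W(2) x]] by simp
  qed
  then have "retract W U" unfolding retract_def using W(1) E'(1) iW(1) rU(1) by blast
  then have W_Delta_filt: "Delta_filt {Suc \<kappa>} W" using Delta_filt_single_retract[OF E(2)] Suc.prems(1) by simp
  have "v (i (w x)) = 0" if "x \<in> S W" for x using W(4) that by blast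
  then obtain iZ where iZ: "iZ \<in> homs Z X'" "\<And>y. y \<in> S Y \<Longrightarrow> iZ (z y) = v (i y)"
    using ses_descend[OF F vi] by blast
  obtain rZ where rZ: "rZ \<in> homs X' Z" "\<And>x. x \<in> S X \<Longrightarrow> rZ (v x) = z (r x)"
    using ses_descend[OF E(1) homs_comp[OF ir(2) F'(5)] zru] by blast
  have "rZ (iZ y) = y" if y: "y \<in> S Z" for y
  proof -
    obtain x where x: "x \<in> S Y" "z x = y" using F'(12)[OF y] by blast
    show ?thesis using iZ(2)[OF x(1)] rZ(2)[OF homs_in[OF ir(1) x(1)]] ir(3)[OF x(1)] x(2) by simp
  qed
  then have "retract Z X'" unfolding retract_def using F'(3) E'(3) iZ(1) rZ(1) by blast
  then have "Delta_filt {1..\<kappa>} Z" using Suc.IH[OF _ E(3)] Suc.prems(1) by simp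
  then have "Delta_filt {1..Suc \<kappa>} Z" by (rule Delta_filt_mono) auto
  moreover have "Delta_filt {1..Suc \<kappa>} W" using W_Delta_filt by (rule Delta_filt_mono) auto
  ultimately show ?case using Delta_filt_ext[OF F] by blast
qed

end

section \<open>Projectives in F(\<Delta>) and a bound on projective dimensions\<close>

locale strongly_stratified = indexed_algebra +
  assumes SSS: "SSS A n L"
begin

text \<open>A projective is a direct summand of a sum of copies of A, and F(\<Delta>) contains A and
  is closed under extensions and summands.\<close>

lemma proj_mod_Delta_filt:
  assumes P: "proj_mod P"
  shows "Delta_filt {1..n} P"
proof -
  note mP = proj_mod_md[OF P]
  have R: "Delta_filt {1..n} (regular A)" using SSS unfolding SSS_def F_Delta_Delta_filt .
  have "Delta_filt {1..n} (dsum (regular A) Q)" if Q: "md Q" "Delta_filt {1..n} Q" for Q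
  proof -
    obtain f g where "ses (regular A) (dsum (regular A) Q) Q f g" using ses_dsum[OF md_regular Q(1)] by blast
    then show ?thesis using Delta_filt_ext R Q(2) by blast
  qed
  then obtain F p where F: "proj_mod F" "Delta_filt {1..n} F" "p \<in> homs F P" "onto F P p"
    using enough_projectives_in[OF mP, of "Delta_filt {1..n}"] Delta_filt_zero by blast
  obtain s where "s \<in> homs P F" "\<And>x. x \<in> S P \<Longrightarrow> p (s x) = x"
    using proj_mod_lift[OF P proj_mod_md[OF F(1)] mP F(3,4) homs_id] by blast
  then have "retract P F" unfolding retract_def using mP proj_mod_md[OF F(1)] F(3) by blast
  then show ?thesis using Delta_filt_retract[OF order_refl F(2)] by blast
qed

text \<open>The reordered filtration of \<open>P\<close> has a submodule \<open>U\<close> with the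
  indices above \<alpha> and a quotient with the others. Maps from \<open>K\<close> to that quotient
  and from \<open>U\<close> to \<open>D\<close> vanish, so \<open>K\<close> and \<open>U\<close> are
  the same submodule of \<open>P\<close>.\<close>

lemma std_mod_kernel_Delta_filt:
  assumes \<alpha>: "\<alpha> \<in> {1..n}" and E: "ses K P D k q" "proj_mod P" and D: "factors_le \<alpha> D"
    and K0: "\<And>Y f x. factors_le \<alpha> Y \<Longrightarrow> f \<in> homs K Y \<Longrightarrow> x \<in> S K \<Longrightarrow> f x = 0"
  shows "Delta_filt {\<alpha><..n} K"
proof -
  note E' = sesD[OF E(1)]
  have I: "{i \<in> {1..n}. \<alpha> < i} = {\<alpha><..n}" using \<alpha> by auto
  have sub: "{\<alpha><..n} \<subseteq> {1..n}" by auto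
  obtain U X u v where F: "ses U P X u v" "Delta_filt {\<alpha><..n} U" "Delta_filt {i \<in> {1..n}. i \<le> \<alpha>} X"
    using Delta_filt_reorder[OF proj_mod_Delta_filt[OF E(2)] order_refl, of \<alpha>] unfolding I by blast
  note F' = sesD[OF F(1)]
  have CX: "factors_le \<alpha> X" using Delta_filt_factors_le[OF F(3)] by blast
  have "v (k x) = 0" if "x \<in> S K" for x using K0[OF CX homs_comp[OF E'(4) F'(5)] that] .
  then obtain a where a: "a \<in> homs K U" "\<And>x. x \<in> S K \<Longrightarrow> u (a x) = k x" using ses_factor[OF F(1) E'(4,1)] by blast
  have "q (u x) = 0" if "x \<in> S U" for x
    using Delta_filt_hom_factors_le[OF F(2) sub _ D homs_comp[OF F'(4) E'(5)] that] by simp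
  then obtain b where b: "b \<in> homs U K" "\<And>x. x \<in> S U \<Longrightarrow> k (b x) = u x" using ses_factor[OF E(1) F'(4,1)] by blast
  have "isom U K"
  proof (rule isom_inverseI[OF F'(1) E'(1) b(1) a(1)])
    show "a (b x) = x" if x: "x \<in> S U" for x
    proof (rule inj_on_modD[OF F'(4,6) _ x])
      show "a (b x) \<in> S U" using homs_in[OF a(1) homs_in[OF b(1) x]] .
      show "u (a (b x)) = u x" using a(2)[OF homs_in[OF b(1) x]] b(2)[OF x] by simp
    qed
    show "b (a x) = x" if x: "x \<in> S K" for x
    proof (rule inj_on_modD[OF E'(4,6) _ x])
      show "b (a x) \<in> S K" using homs_in[OF b(1) homs_in[OF a(1) x]] .
      show "k (b (a x)) = k x" using b(2)[OF homs_in[OF a(1) x]] a(2)[OF x] by simp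
    qed
  qed
  then show ?thesis using Delta_filt_isom[OF F(2)] by blast
qed

lemma Delta_filt_pdle: "m \<le> n \<Longrightarrow> Delta_filt {n - m<..n} X \<Longrightarrow> pdle m X"
proof (induction m arbitrary: X)
  case 0
  then have "Delta_filt {} X" by simp
  then show ?case using proj_mod_zero Delta_filt_empty Delta_filt_md by (auto intro: Delta_filt_md)
next
  case (Suc m)
  show ?case using Suc.prems(2)
  proof (induction rule: Delta_filt_induct)
    case (zero Z)
    then show ?case using proj_mod_pdle proj_mod_zero by blast
  next
    case (step X Y D f g \<alpha>)
    have \<alpha>: "\<alpha> \<in> {1..n}" "{\<alpha><..n} \<subseteq> {n - m<..n}" using step(3) by auto
    have "pdle (Suc m) D"
    proof (rule std_mod_presentation[OF step(4) \<alpha>(1)])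
      fix K P k q assume E: "ses K P D k q" "proj_mod P" "factors_le \<alpha> D"
        and K0: "\<And>Y f x. factors_le \<alpha> Y \<Longrightarrow> f \<in> homs K Y \<Longrightarrow> x \<in> S K \<Longrightarrow> f x = 0"
      have "Delta_filt {\<alpha><..n} K" by (rule std_mod_kernel_Delta_filt[OF \<alpha>(1) E]) (rule K0)
      then have "Delta_filt {n - m<..n} K" using Delta_filt_mono \<alpha>(2) by blast
      then have "pdle m K" using Suc.IH Suc.prems(1) by simp
      then show ?thesis using pdle_SucI[OF E(1,2)] by blast
    qed
    then show ?case using pdle_ext[OF step(1,5)] by blast
  qed
qed

end

section \<open>Universal extensions\<close>

context fd_algebra
begin

lemma homs_sum: "(\<And>i. i \<in> I \<Longrightarrow> f i \<in> homs M N) \<Longrightarrow> (\<lambda>x. \<Sum>i\<in>I. smult (c i) (f i x)) \<in> homs M N"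
proof (induction I rule: infinite_finite_induct)
  case (insert i I)
  have "(\<lambda>x. smult (c i) (f i x) + (\<Sum>i\<in>I. smult (c i) (f i x))) \<in> homs M N"
    using insert by (intro homs_add homs_smult) auto
  then show ?case using insert(1,2) by simp
qed (auto intro: homs_zero)

text \<open>Realises the space of homomorphisms as a subspace of a coordinate space, by concatenating the values on
  the unit vectors.\<close>

definition code :: "'k fmod \<Rightarrow> 'k fmod \<Rightarrow> ('k poly \<Rightarrow> 'k poly) \<Rightarrow> 'k poly" where
  "code K X \<phi> = (\<Sum>c<mdim K. monom 1 (c * mdim X) * \<phi> (unit c))"

lemma coeff_code:
  assumes \<phi>: "\<phi> \<in> homs K X" and c: "c < mdim K" and i: "i < mdim X"
  shows "coeff (code K X \<phi>) (c * mdim X + i) = coeff (\<phi> (unit c)) i"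
proof -
  let ?b = "mdim X"
  have "coeff (monom 1 (c' * ?b) * \<phi> (unit c')) (c * ?b + i) = (if c' = c then coeff (\<phi> (unit c)) i else 0)"
    if c': "c' < mdim K" for c'
  proof -
    consider "c' < c" | "c' = c" | "c < c'" by linarith
    then show ?thesis
    proof cases
      case 1
      have "Suc c' * ?b \<le> c * ?b" using 1 by (intro mult_le_mono1) simp
      then have "c' * ?b + ?b \<le> c * ?b + i" by simp
      moreover have "\<phi> (unit c') \<in> S X" using homs_in[OF \<phi>] c' by blast
      ultimately show ?thesis using 1 by (simp add: coeff_monom_mult Sp_def)
    next
      case 2
      then show ?thesis by (simp add: coeff_monom_mult)
    next
      case 3
      have "Suc c * ?b \<le> c' * ?b" using 3 by (intro mult_le_mono1) simp
      then have "c * ?b + i < c' * ?b" using i by simp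
      then show ?thesis using 3 by (simp add: coeff_monom_mult)
    qed
  qed
  then show ?thesis using c by (simp add: code_def coeff_sum)
qed

lemma code_Sp:
  assumes "\<phi> \<in> homs K X"
  shows "code K X \<phi> \<in> Sp (mdim K * mdim X)"
  unfolding code_def
proof (rule subsp_sum[OF subsp_Sp])
  fix c assume "c \<in> {..<mdim K}"
  then have c: "Suc c * mdim X \<le> mdim K * mdim X" by (intro mult_le_mono1) simp
  have "\<phi> (unit c) \<in> S X" using homs_in[OF assms] \<open>c \<in> {..<mdim K}\<close> by blast
  then show "monom 1 (c * mdim X) * \<phi> (unit c) \<in> Sp (mdim K * mdim X)"
    using c by (auto simp: Sp_def coeff_monom_mult)
qed

lemma code_sum: "code K X (\<lambda>x. \<Sum>i\<in>I. smult (c i) (f i x)) = (\<Sum>i\<in>I. smult (c i) (code K X (f i)))"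
  unfolding code_def smult_sum_right sum_distrib_left
  by (subst sum.swap) (simp add: mult_smult_right)

lemma code_inj:
  assumes \<phi>: "\<phi> \<in> homs K X" and \<psi>: "\<psi> \<in> homs K X" and eq: "code K X \<phi> = code K X \<psi>" and x: "x \<in> S K"
  shows "\<phi> x = \<psi> x"
proof (rule lin_eqI[OF homs_lin[OF \<phi>] homs_lin[OF \<psi>] _ x])
  fix c assume c: "c < mdim K"
  then have S: "\<phi> (unit c) \<in> S X" "\<psi> (unit c) \<in> S X" using homs_in[OF \<phi>] homs_in[OF \<psi>] by auto
  show "\<phi> (unit c) = \<psi> (unit c)"
  proof (rule poly_eqI)
    fix i
    show "coeff (\<phi> (unit c)) i = coeff (\<psi> (unit c)) i"
      using coeff_code[OF \<phi> c, of i] coeff_code[OF \<psi> c, of i] eq S by (cases "i < mdim X") (auto simp: Sp_def)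
  qed
qed

text \<open>Finite dimension of Hom(K, X): a basis of the subspace of codes yields the spanning
  family, and injectivity of \<open>code\<close> on homomorphisms turns equations of codes into
  equations of maps.\<close>

lemma homs_generators:
  obtains r :: nat and \<phi>s where "\<And>i. i < r \<Longrightarrow> \<phi>s i \<in> homs K X"
    "\<And>\<phi>. \<phi> \<in> homs K X \<Longrightarrow> \<exists>c. \<forall>x\<in>S K. \<phi> x = (\<Sum>i<r. smult (c i) (\<phi>s i x))"
proof -
  let ?m = "mdim K * mdim X" and ?H = "code K X ` homs K X"
  have 0: "code K X (\<lambda>x. 0) = 0" by (simp add: code_def)
  have add: "code K X (\<lambda>x. f x + g x) = code K X f + code K X g" for f g
    by (simp add: code_def distrib_left sum.distrib)
  have simple_mod: "code K X (\<lambda>x. smult c (f x)) = smult c (code K X f)" for f c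
    by (simp add: code_def smult_sum_right mult_smult_right)
  have sub: "subsp ?H" unfolding subsp_def
  proof (intro conjI ballI allI)
    show "0 \<in> ?H" using imageI[OF homs_zero, of "code K X"] unfolding 0 .
    show "x + y \<in> ?H" if xy: "x \<in> ?H" "y \<in> ?H" for x y
    proof -
      obtain f g where fg: "f \<in> homs K X" "x = code K X f" "g \<in> homs K X" "y = code K X g" using xy by blast
      show ?thesis using imageI[OF homs_add[OF fg(1,3)], of "code K X"] unfolding add fg(2,4) .
    qed
    show "smult c x \<in> ?H" if x: "x \<in> ?H" for c x
    proof -
      obtain f where f: "f \<in> homs K X" "x = code K X f" using x by blast
      show ?thesis using imageI[OF homs_smult[OF f(1)], of "code K X"] unfolding simple_mod f(2) .
    qed
  qed
  have "?H \<subseteq> Sp ?m" using code_Sp by blast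
  from subspace_split[OF sub this]
  obtain r j l where j: "lin j" "\<forall>x\<in>Sp r. j x \<in> ?H \<and> l (j x) = x" "\<forall>u\<in>?H. l u \<in> Sp r \<and> j (l u) = u" by blast
  have "\<forall>i. \<exists>\<phi>. i < r \<longrightarrow> \<phi> \<in> homs K X \<and> code K X \<phi> = j (unit i)"
    using j(2) unit_Sp by (metis imageE)
  then obtain \<phi>s where \<phi>s: "\<And>i. i < r \<Longrightarrow> \<phi>s i \<in> homs K X \<and> code K X (\<phi>s i) = j (unit i)" by metis
  have "\<exists>c. \<forall>x\<in>S K. \<phi> x = (\<Sum>i<r. smult (c i) (\<phi>s i x))" if \<phi>: "\<phi> \<in> homs K X" for \<phi>
  proof -
    let ?x = "l (code K X \<phi>)"
    have x: "?x \<in> Sp r" "j ?x = code K X \<phi>" using j(3) \<phi> by auto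
    let ?\<psi> = "\<lambda>x. \<Sum>i<r. smult (coeff ?x i) (\<phi>s i x)"
    have \<psi>: "?\<psi> \<in> homs K X" by (rule homs_sum) (use \<phi>s in auto)
    have "code K X \<phi> = lincomb r (\<lambda>i. j (unit i)) ?x" using lin_eq_lincomb[OF j(1) x(1)] x(2) by simp
    also have "\<dots> = code K X ?\<psi>" unfolding code_sum lincomb_def using \<phi>s by (intro sum.cong) auto
    finally have eq: "code K X \<phi> = code K X ?\<psi>" .
    have "\<forall>x\<in>S K. \<phi> x = ?\<psi> x" using code_inj[OF \<phi> \<psi> eq] by blast
    then show ?thesis by (rule exI[of _ "coeff ?x"])
  qed
  then show ?thesis using that[of r \<phi>s] \<phi>s by blast
qed

end

context indexed_algebra
begin

text \<open>Each of the \<open>r\<close> maps is made extendable to \<open>P\<close> by a pushout of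
  the presentation of \<Delta>(\<alpha>), at the price of one further \<Delta>(\<alpha>) in the
  cokernel \<open>N\<close>. Extensions found before survive composition with the new
  embedding.\<close>

lemma push_out_homs:
  fixes r :: nat
  assumes D: "std_mod \<alpha> D" and E: "ses K P D k q" and X: "md X" and \<phi>: "\<And>i. i < r \<Longrightarrow> \<phi>s i \<in> homs K X"
  shows "\<exists>X' N j c. ses X X' N j c \<and> Delta_filt {\<alpha>} N \<and> (\<forall>i<r. \<exists>\<psi>\<in>homs P X'. \<forall>x\<in>S K. \<psi> (k x) = j (\<phi>s i x))"
  using \<phi>
proof (induction r)
  case 0
  obtain Z where Z: "md Z" "mdim Z = 0" using zero_mod by blast
  have "ses X X Z (\<lambda>x. x) (\<lambda>x. 0)" using X Z homs_id homs_zero by (intro sesI) auto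
  then show ?case using Delta_filt_zero[OF Z] by blast
next
  case (Suc r)
  obtain X' N j c where IH: "ses X X' N j c" "Delta_filt {\<alpha>} N"
    "\<forall>i<r. \<exists>\<psi>\<in>homs P X'. \<forall>x\<in>S K. \<psi> (k x) = j (\<phi>s i x)"
    using Suc.IH[OF Suc.prems[OF less_SucI]] by blast
  note F = sesD[OF IH(1)]
  have \<phi>: "\<phi>s r \<in> homs K X" using Suc.prems by simp
  obtain X'' j' c' \<psi> where Q: "ses X' X'' D j' c'" "\<psi> \<in> homs P X''"
    "\<And>x. x \<in> S K \<Longrightarrow> \<psi> (k x) = j' (j (\<phi>s r x))" "\<And>x. x \<in> S P \<Longrightarrow> c' (\<psi> x) = q x"
    using ses_pushout[OF E F(2) homs_comp[OF \<phi> F(4)]] by blast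
  note Q' = sesD[OF Q(1)]
  obtain R e u v where R: "ses X X'' R (\<lambda>x. j' (j x)) e" "ses N R D u v"
    by (rule ses_third_iso[OF IH(1) Q(1)]) (rule that)
  have "\<exists>\<psi>\<in>homs P X''. \<forall>x\<in>S K. \<psi> (k x) = j' (j (\<phi>s i x))" if "i < Suc r" for i
  proof (cases "i = r")
    case True
    then show ?thesis using Q(2,3) by blast
  next
    case False
    then have "i < r" using that by simp
    then obtain \<chi> where \<chi>: "\<chi> \<in> homs P X'" "\<forall>x\<in>S K. \<chi> (k x) = j (\<phi>s i x)" using IH(3) by blast
    then have "\<forall>x\<in>S K. j' (\<chi> (k x)) = j' (j (\<phi>s i x))" by simp
    then show ?thesis by (intro bexI[OF _ homs_comp[OF \<chi>(1) Q'(4)]])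
  qed
  moreover have "Delta_filt {\<alpha>} R" using Delta_filt_step[OF R(2) IH(2) _ D] by blast
  ultimately show ?case using R(1) by blast
qed

text \<open>A map from \<open>K\<close> to \<open>X'\<close> can be corrected, through
  Ext^1(\<Delta>(\<alpha>), N) = 0, so that its values lie in \<open>X\<close>. There it is a
  combination of the generators of Hom(K, X), each of which extends to \<open>P\<close> with values
  in \<open>X'\<close>.\<close>

lemma universal_extension:
  assumes D: "std_mod \<alpha> D" "\<alpha> \<in> {1..n}" and X: "md X"
  obtains X' N j c where "ses X X' N j c" "Delta_filt {\<alpha>} N" "Ext1_zero D X'"
proof (rule std_mod_presentation[OF D])
  fix K P k q assume E: "ses K P D k q" "proj_mod P"
  note E' = sesD[OF E(1)]
  show ?thesis
  proof (rule homs_generators[of K X])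
    fix r :: nat and \<phi>s assume \<phi>s: "\<And>i. i < r \<Longrightarrow> \<phi>s i \<in> homs K X"
      and gen: "\<And>\<phi>. \<phi> \<in> homs K X \<Longrightarrow> \<exists>c. \<forall>x\<in>S K. \<phi> x = (\<Sum>i<r. smult (c i) (\<phi>s i x))"
    obtain X' N j c where F: "ses X X' N j c" "Delta_filt {\<alpha>} N"
      and ex: "\<forall>i<r. \<exists>\<psi>\<in>homs P X'. \<forall>x\<in>S K. \<psi> (k x) = j (\<phi>s i x)"
      using push_out_homs[OF D(1) E(1) X, of r \<phi>s] \<phi>s by blast
    note F' = sesD[OF F(1)]
    obtain \<psi>s where \<psi>s: "\<And>i. i < r \<Longrightarrow> \<psi>s i \<in> homs P X' \<and> (\<forall>x\<in>S K. \<psi>s i (k x) = j (\<phi>s i x))"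
      using ex by metis
    have "factors_le \<alpha> N" using Delta_filt_factors_le[OF F(2)] D(2) by simp
    then have EN: "Ext1_zero D N" using std_mod_Ext1_zero[OF D] by blast
    have "Ext1_zero D X'"
    proof (rule Ext1_zero_I[OF E])
      fix \<phi> assume \<phi>: "\<phi> \<in> homs K X'"
      obtain \<chi> where \<chi>: "\<chi> \<in> homs P N" "\<And>x. x \<in> S K \<Longrightarrow> \<chi> (k x) = c (\<phi> x)"
        using Ext1_zero_extend[OF EN E(1) F'(3) homs_comp[OF \<phi> F'(5)]] by blast
      obtain h where h: "h \<in> homs P X'" "\<And>x. x \<in> S P \<Longrightarrow> c (h x) = \<chi> x"
        using proj_mod_lift[OF E(2) F'(2,3,5,7) \<chi>(1)] by blast
      have d: "(\<lambda>x. \<phi> x - h (k x)) \<in> homs K X'" using homs_diff[OF \<phi> homs_comp[OF E'(4) h(1)]] .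
      have "c (\<phi> x - h (k x)) = 0" if "x \<in> S K" for x
        using \<chi>(2)[OF that] h(2)[OF homs_in[OF E'(4) that]] by (simp add: hmL[OF F'(5)])
      then obtain t where t: "t \<in> homs K X" "\<And>x. x \<in> S K \<Longrightarrow> j (t x) = \<phi> x - h (k x)"
        using ses_factor[OF F(1) d E'(1)] by blast
      obtain a where a: "\<forall>x\<in>S K. t x = (\<Sum>i<r. smult (a i) (\<phi>s i x))" using gen[OF t(1)] by blast
      let ?\<psi> = "\<lambda>x. h x + (\<Sum>i<r. smult (a i) (\<psi>s i x))"
      have \<psi>: "?\<psi> \<in> homs P X'" by (intro homs_add h(1) homs_sum) (use \<psi>s in auto)
      have "?\<psi> (k x) = \<phi> x" if x: "x \<in> S K" for x
      proof -
        have "(\<Sum>i<r. smult (a i) (\<psi>s i (k x))) = (\<Sum>i<r. j (smult (a i) (\<phi>s i x)))"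
          using \<psi>s x by (intro sum.cong) (auto simp: hmL[OF F'(4)])
        also have "\<dots> = j (t x)" using a x by (simp add: lin_sum[OF homs_lin[OF F'(4)]])
        finally show ?thesis using t(2)[OF x] by simp
      qed
      then show "\<exists>\<psi>\<in>homs P X'. \<forall>x\<in>S K. \<psi> (k x) = \<phi> x" by (intro bexI[OF _ \<psi>] ballI)
    qed
    then show ?thesis using that F by blast
  qed
qed

text \<open>A fixed representative for each index in \<open>{1..n}\<close>, so that vanishing
  conditions can be quantified over indices.\<close>

definition Delta :: "nat \<Rightarrow> 'k fmod" where
  "Delta \<alpha> = (SOME D. std_mod \<alpha> D)"

lemma std_mod_Delta: "\<alpha> \<in> {1..n} \<Longrightarrow> std_mod \<alpha> (Delta \<alpha>)"
  unfolding Delta_def by (rule ex_std_mod) (auto intro: someI)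

lemma Delta_extension:
  assumes X: "md X"
  shows "m \<le> n \<Longrightarrow> \<exists>Y N j c. ses X Y N j c \<and> Delta_filt {1..n} N \<and> (\<forall>\<mu>\<in>{n - m<..n}. Ext1_zero (Delta \<mu>) Y)"
proof (induction m)
  case 0
  obtain Z where Z: "md Z" "mdim Z = 0" using zero_mod by blast
  have "ses X X Z (\<lambda>x. x) (\<lambda>x. 0)" using X Z homs_id homs_zero by (intro sesI) auto
  then show ?case using Delta_filt_zero[OF Z] by auto
next
  case (Suc m)
  obtain Y N j c where Y: "ses X Y N j c" "Delta_filt {1..n} N" "\<forall>\<mu>\<in>{n - m<..n}. Ext1_zero (Delta \<mu>) Y"
    using Suc by auto
  let ?\<alpha> = "n - m"
  have \<alpha>: "?\<alpha> \<in> {1..n}" using Suc.prems by auto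
  obtain Y' N' j' c' where Y': "ses Y Y' N' j' c'" "Delta_filt {?\<alpha>} N'" "Ext1_zero (Delta ?\<alpha>) Y'"
    using universal_extension[OF std_mod_Delta[OF \<alpha>] \<alpha> sesD(2)[OF Y(1)]] by blast
  obtain R e u v where R: "ses X Y' R (\<lambda>x. j' (j x)) e" "ses N R N' u v"
    by (rule ses_third_iso[OF Y(1) Y'(1)]) (rule that)
  have "Delta_filt {1..n} N'" using Delta_filt_mono[OF Y'(2)] \<alpha> by blast
  then have "Delta_filt {1..n} R" using Delta_filt_ext[OF R(2) Y(2)] by blast
  moreover have "Ext1_zero (Delta \<mu>) Y'" if \<mu>: "\<mu> \<in> {n - Suc m<..n}" for \<mu>
  proof (cases "\<mu> = ?\<alpha>")
    case True
    then show ?thesis using Y'(3) by simp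
  next
    case False
    then have \<mu>': "\<mu> \<in> {n - m<..n}" "\<mu> \<in> {1..n}" using \<mu> by auto
    \<comment> \<open>The reason for decreasing indices: \<open>N'\<close> is filtered by
      \<Delta>(\<alpha>) with \<alpha> \<le> \<mu>, so \<Delta>(\<mu>) has no extensions by it and
      the vanishing for \<open>Y\<close> passes to \<open>Y'\<close>.\<close>
    have "factors_le \<mu> N'" using Delta_filt_factors_le[OF Y'(2), of \<mu>] \<alpha> \<mu>' by simp
    then have "Ext1_zero (Delta \<mu>) N'" using std_mod_Ext1_zero[OF std_mod_Delta[OF \<mu>'(2)] \<mu>'(2)] by blast
    then show ?thesis using Ext1_zero_ext_right[OF std_mod_md[OF std_mod_Delta[OF \<mu>'(2)]] Y'(1)] Y(3) \<mu>'(1) by blast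
  qed
  ultimately show ?case using R(1) by blast
qed

end

section \<open>Proper costandard modules\<close>

context fd_algebra
begin

lemma sqiso_isom:
  assumes M: "md M" and U: "submod A M U" and W: "submod A M W" and UW: "U \<subseteq> W"
    and N: "md N" "sqiso A M U W N" and N': "md N'" "sqiso A M U W N'"
  shows "isom N N'"
proof -
  let ?U = "pv ` U" and ?W = "pv ` W"
  have eq: "vs M ?U = U" "vs M ?W = W" using vc_pv_image[OF submod_carrier] U W by auto
  have s: "sqiso A M (vs M ?U) (vs M ?W) N" "sqiso A M (vs M ?U) (vs M ?W) N'" using N(2) N'(2) eq by auto
  obtain B j where B: "md B" "j \<in> homs B M" "inj_on_mod B j" "j ` S B = ?W"
    using realize_sub[OF M submod_pv[OF M W]] by blast
  have sub: "?U \<subseteq> ?W" using UW by blast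
  obtain g where g: "g \<in> homs B N" "onto B N g" "\<And>x. x \<in> S B \<Longrightarrow> g x = 0 \<longleftrightarrow> j x \<in> ?U"
    by (rule sqiso_map[OF s(1) sub M B(1) N(1) B(2,4)]) (rule that)
  obtain h where h: "h \<in> homs B N'" "onto B N' h" "\<And>x. x \<in> S B \<Longrightarrow> h x = 0 \<longleftrightarrow> j x \<in> ?U"
    by (rule sqiso_map[OF s(2) sub M B(1) N'(1) B(2,4)]) (rule that)
  have gh: "g x = 0 \<longleftrightarrow> h x = 0" if "x \<in> S B" for x using g(3)[OF that] h(3)[OF that] by simp
  obtain a where a: "a \<in> homs N N'" "\<And>x. x \<in> S B \<Longrightarrow> a (g x) = h x"
    using descend[OF B(1) h(1) g(1,2)] gh by blast
  show ?thesis
  proof (rule isomI[OF N(1) N'(1) a(1)])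
    show "inj_on_mod N a" unfolding inj_on_mod_def
    proof (intro ballI impI)
      fix y assume y: "y \<in> S N" "a y = 0"
      obtain x where x: "x \<in> S B" "g x = y" using g(2) y(1) unfolding onto_def by blast
      then show "y = 0" using a(2)[OF x(1)] y(2) gh[OF x(1)] by simp
    qed
    show "onto N N' a" unfolding onto_def
    proof
      fix y assume "y \<in> S N'"
      then obtain x where x: "x \<in> S B" "h x = y" using h(2) unfolding onto_def by blast
      then show "\<exists>x\<in>S N. a x = y" using a(2)[OF x(1)] homs_in[OF g(1) x(1)] by blast
    qed
  qed
qed

text \<open>Like \<open>subchain\<close>, but with free ends and with the class of subquotients
  built in. A chain may thus start above zero and be prolonged at the top.\<close>

definition chain :: "'k fmod \<Rightarrow> ('k fmod \<Rightarrow> bool) \<Rightarrow> 'k vec set list \<Rightarrow> bool" where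
  "chain M C us \<longleftrightarrow> us \<noteq> [] \<and> (\<forall>i<length us. submod A M (us ! i)) \<and>
     (\<forall>i. Suc i < length us \<longrightarrow> us ! i \<subseteq> us ! Suc i \<and> (\<exists>N. C N \<and> sqiso A M (us ! i) (us ! Suc i) N))"

lemma chain_single: "submod A M U \<Longrightarrow> chain M C [U]"
  by (simp add: chain_def)

lemma chain_snoc:
  assumes "chain M C us" "submod A M W" "last us \<subseteq> W" "C N" "sqiso A M (last us) W N"
  shows "chain M C (us @ [W])"
proof -
  have "(us @ [W]) ! i \<subseteq> (us @ [W]) ! Suc i \<and> (\<exists>N. C N \<and> sqiso A M ((us @ [W]) ! i) ((us @ [W]) ! Suc i) N)"
    if "Suc i < length (us @ [W])" for i
  proof (cases "Suc i < length us")
    case True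
    then show ?thesis using assms(1) unfolding chain_def by (simp add: nth_append)
  next
    case False
    then have i: "Suc i = length us" using that by simp
    then have "us ! i = last us" using assms(1) unfolding chain_def by (simp add: last_conv_nth flip: i)
    then show ?thesis using i assms(3-5) by (auto simp: nth_append)
  qed
  then show ?thesis using assms(1,2) unfolding chain_def by (auto simp: nth_append less_Suc_eq)
qed

end

context indexed_algebra
begin

lemma factors_le_chain:
  assumes I: "md I"
  shows "factors_le \<kappa> Q \<Longrightarrow> md B \<Longrightarrow> j \<in> homs B I \<Longrightarrow> inj_on_mod B j \<Longrightarrow> q \<in> homs B Q \<Longrightarrow> onto B Q q \<Longrightarrow>
    \<exists>us. chain I (\<lambda>N. \<exists>\<mu>\<in>{1..n}. \<mu> \<le> \<kappa> \<and> N = L \<mu>) us \<and> hd us = vs I (j ` {x \<in> S B. q x = 0}) \<and> last us = vs I (j ` S B)"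
proof (induction "mdim Q" arbitrary: Q B j q rule: less_induct)
  case less
  note CQ = less.prems(1) and B = less.prems(2) and j = less.prems(3,4) and q = less.prems(5,6)
  note mQ = factors_le_md[OF CQ]
  have sub: "submod A I (vs I (j ` S B))"
    using smod_range[OF B j(1) smod_UNIV[OF B]] submod_vs[OF I smodD(1)] by blast
  show ?case
  proof (cases "mdim Q = 0")
    case True
    have "{x \<in> S B. q x = 0} = S B" using homs_in[OF q(1)] True by auto
    then show ?thesis using chain_single[OF sub] by (intro exI[of _ "[vs I (j ` S B)]"]) simp
  next
    case False
    then obtain \<mu> g where \<mu>: "\<mu> \<in> {1..n}" "g \<in> homs Q (L \<mu>)" "onto Q (L \<mu>) g" using ex_L_quotient[OF mQ] by blast
    obtain K k where E: "ses K Q (L \<mu>) k g" using ses_kernel[OF mQ md_L[OF \<mu>(1)] \<mu>(2,3)] by blast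
    note E' = sesD[OF E]
    have le: "\<mu> \<le> \<kappa>" using factors_le_onto[OF CQ md_L[OF \<mu>(1)] \<mu>(2,3)] factors_le_L[OF \<mu>(1)] by blast
    have gq: "(\<lambda>x. g (q x)) \<in> homs B (L \<mu>)" using homs_comp[OF q(1) \<mu>(2)] .
    have gqo: "onto B (L \<mu>) (\<lambda>x. g (q x))" using q(2) \<mu>(3) unfolding onto_def by metis
    obtain B' b where F: "ses B' B (L \<mu>) b (\<lambda>x. g (q x))" using ses_kernel[OF B md_L[OF \<mu>(1)] gq gqo] by blast
    note F' = sesD[OF F]
    obtain q' where q': "q' \<in> homs B' K" "\<And>x. x \<in> S B' \<Longrightarrow> k (q' x) = q (b x)"
      using ses_factor[OF E homs_comp[OF F'(4) q(1)] F'(1) F'(8)] by blast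
    have q'o: "onto B' K q'" unfolding onto_def
    proof
      fix x assume x: "x \<in> S K"
      obtain y where y: "y \<in> S B" "q y = k x" using q(2) homs_in[OF E'(4) x] unfolding onto_def by blast
      have "g (q y) = 0" using y(2) E'(8)[OF x] by simp
      then obtain z where z: "z \<in> S B'" "b z = y" using F'(10)[OF y(1)] by blast
      have "k (q' z) = k x" using q'(2)[OF z(1)] z(2) y(2) by simp
      then show "\<exists>z\<in>S B'. q' z = x" using inj_on_modD[OF E'(4,6) homs_in[OF q'(1) z(1)] x] z(1) by blast
    qed
    have jb: "(\<lambda>x. j (b x)) \<in> homs B' I" using homs_comp[OF F'(4) j(1)] .
    have jbi: "inj_on_mod B' (\<lambda>x. j (b x))"
      using j(2) F'(11) homs_in[OF F'(4)] unfolding inj_on_mod_def by blast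
    obtain us where us: "chain I (\<lambda>N. \<exists>\<mu>\<in>{1..n}. \<mu> \<le> \<kappa> \<and> N = L \<mu>) us"
      "hd us = vs I ((\<lambda>x. j (b x)) ` {x \<in> S B'. q' x = 0})" "last us = vs I ((\<lambda>x. j (b x)) ` S B')"
      using less.hyps[OF ses_dim_less[OF E L_nonzero[OF \<mu>(1)]] factors_le_inj[OF CQ E'(1,4,6)] F'(1) jb jbi q'(1) q'o] by blast
    have bi: "b ` {x \<in> S B'. q' x = 0} = {x \<in> S B. q x = 0}"
    proof (intro equalityI subsetI)
      fix y assume "y \<in> b ` {x \<in> S B'. q' x = 0}"
      then obtain x where x: "x \<in> S B'" "q' x = 0" "y = b x" by blast
      then show "y \<in> {x \<in> S B. q x = 0}" using q'(2)[OF x(1)] hmL(3)[OF E'(4)] homs_in[OF F'(4) x(1)] by simp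
    next
      fix y assume "y \<in> {x \<in> S B. q x = 0}"
      then have y: "y \<in> S B" "q y = 0" by auto
      then have "g (q y) = 0" using hmL(3)[OF E'(5)] by simp
      then obtain x where x: "x \<in> S B'" "b x = y" using F'(10)[OF y(1)] by blast
      then have "q' x = 0" using q'(2)[OF x(1)] y(2) E'(11)[OF homs_in[OF q'(1) x(1)]] by simp
      then show "y \<in> b ` {x \<in> S B'. q' x = 0}" using x by blast
    qed
    have hd: "hd us = vs I (j ` {x \<in> S B. q x = 0})" unfolding us(2) bi[symmetric] by (simp only: image_image)
    have ker: "{x \<in> S B. g (q x) = 0} = b ` S B'" using F'(9) homs_in[OF F'(4)] by blast
    have last: "last us = vs I (j ` b ` S B')" unfolding us(3) by (simp only: image_image)
    have "sqiso A I (last us) (vs I (j ` S B)) (L \<mu>)"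
      using sqiso_of[OF I B md_L[OF \<mu>(1)] j gq gqo] unfolding ker last .
    moreover have "last us \<subseteq> vs I (j ` S B)" unfolding last using homs_in[OF F'(4)] by blast
    ultimately have "chain I (\<lambda>N. \<exists>\<mu>\<in>{1..n}. \<mu> \<le> \<kappa> \<and> N = L \<mu>) (us @ [vs I (j ` S B)])"
      using chain_snoc[OF us(1) sub] \<mu>(1) le by blast
    moreover have "us \<noteq> []" using us(1) by (simp add: chain_def)
    ultimately show ?thesis using hd by (intro exI[of _ "us @ [vs I (j ` S B)]"]) simp
  qed
qed

section \<open>The largest good submodule of an injective envelope\<close>

context
  fixes \<alpha> I i
  assumes \<alpha>: "\<alpha> \<in> {1..n}" and env: "envelope I i (L \<alpha>)"
begin

abbreviation socle :: "'k poly set" where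
  "socle \<equiv> i ` S (L \<alpha>)"

text \<open>\<open>good U\<close> says that \<open>U\<close> contains the socle of \<open>I(\<alpha>)\<close> and that the composition factors of the quotient by
  the socle are \<open>L \<mu>\<close> with \<open>\<mu> < \<alpha>\<close>.\<close>

definition good :: "'k poly set \<Rightarrow> bool" where
  "good U \<longleftrightarrow> smod I U \<and> socle \<subseteq> U \<and> (\<forall>\<nu> P p f. \<alpha> \<le> \<nu> \<longrightarrow> \<nu> \<le> n \<longrightarrow> pcover P p (L \<nu>) \<longrightarrow> f \<in> homs P I \<longrightarrow>
     f ` S P \<subseteq> U \<longrightarrow> f ` S P \<subseteq> socle)"

lemma goodD:
  assumes "good U"
  shows "smod I U" "socle \<subseteq> U"
    "\<alpha> \<le> \<nu> \<Longrightarrow> \<nu> \<le> n \<Longrightarrow> pcover P p (L \<nu>) \<Longrightarrow> f \<in> homs P I \<Longrightarrow> f ` S P \<subseteq> U \<Longrightarrow> f ` S P \<subseteq> socle"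
  using assms unfolding good_def by blast+

lemmas I = ieD[OF env]

lemma socle_smod: "smod I socle"
  using smod_range[OF I(3,4) smod_UNIV[OF I(3)]] .

lemma good_socle: "good socle"
  unfolding good_def using socle_smod by blast

text \<open>A map from P(\<nu>) into the sum of \<open>U\<close> and \<open>W\<close> lifts by
  projectivity to their direct sum. Both components have their image in the socle, hence so has the
  map.\<close>

lemma good_sum:
  assumes U: "good U" and W: "good W"
  obtains T where "good T" "U \<subseteq> T" "W \<subseteq> T"
proof -
  note U' = goodD[OF U] and W' = goodD[OF W]
  obtain B1 j1 where B1: "md B1" "j1 \<in> homs B1 I" "inj_on_mod B1 j1" "j1 ` S B1 = U"
    using realize_sub[OF I(2) U'(1)] by blast
  obtain B2 j2 where B2: "md B2" "j2 \<in> homs B2 I" "inj_on_mod B2 j2" "j2 ` S B2 = W"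
    using realize_sub[OF I(2) W'(1)] by blast
  let ?D = "dsum B1 B2"
  obtain i1 i2 p1 p2 where D: "md ?D"
    "i1 \<in> homs B1 ?D" "i2 \<in> homs B2 ?D" "p1 \<in> homs ?D B1" "p2 \<in> homs ?D B2"
    "\<And>x. x \<in> S B1 \<Longrightarrow> p1 (i1 x) = x" "\<And>x. x \<in> S B1 \<Longrightarrow> p2 (i1 x) = 0"
    "\<And>y. y \<in> S B2 \<Longrightarrow> p2 (i2 y) = y" "\<And>y. y \<in> S B2 \<Longrightarrow> p1 (i2 y) = 0"
    "\<And>z. z \<in> S ?D \<Longrightarrow> i1 (p1 z) + i2 (p2 z) = z"
    using dsum_maps[OF B1(1) B2(1)] by blast
  let ?m = "\<lambda>z. j1 (p1 z) + j2 (p2 z)"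
  have m: "?m \<in> homs ?D I" using homs_add[OF homs_comp[OF D(4) B1(2)] homs_comp[OF D(5) B2(2)]] .
  have sT: "smod I (?m ` S ?D)" using smod_range[OF D(1) m smod_UNIV[OF D(1)]] .
  have UT: "U \<subseteq> ?m ` S ?D"
  proof
    fix u assume "u \<in> U"
    then obtain x where x: "x \<in> S B1" "j1 x = u" using B1(4) by blast
    then have "u = ?m (i1 x)" using D(6,7)[OF x(1)] hmL(3)[OF B2(2)] by simp
    then show "u \<in> ?m ` S ?D" using homs_in[OF D(2) x(1)] by (rule image_eqI)
  qed
  have WT: "W \<subseteq> ?m ` S ?D"
  proof
    fix u assume "u \<in> W"
    then obtain x where x: "x \<in> S B2" "j2 x = u" using B2(4) by blast
    then have "u = ?m (i2 x)" using D(8,9)[OF x(1)] hmL(3)[OF B1(2)] by simp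
    then show "u \<in> ?m ` S ?D" using homs_in[OF D(3) x(1)] by (rule image_eqI)
  qed
  have "f ` S P \<subseteq> socle"
    if f: "\<alpha> \<le> \<nu>" "\<nu> \<le> n" "pcover P p (L \<nu>)" "f \<in> homs P I" "f ` S P \<subseteq> ?m ` S ?D" for \<nu> P p f
  proof -
    note mP = pcD(2)[OF f(3)]
    obtain M w where M: "md M" "w \<in> homs M I" "inj_on_mod M w" "w ` S M = ?m ` S ?D"
      using realize_sub[OF I(2) sT] by blast
    have "?m z \<in> w ` S M" if "z \<in> S ?D" for z unfolding M(4) using that by (rule imageI)
    then obtain m' where m': "m' \<in> homs ?D M" "\<And>z. z \<in> S ?D \<Longrightarrow> w (m' z) = ?m z"
      using corestrict[OF m M(2,3) D(1) M(1)] by blast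
    have "f x \<in> w ` S M" if "x \<in> S P" for x unfolding M(4) using that f(5) by blast
    then obtain f' where f': "f' \<in> homs P M" "\<And>x. x \<in> S P \<Longrightarrow> w (f' x) = f x"
      using corestrict[OF f(4) M(2,3) mP M(1)] by blast
    have on: "onto ?D M m'" unfolding onto_def
    proof
      fix y assume y: "y \<in> S M"
      have "w y \<in> ?m ` S ?D" unfolding M(4)[symmetric] using y by (rule imageI)
      then obtain z where z: "z \<in> S ?D" "w y = ?m z" by blast
      have "w (m' z) = w y" using m'(2)[OF z(1)] z(2) by simp
      then have "m' z = y" using inj_on_modD[OF M(2,3) homs_in[OF m'(1) z(1)] y] by blast
      then show "\<exists>z\<in>S ?D. m' z = y" using z(1) by blast
    qed
    obtain h where h: "h \<in> homs P ?D" "\<And>x. x \<in> S P \<Longrightarrow> m' (h x) = f' x"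
      using proj_mod_lift[OF pcD(1)[OF f(3)] D(1) M(1) m'(1) on f'(1)] by blast
    note h1 = homs_comp[OF h(1) D(4)] and h2 = homs_comp[OF h(1) D(5)]
    have a: "(\<lambda>x. j1 (p1 (h x))) ` S P \<subseteq> socle"
      by (rule U'(3)[OF f(1-3) homs_comp[OF h1 B1(2)]]) (use homs_in[OF h1] B1(4) in blast)
    have b: "(\<lambda>x. j2 (p2 (h x))) ` S P \<subseteq> socle"
      by (rule W'(3)[OF f(1-3) homs_comp[OF h2 B2(2)]]) (use homs_in[OF h2] B2(4) in blast)
    show ?thesis
    proof
      fix y assume "y \<in> f ` S P"
      then obtain x where x: "x \<in> S P" "y = f x" by blast
      have "y = j1 (p1 (h x)) + j2 (p2 (h x))"
        using x m'(2)[OF homs_in[OF h(1) x(1)]] h(2)[OF x(1)] f'(2)[OF x(1)] by simp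
      moreover have "j1 (p1 (h x)) \<in> socle" "j2 (p2 (h x)) \<in> socle" using a b x(1) by blast+
      ultimately show "y \<in> socle" using subspD(2)[OF smodD(2)[OF socle_smod]] by simp
    qed
  qed
  then have "good (?m ` S ?D)" unfolding good_def using sT U'(2) UT by blast
  then show ?thesis using that UT WT by blast
qed

text \<open>A good submodule of largest dimension contains every other one, because its sum with the
  other is good again and cannot be larger.\<close>

lemma largest_good:
  obtains B j where "md B" "j \<in> homs B I" "inj_on_mod B j" "good (j ` S B)" "\<And>U. good U \<Longrightarrow> U \<subseteq> j ` S B"
proof -
  define T where "T = (\<lambda>(B, j). md B \<and> j \<in> homs B I \<and> inj_on_mod B j \<and> good (j ` S B))"
  have TI: "\<exists>B j. T (B, j) \<and> j ` S B = U" if U: "good U" for U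
  proof -
    obtain B j where B: "md B" "j \<in> homs B I" "inj_on_mod B j" "j ` S B = U"
      using realize_sub[OF I(2) goodD(1)[OF U]] by blast
    then have "T (B, j)" using U unfolding T_def by simp
    then show ?thesis using B(4) by blast
  qed
  obtain x0 where x0: "T x0" using TI[OF good_socle] by blast
  have "mdim (fst x) \<le> mdim I" if "T x" for x
    using that inj_dim unfolding T_def by (cases x) auto
  then have "\<exists>x. T x \<and> (\<forall>y. T y \<longrightarrow> mdim (fst y) \<le> mdim (fst x))"
    using ex_has_greatest_nat[of T x0 "\<lambda>x. mdim (fst x)" "Suc (mdim I)"] x0 by (simp add: less_Suc_eq_le)
  then obtain B j where T: "T (B, j)" and max: "\<And>B' j'. T (B', j') \<Longrightarrow> mdim B' \<le> mdim B" by fastforce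
  have B: "md B" "j \<in> homs B I" "inj_on_mod B j" "good (j ` S B)" using T unfolding T_def by auto
  have "U \<subseteq> j ` S B" if U: "good U" for U
  proof -
    obtain W where W: "good W" "j ` S B \<subseteq> W" "U \<subseteq> W" using good_sum[OF B(4) U] by blast
    obtain B' j' where T': "T (B', j')" "j' ` S B' = W" using TI[OF W(1)] by blast
    have B': "md B'" "j' \<in> homs B' I" "inj_on_mod B' j'" using T'(1) unfolding T_def by auto
    have "j x \<in> j' ` S B'" if "x \<in> S B" for x using W(2) T'(2) that by blast
    then obtain h where h: "h \<in> homs B B'" "\<And>x. x \<in> S B \<Longrightarrow> j' (h x) = j x"
      using corestrict[OF B(2) B'(2,3) B(1) B'(1)] by blast
    have hi: "inj_on_mod B h" unfolding inj_on_mod_def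
    proof (intro ballI impI)
      fix x assume x: "x \<in> S B" "h x = 0"
      then have "j x = 0" using h(2)[OF x(1)] hmL(3)[OF B'(2)] by simp
      then show "x = 0" using B(3) x(1) unfolding inj_on_mod_def by blast
    qed
    have "mdim B = mdim B'" using max[OF T'(1)] inj_dim[OF h(1) hi] by simp
    then have "h ` S B = S B'" using onto_image_eq[OF h(1) inj_eq_dim_onto[OF h(1) hi]] by blast
    have "W \<subseteq> j ` S B"
    proof
      fix w assume "w \<in> W"
      then obtain y where y: "y \<in> S B'" "w = j' y" using T'(2) by blast
      then obtain x where "x \<in> S B" "y = h x" using \<open>h ` S B = S B'\<close> by blast
      then show "w \<in> j ` S B" using h(2) y(2) by simp
    qed
    then show ?thesis using W(3) by blast
  qed
  then show ?thesis using that B by blast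
qed

text \<open>The lowest subquotient is a simple submodule of \<open>I\<close> and therefore equals
  the socle, which uses up the single occurrence of L(\<alpha>). Each later step adds L(\<mu>) with
  \<mu> < \<alpha>, to which no cover of L(\<nu>) with \<nu> \<ge> \<alpha> maps nontrivially, so
  goodness is preserved.\<close>

lemma good_if_pcostd_prop:
  assumes "pcostd_prop A L \<alpha> I W"
  shows "good (pv ` W)"
proof -
  obtain us where us: "subchain A I W us"
    and sq: "\<And>i. Suc i < length us \<Longrightarrow> \<exists>\<mu>\<in>{1..\<alpha>}. sqiso A I (us ! i) (us ! Suc i) (L \<mu>)"
    and card: "card {i. Suc i < length us \<and> sqiso A I (us ! i) (us ! Suc i) (L \<alpha>)} = 1"
    using assms unfolding pcostd_prop_def by blast
  have ne: "us \<noteq> []" and hd: "hd us = {0\<^sub>v (mdim I)}" and last: "last us = W"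
    and sub: "\<And>i. i < length us \<Longrightarrow> submod A I (us ! i)"
    and inc: "\<And>i. Suc i < length us \<Longrightarrow> us ! i \<subseteq> us ! Suc i"
    using us unfolding subchain_def by auto
  let ?A = "{i. Suc i < length us \<and> sqiso A I (us ! i) (us ! Suc i) (L \<alpha>)}"
  \<comment> \<open>An occurrence of L(\<alpha>) needs a step, so the chain has at least two
    terms.\<close>
  have len: "Suc 0 < length us" using card by (cases "length us"; cases "length us - 1") auto
  have simple_step: "\<exists>B j g. md B \<and> j \<in> homs B I \<and> inj_on_mod B j \<and> j ` S B = pv ` (us ! Suc i) \<and>
      g \<in> homs B (L \<mu>) \<and> onto B (L \<mu>) g \<and> (\<forall>x\<in>S B. g x = 0 \<longleftrightarrow> j x \<in> pv ` (us ! i))"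
    if i: "Suc i < length us" and \<mu>: "\<mu> \<in> {1..n}" "sqiso A I (us ! i) (us ! Suc i) (L \<mu>)" for i \<mu>
  proof -
    let ?U = "pv ` (us ! i)" and ?W = "pv ` (us ! Suc i)"
    have s: "submod A I (us ! i)" "submod A I (us ! Suc i)" using sub i by auto
    have eq: "vs I ?U = us ! i" "vs I ?W = us ! Suc i" using vc_pv_image[OF submod_carrier] s by auto
    have sq': "sqiso A I (vs I ?U) (vs I ?W) (L \<mu>)" using \<mu>(2) eq by simp
    have UW: "?U \<subseteq> ?W" using inc[OF i] by blast
    obtain B j where B: "md B" "j \<in> homs B I" "inj_on_mod B j" "j ` S B = ?W"
      using realize_sub[OF I(2) submod_pv[OF I(2) s(2)]] by blast
    obtain g where g: "g \<in> homs B (L \<mu>)" "onto B (L \<mu>) g" "\<And>x. x \<in> S B \<Longrightarrow> g x = 0 \<longleftrightarrow> j x \<in> ?U"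
      by (rule sqiso_map[OF sq' UW I(2) B(1) md_L[OF \<mu>(1)] B(2,4)]) (rule that)
    have "\<forall>x\<in>S B. g x = 0 \<longleftrightarrow> j x \<in> ?U" using g(3) by blast
    then show ?thesis using B g(1,2) by blast
  qed
  have u0: "us ! 0 = {0\<^sub>v (mdim I)}" using hd ne by (simp add: hd_conv_nth)
  have pu0: "pv ` (us ! 0) = {0}" unfolding u0 using pv_simps(3) by simp
  obtain \<mu>1 where \<mu>1: "\<mu>1 \<in> {1..\<alpha>}" "sqiso A I (us ! 0) (us ! Suc 0) (L \<mu>1)" using sq[OF len] by blast
  have \<mu>1n: "\<mu>1 \<in> {1..n}" using \<mu>1(1) \<alpha> by auto
  obtain B1 j1 g1 where B1: "md B1" "j1 \<in> homs B1 I" "inj_on_mod B1 j1" "j1 ` S B1 = pv ` (us ! Suc 0)"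
    "g1 \<in> homs B1 (L \<mu>1)" "onto B1 (L \<mu>1) g1" "\<forall>x\<in>S B1. g1 x = 0 \<longleftrightarrow> j1 x \<in> {0}"
    using simple_step[OF len \<mu>1n \<mu>1(2)] unfolding pu0 by blast
  have g1i: "inj_on_mod B1 g1" using B1(3,7) unfolding inj_on_mod_def by blast
  let ?U1 = "pv ` (us ! Suc 0)"
  have sU1: "smod I ?U1" using submod_pv[OF I(2) sub[OF len]] .
  have "?U1 \<noteq> {0}"
  proof
    assume e: "?U1 = {0}"
    obtain z where z: "z \<in> S (L \<mu>1)" "z \<noteq> 0" using L_nonzero[OF \<mu>1n] nonzero_element by blast
    obtain x where x: "x \<in> S B1" "g1 x = z" using B1(6) z(1) unfolding onto_def by blast
    have "j1 x = 0" using B1(4) e x(1) by blast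
    then show False using B1(7) x z(2) by blast
  qed
  then obtain v where v: "v \<in> ?U1" "v \<noteq> 0" "v \<in> socle" using I(6)[OF sU1] by blast
  have "{x \<in> S (L \<alpha>). i x \<in> ?U1} = S (L \<alpha>)"
  proof -
    have "smod (L \<alpha>) {x \<in> S (L \<alpha>). i x \<in> ?U1}" using smod_vimage[OF I(3,4) sU1] .
    moreover obtain x where "x \<in> S (L \<alpha>)" "v = i x" using v(3) by blast
    moreover have "x \<noteq> 0" using v(2) hmL(3)[OF I(4)] \<open>v = i x\<close> by auto
    ultimately show ?thesis using simple_mod_L[OF \<alpha>] v(1) unfolding simple_mod_def by blast
  qed
  then have socU: "socle \<subseteq> ?U1" by blast
  have Usoc: "?U1 \<subseteq> socle"
  proof -
    let ?T = "{x \<in> S B1. j1 x \<in> socle}"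
    have "smod (L \<mu>1) (g1 ` ?T)" using smod_range[OF B1(1,5) smod_vimage[OF B1(1,2) socle_smod]] .
    moreover obtain x where x: "x \<in> S B1" "v = j1 x" using v(1) B1(4) by blast
    moreover have "g1 x \<noteq> 0" using B1(7) x v(2) by blast
    ultimately have "g1 ` ?T = S (L \<mu>1)" using simple_mod_L[OF \<mu>1n] v(3) unfolding simple_mod_def by blast
    have "y \<in> socle" if y: "y \<in> ?U1" for y
    proof -
      obtain b where b: "b \<in> S B1" "y = j1 b" using y B1(4) by blast
      then have "g1 b \<in> g1 ` ?T" using \<open>g1 ` ?T = S (L \<mu>1)\<close> homs_in[OF B1(5) b(1)] by blast
      then obtain c where c: "c \<in> S B1" "j1 c \<in> socle" "g1 b = g1 c" by blast
      then have "b = c" using inj_on_modD[OF B1(5) g1i b(1) c(1)] by blast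
      then show ?thesis using c(2) b(2) by simp
    qed
    then show ?thesis by blast
  qed
  have eqU: "?U1 = socle" using socU Usoc by blast
  have "sqiso A I (vs I (i ` {x \<in> S (L \<alpha>). x = 0})) (vs I socle) (L \<alpha>)"
    using sqiso_of[OF I(2,3,3,4,5) homs_id] by (simp add: onto_def)
  moreover have "i ` {x \<in> S (L \<alpha>). x = 0} = {0}" using hmL(3)[OF I(4)] by auto
  moreover have "vs I socle = us ! Suc 0" unfolding eqU[symmetric] using vc_pv_image[OF submod_carrier[OF sub[OF len]]] .
  ultimately have "sqiso A I (us ! 0) (us ! Suc 0) (L \<alpha>)" unfolding u0 by (simp add: vc_simps(3))
  then have "0 \<in> ?A" using len by simp
  then have A0: "?A = {0}" using card by (metis card_1_singletonE singletonD)
  have "Suc i < length us \<Longrightarrow> good (pv ` (us ! Suc i))" for i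
  proof (induction i)
    case 0
    show ?case unfolding eqU by (rule good_socle)
  next
    case (Suc i)
    have IH: "good (pv ` (us ! Suc i))" using Suc by simp
    note IH' = goodD[OF IH]
    obtain \<mu> where \<mu>: "\<mu> \<in> {1..\<alpha>}" "sqiso A I (us ! Suc i) (us ! Suc (Suc i)) (L \<mu>)" using sq[OF Suc.prems] by blast
    have "Suc i \<notin> ?A" using A0 by simp
    then have "\<mu> \<noteq> \<alpha>" using \<mu>(2) Suc.prems by auto
    then have \<mu>lt: "\<mu> < \<alpha>" using \<mu>(1) by simp
    have \<mu>n: "\<mu> \<in> {1..n}" using \<mu>(1) \<alpha> by auto
    obtain B j g where B: "md B" "j \<in> homs B I" "inj_on_mod B j" "j ` S B = pv ` (us ! Suc (Suc i))"
      "g \<in> homs B (L \<mu>)" "onto B (L \<mu>) g" "\<forall>x\<in>S B. g x = 0 \<longleftrightarrow> j x \<in> pv ` (us ! Suc i)"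
      using simple_step[OF Suc.prems \<mu>n \<mu>(2)] by blast
    have "f ` S P \<subseteq> socle"
      if f: "\<alpha> \<le> \<nu>" "\<nu> \<le> n" "pcover P p (L \<nu>)" "f \<in> homs P I" "f ` S P \<subseteq> pv ` (us ! Suc (Suc i))" for \<nu> P p f
    proof -
      have "f x \<in> j ` S B" if "x \<in> S P" for x unfolding B(4) using that f(5) by blast
      then obtain f' where f': "f' \<in> homs P B" "\<And>x. x \<in> S P \<Longrightarrow> j (f' x) = f x"
        using corestrict[OF f(4) B(2,3) pcD(2)[OF f(3)] B(1)] by blast
      have C: "factors_le \<mu> (L \<mu>)" using factors_le_L[OF \<mu>n] by blast
      have lt: "\<mu> < \<nu>" using \<mu>lt f(1) by simp
      have "f x \<in> pv ` (us ! Suc i)" if x: "x \<in> S P" for x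
      proof -
        have "g (f' x) = 0" using ClD[OF C lt f(2,3) homs_comp[OF f'(1) B(5)] x] .
        then show ?thesis using B(7) homs_in[OF f'(1) x] f'(2)[OF x] by auto
      qed
      then have "f ` S P \<subseteq> pv ` (us ! Suc i)" by blast
      then show ?thesis using IH'(3)[OF f(1-4)] by blast
    qed
    moreover have "socle \<subseteq> pv ` (us ! Suc (Suc i))" using IH'(2) inc[OF Suc.prems] by blast
    ultimately show ?case unfolding good_def using submod_pv[OF I(2) sub[OF Suc.prems]] by blast
  qed
  moreover have "Suc (length us - 2) = length us - 1" using len by simp
  ultimately have "good (pv ` (us ! (length us - 1)))" using len by (metis Suc_diff_1 Suc_lessD lessI)
  then show ?thesis using last last_conv_nth[OF ne] by simp
qed

end

end

section \<open>Existence of proper costandard modules and vanishing of extensions\<close>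

context indexed_algebra
begin

text \<open>\<open>B\<close> is the largest good submodule of I(\<alpha>). Extensions of
  \<Delta>(\<mu>) by \<open>B\<close> vanish for \<mu> \<ge> \<alpha> by relative projectivity, and
  for \<mu> < \<alpha> by maximality of \<open>B\<close>: inside the injective module nothing with
  factors of index below \<alpha> can be put on top of it.\<close>

lemma ex_pcostd:
  assumes \<alpha>: "\<alpha> \<in> {1..n}"
  obtains B s Q q where "is_pcostd A L \<alpha> B" "ses (L \<alpha>) B Q s q" "factors_le (\<alpha> - 1) Q"
    "\<And>U. smod B U \<Longrightarrow> U \<noteq> {0} \<Longrightarrow> \<exists>v\<in>U. v \<noteq> 0 \<and> v \<in> s ` S (L \<alpha>)"
    "\<And>\<mu> D. \<mu> \<in> {1..n} \<Longrightarrow> std_mod \<mu> D \<Longrightarrow> Ext1_zero D B"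
proof -
  obtain I i where env: "envelope I i (L \<alpha>)" using ex_envelope[OF simple_mod_L[OF \<alpha>]] by blast
  note I = ieD[OF env]
  let ?soc = "i ` S (L \<alpha>)"
  obtain B j where B: "md B" "j \<in> homs B I" "inj_on_mod B j" "good \<alpha> I i (j ` S B)"
    "\<And>U. good \<alpha> I i U \<Longrightarrow> U \<subseteq> j ` S B"
    using largest_good[OF \<alpha> env] by blast
  note G = goodD[OF \<alpha> env B(4)]
  have "i x \<in> j ` S B" if "x \<in> S (L \<alpha>)" for x using G(2) that by blast
  then obtain s where s: "s \<in> homs (L \<alpha>) B" "\<And>x. x \<in> S (L \<alpha>) \<Longrightarrow> j (s x) = i x"
    using corestrict[OF I(4) B(2,3) I(3) B(1)] by blast
  have sinj: "inj_on_mod (L \<alpha>) s" unfolding inj_on_mod_def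
  proof (intro ballI impI)
    fix x assume x: "x \<in> S (L \<alpha>)" "s x = 0"
    then have "i x = 0" using s(2)[OF x(1)] hmL(3)[OF B(2)] by simp
    then show "x = 0" using I(5) x(1) unfolding inj_on_mod_def by blast
  qed
  obtain Q q where E: "ses (L \<alpha>) B Q s q" using ses_cokernel[OF I(3) B(1) s(1) sinj] by blast
  note E' = sesD[OF E]
  have socE: "y \<in> s ` S (L \<alpha>)" if y: "y \<in> S B" "j y \<in> ?soc" for y
  proof -
    obtain x where x: "x \<in> S (L \<alpha>)" "j y = i x" using y(2) by blast
    have "j (s x) = j y" using s(2)[OF x(1)] x(2) by simp
    then have "s x = y" using inj_on_modD[OF B(2,3) homs_in[OF s(1) x(1)] y(1)] by blast
    then show ?thesis using x(1) by blast
  qed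
  \<comment> \<open>A map from P(\<nu>) with \<nu> \<ge> \<alpha> to the quotient lifts to
    \<open>B\<close>, where goodness forces its image into the socle.\<close>
  have CQ: "factors_le (\<alpha> - 1) Q"
  proof (rule ClI[OF E'(3)])
    fix \<nu> P p f x assume *: "\<alpha> - 1 < \<nu>" "\<nu> \<le> n" "pcover P p (L \<nu>)" "f \<in> homs P Q" "x \<in> S P"
    have le: "\<alpha> \<le> \<nu>" using *(1) by simp
    obtain h where h: "h \<in> homs P B" "\<And>x. x \<in> S P \<Longrightarrow> q (h x) = f x"
      using proj_mod_lift[OF pcD(1)[OF *(3)] E'(2,3,5,7) *(4)] by blast
    have "(\<lambda>x. j (h x)) ` S P \<subseteq> ?soc"
      by (rule G(3)[OF le *(2,3) homs_comp[OF h(1) B(2)]]) (use homs_in[OF h(1)] in blast)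
    then have "h x \<in> s ` S (L \<alpha>)" using socE[OF homs_in[OF h(1) *(5)]] *(5) by blast
    then show "f x = 0" using E'(9)[OF homs_in[OF h(1) *(5)]] h(2)[OF *(5)] by simp
  qed
  have ess: "\<exists>v\<in>U. v \<noteq> 0 \<and> v \<in> s ` S (L \<alpha>)" if U: "smod B U" "U \<noteq> {0}" for U
  proof -
    have US: "U \<subseteq> S B" using smodD(1)[OF U(1)] .
    obtain u where u: "u \<in> U" "u \<noteq> 0" using U(2) subspD(1)[OF smodD(2)[OF U(1)]] by blast
    have "j u \<noteq> 0" using B(3) u US unfolding inj_on_mod_def by blast
    then have "j ` U \<noteq> {0}" using u(1) by blast
    then obtain v where v: "v \<in> j ` U" "v \<noteq> 0" "v \<in> ?soc" using I(6)[OF smod_range[OF B(1,2) U(1)]] by blast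
    then obtain w where w: "w \<in> U" "v = j w" by blast
    have "w \<noteq> 0" using v(2) w(2) hmL(3)[OF B(2)] by auto
    moreover have "w \<in> s ` S (L \<alpha>)" using socE[of w] w US v(3) by blast
    ultimately show ?thesis using w(1) by blast
  qed
  have CB: "factors_le \<alpha> B" using factors_le_ext[OF E] factors_le_L[OF \<alpha>] factors_le_mono[OF CQ] by simp
  have EB: "Ext1_zero D B" if D: "\<mu> \<in> {1..n}" "std_mod \<mu> D" for \<mu> D
  proof (cases "\<alpha> \<le> \<mu>")
    case True
    then show ?thesis using std_mod_Ext1_zero[OF D(2,1) factors_le_mono[OF CB]] by blast
  next
    case False
    show ?thesis
    proof (rule std_mod_presentation[OF D(2,1)])
      fix K P k d assume F: "ses K P D k d" "proj_mod P" and CD: "factors_le \<mu> D"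
      note F' = sesD[OF F(1)]
      show ?thesis
      proof (rule Ext1_zero_I[OF F])
        fix \<phi> assume \<phi>: "\<phi> \<in> homs K B"
        \<comment> \<open>Injectivity of \<open>I\<close> extends \<open>\<phi>\<close> to
          \<open>P\<close>, but with values in \<open>I\<close>. It remains to see that these values
          lie in \<open>B\<close>.\<close>
        obtain \<Phi> where \<Phi>: "\<Phi> \<in> homs P I" "\<And>x. x \<in> S K \<Longrightarrow> \<Phi> (k x) = j (\<phi> x)"
          using injective_mod_extend[OF I(1) F'(1,2,4,6) homs_comp[OF \<phi> B(2)]] by blast
        let ?D = "dsum B P"
        obtain i1 i2 p1 p2 where DS: "md ?D"
          "i1 \<in> homs B ?D" "i2 \<in> homs P ?D" "p1 \<in> homs ?D B" "p2 \<in> homs ?D P"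
          "\<And>x. x \<in> S B \<Longrightarrow> p1 (i1 x) = x" "\<And>x. x \<in> S B \<Longrightarrow> p2 (i1 x) = 0"
          "\<And>y. y \<in> S P \<Longrightarrow> p2 (i2 y) = y" "\<And>y. y \<in> S P \<Longrightarrow> p1 (i2 y) = 0"
          "\<And>z. z \<in> S ?D \<Longrightarrow> i1 (p1 z) + i2 (p2 z) = z"
          using dsum_maps[OF B(1) F'(2)] by blast
        let ?m = "\<lambda>z. j (p1 z) + \<Phi> (p2 z)"
        have m: "?m \<in> homs ?D I" using homs_add[OF homs_comp[OF DS(4) B(2)] homs_comp[OF DS(5) \<Phi>(1)]] .
        have sT: "smod I (?m ` S ?D)" using smod_range[OF DS(1) m smod_UNIV[OF DS(1)]] .
        \<comment> \<open>\<open>M\<close> realises the sum of \<open>B\<close> and the image of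
          \<open>\<Phi>\<close> inside \<open>I\<close>.\<close>
        obtain M w where M: "md M" "w \<in> homs M I" "inj_on_mod M w" "w ` S M = ?m ` S ?D"
          using realize_sub[OF I(2) sT] by blast
        have jM: "j x \<in> w ` S M" if "x \<in> S B" for x
        proof -
          have "j x = ?m (i1 x)" using DS(6,7)[OF that] hmL(3)[OF \<Phi>(1)] by simp
          then show ?thesis unfolding M(4) using homs_in[OF DS(2) that] by (rule image_eqI)
        qed
        have \<Phi>M: "\<Phi> x \<in> w ` S M" if "x \<in> S P" for x
        proof -
          have "\<Phi> x = ?m (i2 x)" using DS(8,9)[OF that] hmL(3)[OF B(2)] by simp
          then show ?thesis unfolding M(4) using homs_in[OF DS(3) that] by (rule image_eqI)
        qed
        obtain u where u: "u \<in> homs B M" "\<And>x. x \<in> S B \<Longrightarrow> w (u x) = j x"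
          using corestrict[OF B(2) M(2,3) B(1) M(1) jM] by blast
        obtain \<Psi> where \<Psi>: "\<Psi> \<in> homs P M" "\<And>x. x \<in> S P \<Longrightarrow> w (\<Psi> x) = \<Phi> x"
          using corestrict[OF \<Phi>(1) M(2,3) F'(2) M(1) \<Phi>M] by blast
        have ui: "inj_on_mod B u" unfolding inj_on_mod_def
        proof (intro ballI impI)
          fix x assume x: "x \<in> S B" "u x = 0"
          then have "j x = 0" using u(2)[OF x(1)] hmL(3)[OF M(2)] by simp
          then show "x = 0" using B(3) x(1) unfolding inj_on_mod_def by blast
        qed
        obtain R c where R: "ses B M R u c" using ses_cokernel[OF B(1) M(1) u(1) ui] by blast
        note R' = sesD[OF R]
        have "c (\<Psi> (k x)) = 0" if x: "x \<in> S K" for x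
        proof -
          have "w (\<Psi> (k x)) = w (u (\<phi> x))"
            using \<Psi>(2)[OF homs_in[OF F'(4) x]] \<Phi>(2)[OF x] u(2)[OF homs_in[OF \<phi> x]] by simp
          then have "\<Psi> (k x) = u (\<phi> x)"
            using inj_on_modD[OF M(2,3) homs_in[OF \<Psi>(1) homs_in[OF F'(4) x]] homs_in[OF u(1) homs_in[OF \<phi> x]]] by blast
          then show ?thesis using R'(8)[OF homs_in[OF \<phi> x]] by simp
        qed
        then obtain e where e: "e \<in> homs D R" "\<And>x. x \<in> S P \<Longrightarrow> e (d x) = c (\<Psi> x)"
          using ses_descend[OF F(1) homs_comp[OF \<Psi>(1) R'(5)]] by blast
        \<comment> \<open>The quotient of \<open>M\<close> by \<open>B\<close> is an image of
          \<Delta>(\<mu>), so its factors have index at most \<mu> < \<alpha>.\<close>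
        have eon: "onto D R e" unfolding onto_def
        proof
          fix y assume "y \<in> S R"
          then obtain t where t: "t \<in> S M" "c t = y" using R'(12) by blast
          have "w t \<in> ?m ` S ?D" unfolding M(4)[symmetric] using t(1) by (rule imageI)
          then obtain z where z: "z \<in> S ?D" "w t = ?m z" by blast
          note z1 = homs_in[OF DS(4) z(1)] and z2 = homs_in[OF DS(5) z(1)]
          have "w t = w (u (p1 z) + \<Psi> (p2 z))" using z(2) u(2)[OF z1] \<Psi>(2)[OF z2] by (simp add: hmL[OF M(2)])
          moreover have "u (p1 z) + \<Psi> (p2 z) \<in> S M" using homs_in[OF u(1) z1] homs_in[OF \<Psi>(1) z2] by blast
          ultimately have "t = u (p1 z) + \<Psi> (p2 z)" using inj_on_modD[OF M(2,3) t(1)] by blast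
          then have "y = c (\<Psi> (p2 z))" using t(2) R'(8)[OF z1] by (simp add: hmL[OF R'(5)])
          then have "e (d (p2 z)) = y" using e(2)[OF z2] by simp
          then show "\<exists>x\<in>S D. e x = y" using homs_in[OF F'(5) z2] by blast
        qed
        have CR: "factors_le \<mu> R" using factors_le_onto[OF CD R'(3) e(1) eon] .
        have "f ` S P' \<subseteq> ?soc"
          if f: "\<alpha> \<le> \<nu>" "\<nu> \<le> n" "pcover P' p (L \<nu>)" "f \<in> homs P' I" "f ` S P' \<subseteq> ?m ` S ?D" for \<nu> P' p f
        proof -
          have "f x \<in> w ` S M" if "x \<in> S P'" for x unfolding M(4) using that f(5) by blast
          then obtain f' where f': "f' \<in> homs P' M" "\<And>x. x \<in> S P' \<Longrightarrow> w (f' x) = f x"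
            using corestrict[OF f(4) M(2,3) pcD(2)[OF f(3)] M(1)] by blast
          have lt: "\<mu> < \<nu>" using False f(1) by simp
          have "c (f' x) = 0" if "x \<in> S P'" for x using ClD[OF CR lt f(2,3) homs_comp[OF f'(1) R'(5)] that] .
          then obtain g where g: "g \<in> homs P' B" "\<And>x. x \<in> S P' \<Longrightarrow> u (g x) = f' x"
            using ses_factor[OF R f'(1) pcD(2)[OF f(3)]] by blast
          have "f x \<in> j ` S B" if x: "x \<in> S P'" for x
          proof (rule image_eqI[OF _ homs_in[OF g(1) x]])
            show "f x = j (g x)" using f'(2)[OF x] g(2)[OF x] u(2)[OF homs_in[OF g(1) x]] by simp
          qed
          then have "f ` S P' \<subseteq> j ` S B" by blast
          then show ?thesis using G(3)[OF f(1-4)] by blast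
        qed
        moreover have "?soc \<subseteq> ?m ` S ?D"
        proof -
          have "j ` S B \<subseteq> w ` S M" using jM by blast
          then show ?thesis using G(2) unfolding M(4) by (rule order_trans[rotated])
        qed
        \<comment> \<open>A map from P(\<nu>) with \<nu> \<ge> \<alpha> into this sum vanishes
          modulo \<open>B\<close>, so the sum is good and contained in \<open>B\<close>.\<close>
        ultimately have "good \<alpha> I i (?m ` S ?D)" unfolding good_def[OF \<alpha> env] using sT by (intro conjI allI impI)
        then have sub: "w ` S M \<subseteq> j ` S B" using B(5) unfolding M(4) by blast
        have "\<Phi> x \<in> j ` S B" if "x \<in> S P" for x using \<Phi>M[OF that] sub by blast
        then obtain \<psi> where \<psi>: "\<psi> \<in> homs P B" "\<And>x. x \<in> S P \<Longrightarrow> j (\<psi> x) = \<Phi> x"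
          using corestrict[OF \<Phi>(1) B(2,3) F'(2) B(1)] by blast
        have "\<psi> (k x) = \<phi> x" if x: "x \<in> S K" for x
        proof (rule inj_on_modD[OF B(2,3) _ homs_in[OF \<phi> x]])
          show "\<psi> (k x) \<in> S B" using homs_in[OF \<psi>(1) homs_in[OF F'(4) x]] .
          show "j (\<psi> (k x)) = j (\<phi> x)" using \<psi>(2)[OF homs_in[OF F'(4) x]] \<Phi>(2)[OF x] by simp
        qed
        then show "\<exists>\<psi>\<in>homs P B. \<forall>x\<in>S K. \<psi> (k x) = \<phi> x" using \<psi>(1) by blast
      qed
    qed
  qed
  have "is_pcostd A L \<alpha> B"
  proof -
    let ?j = "mt (mdim I) (mdim B) j"
    have "fm ?j ` S B = j ` S B" using fm_mt_homs[OF B(2)] by (intro image_cong) auto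
    then have im: "img ?j = vs I (j ` S B)" using img_fm[OF mt_carrier, of "mdim I" "mdim B" j] by simp
    obtain us where us: "chain I (\<lambda>N. \<exists>\<mu>\<in>{1..n}. \<mu> \<le> \<alpha> - 1 \<and> N = L \<mu>) us"
      "hd us = vs I (j ` {x \<in> S B. q x = 0})" "last us = vs I (j ` S B)"
      using factors_le_chain[OF I(2) CQ B(1,2,3) E'(5,7)] by blast
    have "{x \<in> S B. q x = 0} = s ` S (L \<alpha>)" using E'(9) homs_in[OF E'(4)] by blast
    moreover have "j ` s ` S (L \<alpha>) = ?soc" unfolding image_image using s(2) by (intro image_cong) auto
    ultimately have hd: "hd us = vs I ?soc" using us(2) by simp
    have ne: "us \<noteq> []" using us(1) by (simp add: chain_def)
    have us0: "us ! 0 = vs I ?soc" using hd ne by (simp add: hd_conv_nth)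
    let ?Z = "{0\<^sub>v (mdim I)}"
    \<comment> \<open>The chain from \<open>factors_le_chain\<close> starts at the socle; the zero
      submodule is put in front. The new lowest step is the only one with subquotient L(\<alpha>),
      as the others have index at most \<open>\<alpha> - 1\<close>.\<close>
    let ?us = "?Z # us"
    have Z: "submod A I ?Z" unfolding zero_vec_image
      using submod_vs[OF I(2), of "{0}"] smod_zero[OF I(2)] by simp
    have "sqiso A I (vs I (i ` {x \<in> S (L \<alpha>). x = 0})) (vs I ?soc) (L \<alpha>)"
      using sqiso_of[OF I(2,3,3,4,5) homs_id] by (simp add: onto_def)
    moreover have "i ` {x \<in> S (L \<alpha>). x = 0} = {0}" using hmL(3)[OF I(4)] by auto
    ultimately have sq0: "sqiso A I ?Z (us ! 0) (L \<alpha>)" unfolding us0 zero_vec_image by simp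
    have Z0: "?Z \<subseteq> us ! 0" unfolding us0 zero_vec_image
      using subspD(1)[OF smodD(2)[OF socle_smod[OF \<alpha> env]]] by blast
    have sub: "submod A I (us ! m)" if "m < length us" for m using us(1) that unfolding chain_def by blast
    have inc: "us ! m \<subseteq> us ! Suc m" and
      step: "\<exists>\<mu>\<in>{1..n}. \<mu> \<le> \<alpha> - 1 \<and> sqiso A I (us ! m) (us ! Suc m) (L \<mu>)" if "Suc m < length us" for m
      using us(1) that unfolding chain_def by blast+
    have "subchain A I (img ?j) ?us" unfolding subchain_def
    proof (intro conjI allI impI)
      show "last ?us = img ?j" using ne us(3) im by simp
      show "submod A I (?us ! m)" if "m < length ?us" for m using that Z sub by (cases m) auto
      show "?us ! m \<subseteq> ?us ! Suc m" if "Suc m < length ?us" for m using that Z0 inc by (cases m) auto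
    qed auto
    moreover have "\<exists>\<mu>\<in>{1..\<alpha>}. sqiso A I (?us ! m) (?us ! Suc m) (L \<mu>)" if m: "Suc m < length ?us" for m
    proof (cases m)
      case 0
      then show ?thesis using sq0 \<alpha> by auto
    next
      case (Suc m')
      then obtain \<mu> where "\<mu> \<in> {1..n}" "\<mu> \<le> \<alpha> - 1" "sqiso A I (us ! m') (us ! Suc m') (L \<mu>)"
        using step[of m'] m by auto
      then show ?thesis using Suc by (intro bexI[of _ \<mu>]) auto
    qed
    moreover have "{m. Suc m < length ?us \<and> sqiso A I (?us ! m) (?us ! Suc m) (L \<alpha>)} = {0}" (is "?T = _")
    proof (intro equalityI subsetI)
      fix m assume "m \<in> {0 :: nat}"
      then show "m \<in> ?T" using sq0 ne by simp
    next
      fix m assume m: "m \<in> ?T"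
      show "m \<in> {0}"
      proof (rule ccontr)
        assume "m \<notin> {0}"
        then obtain m' where m': "m = Suc m'" by (cases m) auto
        then have l: "Suc m' < length us" and sq: "sqiso A I (us ! m') (us ! Suc m') (L \<alpha>)" using m by auto
        obtain \<mu> where \<mu>: "\<mu> \<in> {1..n}" "\<mu> \<le> \<alpha> - 1" "sqiso A I (us ! m') (us ! Suc m') (L \<mu>)"
          using step[OF l] by blast
        have "isom (L \<mu>) (L \<alpha>)"
          using sqiso_isom[OF I(2) sub sub[OF l] inc[OF l] md_L[OF \<mu>(1)] \<mu>(3) I(3) sq] l by simp
        then have "\<mu> = \<alpha>" using isom_L[OF \<mu>(1) \<alpha>] by blast
        moreover have "1 \<le> \<alpha>" using \<alpha> by simp
        ultimately show False using \<mu>(2) by linarith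
      qed
    qed
    moreover have "submod A I (img ?j)" unfolding im using submod_vs[OF I(2) smodD(1)[OF G(1)]] G(1) by blast
    ultimately have pcp: "pcostd_prop A L \<alpha> I (img ?j)" unfolding pcostd_prop_def
      by (intro conjI exI[of _ ?us]) auto
    have "W \<subseteq> img ?j" if W: "pcostd_prop A L \<alpha> I W" for W
    proof -
      have sW: "submod A I W" using W by (simp add: pcostd_prop_def)
      have "pv ` W \<subseteq> j ` S B" using B(5)[OF good_if_pcostd_prop[OF \<alpha> env W]] .
      then have "vs I (pv ` W) \<subseteq> vs I (j ` S B)" by (rule image_mono)
      then show ?thesis unfolding im vc_pv_image[OF submod_carrier[OF sW]] .
    qed
    then show ?thesis unfolding is_pcostd_def
      using B(1) envelope_mt[OF env] mt_hom[OF B(1) I(2) B(2)] mt_inj[OF B(1) I(2) B(2)] B(3) pcp by blast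
  qed
  then show ?thesis
  proof (rule that[OF _ E CQ])
    show "\<exists>v\<in>U. v \<noteq> 0 \<and> v \<in> s ` S (L \<alpha>)" if "smod B U" "U \<noteq> {0}" for U using ess[OF that] .
    show "Ext1_zero D B" if "\<mu> \<in> {1..n}" "std_mod \<mu> D" for \<mu> D using EB[OF that] .
  qed
qed

end

section \<open>Modules without extensions by standard modules\<close>

context strongly_stratified
begin

text \<open>For \<open>\<alpha>\<close> minimal with \<open>L \<alpha>\<close> in the socle of \<open>N\<close>, the inclusion of \<open>L \<alpha>\<close> extends to an embedding of the proper
  costandard module, and the cokernel again has no extensions by standard modules.\<close>

lemma F_pcostd_if_Ext1_zero:
  assumes "md N" "\<And>\<mu>. \<mu> \<in> {1..n} \<Longrightarrow> Ext1_zero (Delta \<mu>) N"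
  shows "F_pcostd A n L N"
  using assms
proof (induction "mdim N" arbitrary: N rule: less_induct)
  case less
  note mN = less.prems(1)
  show ?case
  proof (cases "mdim N = 0")
    case True
    then show ?thesis unfolding F_pcostd_def using filt_zero mN by blast
  next
    case False
    define R where "R \<alpha> \<longleftrightarrow> \<alpha> \<in> {1..n} \<and> (\<exists>g\<in>homs (L \<alpha>) N. inj_on_mod (L \<alpha>) g)" for \<alpha>
    obtain \<alpha>0 g0 where "\<alpha>0 \<in> {1..n}" "g0 \<in> homs (L \<alpha>0) N" "inj_on_mod (L \<alpha>0) g0"
      using ex_L_sub[OF mN] False by blast
    then have "R \<alpha>0" unfolding R_def by blast
    define \<alpha> where "\<alpha> = (LEAST \<alpha>. R \<alpha>)"
    have "R \<alpha>" unfolding \<alpha>_def using \<open>R \<alpha>0\<close> by (rule LeastI)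
    then obtain g where \<alpha>: "\<alpha> \<in> {1..n}" and g: "g \<in> homs (L \<alpha>) N" "inj_on_mod (L \<alpha>) g" unfolding R_def by blast
    have min: "\<alpha> \<le> \<mu>" if "R \<mu>" for \<mu> unfolding \<alpha>_def using that by (rule Least_le)
    show ?thesis
    proof (rule ex_pcostd[OF \<alpha>])
      fix B s Q q assume pB: "is_pcostd A L \<alpha> B" and E: "ses (L \<alpha>) B Q s q" and CQ: "factors_le (\<alpha> - 1) Q"
        and ess: "\<And>U. smod B U \<Longrightarrow> U \<noteq> {0} \<Longrightarrow> \<exists>v\<in>U. v \<noteq> 0 \<and> v \<in> s ` S (L \<alpha>)"
        and EB: "\<And>\<mu> D. \<mu> \<in> {1..n} \<Longrightarrow> std_mod \<mu> D \<Longrightarrow> Ext1_zero D B"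
      note E' = sesD[OF E]
      \<comment> \<open>Let \<open>T\<close> be the kernel of \<Delta>(\<mu>) -> L(\<mu>). The image
        of a nonzero map from \<open>T\<close> to \<open>N\<close> would have a simple submodule of
        index at most \<mu> < \<alpha>, against the minimality of \<alpha>. So Hom(T, N) = 0, and
        the vanishing passes from \<Delta>(\<mu>) to L(\<mu>).\<close>
      have EL: "Ext1_zero (L \<mu>) N" if \<mu>: "\<mu> \<in> {1..n}" "\<mu> \<le> \<alpha> - 1" for \<mu>
      proof (rule std_mod_presentation[OF std_mod_Delta[OF \<mu>(1)] \<mu>(1)])
        fix r assume C: "factors_le \<mu> (Delta \<mu>)" and r: "r \<in> homs (Delta \<mu>) (L \<mu>)" "onto (Delta \<mu>) (L \<mu>) r"
        obtain T t where T: "ses T (Delta \<mu>) (L \<mu>) t r"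
          using ses_kernel[OF factors_le_md[OF C] md_L[OF \<mu>(1)] r] by blast
        note T' = sesD[OF T]
        have CT: "factors_le \<mu> T" using factors_le_inj[OF C T'(1,4,6)] .
        have "f x = 0" if f: "f \<in> homs T N" "x \<in> S T" for f x
        proof (rule ccontr)
          assume fx: "f x \<noteq> 0"
          obtain M w where M: "md M" "w \<in> homs M N" "inj_on_mod M w" "w ` S M = f ` S T"
            using realize_sub[OF mN smod_range[OF T'(1) f(1) smod_UNIV[OF T'(1)]]] by blast
          have "f y \<in> w ` S M" if "y \<in> S T" for y unfolding M(4) using that by (rule imageI)
          then obtain f' where f': "f' \<in> homs T M" "\<And>y. y \<in> S T \<Longrightarrow> w (f' y) = f y"
            using corestrict[OF f(1) M(2,3) T'(1) M(1)] by blast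
          have on: "onto T M f'" unfolding onto_def
          proof
            fix y assume y: "y \<in> S M"
            have "w y \<in> f ` S T" unfolding M(4)[symmetric] using y by (rule imageI)
            then obtain z where z: "z \<in> S T" "w y = f z" by blast
            have "w (f' z) = w y" using f'(2)[OF z(1)] z(2) by simp
            then show "\<exists>z\<in>S T. f' z = y" using inj_on_modD[OF M(2,3) homs_in[OF f'(1) z(1)] y] z(1) by blast
          qed
          have CM: "factors_le \<mu> M" using factors_le_onto[OF CT M(1) f'(1) on] .
          have "f' x \<noteq> 0" using f'(2)[OF f(2)] fx hmL(3)[OF M(2)] by auto
          then have "mdim M > 0" using nonzero_element homs_in[OF f'(1) f(2)] by blast
          then obtain \<nu> h where h: "\<nu> \<in> {1..n}" "h \<in> homs (L \<nu>) M" "inj_on_mod (L \<nu>) h"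
            using ex_L_sub[OF M(1)] by blast
          have "\<nu> \<le> \<mu>" using factors_le_inj[OF CM md_L[OF h(1)] h(2,3)] factors_le_L[OF h(1)] by blast
          moreover have "R \<nu>"
          proof -
            have "inj_on_mod (L \<nu>) (\<lambda>x. w (h x))"
              using h(3) M(3) homs_in[OF h(2)] unfolding inj_on_mod_def by blast
            then show ?thesis unfolding R_def using h(1) homs_comp[OF h(2) M(2)] by blast
          qed
          moreover have "1 \<le> \<mu>" using \<mu>(1) by simp
          ultimately show False using min[of \<nu>] \<mu>(2) by linarith
        qed
        then show ?thesis using Ext1_zero_quot_left[OF T less.prems(2)[OF \<mu>(1)]] by blast
      qed
      \<comment> \<open>All composition factors of \<open>Q\<close> have index below \<alpha>, so
        \<open>EL\<close> applies to each of them. This is what extends the embedding of L(\<alpha>)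
        to \<open>B\<close>.\<close>
      have EQ: "Ext1_zero Q N" using factors_le_filt[OF CQ]
      proof (induction rule: filt_induct)
        case (zero Z)
        then show ?case using Ext1_zero_proj_mod proj_mod_zero by blast
      next
        case (step X Y Z f g)
        then have "Ext1_zero Z N" using EL by blast
        then show ?case using Ext1_zero_ext_left[OF step(1,4) _ mN] by blast
      qed
      obtain h where h: "h \<in> homs B N" "\<And>x. x \<in> S (L \<alpha>) \<Longrightarrow> h (s x) = g x"
        using Ext1_zero_extend[OF EQ E mN g(1)] by blast
      \<comment> \<open>A nonzero kernel would meet the socle L(\<alpha>) of \<open>B\<close>, on
        which \<open>h\<close> agrees with the injective map \<open>g\<close>.\<close>
      have hi: "inj_on_mod B h"
      proof (rule ccontr)
        assume "\<not> inj_on_mod B h"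
        then have "{x \<in> S B. h x = 0} \<noteq> {0}" unfolding inj_ker by blast
        then obtain v where v: "h v = 0" "v \<noteq> 0" "v \<in> s ` S (L \<alpha>)"
          using ess[OF smod_ker[OF E'(2) mN h(1)]] by blast
        then obtain x where x: "x \<in> S (L \<alpha>)" "v = s x" by blast
        have "g x = 0" using h(2)[OF x(1)] v(1) x(2) by simp
        then have "x = 0" using g(2) x(1) unfolding inj_on_mod_def by blast
        then show False using v(2) x(2) hmL(3)[OF E'(4)] by simp
      qed
      obtain Z c where F: "ses B N Z h c" using ses_cokernel[OF E'(2) mN h(1) hi] by blast
      note F' = sesD[OF F]
      have dB: "mdim B > 0" using inj_dim[OF E'(4,6)] L_nonzero[OF \<alpha>] by simp
      \<comment> \<open>Passing to the cokernel needs the second extension group of \<Delta>(\<mu>)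
        by \<open>B\<close> to vanish. The syzygy of \<Delta>(\<mu>) is filtered by standard
        modules, none of which has an extension by \<open>B\<close>.\<close>
      have "Ext1_zero (Delta \<mu>) Z" if \<mu>: "\<mu> \<in> {1..n}" for \<mu>
      proof (rule std_mod_presentation[OF std_mod_Delta[OF \<mu>] \<mu>])
        fix K P k d assume G: "ses K P (Delta \<mu>) k d" "proj_mod P" "factors_le \<mu> (Delta \<mu>)"
          and K0: "\<And>Y f x. factors_le \<mu> Y \<Longrightarrow> f \<in> homs K Y \<Longrightarrow> x \<in> S K \<Longrightarrow> f x = 0"
        have K: "Delta_filt {\<mu><..n} K" by (rule std_mod_kernel_Delta_filt[OF \<mu> G]) (rule K0)
        have "Ext1_zero D B" if "\<alpha>' \<in> {\<mu><..n}" "std_mod \<alpha>' D" for D \<alpha>'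
          by (rule EB[OF _ that(2)]) (use that(1) in auto)
        moreover have "{\<mu><..n} \<subseteq> {1..n}" by auto
        ultimately have "Ext1_zero K B" by (intro Delta_filt_Ext1_zero[OF K _ E'(2)])
        then show ?thesis using Ext1_zero_quot_right[OF G(1,2) F] less.prems(2)[OF \<mu>] by blast
      qed
      then have "F_pcostd A n L Z" using less.hyps[OF ses_dim_less'[OF F dB] F'(3)] by blast
      moreover have "F_pcostd A n L B" unfolding F_pcostd_def
        by (rule filt_single[OF E'(2)]) (use pB \<alpha> in blast)
      ultimately show ?thesis using filt_ext[OF F] unfolding F_pcostd_def by blast
    qed
  qed
qed

section \<open>The bound on the finitistic dimension\<close>

lemma tilting_coresolution_step:
  assumes X: "Delta_filt {1..n} X"
  obtains T X' u v where "ses X T X' u v" "Delta_filt {1..n} X'" "Delta_filt {1..n} T" "F_pcostd A n L T"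
proof -
  obtain T X' u v where E: "ses X T X' u v" "Delta_filt {1..n} X'" "\<forall>\<mu>\<in>{n - n<..n}. Ext1_zero (Delta \<mu>) T"
    using Delta_extension[OF Delta_filt_md[OF X] order_refl] by blast
  have "F_pcostd A n L T" using F_pcostd_if_Ext1_zero[OF sesD(2)[OF E(1)]] E(3) by auto
  moreover have "Delta_filt {1..n} T" using Delta_filt_ext[OF E(1) X E(2)] .
  ultimately show ?thesis using that E(1,2) by blast
qed

lemma Delta_filt_pdle_tilting:
  assumes T: "\<And>T. Delta_filt {1..n} T \<Longrightarrow> F_pcostd A n L T \<Longrightarrow> pdle t T"
  shows "Delta_filt {1..n} X \<Longrightarrow> pdle t X"
proof -
  define R where "R m \<longleftrightarrow> (\<forall>X. Delta_filt {1..n} X \<longrightarrow> pdle m X)" for m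
  have I: "{n - n<..n} = {1..n}" by auto
  \<comment> \<open>Some uniform bound is needed for a least one to exist; its value
    \<open>n\<close> does not enter the result.\<close>
  have "R n" unfolding R_def using Delta_filt_pdle[OF order_refl] unfolding I by blast
  then have Rm: "R (LEAST m. R m)" by (rule LeastI)
  have "(LEAST m. R m) \<le> t"
  proof (rule ccontr)
    assume gt: "\<not> (LEAST m. R m) \<le> t"
    then obtain m where m: "(LEAST m. R m) = Suc m" "t \<le> m" by (cases "LEAST m. R m") auto
    have RSuc: "R (Suc m)" using Rm m(1) by simp
    have "R m" unfolding R_def
    proof (intro allI impI)
      fix X assume X: "Delta_filt {1..n} X"
      obtain T0 X' u v where E: "ses X T0 X' u v" "Delta_filt {1..n} X'" "Delta_filt {1..n} T0" "F_pcostd A n L T0"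
        by (rule tilting_coresolution_step[OF X]) (rule that)
      \<comment> \<open>Dimension shift: the middle term has dimension at most
        \<open>t \<le> m\<close> and the right one at most \<open>Suc m\<close>, so the left one has
        dimension at most \<open>m\<close>, which contradicts minimality.\<close>
      have "pdle m T0" using pdle_mono[OF m(2) T[OF E(3,4)]] .
      moreover have "pdle (Suc m) X'" using RSuc E(2) unfolding R_def by blast
      ultimately show "pdle m X" using pdle_kernel[OF E(1)] by blast
    qed
    then have "(LEAST m. R m) \<le> m" by (rule Least_le)
    then show False using m(1) by simp
  qed
  then show "Delta_filt {1..n} X \<Longrightarrow> pdle t X" using Rm pdle_mono unfolding R_def by blast
qed

end

section \<open>Direct summands of powers of T, and attained lengths of resolutions\<close>

context fd_algebra
begin

lemma pdle_dpow:
  assumes "pdle t T"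
  shows "pdle t (dpow T r)"
proof (induction r)
  case 0
  have "md (dpow T 0)" by (rule mdI) (auto simp: ac_def fm_add[of _ 0 0] coeff_fm intro!: poly_eqI)
  then show ?case using proj_mod_pdle proj_mod_zero by simp
next
  case (Suc r)
  obtain f g where "ses T (dsum T (dpow T r)) (dpow T r) f g"
    using ses_dsum[OF pdle_md[OF assms] pdle_md[OF Suc]] by blast
  then show ?case using pdle_ext assms Suc by simp
qed

lemma pdle_in_add:
  assumes T: "pdle t T" and M: "in_add A T M"
  shows "pdle t M"
proof -
  obtain r i p where r: "md M" "i \<in> hom A M (dpow T r)" "p \<in> hom A (dpow T r) M" "p * i = 1\<^sub>m (mdim M)"
    using M unfolding in_add_def summand_def by blast
  note D = pdle_dpow[OF T, of r]
  have "fm p (fm i x) = x" if "x \<in> S M" for x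
    using fm_mult[OF hom_carrier[OF r(3)] hom_carrier[OF r(2)], of x] fm_one[OF that] r(4) by simp
  then have "retract M (dpow T r)" unfolding retract_def
    using r(1) pdle_md[OF D] fm_homs[OF r(1) pdle_md[OF D] r(2)] fm_homs[OF pdle_md[OF D] r(1,3)] by blast
  then show ?thesis using pdle_retract D by blast
qed

end

text \<open>A finite value excludes the empty set, whose infimum is infinite, and an infimum of a
  nonempty set in \<open>enat\<close> is its least element.\<close>

lemma rdim_attained:
  assumes "rdim A C M = enat d"
  shows "resolution A C M d"
proof -
  define R where "R = enat ` {l. resolution A C M l}"
  have R: "Inf R = enat d" using assms unfolding rdim_def R_def .
  then have ne: "R \<noteq> {}" by (auto simp add: Inf_enat_def)
  have "Inf R = (LEAST x. x \<in> R)" unfolding Inf_enat_def by (simp only: if_False ne)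
  moreover obtain r where "r \<in> R" using ne by blast
  then have "(LEAST x. x \<in> R) \<in> R" by (rule LeastI)
  ultimately have "enat d \<in> R" using R by simp
  then show ?thesis unfolding R_def by auto
qed

lemma rdim_le: "resolution A C M d \<Longrightarrow> rdim A C M \<le> enat d"
  unfolding rdim_def by (rule INF_lower) simp

lemma resolution_mono: "resolution A C M d \<Longrightarrow> (\<And>X. is_mod A X \<Longrightarrow> C X \<Longrightarrow> E X) \<Longrightarrow> resolution A E M d"
  unfolding resolution_def by blast

theorem theorem3:
  fixes A :: "'k::field falg" and n :: nat and L :: "nat \<Rightarrow> 'k fmod" and T :: "'k fmod"
  assumes "alg_closed TYPE('k)"
    and "is_falg A"
    and "simples_indexed A n L"
    and "SSS A n L"
    and "char_tilting A n L T"
  shows "fdim A \<le> fdim_Delta A n L + pd A T"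
proof (cases "pd A T")
  case infinity
  then show ?thesis by simp
next
  case (enat t)
  interpret strongly_stratified A n L
    by unfold_locales (use assms in auto)
  have mT: "md T" using assms(5) by (simp add: char_tilting_def)
  have "resolution A (projective A) T t" using rdim_attained enat unfolding pd_def by blast
  \<comment> \<open>The members of the class have dimension 0 here, so only the length of the
    resolution counts.\<close>
  then have T: "pdle t T"
    using resolution_pdle[of "projective A" 0 T t] projective_iff mT by simp
  have "pdle t X" if X: "Delta_filt {1..n} X" for X
  proof (rule Delta_filt_pdle_tilting[OF _ X])
    fix T' assume T': "Delta_filt {1..n} T'" "F_pcostd A n L T'"
    \<comment> \<open>The defining property of the characteristic tilting module: such a
      \<open>T'\<close> is a direct summand of a power of \<open>T\<close>, so the bound
      \<open>t\<close> passes to it.\<close>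
    have "in_add A T T'" using assms(5) T' Delta_filt_md[OF T'(1)] unfolding char_tilting_def F_Delta_Delta_filt by blast
    then show "pdle t T'" using pdle_in_add[OF T] by blast
  qed
  note Delta_filt_t = this
  show ?thesis unfolding fdim_def
  proof (rule SUP_least)
    fix M assume "M \<in> {M. md M \<and> pd A M < \<infinity>}"
    then obtain p where M: "md M" "pd A M = enat p" by (cases "pd A M") auto
    have "resolution A (projective A) M p" using rdim_attained M(2) unfolding pd_def by blast
    then have "resolution A (F_Delta A n L) M p"
      by (rule resolution_mono) (use proj_mod_Delta_filt projective_iff in \<open>auto simp: F_Delta_Delta_filt\<close>)
    then have "Delta_dim A n L M \<le> enat p" unfolding Delta_dim_def by (rule rdim_le)
    then obtain d where d: "Delta_dim A n L M = enat d" by (cases "Delta_dim A n L M") auto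
    then have "resolution A (F_Delta A n L) M d" unfolding Delta_dim_def by (rule rdim_attained)
    then have "pdle (d + t) M" unfolding F_Delta_Delta_filt
      by (rule resolution_pdle[rotated 2]) (use Delta_filt_t M(1) in auto)
    then have "pd A M \<le> enat (d + t)" unfolding pd_def by (intro rdim_le pdle_resolution)
    also have "\<dots> = Delta_dim A n L M + pd A T" using d enat by simp
    also have "\<dots> \<le> fdim_Delta A n L + pd A T" unfolding fdim_Delta_def
      by (intro add_right_mono SUP_upper) (use M(1) d in simp)
    finally show "pd A M \<le> fdim_Delta A n L + pd A T" .
  qed
qed

end
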